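(* For every integer $k\ge 1$, the $k$-specialization $\eta_k(ss(\cdot))$ of the VSE-invariant is a regular isotopy invariant of links: if $D$ and $D'$ are checkerboard-shaded link diagrams in the plane such that $D$ can be transformed into $D'$ by planar isotopies and a finite sequence of Reidemeister moves 2 and 3 (the shading being carried along by each move), then $$\eta_k(ss(D))=\eta_k(ss(D')).$$
   Context: Shaded diagrams. The faces of a link diagram in the plane are 2-colored (shaded/white) in checkerboard fashion, so that faces sharing an edge have different colors. A Reidemeister move (inside a disc) carries the shading to the unique checkerboard shading of the new diagram that agrees with the old one outside the disc. Regular isotopy is the equivalence relation generated by planar isotopy and Reidemeister moves 2 and 3 (not move 1). Crossing types. A crossing is of type $X1$ if the region swept by rotating the overpass counterclockwise to the underpass is shaded, and of type $X2$ if this region is white. Give the edges of the diagram distinct labels. A crossing whose four edge-ends are, in counterclockwise cyclic order, $a,b,c,d$, where $a,c$ are the ends of the underpass, is encoded by the symbol $X1[a,b,c,d]$ or $X2[a,b,c,d]$ according to its type. (The two choices of starting underpass end give the same expansion below.) Expansion. Work in $\mathbb{Z}[A,B,F,X,Y,Z,M,o]$. Let $\mathrm{con}[xy]=\mathrm{con}[yx]$ be formal commuting symbols (arcs joining labels $x$ and $y$). Expand $$X1[a,b,c,d]\to MA\,\mathrm{con}[ab]\mathrm{con}[cd]+MB\,\mathrm{con}[ad]\mathrm{con}[bc]+F\,\mathrm{con}[ac]\mathrm{con}[bd],$$ $$X2[a,b,c,d]\to MX\,\mathrm{con}[ab]\mathrm{con}[cd]+MY\,\mathrm{con}[ad]\mathrm{con}[bc]+Z\,\mathrm{con}[ac]\mathrm{con}[bd],$$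 and simplify products by $\mathrm{con}[ab]\mathrm{con}[bc]\to\mathrm{con}[ac]$, $\mathrm{con}[ab]\mathrm{con}[ba]\to\mathrm{con}[aa]$, $\mathrm{con}[aa]\to o$. For a product $P$ of symbols $X1,X2,\mathrm{con}$ in which every label occurs exactly twice, this gives a polynomial $[P]\in\mathbb{Z}[A,B,F,X,Y,Z,M,o]$. The VSE-state sum $ss(D)$ of a shaded diagram $D$ is $[P]$ for $P$ the product of the symbols of all its crossings, multiplied by one factor $o$ for each crossingless component. The ideals. Consider the four pairs $(L,R)$: (2.1) $L=X1[a,b,f,e]\,X2[d,e,f,c]$, $R=\mathrm{con}[ad]\mathrm{con}[bc]$; (2.2) $L=X2[a,b,f,e]\,X1[d,e,f,c]$, $R=\mathrm{con}[ad]\mathrm{con}[bc]$; (3.1) $L=X1[a,b,h,g]\,X2[i,e,f,g]\,X2[h,c,d,i]$, $R=X1[a,i,h,f]\,X1[c,g,i,b]\,X2[h,g,d,e]$; (3.2) $L=X2[a,b,h,g]\,X1[i,e,f,g]\,X1[h,c,d,i]$, $R=X2[a,i,h,f]\,X2[c,g,i,b]\,X1[h,g,d,e]$. The boundary labels are $a,b,c,d$ for (2.1),(2.2) and $a,b,c,d,e,f$ for (3.1),(3.2). For each pair and each perfect matching $\epsilon$ of its boundary labels (3 matchings for the first two pairs, 15 for the last two), let $E_\epsilon=\prod_{\{x,y\}\in\epsilon}\mathrm{con}[xy]$ and take the polynomial $[L\,E_\epsilon]-[R\,E_\epsilon]$. $\mathcal{I}_\infty$ is the ideal generated by these 36 polynomials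 (27 of them are distinct). For an integer $k\ge1$, $\mathcal{I}_k$ is the ideal generated by $\mathcal{I}_\infty\cup\{M^{k+1}\}$. Normal form. $\eta_k(p)$ is the normal form (remainder) of the polynomial $p$ with respect to the Gröbner basis of $\mathcal{I}_k$ for the lexicographic monomial order with variable order $A,B,F,X,Y,Z,M,o$, computed over the coefficient field $\mathbb{Q}$; thus $\eta_k(p)=\eta_k(q)$ iff $p-q$ lies in the ideal generated by $\mathcal{I}_k$ in $\mathbb{Q}[A,B,F,X,Y,Z,M,o]$. *)

theory Defs
  imports "HOL-Analysis.Analysis" "HOL-Library.Poly_Mapping" "HOL-Library.Uprod"
    "HOL-Library.Multiset"
begin

section \<open>The coefficient ring and the formal arcs\<close>

datatype variable = VA | VB | VF | VX | VY | VZ | VM | Vo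

primrec var_index :: "variable \<Rightarrow> nat" where
  "var_index VA = 0"
| "var_index VB = 1"
| "var_index VF = 2"
| "var_index VX = 3"
| "var_index VY = 4"
| "var_index VZ = 5"
| "var_index VM = 6"
| "var_index Vo = 7"

lemma inj_var_index: "inj var_index"
proof (rule injI)
  fix v w :: variable
  assume "var_index v = var_index w"
  then show "v = w" by (cases v; cases w; simp)
qed

instantiation variable :: linorder
begin

definition less_eq_variable :: "variable \<Rightarrow> variable \<Rightarrow> bool" where
  "less_eq_variable v w \<longleftrightarrow> var_index v \<le> var_index w"

definition less_variable :: "variable \<Rightarrow> variable \<Rightarrow> bool" where
  "less_variable v w \<longleftrightarrow> var_index v < var_index w"

instance
  by standard
    (auto simp: less_eq_variable_def less_variable_def dest: injD[OF inj_var_index])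

end

text \<open>
  Monomials are exponent vectors. The library order on \<open>variable \<Rightarrow>\<^sub>0 nat\<close> compares two exponent
  vectors at the smallest variable where they differ; with \<open>VA < VB < \<dots> < Vo\<close> this is exactly the
  lexicographic monomial order with variable order A, B, F, X, Y, Z, M, o.
\<close>

type_synonym monomial = "variable \<Rightarrow>\<^sub>0 nat"
type_synonym 'r mpoly = "monomial \<Rightarrow>\<^sub>0 'r"
type_synonym zpoly = "int mpoly"
type_synonym qpoly = "rat mpoly"

definition Var :: "variable \<Rightarrow> zpoly" where
  "Var v = Poly_Mapping.single (Poly_Mapping.single v 1) 1"

text \<open>
  Polynomials over \<open>zpoly\<close> in the commuting symbols \<open>con[xy] = con[yx]\<close>: a monomial is a multiset of
  unordered pairs of labels.
\<close>

type_synonym 'l conpoly = "'l uprod multiset \<Rightarrow>\<^sub>0 zpoly"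

definition con_arc :: "'l uprod \<Rightarrow> 'l conpoly" where
  "con_arc u = Poly_Mapping.single {#u#} 1"

abbreviation con :: "'l \<Rightarrow> 'l \<Rightarrow> 'l conpoly" where
  "con x y \<equiv> con_arc (Upair x y)"

definition scalar :: "zpoly \<Rightarrow> 'l conpoly" where
  "scalar p = Poly_Mapping.single 0 p"

datatype 'l crossing_symbol = X1 'l 'l 'l 'l | X2 'l 'l 'l 'l

fun expand :: "'l crossing_symbol \<Rightarrow> 'l conpoly" where
  "expand (X1 a b c d) =
     scalar (Var VM * Var VA) * con a b * con c d
   + scalar (Var VM * Var VB) * con a d * con b c
   + scalar (Var VF) * con a c * con b d"
| "expand (X2 a b c d) =
     scalar (Var VM * Var VX) * con a b * con c d
   + scalar (Var VM * Var VY) * con a d * con b c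
   + scalar (Var VZ) * con a c * con b d"

text \<open>
  The simplification rules; the second component counts the factors \<open>o\<close>. The rule
  \<open>con[ab] con[ba] \<rightarrow> con[aa]\<close> is the case \<open>c = a\<close> of \<open>join\<close>. The rules are only ever used on monomials in
  which every label occurs exactly twice.
\<close>

inductive con_step :: "'l uprod multiset \<times> nat \<Rightarrow> 'l uprod multiset \<times> nat \<Rightarrow> bool" where
  join: "con_step (m + {#Upair a b, Upair b c#}, n) (m + {#Upair a c#}, n)"
| loop: "con_step (m + {#Upair a a#}, n) (m, Suc n)"

definition loop_count :: "'l uprod multiset \<Rightarrow> nat" where
  "loop_count m = (THE n. con_step\<^sup>*\<^sup>* (m, 0) ({#}, n))"

definition bracket :: "'l conpoly \<Rightarrow> zpoly" where
  "bracket P = (\<Sum>m\<in>Poly_Mapping.keys P. Poly_Mapping.lookup P m * Var Vo ^ loop_count m)"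


section \<open>The ideals\<close>

definition ideal_generated :: "'r::comm_ring_1 set \<Rightarrow> 'r set" where
  "ideal_generated G = module.span (*) G"

text \<open>
  The labels a, b, c, \dots are the numbers 0, 1, 2, \dots, so that the boundary labels form an initial
  segment. The crossing types are parameters, to be instantiated by \<open>(X1, X2)\<close> and \<open>(X2, X1)\<close>: the
  two shadings of the same move.
\<close>

type_synonym symbol_type = "nat \<Rightarrow> nat \<Rightarrow> nat \<Rightarrow> nat \<Rightarrow> nat crossing_symbol"

definition R2_pair :: "symbol_type \<Rightarrow> symbol_type \<Rightarrow> nat conpoly \<times> nat conpoly" where
  "R2_pair S T =
    (let a = 0; b = 1; c = 2; d = 3; e = 4; f = 5
     in (expand (S a b f e) * expand (T d e f c),
         con a d * con b c))"

definition R3_pair :: "symbol_type \<Rightarrow> symbol_type \<Rightarrow> nat conpoly \<times> nat conpoly" where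
  "R3_pair S T =
    (let a = 0; b = 1; c = 2; d = 3; e = 4; f = 5; g = 6; h = 7; i = 8
     in (expand (S a b h g) * expand (T i e f g) * expand (T h c d i),
         expand (S a i h f) * expand (S c g i b) * expand (T h g d e)))"

definition perfect_matching :: "'l set \<Rightarrow> 'l uprod set \<Rightarrow> bool" where
  "perfect_matching B M \<longleftrightarrow>
     (\<forall>u\<in>M. proper_uprod u \<and> set_uprod u \<subseteq> B) \<and> (\<forall>x\<in>B. \<exists>!u. u \<in> M \<and> x \<in> set_uprod u)"

definition relators :: "'l set \<Rightarrow> 'l conpoly \<times> 'l conpoly \<Rightarrow> zpoly set" where
  "relators B LR =
     {bracket (fst LR * (\<Prod>u\<in>M. con_arc u)) - bracket (snd LR * (\<Prod>u\<in>M. con_arc u)) | M.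
        perfect_matching B M}"

definition I_infinity :: "zpoly set" where
  "I_infinity = ideal_generated
     (relators {..<4} (R2_pair X1 X2) \<union> relators {..<4} (R2_pair X2 X1) \<union>
      relators {..<6} (R3_pair X1 X2) \<union> relators {..<6} (R3_pair X2 X1))"

definition I_level :: "nat \<Rightarrow> zpoly set" where
  "I_level k = ideal_generated (I_infinity \<union> {Var VM ^ (k + 1)})"


section \<open>Normal forms\<close>

definition to_qpoly :: "zpoly \<Rightarrow> qpoly" where
  "to_qpoly p = Poly_Mapping.map of_int p"

definition leading_monomial :: "qpoly \<Rightarrow> monomial" where
  "leading_monomial p = Max (Poly_Mapping.keys p)"

definition monomial_dvd :: "monomial \<Rightarrow> monomial \<Rightarrow> bool" where
  "monomial_dvd m n \<longleftrightarrow> (\<exists>d. n = m + d)"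

definition groebner_basis :: "qpoly set \<Rightarrow> qpoly set \<Rightarrow> bool" where
  "groebner_basis G I \<longleftrightarrow>
     finite G \<and> G \<subseteq> I \<and> 0 \<notin> G \<and>
     (\<forall>f\<in>I. f \<noteq> 0 \<longrightarrow> (\<exists>g\<in>G. monomial_dvd (leading_monomial g) (leading_monomial f)))"

definition is_remainder :: "qpoly \<Rightarrow> qpoly set \<Rightarrow> qpoly \<Rightarrow> bool" where
  "is_remainder p G r \<longleftrightarrow>
     p - r \<in> ideal_generated G \<and>
     (\<forall>m\<in>Poly_Mapping.keys r. \<forall>g\<in>G. \<not> monomial_dvd (leading_monomial g) m)"

text \<open>
  The remainder does not depend on the choice of the Groebner basis, so the basis need not be reduced.
\<close>

definition normal_form :: "qpoly set \<Rightarrow> qpoly \<Rightarrow> qpoly" where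
  "normal_form I p = (THE r. \<exists>G. groebner_basis G I \<and> is_remainder p G r)"

definition eta :: "nat \<Rightarrow> zpoly \<Rightarrow> qpoly" where
  "eta k p = normal_form (ideal_generated (to_qpoly ` I_level k)) (to_qpoly p)"


section \<open>Shaded link diagrams in the plane\<close>

text \<open>
  \<open>planar_map h\<close>: \<open>h\<close> is the final homeomorphism of an ambient isotopy of the plane.
\<close>

definition planar_map :: "(complex \<Rightarrow> complex) \<Rightarrow> bool" where
  "planar_map h \<longleftrightarrow>
     homotopic_with_canon (\<lambda>f. \<exists>g. homeomorphism UNIV UNIV f g) UNIV UNIV id h"

text \<open>
  The curve is the union of the strands (a subset of the plane). For a crossing \<open>v\<close> only the germ at
  \<open>v\<close> of the set \<open>overpass D v\<close> is meaningful. The last field is the union of the shaded faces.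
\<close>

record shaded_diagram =
  curve :: "complex set"
  crossings :: "complex set"
  overpass :: "complex \<Rightarrow> complex set"
  shaded :: "complex set"

text \<open>
  A crossing chart straightens a neighbourhood of the crossing: the overpass becomes the real axis, the
  underpass the imaginary axis. It preserves the orientation since it is isotopic to the identity. Two
  charts at the same crossing can differ by a half turn, but not by a reflection or a quarter turn.
\<close>

definition crossing_chart :: "shaded_diagram \<Rightarrow> complex \<Rightarrow> (complex \<Rightarrow> complex) \<Rightarrow> bool" where
  "crossing_chart D v h \<longleftrightarrow>
     planar_map h \<and> h v = 0 \<and>
     h ` crossings D \<inter> ball 0 1 = {0} \<and>
     h ` curve D \<inter> ball 0 1 = {z \<in> ball 0 1. Re z = 0 \<or> Im z = 0} \<and>
     h ` overpass D v \<inter> ball 0 1 = {z \<in> ball 0 1. Im z = 0}"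

text \<open>
  The edges are the components of the curve minus the crossings. This includes the crossingless
  components of the diagram, which are simple closed curves.
\<close>

definition edges :: "shaded_diagram \<Rightarrow> complex set set" where
  "edges D = components (curve D - crossings D)"

definition open_edge :: "shaded_diagram \<Rightarrow> complex set \<Rightarrow> bool" where
  "open_edge D e \<longleftrightarrow>
     (\<exists>g. simple_path g \<and> pathstart g \<in> crossings D \<and> pathfinish g \<in> crossings D \<and>
          e = path_image g - {pathstart g, pathfinish g})"

definition closed_edge :: "complex set \<Rightarrow> bool" where
  "closed_edge e \<longleftrightarrow> (\<exists>g. simple_path g \<and> pathfinish g = pathstart g \<and> e = path_image g)"

definition link_diagram :: "shaded_diagram \<Rightarrow> bool" where
  "link_diagram D \<longleftrightarrow>
     finite (crossings D) \<and> crossings D \<subseteq> curve D \<and>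
     (\<forall>v\<in>crossings D. \<exists>h. crossing_chart D v h) \<and>
     finite (edges D) \<and> (\<forall>e\<in>edges D. open_edge D e \<or> closed_edge e)"

definition faces :: "shaded_diagram \<Rightarrow> complex set set" where
  "faces D = components (- curve D)"

text \<open>
  Checkerboard shading: the two faces along each edge have different colours.
\<close>

definition checkerboard :: "shaded_diagram \<Rightarrow> bool" where
  "checkerboard D \<longleftrightarrow>
     shaded D \<inter> curve D = {} \<and>
     (\<forall>F\<in>faces D. F \<subseteq> shaded D \<or> F \<inter> shaded D = {}) \<and>
     (\<forall>e\<in>edges D. \<exists>F\<in>faces D. \<exists>G\<in>faces D.
        F \<subseteq> shaded D \<and> G \<inter> shaded D = {} \<and> e \<subseteq> frontier F \<and> e \<subseteq> frontier G)"

definition shaded_link_diagram :: "shaded_diagram \<Rightarrow> bool" where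
  "shaded_link_diagram D \<longleftrightarrow> link_diagram D \<and> checkerboard D"


section \<open>The state sum\<close>

text \<open>
  Each edge is its own label. In a chart, counterclockwise rotation of the overpass (real axis) to the
  underpass (imaginary axis) sweeps the two quadrants \<open>Re z * Im z > 0\<close>; the four edge-ends, starting
  with an end of the underpass, leave the crossing in the directions \<open>\<i>, -1, -\<i>, 1\<close>.
\<close>

definition edge_at :: "shaded_diagram \<Rightarrow> complex \<Rightarrow> complex set" where
  "edge_at D z = connected_component_set (curve D - crossings D) z"

definition chart_symbol ::
    "shaded_diagram \<Rightarrow> (complex \<Rightarrow> complex) \<Rightarrow> complex set crossing_symbol" where
  "chart_symbol D h =
     (let end_edge = (\<lambda>u. edge_at D (inv h (u / 2)));
          swept = inv h ` {z \<in> ball 0 1. Re z * Im z > 0}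
      in (if swept \<subseteq> shaded D then X1 else X2)
           (end_edge \<i>) (end_edge (- 1)) (end_edge (- \<i>)) (end_edge 1))"

definition symbol_at :: "shaded_diagram \<Rightarrow> complex \<Rightarrow> complex set crossing_symbol" where
  "symbol_at D v = chart_symbol D (SOME h. crossing_chart D v h)"

definition crossingless_components :: "shaded_diagram \<Rightarrow> complex set set" where
  "crossingless_components D = {C \<in> components (curve D). C \<inter> crossings D = {}}"

definition ss :: "shaded_diagram \<Rightarrow> zpoly" where
  "ss D = bracket (\<Prod>v\<in>crossings D. expand (symbol_at D v))
            * Var Vo ^ card (crossingless_components D)"


section \<open>Planar isotopy and Reidemeister moves\<close>

definition same_germ :: "complex \<Rightarrow> complex set \<Rightarrow> complex set \<Rightarrow> bool" where
  "same_germ p S T \<longleftrightarrow> (\<forall>\<^sub>F z in nhds p. z \<in> S \<longleftrightarrow> z \<in> T)"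

definition planar_isotopic :: "shaded_diagram \<Rightarrow> shaded_diagram \<Rightarrow> bool" where
  "planar_isotopic D D' \<longleftrightarrow>
     (\<exists>h. planar_map h \<and> curve D' = h ` curve D \<and> crossings D' = h ` crossings D \<and>
          shaded D' = h ` shaded D \<and>
          (\<forall>v\<in>crossings D. same_germ (h v) (h ` overpass D v) (overpass D' (h v))))"

text \<open>
  A local picture in the closed unit disc: strands, crossings, and the overpass at each crossing
  (again only up to germs).
\<close>

record picture =
  strands :: "complex set"
  crossing_points :: "complex set"
  over_strand :: "complex \<Rightarrow> complex set"

text \<open>
  \<open>h\<close> carries the part of the diagram \<open>D\<close> inside the disc \<open>h -` cball 0 1\<close> to the picture \<open>P\<close>.
\<close>

definition shows_picture :: "(complex \<Rightarrow> complex) \<Rightarrow> shaded_diagram \<Rightarrow> picture \<Rightarrow> bool" where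
  "shows_picture h D P \<longleftrightarrow>
     h ` curve D \<inter> cball 0 1 = strands P \<and>
     h ` crossings D \<inter> cball 0 1 = crossing_points P \<and>
     (\<forall>v\<in>crossings D. h v \<in> cball 0 1 \<longrightarrow>
        same_germ (h v) (h ` overpass D v) (over_strand P (h v)))"

definition agree_outside :: "complex set \<Rightarrow> shaded_diagram \<Rightarrow> shaded_diagram \<Rightarrow> bool" where
  "agree_outside U D D' \<longleftrightarrow>
     curve D - U = curve D' - U \<and> crossings D - U = crossings D' - U \<and>
     shaded D - U = shaded D' - U \<and>
     (\<forall>v\<in>crossings D - U. same_germ v (overpass D v) (overpass D' v))"

definition replaces :: "picture \<Rightarrow> picture \<Rightarrow> shaded_diagram \<Rightarrow> shaded_diagram \<Rightarrow> bool" where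
  "replaces P Q D D' \<longleftrightarrow>
     (\<exists>h. planar_map h \<and> agree_outside (h -` cball 0 1) D D' \<and>
          shows_picture h D P \<and> shows_picture h D' Q)"

text \<open>
  Reidemeister 2: two strands with end points \<open>(\<plusminus>4/5, 3/5)\<close> and \<open>(\<plusminus>4/5, -3/5)\<close>. On the left the one with
  the upper end points dips below the other, crossing over it at \<open>(\<plusminus>2/5, 0)\<close>.
\<close>

definition R2_left :: picture where
  "R2_left =
     (let upper = {z. \<bar>Re z\<bar> \<le> 4/5 \<and> Im z = 3/2 * \<bar>Re z\<bar> - 3/5};
          lower = {z. \<bar>Re z\<bar> \<le> 4/5 \<and> Im z = 3/5 - 3/2 * \<bar>Re z\<bar>}
      in \<lparr>strands = upper \<union> lower, crossing_points = {Complex (-2/5) 0, Complex (2/5) 0},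
          over_strand = (\<lambda>_. upper)\<rparr>)"

definition R2_right :: picture where
  "R2_right =
     \<lparr>strands = {z. \<bar>Re z\<bar> \<le> 4/5 \<and> \<bar>Im z\<bar> = 3/5}, crossing_points = {},
      over_strand = (\<lambda>_. {})\<rparr>"

text \<open>
  Reidemeister 3: the two diagonals cross at the origin, and a third strand from \<open>-1\<close> to \<open>1\<close> slides from
  below (\<open>s = -1\<close>) to above (\<open>s = 1\<close>) this crossing. If \<open>slide_over\<close> it passes over both diagonals,
  otherwise under both; \<open>rising_over\<close> tells which diagonal is the overpass at the origin.
\<close>

definition R3_picture :: "bool \<Rightarrow> bool \<Rightarrow> real \<Rightarrow> picture" where
  "R3_picture slide_over rising_over s =
     (let rising = {z \<in> cball 0 1. Im z = Re z};
          falling = {z \<in> cball 0 1. Im z = - Re z};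
          sliding = {z. \<bar>Re z\<bar> \<le> 1 \<and> Im z = s * (1 - \<bar>Re z\<bar>) / 2}
      in \<lparr>strands = rising \<union> falling \<union> sliding,
          crossing_points = {0, Complex (-1/3) (s/3), Complex (1/3) (s/3)},
          over_strand = (\<lambda>p. if p = 0 then if rising_over then rising else falling
                             else if slide_over then sliding else rising \<union> falling)\<rparr>)"

definition reidemeister2 :: "shaded_diagram \<Rightarrow> shaded_diagram \<Rightarrow> bool" where
  "reidemeister2 D D' \<longleftrightarrow> replaces R2_left R2_right D D'"

definition reidemeister3 :: "shaded_diagram \<Rightarrow> shaded_diagram \<Rightarrow> bool" where
  "reidemeister3 D D' \<longleftrightarrow>
     (\<exists>slide_over rising_over.
        replaces (R3_picture slide_over rising_over (- 1)) (R3_picture slide_over rising_over 1) D D')"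

definition regular_step :: "shaded_diagram \<Rightarrow> shaded_diagram \<Rightarrow> bool" where
  "regular_step D D' \<longleftrightarrow>
     shaded_link_diagram D \<and> shaded_link_diagram D' \<and>
     (planar_isotopic D D' \<or> reidemeister2 D D' \<or> reidemeister3 D D')"

definition regularly_isotopic :: "shaded_diagram \<Rightarrow> shaded_diagram \<Rightarrow> bool" where
  "regularly_isotopic = equivclp regular_step"

end

theory Submission
  imports Defs "HOL-Complex_Analysis.Complex_Analysis"
begin

text \<open>
  The state sum is local. Cut a diagram along a circle that meets it transversally in a finite set of
  points, and give every cut point a label of its own, joined to the two edges that end there by formal
  arcs. The simplification rules then write the state sum as the bracket of the product of an inner and
  an outer polynomial which share only these labels. To expand the outer factor is to glue perfect
  matchings to the inner one, so replacing the inner factor by another one changes the state sum by an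
  element of the ideal as soon as this holds for the matchings; for the two pictures of a Reidemeister
  move these differences are the generators of the ideal, up to half turns of the symbols.

  The number of loops of a product of arcs is read off from the number of subsets of labels that no arc
  separates, which for all edges of a cut or uncut diagram counts the unions of components of the curve.
  This makes loop counts independent of the subdivision.
\<close>

section \<open>Ideals and normal forms\<close>

text \<open>Diagrams are topological objects: crossing charts are picked by \<open>SOME\<close>
  among homeomorphisms isotopic to the identity, with no smoothness to fall back on. Two charts of
  one crossing are compared through the winding number of the image of a small circle, which rules
  out foldings and reflections. That every open edge carries exactly two of the ends at crossings
  and cut points has to be proved for arbitrary arcs: near a vertex the curve is a finite union of
  rays, and connectedness pins each end of an edge to one ray. The generators contain third moves of
  one handedness only: around their boundary, counterclockwise, the bottom, the top and the middle
  strand follow each other. The opposite cyclic order is reduced to this one by two second moves.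
  All comparisons end in \<open>I_infinity\<close>, so every level k is treated at once.\<close>

lemma module_times: "module ((*) :: 'a::comm_ring_1 => 'a => 'a)"
  by unfold_locales (auto simp: algebra_simps)

lemma ideal_base: "x \<in> G ==> x \<in> ideal_generated G"
  unfolding ideal_generated_def by (rule module.span_base[OF module_times])

lemma ideal_zero: "0 \<in> ideal_generated G"
  unfolding ideal_generated_def by (rule module.span_zero[OF module_times])

lemma ideal_add: "x \<in> ideal_generated G ==> y \<in> ideal_generated G ==> x + y \<in> ideal_generated G"
  unfolding ideal_generated_def by (rule module.span_add[OF module_times])

lemma ideal_diff: "x \<in> ideal_generated G ==> y \<in> ideal_generated G ==> x - y \<in> ideal_generated G"
  unfolding ideal_generated_def by (rule module.span_diff[OF module_times])

lemma ideal_times: "x \<in> ideal_generated G ==> a * x \<in> ideal_generated G"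
  unfolding ideal_generated_def by (rule module.span_scale[OF module_times])

lemma ideal_sum:
  "(\<And>i. i \<in> S ==> f i \<in> ideal_generated G) ==> (\<Sum>i\<in>S. f i) \<in> ideal_generated G"
  unfolding ideal_generated_def by (rule module.span_sum[OF module_times])

section \<open>Remainders modulo a Groebner basis\<close>

text \<open>Listed in the order of the variables, the exponents turn a comparison at the smallest
  differing variable into \<open>lex less_than\<close> on lists of length 8. Since
  \<open>lex\<close> relates only lists of equal length, it is well-founded.\<close>

lemma wf_monomial_less: "wf {(m, n :: monomial). m < n}"
proof -
  define vs where "vs = [VA, VB, VF, VX, VY, VZ, VM, Vo]"
  define l where "l = (\<lambda>m :: monomial. map (Poly_Mapping.lookup m) vs)"
  have sorted: "i < 8 ==> var_index (vs ! i) = i" for i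
    by (auto simp: vs_def less_Suc_eq numeral_eq_Suc)
  have nth: "vs ! var_index v = v" for v
    by (cases v) (auto simp: vs_def numeral_eq_Suc)
  have bound: "var_index v < 8" for v by (cases v) auto
  have "(l m, l n) \<in> lex less_than" if "m < n" for m n :: monomial
  proof -
    from that obtain v where v: "Poly_Mapping.lookup m v < Poly_Mapping.lookup n v"
      and eq: "\<And>w. w < v ==> Poly_Mapping.lookup m w = Poly_Mapping.lookup n w"
      by (auto simp: less_poly_mapping.rep_eq less_fun_def)
    let ?i = "var_index v"
    have len: "length vs = 8" by (simp add: vs_def)
    have "take ?i (l m) = take ?i (l n)"
    proof (rule nth_equalityI)
      fix j assume "j < length (take ?i (l m))"
      then have j: "j < ?i" "j < 8" by (auto simp: l_def len)
      then have "vs ! j < v" by (simp add: less_variable_def sorted)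
      then show "take ?i (l m) ! j = take ?i (l n) ! j"
        using j eq by (simp add: l_def len)
    qed (simp add: l_def)
    moreover have "l m ! ?i < l n ! ?i"
      using v bound[of v] by (simp add: l_def len nth)
    moreover have "?i < length (l m)" "?i < length (l n)" using bound[of v] by (auto simp: l_def len)
    ultimately have "l m = take ?i (l m) @ l m ! ?i # drop (Suc ?i) (l m)"
      "l n = take ?i (l m) @ l n ! ?i # drop (Suc ?i) (l n)" "(l m ! ?i, l n ! ?i) \<in> less_than"
      using id_take_nth_drop[of ?i "l m"] id_take_nth_drop[of ?i "l n"] by auto
    moreover have "length (l m) = length (l n)" by (simp add: l_def)
    ultimately show ?thesis unfolding lex_conv by blast
  qed
  then have "{(m, n :: monomial). m < n} \<subseteq> inv_image (lex less_than) l"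
    by (auto simp: inv_image_def)
  with wf_subset[OF wf_inv_image[OF wf_lex[OF wf_less_than]]] show ?thesis by blast
qed

lemma lookup_single_times:
  fixes p :: "monomial \<Rightarrow>\<^sub>0 'r::comm_ring_1"
  shows "Poly_Mapping.lookup (Poly_Mapping.single d c * p) (d + m) = c * Poly_Mapping.lookup p m"
proof -
  have "Poly_Mapping.lookup (Poly_Mapping.single d c * p) (d + m)
      = (\<Sum>l. Poly_Mapping.lookup (Poly_Mapping.single d c) l * (\<Sum>q. Poly_Mapping.lookup p q when d + m = l + q))"
    by (rule lookup_mult)
  also have "\<dots> = (\<Sum>l. (c * (\<Sum>q. Poly_Mapping.lookup p q when d + m = l + q)) when l = d)"
    by (rule arg_cong[where f = Sum_any]) (auto simp: lookup_single when_def)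
  also have "\<dots> = c * (\<Sum>q. Poly_Mapping.lookup p q when d + m = d + q)"
    by simp
  also have "\<dots> = c * Poly_Mapping.lookup p m"
    by simp
  finally show ?thesis .
qed

lemma keys_single_times:
  fixes p :: "monomial \<Rightarrow>\<^sub>0 'r::comm_ring_1"
  shows "Poly_Mapping.keys (Poly_Mapping.single d c * p) \<subseteq> (+) d ` Poly_Mapping.keys p"
  using keys_mult[of "Poly_Mapping.single d c" p] by (cases "c = 0") (auto simp: image_def)

text \<open>Division by a Groebner basis, run on an element of the ideal with the least leading monomial among
  the counterexamples.\<close>

lemma ideal_generated_groebner:
  assumes "groebner_basis G I" and I: "I = ideal_generated H" and "f \<in> I"
  shows "f \<in> ideal_generated G"
proof (rule ccontr)
  assume f: "f ~: ideal_generated G"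
  define S where "S = leading_monomial ` (I - ideal_generated G)"
  have "leading_monomial f \<in> S" using f \<open>f \<in> I\<close> by (auto simp: S_def)
  then obtain m where m: "m \<in> S" and min: "\<And>n. n < m ==> n ~: S"
    using wf_monomial_less unfolding wf_eq_minimal by (metis (mono_tags, lifting) case_prodI mem_Collect_eq)
  then obtain p where p: "p \<in> I" "p ~: ideal_generated G" and mp: "m = leading_monomial p"
    by (auto simp: S_def)
  have "p ~= 0" using p(2) ideal_zero by metis
  have G: "G \<subseteq> I" "0 ~: G" using assms(1) by (auto simp: groebner_basis_def)
  obtain g d where g: "g \<in> G" and d: "leading_monomial p = leading_monomial g + d"
    using assms(1) p(1) \<open>p ~= 0\<close> by (auto simp: groebner_basis_def monomial_dvd_def)
  have "g ~= 0" using g G by auto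
  define n where "n = leading_monomial g"
  have n: "n \<in> Poly_Mapping.keys g" "\<And>k. k \<in> Poly_Mapping.keys g ==> k \<le> n"
    using \<open>g ~= 0\<close> unfolding n_def leading_monomial_def by (auto intro: Max_in)
  have m': "m \<in> Poly_Mapping.keys p" "\<And>k. k \<in> Poly_Mapping.keys p ==> k \<le> m"
    using \<open>p ~= 0\<close> unfolding mp leading_monomial_def by (auto intro: Max_in)
  have mdn: "m = d + n" using d by (simp add: mp n_def add.commute)
  \<comment> \<open>The quotient of the leading coefficients: subtracting this multiple of g cancels
    the term of p at m, and every other term involved lies below m.\<close>
  define c where "c = Poly_Mapping.lookup p m / Poly_Mapping.lookup g n"
  define q where "q = p - Poly_Mapping.single d c * g"
  have "Poly_Mapping.single d c * g \<in> ideal_generated G" by (intro ideal_times ideal_base g)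
  then have qG: "q ~: ideal_generated G"
    using p(2) ideal_add[of q G "Poly_Mapping.single d c * g"] by (auto simp: q_def)
  have qI: "q \<in> I"
    using p(1) g G(1) unfolding q_def I by (intro ideal_diff ideal_times) auto
  have "q ~= 0" using qG ideal_zero by metis
  have "k < m" if k: "k \<in> Poly_Mapping.keys q" for k
  proof -
    have "k \<in> Poly_Mapping.keys p \<or> k \<in> (+) d ` Poly_Mapping.keys g"
      using k keys_diff[of p "Poly_Mapping.single d c * g"] keys_single_times[of d c g]
      by (auto simp: q_def)
    then have "k \<le> m" using m'(2) n(2) by (auto simp: mdn add_left_mono)
    moreover have "Poly_Mapping.lookup q m = 0"
      using n(1) by (simp add: q_def lookup_minus mdn lookup_single_times c_def in_keys_iff)
    then have "k ~= m" using k by (auto simp: in_keys_iff)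
    ultimately show ?thesis by simp
  qed
  moreover have "leading_monomial q \<in> Poly_Mapping.keys q"
    using \<open>q ~= 0\<close> unfolding leading_monomial_def by (auto intro: Max_in)
  ultimately have "leading_monomial q < m" by blast
  moreover have "leading_monomial q \<in> S" using qI qG by (auto simp: S_def)
  ultimately show False using min by blast
qed

text \<open>For each Groebner basis of the ideal, congruent polynomials have the same remainders.
  The two definite descriptions therefore range over one and the same predicate.\<close>

lemma normal_form_eqI:
  fixes p q :: qpoly
  assumes I: "I = ideal_generated H" and pq: "p - q \<in> I"
  shows "normal_form I p = normal_form I q"
proof -
  have "is_remainder a G r ==> is_remainder b G r"
    if "groebner_basis G I" "a - b \<in> I" for a b r :: qpoly and G
  proof -
    assume r: "is_remainder a G r"
    have "a - b \<in> ideal_generated G" using ideal_generated_groebner[OF that(1) I that(2)] .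
    moreover have "a - r \<in> ideal_generated G" using r by (simp add: is_remainder_def)
    ultimately have "(a - r) - (a - b) \<in> ideal_generated G" by (rule ideal_diff[rotated])
    moreover have "(a - r) - (a - b) = b - r" by simp
    ultimately show ?thesis using r unfolding is_remainder_def by metis
  qed
  moreover have "q - p \<in> I"
    using pq ideal_diff[OF ideal_zero, of "p - q" H] by (simp add: I)
  ultimately have "(\<lambda>r. \<exists>G. groebner_basis G I \<and> is_remainder p G r)
      = (\<lambda>r. \<exists>G. groebner_basis G I \<and> is_remainder q G r)"
    using pq by blast
  then show ?thesis by (simp add: normal_form_def)
qed

text \<open>An element of \<open>I_infinity\<close> is a generator of \<open>I_level k\<close>, and
  its image is a generator of the ideal over the rationals; additivity of \<open>to_qpoly\<close>
  does the rest.\<close>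

lemma eta_eqI:
  assumes "p - q \<in> I_infinity"
  shows "eta k p = eta k q"
  unfolding eta_def
proof (rule normal_form_eqI[OF refl])
  have "p - q \<in> I_level k"
    unfolding I_level_def using assms by (intro ideal_base) auto
  moreover have "to_qpoly (p - q) = to_qpoly p - to_qpoly q"
    by (rule poly_mapping_eqI) (simp add: to_qpoly_def map.rep_eq when_def lookup_minus)
  ultimately show "to_qpoly p - to_qpoly q \<in> ideal_generated (to_qpoly ` I_level k)"
    by (metis ideal_base imageI)
qed

section \<open>Loop counts\<close>

text \<open>An arc con[aa] has both its ends at a, so a degenerate pair must contribute its label
  twice, which \<open>set_uprod\<close> does not see.\<close>

definition mset_uprod :: "'l uprod => 'l multiset" where
  "mset_uprod u = (if proper_uprod u then mset_set (set_uprod u)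
                   else mset_set (set_uprod u) + mset_set (set_uprod u))"

lemma mset_uprod_Upair [simp]: "mset_uprod (Upair a b) = {#a, b#}"
  by (simp add: mset_uprod_def)

definition ends :: "'l uprod multiset => 'l multiset" where
  "ends m = (\<Sum>u\<in>#m. mset_uprod u)"

lemma ends_simps [simp]:
  "ends {#} = {#}" "ends (add_mset u m) = mset_uprod u + ends m" "ends (m + m') = ends m + ends m'"
  by (simp_all add: ends_def)

lemma ends_sum: "ends (sum f S) = (\<Sum>x\<in>S. ends (f x))"
  by (induction S rule: infinite_finite_induct) auto

lemma set_uprod_subset_ends: "u \<in># m ==> set_uprod u \<subseteq> set_mset (ends m)"
  by (induction m) (auto simp: mset_uprod_def)

lemma in_ends_iff: "x \<in># ends m \<longleftrightarrow> (\<exists>u\<in>#m. x \<in> set_uprod u)"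
  by (induction m) (auto simp: mset_uprod_def)

lemma count_image_mset_on_inj:
  fixes f :: "'a => 'b"
  shows   "inj_on f (set_mset N) ==> x \<in># N ==> count (image_mset f N) (f x) = count N x"
proof -
  assume "inj_on f (set_mset N)" "x \<in># N"
  then have "f -` {f x} \<inter> set_mset N = {x}" by (auto simp: inj_on_def)
  then show ?thesis by (simp add: count_image_mset)
qed

lemma ends_image_mset: "ends (image_mset (map_uprod f) m) = image_mset f (ends m)"
proof (induction m)
  case (add u m)
  then show ?case by (cases u) auto
qed auto

definition twice :: "'l uprod multiset => bool" where
  "twice m \<longleftrightarrow> (\<forall>x\<in>#ends m. count (ends m) x = 2)"

lemma twiceI: "ends m = mset_set Y + mset_set Y ==> twice m"
  by (cases "finite Y") (auto simp: twice_def)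

text \<open>For the graph with vertices S and edges m these are the unions of connected components,
  so their number is 2 to the number of components. If every label of S lies on exactly two arc
  ends, the components are the loops.\<close>

definition colourings :: "'l set => 'l uprod multiset => 'l set set" where
  "colourings S m = {A. A \<subseteq> S \<and> (\<forall>u\<in>#m. set_uprod u \<subseteq> A \<or> set_uprod u \<inter> A = {})}"

lemma finite_colourings: "finite S ==> finite (colourings S m)"
  by (rule finite_subset[of _ "Pow S"]) (auto simp: colourings_def)

text \<open>A label on no arc can be put into a colouring or left out at will.\<close>

lemma card_colourings_insert:
  assumes "finite S" "x ~: S" "set_mset (ends m) \<subseteq> S"
  shows "card (colourings (insert x S) m) = 2 * card (colourings S m)"
proof -
  have x: "x ~: set_uprod u" if "u \<in># m" for u
    using assms set_uprod_subset_ends[OF that] by auto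
  have "colourings (insert x S) m = colourings S m \<union> insert x ` colourings S m"
  proof (intro equalityI subsetI)
    fix A assume A: "A \<in> colourings (insert x S) m"
    have A': "A - {x} \<in> colourings S m" using A x by (auto simp: colourings_def)
    show "A \<in> colourings S m \<union> insert x ` colourings S m"
    proof (cases "x \<in> A")
      case True
      then have "A = insert x (A - {x})" by auto
      then show ?thesis using A' by blast
    next
      case False
      then show ?thesis using A' by auto
    qed
  next
    fix A assume "A \<in> colourings S m \<union> insert x ` colourings S m"
    then show "A \<in> colourings (insert x S) m"
      using x by (fastforce simp: colourings_def)
  qed
  moreover have "colourings S m \<inter> insert x ` colourings S m = {}"
    using assms(2) by (auto simp: colourings_def)
  moreover have "inj_on (insert x) (colourings S m)"
    using assms(2) by (auto simp: inj_on_def colourings_def)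
  ultimately show ?thesis
    using finite_colourings[OF assms(1)] by (simp add: card_Un_disjoint card_image)
qed

lemma card_colourings_superset:
  assumes "finite T" "set_mset (ends m) \<inter> T = {}"
  shows "card (colourings (set_mset (ends m) \<union> T) m) = 2 ^ card T * card (colourings (set_mset (ends m)) m)"
  using assms
proof (induction T)
  case (insert x T)
  then show ?case
    using card_colourings_insert[of "set_mset (ends m) \<union> T" x m] by simp
qed simp

text \<open>The first assumption puts b on the two displayed arcs only. Its colour is then forced to
  be that of a and c, so forgetting b is a bijection; the inverse lets b follow a.\<close>

lemma card_colourings_join:
  assumes b: "b ~:# ends m" "a ~= b" "c ~= b"
  shows "card (colourings (set_mset (ends (m + {#Upair a b, Upair b c#}))) (m + {#Upair a b, Upair b c#}))
       = card (colourings (set_mset (ends (m + {#Upair a c#}))) (m + {#Upair a c#}))"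
proof (rule bij_betw_same_card[of "\<lambda>A. A - {b}"], rule bij_betw_byWitness[of _ "\<lambda>A. if a \<in> A then insert b A else A"])
  have *: "b ~: set_uprod u" if "u \<in># m" for u
    using b that set_uprod_subset_ends by blast
  let ?S = "set_mset (ends (m + {#Upair a b, Upair b c#}))" and ?S' = "set_mset (ends (m + {#Upair a c#}))"
  show "\<forall>A\<in>colourings ?S (m + {#Upair a b, Upair b c#}). (if a \<in> A - {b} then insert b (A - {b}) else A - {b}) = A"
    using b by (auto simp: colourings_def)
  show "\<forall>A\<in>colourings ?S' (m + {#Upair a c#}). (if a \<in> A then insert b A else A) - {b} = A"
    using b by (auto simp: colourings_def)
  show "(\<lambda>A. A - {b}) ` colourings ?S (m + {#Upair a b, Upair b c#}) \<subseteq> colourings ?S' (m + {#Upair a c#})"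
    using b * by (fastforce simp: colourings_def)
  show "(\<lambda>A. if a \<in> A then insert b A else A) ` colourings ?S' (m + {#Upair a c#})
      \<subseteq> colourings ?S (m + {#Upair a b, Upair b c#})"
    using b * by (fastforce simp: colourings_def)
qed

text \<open>The invariant of the reductions: \<open>join\<close> forgets a label of forced colour,
  while \<open>loop\<close> removes a free label and moves its factor 2 into the power. In the
  terminal state only the empty colouring is left, so the invariant reads off the number of
  loops.\<close>

lemma con_step_twice:
  assumes "con_step p q" "twice (fst p)"
  shows "twice (fst q) \<and>
    2 ^ snd p * card (colourings (set_mset (ends (fst p))) (fst p))
      = 2 ^ snd q * card (colourings (set_mset (ends (fst q))) (fst q))"
  using assms
proof cases
  case (join m a b c n)
  let ?m = "m + {#Upair a b, Upair b c#}"
  have two: "count (ends ?m) x = 2" if "x \<in># ends ?m" for x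
    using assms(2) join that by (simp add: twice_def del: ends_simps)
  from two[of b] have b: "b ~:# ends m" "a ~= b" "c ~= b"
    by (auto simp: not_in_iff split: if_splits)
  have "count (ends (m + {#Upair a c#})) x = 2" if "x \<in># ends (m + {#Upair a c#})" for x
  proof -
    have "x ~= b" using that b by auto
    moreover have "x \<in># ends ?m" using that by auto
    ultimately show ?thesis using two[of x] by (auto split: if_splits)
  qed
  then show ?thesis using join card_colourings_join[OF b] by (simp add: twice_def del: ends_simps)
next
  case (loop m a n)
  let ?m = "m + {#Upair a a#}"
  have two: "count (ends ?m) x = 2" if "x \<in># ends ?m" for x
    using assms(2) loop that by (simp add: twice_def del: ends_simps)
  from two[of a] have a: "a ~:# ends m" by (auto simp: not_in_iff)
  have "count (ends m) x = 2" if "x \<in># ends m" for x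
    using two[of x] a that by (auto split: if_splits)
  moreover have "colourings S ?m = colourings S m" for S
    by (auto simp: colourings_def)
  moreover have "set_mset (ends ?m) = insert a (set_mset (ends m))" by auto
  ultimately show ?thesis
    using loop card_colourings_insert[of "set_mset (ends m)" a m] a by (simp add: twice_def del: ends_simps)
qed

lemma con_steps_twice:
  assumes "con_step\<^sup>*\<^sup>* p q" "twice (fst p)"
  shows "twice (fst q) \<and>
    2 ^ snd p * card (colourings (set_mset (ends (fst p))) (fst p))
      = 2 ^ snd q * card (colourings (set_mset (ends (fst q))) (fst q))"
  using assms by (induction rule: rtranclp_induct) (auto dest: con_step_twice)

text \<open>Reductions may take place in the presence of further arcs l and of k loops already split
  off, so a factor of a product can be reduced before it meets the other factor.\<close>

lemma con_step_context: "con_step (m, n) (m', n') ==> con_step (l + m, n + k) (l + m', n' + k)"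
proof (cases rule: con_step.cases, assumption)
  fix m0 a b c n0
  assume "(m, n) = (m0 + {#Upair a b, Upair b c#}, n0)" "(m', n') = (m0 + {#Upair a c#}, n0)"
  then show ?thesis using con_step.join[of "l + m0" a b c "n0 + k"] by (simp add: add.assoc)
next
  fix m0 a n0
  assume "(m, n) = (m0 + {#Upair a a#}, n0)" "(m', n') = (m0, Suc n0)"
  then show ?thesis using con_step.loop[of "l + m0" a "n0 + k"] by (simp add: add.assoc)
qed

lemma con_steps_context:
  assumes "con_step\<^sup>*\<^sup>* (m, n) (m', n')"
  shows "con_step\<^sup>*\<^sup>* (l + m, n + k) (l + m', n' + k)"
proof -
  have "con_step\<^sup>*\<^sup>* (l + fst p, snd p + k) (l + fst q, snd q + k)" if "con_step\<^sup>*\<^sup>* p q" for p q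
    using that
  proof (induction rule: rtranclp_induct)
    case (step y z)
    have "con_step (l + fst y, snd y + k) (l + fst z, snd z + k)"
      using con_step_context[of "fst y" "snd y" "fst z" "snd z"] step(2) by simp
    then show ?case using step(3) by simp
  qed simp
  from this[OF assms] show ?thesis by simp
qed

text \<open>A label with two occurrences lies twice on one arc, which is then a loop, or on two
  arcs, which can be joined. Either way an arc disappears, so repeated reduction ends.\<close>

lemma con_step_exists:
  assumes "b \<in># ends m" "count (ends m) b = 2"
  obtains m' n' where "con_step (m, n) (m', n')" "size m' < size m"
proof -
  obtain u where u: "u \<in># m" "b \<in> set_uprod u" using assms(1) by (auto simp: in_ends_iff)
  then obtain a where ua: "u = Upair a b" by (cases u) auto
  obtain m0 where m0: "m = add_mset u m0" using u(1) by (metis insert_DiffM)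
  show thesis
  proof (cases "a = b")
    case True
    then show thesis using that[of m0 "Suc n"] con_step.loop[of m0 b n] m0 ua by simp
  next
    case False
    then have "count (ends m0) b = 1" using assms(2) m0 ua by simp
    then have "b \<in># ends m0" by (metis count_eq_zero_iff zero_neq_one)
    then obtain w where w: "w \<in># m0" "b \<in> set_uprod w" by (auto simp: in_ends_iff)
    then obtain c where wc: "w = Upair b c" by (cases w) auto
    obtain m1 where m1: "m0 = add_mset w m1" using w(1) by (metis insert_DiffM)
    show thesis
      using that[of "m1 + {#Upair a c#}" n] con_step.join[of m1 a b c n] m0 m1 ua wc
      by (simp add: add_mset_commute)
  qed
qed

lemma con_steps_to_empty:
  assumes "twice m"
  shows "\<exists>k. con_step\<^sup>*\<^sup>* (m, n) ({#}, k)"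
  using assms
proof (induction "size m" arbitrary: m n rule: less_induct)
  case less
  show ?case
  proof (cases "m = {#}")
    case False
    then obtain u where "u \<in># m" by auto
    then obtain b where b: "b \<in># ends m" by (cases u) (force simp: in_ends_iff)
    then obtain m' n' where st: "con_step (m, n) (m', n')" "size m' < size m"
      using con_step_exists[of b m n] less.prems by (auto simp: twice_def)
    then have "twice m'" using con_step_twice[OF st(1)] less.prems by simp
    then show ?thesis using less.hyps[OF st(2), of n'] st(1) by (meson converse_rtranclp_into_rtranclp)
  qed auto
qed

lemma card_colourings_empty: "card (colourings {} {#}) = 1"
  by (simp add: colourings_def)

text \<open>This justifies the definite description in \<open>loop_count\<close>: by the invariant,
  two complete reductions of the same multiset give equal powers of 2.\<close>

lemma loop_count_eqI:
  assumes "twice m" "con_step\<^sup>*\<^sup>* (m, 0) ({#}, n)"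
  shows "loop_count m = n"
  unfolding loop_count_def
proof (rule the_equality[of _ n])
  fix k assume "con_step\<^sup>*\<^sup>* (m, 0) ({#}, k)"
  with con_steps_twice[OF this] con_steps_twice[OF assms(2)] assms(1)
  have "(2 :: nat) ^ k = 2 ^ n" by (simp add: card_colourings_empty)
  then show "k = n" by simp
qed fact

lemma con_steps_loop_count:
  assumes "twice m" shows "con_step\<^sup>*\<^sup>* (m, 0) ({#}, loop_count m)"
  using con_steps_to_empty[OF assms, of 0] loop_count_eqI[OF assms] by auto

lemma card_colourings_loop_count:
  assumes "twice m" shows "card (colourings (set_mset (ends m)) m) = 2 ^ loop_count m"
  using con_steps_twice[OF con_steps_loop_count[OF assms]] assms by (simp add: card_colourings_empty)

text \<open>Labels on no arc are free and double the count. In this way the closed edges, which meet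
  no vertex, are counted together with the loops.\<close>

lemma card_colourings_loop_count_superset:
  assumes "twice m" "finite S" "set_mset (ends m) \<subseteq> S"
  shows "card (colourings S m) = 2 ^ (loop_count m + card (S - set_mset (ends m)))"
proof -
  have "set_mset (ends m) \<union> (S - set_mset (ends m)) = S" using assms by auto
  with card_colourings_superset[of "S - set_mset (ends m)" m] assms
  show ?thesis by (simp add: card_colourings_loop_count power_add mult.commute)
qed

lemma loop_count_steps:
  assumes "twice m" "con_step\<^sup>*\<^sup>* (m, n) (m', n')"
  shows "twice m'" "loop_count m + n = loop_count m' + n'"
proof -
  show t: "twice m'" using con_steps_twice[OF assms(2)] assms(1) by simp
  have "(2 :: nat) ^ (n + loop_count m) = 2 ^ (n' + loop_count m')"
    using con_steps_twice[OF assms(2)] assms(1) t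
    by (simp add: card_colourings_loop_count power_add)
  then show "loop_count m + n = loop_count m' + n'" by simp
qed

lemma loop_count_empty [simp]: "loop_count {#} = 0"
  by (rule loop_count_eqI) (auto simp: twice_def)

lemma loop_count_image:
  assumes "twice m" "inj_on f (set_mset (ends m))"
  shows "loop_count (image_mset (map_uprod f) m) = loop_count m"
proof -
  have step: "con_step (image_mset (map_uprod f) (fst p), snd p) (image_mset (map_uprod f) (fst q), snd q)"
    if "con_step p q" for p q
    using that
  proof cases
    case (join m a b c n)
    then show ?thesis using con_step.join[of "image_mset (map_uprod f) m" "f a" "f b" "f c" n] by simp
  next
    case (loop m a n)
    then show ?thesis using con_step.loop[of "image_mset (map_uprod f) m" "f a" n] by simp
  qed
  have "con_step\<^sup>*\<^sup>* (image_mset (map_uprod f) (fst p), snd p) (image_mset (map_uprod f) (fst q), snd q)"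
    if "con_step\<^sup>*\<^sup>* p q" for p q
    using that by (induction rule: rtranclp_induct) (auto dest: step)
  from this[OF con_steps_loop_count[OF assms(1)]]
  have "con_step\<^sup>*\<^sup>* (image_mset (map_uprod f) m, 0) ({#}, loop_count m)" by simp
  moreover have "twice (image_mset (map_uprod f) m)"
    unfolding twice_def ends_image_mset
  proof
    fix y assume "y \<in># image_mset f (ends m)"
    then obtain x where "x \<in># ends m" "y = f x" by auto
    then show "count (image_mset f (ends m)) y = 2"
      using assms count_image_mset_on_inj[of f "ends m" x] by (simp add: twice_def)
  qed
  ultimately show ?thesis by (rule loop_count_eqI[rotated])
qed

text \<open>The multiset of arc ends of a tangle is \<open>mset_set B + (mset_set Y + mset_set Y)\<close>: each boundary
  label once, each inner label twice.\<close>

lemma con_steps_to_matching: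
  assumes "ends m = mset_set B + (mset_set Y + mset_set Y)" "finite B" "finite Y" "B \<inter> Y = {}"
  shows "\<exists>M k. perfect_matching B M \<and> finite M \<and> con_step\<^sup>*\<^sup>* (m, n) (mset_set M, k)"
  using assms
proof (induction "card Y" arbitrary: m n Y rule: less_induct)
  case less
  show ?case
  proof (cases "Y = {}")
    case True
    then have e: "ends m = mset_set B" using less.prems by simp
    \<comment> \<open>Without inner labels no label repeats, so no arc is degenerate, no arc occurs
      twice and no label lies on two arcs: the arcs form a matching.\<close>
    have c1: "count (ends m) x \<le> 1" for x using e by (auto simp: count_mset_set')
    have "count m u = 1" if "u \<in># m" for u
    proof (rule ccontr)
      assume "count m u ~= 1"
      moreover obtain m1 where m1: "m = add_mset u m1" using \<open>u \<in># m\<close> by (metis insert_DiffM)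
      ultimately have "u \<in># m1" by (auto simp: not_in_iff)
      then obtain m2 where m2: "m1 = add_mset u m2" by (metis insert_DiffM)
      obtain a b where u: "u = Upair a b" by (cases u)
      show False using c1[of a] m1 m2 u by (simp split: if_splits)
    qed
    then have m: "mset_set (set_mset m) = m"
      by (intro multiset_eqI) (auto simp: count_mset_set' not_in_iff)
    have proper: "proper_uprod u" "set_uprod u \<subseteq> B" if "u \<in># m" for u
    proof -
      obtain m1 where m1: "m = add_mset u m1" using \<open>u \<in># m\<close> by (metis insert_DiffM)
      obtain a b where u: "u = Upair a b" by (cases u)
      show "proper_uprod u" using c1[of a] m1 u by (auto split: if_splits)
      show "set_uprod u \<subseteq> B" using set_uprod_subset_ends[OF that] e less.prems(2) by simp
    qed
    have "\<exists>!u. u \<in> set_mset m \<and> x \<in> set_uprod u" if "x \<in> B" for x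
    proof -
      have "x \<in># ends m" using e that less.prems(2) by simp
      then obtain u where u: "u \<in># m" "x \<in> set_uprod u" by (auto simp: in_ends_iff)
      moreover have "w = u" if w: "w \<in># m" "x \<in> set_uprod w" for w
      proof (rule ccontr)
        assume "w ~= u"
        obtain m1 where m1: "m = add_mset u m1" using u(1) by (metis insert_DiffM)
        then have "w \<in># m1" using w \<open>w ~= u\<close> by auto
        then have "x \<in># ends m1" using w(2) by (auto simp: in_ends_iff)
        moreover have "x \<in># mset_uprod u" using u(2) by (auto simp: mset_uprod_def)
        ultimately have "count (ends m) x \<ge> 2"
          using m1 by (auto simp: count_greater_zero_iff[symmetric] simp del: count_greater_zero_iff)
        then show False using c1[of x] by simp
      qed
      ultimately show ?thesis by blast
    qed
    then have "perfect_matching B (set_mset m)" using proper by (auto simp: perfect_matching_def)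
    then show ?thesis using m by (metis finite_set_mset rtranclp.rtrancl_refl)
  next
    case False
    \<comment> \<open>One step at b removes b from the inner labels and leaves the boundary labels
      alone: a loop if both occurrences of b are on one arc, a join otherwise.\<close>
    then obtain b where b: "b \<in> Y" by auto
    then have c2: "count (ends m) b = 2" "b ~: B" using less.prems by (auto simp: count_mset_set')
    obtain u where u: "u \<in># m" "b \<in> set_uprod u"
      using c2 by (metis in_ends_iff count_eq_zero_iff zero_neq_numeral)
    then obtain a where ua: "u = Upair a b" by (cases u) auto
    obtain m0 where m0: "m = add_mset u m0" using u(1) by (metis insert_DiffM)
    let ?Y = "Y - {b}"
    have Y: "mset_set Y = add_mset b (mset_set ?Y)" using b less.prems(3) by (simp add: mset_set.remove)
    have IH: "\<exists>M k. perfect_matching B M \<and> finite M \<and> con_step\<^sup>*\<^sup>* (m', n') (mset_set M, k)"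
      if "ends m' = mset_set B + (mset_set ?Y + mset_set ?Y)" for m' n'
    proof (rule less.hyps[OF _ that])
      show "card ?Y < card Y" using b less.prems(3) by (rule card_Diff1_less[rotated])
    qed (use less.prems in auto)
    show ?thesis
    proof (cases "a = b")
      case True
      then have "con_step (m, n) (m0, Suc n)" using con_step.loop[of m0 b n] m0 ua by simp
      moreover have "ends m0 = mset_set B + (mset_set ?Y + mset_set ?Y)"
        using less.prems(1) m0 ua True Y by simp
      ultimately show ?thesis using IH by (meson converse_rtranclp_into_rtranclp)
    next
      case False
      then have "count (ends m0) b = 1" using c2 m0 ua by simp
      then have "b \<in># ends m0" by (metis count_eq_zero_iff zero_neq_one)
      then obtain w where w: "w \<in># m0" "b \<in> set_uprod w" by (auto simp: in_ends_iff)
      then obtain c where wc: "w = Upair b c" by (cases w) auto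
      obtain m1 where m1: "m0 = add_mset w m1" using w(1) by (metis insert_DiffM)
      have "con_step (m, n) (m1 + {#Upair a c#}, n)"
        using con_step.join[of m1 a b c n] m0 m1 ua wc by (simp add: add_mset_commute)
      moreover have "ends (m1 + {#Upair a c#}) = mset_set B + (mset_set ?Y + mset_set ?Y)"
        using less.prems(1) m0 m1 ua wc Y by (simp add: add_mset_commute)
      ultimately show ?thesis using IH by (meson converse_rtranclp_into_rtranclp)
    qed
  qed
qed

section \<open>Brackets and tangles\<close>

lemma poly_mapping_sum_single:
  "P = (\<Sum>m\<in>Poly_Mapping.keys P. Poly_Mapping.single m (Poly_Mapping.lookup P m))"
proof (rule poly_mapping_eqI)
  fix k
  show "Poly_Mapping.lookup P k
      = Poly_Mapping.lookup (\<Sum>m\<in>Poly_Mapping.keys P. Poly_Mapping.single m (Poly_Mapping.lookup P m)) k"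
    by (simp add: lookup_sum lookup_single when_def in_keys_iff)
qed

lemma bracket_superset:
  assumes "finite K" "Poly_Mapping.keys P \<subseteq> K"
  shows "bracket P = (\<Sum>m\<in>K. Poly_Mapping.lookup P m * Var Vo ^ loop_count m)"
  unfolding bracket_def
  by (rule sum.mono_neutral_left) (use assms in \<open>auto simp: in_keys_iff\<close>)

lemma bracket_zero [simp]: "bracket 0 = 0"
  by (simp add: bracket_def)

lemma bracket_add: "bracket (P + Q) = bracket P + bracket Q"
proof -
  let ?K = "Poly_Mapping.keys P \<union> Poly_Mapping.keys Q"
  have "Poly_Mapping.keys (P + Q) \<subseteq> ?K" by (rule keys_add)
  then have "bracket (P + Q) = (\<Sum>m\<in>?K. Poly_Mapping.lookup (P + Q) m * Var Vo ^ loop_count m)"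
    by (intro bracket_superset) auto
  also have "\<dots> = bracket P + bracket Q"
    by (subst (1 2) bracket_superset[of ?K]) (auto simp: lookup_add distrib_right sum.distrib)
  finally show ?thesis .
qed

lemma bracket_sum: "bracket (sum f S) = (\<Sum>x\<in>S. bracket (f x))"
  by (induction S rule: infinite_finite_induct) (auto simp: bracket_add)

lemma bracket_single: "bracket (Poly_Mapping.single m c) = c * Var Vo ^ loop_count m"
  by (subst bracket_superset[of "{m}"]) auto

lemma bracket_times_single:
  "bracket (P * Poly_Mapping.single m c)
    = (\<Sum>l\<in>Poly_Mapping.keys P. Poly_Mapping.lookup P l * c * Var Vo ^ loop_count (l + m))"
  by (subst poly_mapping_sum_single[of P])
    (simp add: sum_distrib_right bracket_sum mult_single bracket_single)

lemma con_arc_prod: "finite M ==> (\<Prod>u\<in>M. con_arc u) = Poly_Mapping.single (mset_set M) 1"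
  by (induction M rule: finite_induct) (auto simp: con_arc_def mult_single)

text \<open>Every smoothing of a crossing uses its four corners once each, so all monomials of a
  product of crossings have the same multiset of arc ends. That each label occurs twice can then be
  checked once for the whole polynomial.\<close>

definition homogeneous :: "'l conpoly => 'l multiset => bool" where
  "homogeneous P N \<longleftrightarrow> (\<forall>m\<in>Poly_Mapping.keys P. ends m = N)"

lemma homogeneous_one: "homogeneous 1 {#}"
  by (simp add: homogeneous_def)

lemma homogeneous_single: "homogeneous (Poly_Mapping.single m c) (ends m)"
  by (simp add: homogeneous_def)

lemma homogeneous_con: "homogeneous (con a b) {#a, b#}"
  using homogeneous_single[of "{#Upair a b#}" 1] by (simp add: con_arc_def)

lemma homogeneous_times: "homogeneous P N ==> homogeneous Q N' ==> homogeneous (P * Q) (N + N')"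
  using keys_mult[of P Q] by (fastforce simp: homogeneous_def)

lemma homogeneous_add: "homogeneous P N ==> homogeneous Q N ==> homogeneous (P + Q) N"
  using keys_add[of P Q] by (fastforce simp: homogeneous_def)

lemma homogeneous_prod:
  "(\<And>x. x \<in> S ==> homogeneous (f x) (N x)) ==> homogeneous (prod f S) (\<Sum>x\<in>S. N x)"
  by (induction S rule: infinite_finite_induct) (auto intro: homogeneous_times simp: homogeneous_one)

fun corners :: "'l crossing_symbol => 'l multiset" where
  "corners (X1 a b c d) = {#a, b, c, d#}"
| "corners (X2 a b c d) = {#a, b, c, d#}"

text \<open>The states are numbered 0, 1, 2 in the order of the terms of \<open>expand\<close>.
  Larger indices repeat state 2, so the arc ends are the corners for every i.\<close>

fun smoothing :: "'l crossing_symbol => nat => 'l uprod multiset" where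
  "smoothing (X1 a b c d) i = (if i = 0 then {#Upair a b, Upair c d#}
     else if i = 1 then {#Upair a d, Upair b c#} else {#Upair a c, Upair b d#})"
| "smoothing (X2 a b c d) i = (if i = 0 then {#Upair a b, Upair c d#}
     else if i = 1 then {#Upair a d, Upair b c#} else {#Upair a c, Upair b d#})"

fun weight :: "'l crossing_symbol => nat => zpoly" where
  "weight (X1 a b c d) i = (if i = 0 then Var VM * Var VA else if i = 1 then Var VM * Var VB else Var VF)"
| "weight (X2 a b c d) i = (if i = 0 then Var VM * Var VX else if i = 1 then Var VM * Var VY else Var VZ)"

lemma expand_eq_sum: "expand x = (\<Sum>i<3. Poly_Mapping.single (smoothing x i) (weight x i))"
  by (cases x) (simp_all add: numeral_3_eq_3 scalar_def con_arc_def mult_single add_mset_commute)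

lemma ends_smoothing [simp]: "ends (smoothing x i) = corners x"
  by (cases x) (auto simp: add_mset_commute)

lemma homogeneous_expand: "homogeneous (expand x) (corners x)"
proof -
  have "Poly_Mapping.keys (expand x) \<subseteq> (\<Union>i<3. {smoothing x i})"
    unfolding expand_eq_sum using keys_sum
    by (rule order_trans) auto
  then show ?thesis by (auto simp: homogeneous_def)
qed

lemma prod_single:
  "finite S ==> (\<Prod>x\<in>S. Poly_Mapping.single (f x) (c x)) = Poly_Mapping.single (\<Sum>x\<in>S. f x) (\<Prod>x\<in>S. c x)"
  by (induction S rule: finite_induct) (auto simp: mult_single)

text \<open>The sum over states: s picks one of the three smoothings at every crossing.\<close>

lemma prod_expand:
  assumes "finite S"
  shows "(\<Prod>v\<in>S. expand (f v)) = (\<Sum>s\<in>S \<rightarrow>\<^sub>E {..<3}.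
    Poly_Mapping.single (\<Sum>v\<in>S. smoothing (f v) (s v)) (\<Prod>v\<in>S. weight (f v) (s v)))"
  unfolding expand_eq_sum using assms by (subst prod_sum_PiE) (auto simp: prod_single)

text \<open>Loop counts do not depend on the order of the reductions, so the arcs m may be reduced
  before they meet those of P; the n loops split off on the way become a power of o.\<close>

lemma bracket_times_steps:
  assumes "\<And>l. l \<in> Poly_Mapping.keys P ==> twice (l + m)"
    and "con_step\<^sup>*\<^sup>* (m, 0) (m', n)"
  shows "bracket (P * Poly_Mapping.single m 1) = Var Vo ^ n * bracket (P * Poly_Mapping.single m' 1)"
proof -
  have "loop_count (l + m) = loop_count (l + m') + n" if "l \<in> Poly_Mapping.keys P" for l
    using loop_count_steps(2)[OF assms(1)[OF that] con_steps_context[OF assms(2), of l 0]] by simp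
  then have "(\<Sum>l\<in>Poly_Mapping.keys P. Poly_Mapping.lookup P l * 1 * Var Vo ^ loop_count (l + m))
      = (\<Sum>l\<in>Poly_Mapping.keys P. Var Vo ^ n * (Poly_Mapping.lookup P l * 1 * Var Vo ^ loop_count (l + m')))"
    by (intro sum.cong) (auto simp: power_add ac_simps)
  then show ?thesis by (simp add: bracket_times_single sum_distrib_left)
qed

lemma I_infinity_zero: "0 \<in> I_infinity"
  unfolding I_infinity_def by (rule ideal_zero)

lemma I_infinity_add: "x \<in> I_infinity ==> y \<in> I_infinity ==> x + y \<in> I_infinity"
  unfolding I_infinity_def by (rule ideal_add)

lemma I_infinity_times: "x \<in> I_infinity ==> a * x \<in> I_infinity"
  unfolding I_infinity_def by (rule ideal_times)

lemma I_infinity_sum: "(\<And>i. i \<in> S ==> f i \<in> I_infinity) ==> (\<Sum>i\<in>S. f i) \<in> I_infinity"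
  unfolding I_infinity_def by (rule ideal_sum)

lemma I_infinity_commute: "x - y \<in> I_infinity ==> y - x \<in> I_infinity"
  using I_infinity_times[of "x - y" "-1"] by simp

lemma I_infinity_trans: "x - y \<in> I_infinity ==> y - z \<in> I_infinity ==> x - z \<in> I_infinity"
  using I_infinity_add[of "x - y" "y - z"] by simp

text \<open>Testing against perfect matchings makes this, for the two sides of a pair, exactly the
  condition that its \<open>relators\<close> lie in \<open>I_infinity\<close>.\<close>

definition tangle_equiv :: "'l set => 'l conpoly => 'l conpoly => bool" where
  "tangle_equiv B P P' \<longleftrightarrow> (\<forall>M. perfect_matching B M \<longrightarrow>
     bracket (P * (\<Prod>u\<in>M. con_arc u)) - bracket (P' * (\<Prod>u\<in>M. con_arc u)) \<in> I_infinity)"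

lemma tangle_equiv_sym: "tangle_equiv B P P' ==> tangle_equiv B P' P"
  by (auto simp: tangle_equiv_def intro: I_infinity_commute)

lemma finite_perfect_matching:
  assumes "perfect_matching B M" "finite B" shows "finite M"
proof (rule finite_subset)
  show "M \<subseteq> (\<lambda>(a, b). Upair a b) ` (B \<times> B)"
  proof
    fix u assume u: "u \<in> M"
    obtain a b where "u = Upair a b" by (cases u)
    then show "u \<in> (\<lambda>(a, b). Upair a b) ` (B \<times> B)"
      using assms(1) u by (force simp: perfect_matching_def)
  qed
qed (use assms(2) in auto)

lemma ends_perfect_matching:
  assumes "perfect_matching B M" "finite B"
  shows "ends (mset_set M) = mset_set B"
proof (rule multiset_eqI)
  fix x
  have fin: "finite M" using assms by (rule finite_perfect_matching)
  have c: "count (mset_uprod u) x = (if x \<in> set_uprod u then 1 else 0)" if "u \<in> M" for u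
    using that assms(1) by (cases u) (auto simp: perfect_matching_def)
  have "count (ends (mset_set M)) x = (\<Sum>u\<in>M. count (mset_uprod u) x)"
    using fin by (simp add: ends_def sum_unfold_sum_mset count_sum flip: sum_unfold_sum_mset)
  also have "\<dots> = (\<Sum>u\<in>M. if x \<in> set_uprod u then 1 else 0)" using c by simp
  also have "\<dots> = card {u \<in> M. x \<in> set_uprod u}" using fin by (simp add: sum.If_cases Int_def)
  also have "\<dots> = (if x \<in> B then 1 else 0)"
  proof (cases "x \<in> B")
    case True
    then have "\<exists>!u. u \<in> M \<and> x \<in> set_uprod u" using assms(1) by (auto simp: perfect_matching_def)
    then obtain u where "{u \<in> M. x \<in> set_uprod u} = {u}" by auto
    then show ?thesis using True by simp
  next
    case False
    then have "{u \<in> M. x \<in> set_uprod u} = {}" using assms(1) by (auto simp: perfect_matching_def)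
    then show ?thesis using False by (simp del: Collect_empty_eq)
  qed
  finally show "count (ends (mset_set M)) x = count (mset_set B) x"
    using assms(2) by (simp add: count_mset_set')
qed

definition inner_twice :: "'l set => 'l multiset => 'l set => bool" where
  "inner_twice B N Y \<longleftrightarrow> finite B \<and> finite Y \<and> B \<inter> Y = {} \<and> N = mset_set B + (mset_set Y + mset_set Y)"

text \<open>Locality: the complement of the tangle reduces to matchings of the boundary labels.\<close>

lemma tangle_equiv_bracket:
  assumes eq: "tangle_equiv B P P'"
    and P: "homogeneous P N" "inner_twice B N Y"
    and P': "homogeneous P' N'" "inner_twice B N' Y'"
    and Q: "homogeneous Q K" "inner_twice B K Z"
    and disj: "Y \<inter> Z = {}" "Y' \<inter> Z = {}"
  shows "bracket (P * Q) - bracket (P' * Q) \<in> I_infinity"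
proof -
  have fin: "finite B" "finite Y" "finite Y'" "finite Z" using P P' Q by (auto simp: inner_twice_def)
  have tw: "twice (l + m)" if "ends l = mset_set B + (mset_set W + mset_set W)"
    "ends m = mset_set B + (mset_set Z + mset_set Z)" "finite W" "W \<inter> B = {}" "W \<inter> Z = {}" "B \<inter> Z = {}" for l m W
  proof (rule twiceI[of _ "B \<union> W \<union> Z"])
    have "mset_set (B \<union> W \<union> Z) = mset_set B + mset_set W + mset_set Z"
      using that fin mset_set_Union[of "B \<union> W" Z] mset_set_Union[of B W]
      by (simp add: Int_Un_distrib Int_commute)
    then show "ends (l + m) = mset_set (B \<union> W \<union> Z) + mset_set (B \<union> W \<union> Z)"
      using that by (simp add: ac_simps)
  qed
  \<comment> \<open>By linearity in Q one monomial m may be treated at a time. It reduces to a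
    matching of B and k loops, and this reduction is the same next to P and next to P'.\<close>
  have "bracket (P * Poly_Mapping.single m 1) - bracket (P' * Poly_Mapping.single m 1) \<in> I_infinity"
    if "m \<in> Poly_Mapping.keys Q" for m
  proof -
    have m: "ends m = mset_set B + (mset_set Z + mset_set Z)" "B \<inter> Z = {}"
      using Q that by (auto simp: homogeneous_def inner_twice_def)
    obtain M k where M: "perfect_matching B M" "finite M" and st: "con_step\<^sup>*\<^sup>* (m, 0) (mset_set M, k)"
      using con_steps_to_matching[OF m(1) fin(1,4) m(2), of 0] by blast
    have "bracket (P * Poly_Mapping.single m 1) = Var Vo ^ k * bracket (P * Poly_Mapping.single (mset_set M) 1)"
      by (rule bracket_times_steps[OF tw[where W = Y, OF _ m(1)] st])
        (use P disj m in \<open>auto simp: homogeneous_def inner_twice_def\<close>)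
    moreover
    have "bracket (P' * Poly_Mapping.single m 1) = Var Vo ^ k * bracket (P' * Poly_Mapping.single (mset_set M) 1)"
      by (rule bracket_times_steps[OF tw[where W = Y', OF _ m(1)] st])
        (use P' disj m in \<open>auto simp: homogeneous_def inner_twice_def\<close>)
    moreover have "bracket (P * Poly_Mapping.single (mset_set M) 1) - bracket (P' * Poly_Mapping.single (mset_set M) 1) \<in> I_infinity"
    proof -
      have "bracket (P * (\<Prod>u\<in>M. con_arc u)) - bracket (P' * (\<Prod>u\<in>M. con_arc u)) \<in> I_infinity"
        using eq M(1) unfolding tangle_equiv_def by blast
      then show ?thesis by (simp only: con_arc_prod[OF M(2)])
    qed
    ultimately show ?thesis
      by (simp only: I_infinity_times flip: right_diff_distrib)
  qed
  moreover have single: "bracket (R * Poly_Mapping.single m c) = c * bracket (R * Poly_Mapping.single m 1)"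
    for R :: "'a conpoly" and m c
    by (simp add: bracket_times_single sum_distrib_left ac_simps)
  have "bracket (R * Q) = (\<Sum>m\<in>Poly_Mapping.keys Q. Poly_Mapping.lookup Q m * bracket (R * Poly_Mapping.single m 1))"
    for R :: "'a conpoly"
  proof -
    have "R * Q = (\<Sum>m\<in>Poly_Mapping.keys Q. R * Poly_Mapping.single m (Poly_Mapping.lookup Q m))"
      by (subst (1) poly_mapping_sum_single[of Q]) (simp add: sum_distrib_left)
    then have "bracket (R * Q) = (\<Sum>m\<in>Poly_Mapping.keys Q. bracket (R * Poly_Mapping.single m (Poly_Mapping.lookup Q m)))"
      by (simp only: bracket_sum)
    then show ?thesis by (simp only: single[of R _ "Poly_Mapping.lookup Q _"])
  qed
  then have "bracket (P * Q) - bracket (P' * Q) = (\<Sum>m\<in>Poly_Mapping.keys Q. Poly_Mapping.lookup Q m *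
      (bracket (P * Poly_Mapping.single m 1) - bracket (P' * Poly_Mapping.single m 1)))"
    by (simp add: sum_subtractf right_diff_distrib)
  ultimately show ?thesis
    by (auto intro: I_infinity_sum I_infinity_times)
qed

lemma homogeneous_matching:
  assumes "perfect_matching B M" "finite B"
  shows "homogeneous (\<Prod>u\<in>M. con_arc u) (mset_set B)"
  using homogeneous_single[of "mset_set M" 1] ends_perfect_matching[OF assms] finite_perfect_matching[OF assms]
  by (simp add: con_arc_prod)



section \<open>Renaming and identifying labels\<close>

text \<open>The map f may identify labels: gluing an arc to a boundary label is such an
  identification, by \<open>bracket_times_con\<close>.\<close>

definition relabel :: "('a => 'b) => 'a conpoly => 'b conpoly" where
  "relabel f P = (\<Sum>m\<in>Poly_Mapping.keys P. Poly_Mapping.single (image_mset (map_uprod f) m) (Poly_Mapping.lookup P m))"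

lemma relabel_superset:
  assumes "finite K" "Poly_Mapping.keys P \<subseteq> K"
  shows "relabel f P = (\<Sum>m\<in>K. Poly_Mapping.single (image_mset (map_uprod f) m) (Poly_Mapping.lookup P m))"
  unfolding relabel_def
  by (rule sum.mono_neutral_left) (use assms in \<open>auto simp: in_keys_iff\<close>)

lemma relabel_single: "relabel f (Poly_Mapping.single m c) = Poly_Mapping.single (image_mset (map_uprod f) m) c"
  by (subst relabel_superset[of "{m}"]) auto

lemma relabel_zero [simp]: "relabel f 0 = 0"
  by (simp add: relabel_def)

lemma relabel_one [simp]: "relabel f 1 = 1"
  using relabel_single[of f "{#}" 1] by simp

lemma relabel_add: "relabel f (P + Q) = relabel f P + relabel f Q"
proof -
  let ?K = "Poly_Mapping.keys P \<union> Poly_Mapping.keys Q"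
  have "Poly_Mapping.keys (P + Q) \<subseteq> ?K" by (rule keys_add)
  then have "relabel f (P + Q) = (\<Sum>m\<in>?K. Poly_Mapping.single (image_mset (map_uprod f) m) (Poly_Mapping.lookup (P + Q) m))"
    by (intro relabel_superset) auto
  also have "\<dots> = relabel f P + relabel f Q"
    by (subst (1 2) relabel_superset[of ?K]) (auto simp: lookup_add single_add sum.distrib)
  finally show ?thesis .
qed

lemma relabel_sum: "relabel f (sum g S) = (\<Sum>x\<in>S. relabel f (g x))"
  by (induction S rule: infinite_finite_induct) (auto simp: relabel_add)

lemma relabel_times: "relabel f (P * Q) = relabel f P * relabel f Q"
proof -
  let ?s = "\<lambda>P m. Poly_Mapping.single m (Poly_Mapping.lookup P m)"
  have "P * Q = (\<Sum>m\<in>Poly_Mapping.keys P. \<Sum>l\<in>Poly_Mapping.keys Q. ?s P m * ?s Q l)"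
    using poly_mapping_sum_single[of P] poly_mapping_sum_single[of Q]
    by (simp add: flip: sum_product)
  then have "relabel f (P * Q) = (\<Sum>m\<in>Poly_Mapping.keys P. \<Sum>l\<in>Poly_Mapping.keys Q. relabel f (?s P m * ?s Q l))"
    by (simp add: relabel_sum)
  also have "\<dots> = relabel f P * relabel f Q"
    by (simp add: mult_single relabel_single relabel_def[of f P] relabel_def[of f Q] sum_product)
  finally show ?thesis .
qed

lemma relabel_prod: "relabel f (prod g S) = (\<Prod>x\<in>S. relabel f (g x))"
  by (induction S rule: infinite_finite_induct) (auto simp: relabel_times)

lemma relabel_con_arc: "relabel f (con_arc u) = con_arc (map_uprod f u)"
  by (simp add: con_arc_def relabel_single)

lemma relabel_expand: "relabel f (expand x) = expand (map_crossing_symbol f x)"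
  by (cases x) (simp_all add: scalar_def con_arc_def mult_single relabel_add relabel_single)

lemma bracket_relabel:
  assumes "homogeneous P (mset_set Y + mset_set Y)" "finite Y" "inj_on f Y"
  shows "bracket (relabel f P) = bracket P"
proof -
  have "loop_count (image_mset (map_uprod f) m) = loop_count m" if "m \<in> Poly_Mapping.keys P" for m
  proof -
    have "ends m = mset_set Y + mset_set Y" using assms(1) that by (simp add: homogeneous_def)
    then show ?thesis using assms(2,3) by (intro loop_count_image twiceI) auto
  qed
  then have "bracket (relabel f P)
      = (\<Sum>m\<in>Poly_Mapping.keys P. Poly_Mapping.lookup P m * Var Vo ^ loop_count m)"
    by (simp add: relabel_def bracket_sum bracket_single)
  then show ?thesis by (simp add: bracket_def)
qed

section \<open>The tangles of the Reidemeister moves\<close>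

text \<open>The symbol of a crossing with ends \<open>p, q, p', q'\<close> in counterclockwise order; \<open>ov\<close> tells whether the
  strand \<open>p p'\<close> is the overpass and \<open>sh\<close> whether the quadrant between \<open>p\<close> and \<open>q\<close> is shaded.\<close>

definition sym4 :: "bool => bool => 'l => 'l => 'l => 'l => 'l crossing_symbol" where
  "sym4 ov sh p q p' q' =
     (if ov then (if sh then X1 else X2) q p' q' p else (if sh then X2 else X1) p' q' p q)"

lemma con_commute: "con a b = con b a"
proof -
  have "Upair a b = Upair b a" by simp
  then show ?thesis by (simp only:)
qed

text \<open>The two choices of the starting end of the underpass.\<close>

lemma expand_half_turn:
  "expand (X1 a b c d) = expand (X1 c d a b)" "expand (X2 a b c d) = expand (X2 c d a b)"
  by (simp_all add: con_commute ac_simps)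

lemma expand_sym4_half_turn: "expand (sym4 ov sh p q p' q') = expand (sym4 ov sh p' q' p q)"
  using expand_half_turn by (auto simp: sym4_def simp del: expand.simps)

text \<open>A quarter turn of the list exchanges the two strands and passes to the neighbouring
  quadrant, which has the other colour.\<close>

lemma expand_sym4_quarter_turn: "expand (sym4 ov sh p q p' q') = expand (sym4 (\<not> ov) (\<not> sh) q p' q' p)"
  using expand_half_turn by (auto simp: sym4_def simp del: expand.simps)

lemma map_sym4: "map_crossing_symbol f (sym4 ov sh p q p' q') = sym4 ov sh (f p) (f q) (f p') (f q')"
  by (simp add: sym4_def)

lemma corners_sym4: "corners (sym4 ov sh p q p' q') = {#p, q, p', q'#}"
  by (simp add: sym4_def add_mset_commute)

lemma homogeneous_sym4: "homogeneous (expand (sym4 ov sh p q p' q')) {#p, q, p', q'#}"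
  using homogeneous_expand[of "sym4 ov sh p q p' q'"] by (simp add: corners_sym4)

lemma perfect_matching_image:
  assumes "perfect_matching B M" "inj_on f B"
  shows "perfect_matching (f ` B) (map_uprod f ` M)"
  unfolding perfect_matching_def
proof (intro conjI ballI)
  have sub: "proper_uprod u" "set_uprod u \<subseteq> B" if "u \<in> M" for u
    using assms(1) that by (auto simp: perfect_matching_def)
  fix w assume "w \<in> map_uprod f ` M"
  then obtain u where u: "u \<in> M" "w = map_uprod f u" by auto
  obtain a b where ab: "u = Upair a b" by (cases u)
  show "proper_uprod w" using sub[OF u(1)] u(2) ab assms(2) by (auto simp: inj_on_def)
  show "set_uprod w \<subseteq> f ` B" using sub[OF u(1)] u(2) ab by auto
next
  have sub: "set_uprod u \<subseteq> B" if "u \<in> M" for u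
    using assms(1) that by (auto simp: perfect_matching_def)
  fix y assume "y \<in> f ` B"
  then obtain x where x: "x \<in> B" "y = f x" by auto
  have ex: "\<exists>!u. u \<in> M \<and> x \<in> set_uprod u" using assms(1) x(1) by (auto simp: perfect_matching_def)
  then obtain u where u: "u \<in> M" "x \<in> set_uprod u" by blast
  show "\<exists>!w. w \<in> map_uprod f ` M \<and> y \<in> set_uprod w"
  proof (rule ex1I[of _ "map_uprod f u"])
    show "map_uprod f u \<in> map_uprod f ` M \<and> y \<in> set_uprod (map_uprod f u)"
      using u x by (auto simp: uprod.set_map)
    fix w assume "w \<in> map_uprod f ` M \<and> y \<in> set_uprod w"
    then obtain v where v: "v \<in> M" "w = map_uprod f v" "f x \<in> f ` set_uprod v"
      using x by (auto simp: uprod.set_map)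
    then have "x \<in> set_uprod v" using sub[OF v(1)] assms(2) x(1) by (metis inj_on_image_mem_iff)
    then show "w = map_uprod f u" using ex u v by blast
  qed
qed

text \<open>A matching of the renamed boundary is pulled back along f, which leaves both brackets
  unchanged. Injectivity is asked on the labels of each side separately because the inner labels of
  the two sides never occur in one product.\<close>

lemma tangle_equiv_relabel:
  assumes eq: "tangle_equiv B P P'"
    and P: "homogeneous P N" "inner_twice B N Y" "inj_on f (B \<union> Y)"
    and P': "homogeneous P' N'" "inner_twice B N' Y'" "inj_on f (B \<union> Y')"
  shows "tangle_equiv (f ` B) (relabel f P) (relabel f P')"
  unfolding tangle_equiv_def
proof (intro allI impI)
  fix M' assume M': "perfect_matching (f ` B) M'"
  have fin: "finite B" using P by (simp add: inner_twice_def)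
  have inj: "inj_on f B" using P(3) by (simp add: inj_on_Un)
  let ?g = "inv_into B f"
  define M where "M = map_uprod ?g ` M'"
  have fg: "map_uprod f (map_uprod ?g u) = u" if "u \<in> M'" for u
  proof -
    have "set_uprod u \<subseteq> f ` B" using M' that by (auto simp: perfect_matching_def)
    then show ?thesis by (cases u) (auto simp: f_inv_into_f)
  qed
  have "perfect_matching (?g ` f ` B) M"
    unfolding M_def by (rule perfect_matching_image[OF M']) (simp add: inj_on_inv_into)
  moreover have "?g ` f ` B = B" using inj by force
  ultimately have M: "perfect_matching B M" by simp
  have injM: "inj_on (map_uprod f) M"
    unfolding M_def by (rule inj_on_inverseI[of _ "map_uprod ?g"]) (use fg in auto)
  have "map_uprod f ` M = M'" unfolding M_def using fg by force
  then have "relabel f (\<Prod>u\<in>M. con_arc u) = (\<Prod>u\<in>M'. con_arc u)"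
    using injM by (auto simp: relabel_prod relabel_con_arc prod.reindex)
  then have rel: "relabel f R * (\<Prod>u\<in>M'. con_arc u) = relabel f (R * (\<Prod>u\<in>M. con_arc u))" for R
    by (simp add: relabel_times)
  have br: "bracket (relabel f (R * (\<Prod>u\<in>M. con_arc u))) = bracket (R * (\<Prod>u\<in>M. con_arc u))"
    if R: "homogeneous R K" "inner_twice B K Z" "inj_on f (B \<union> Z)" for R K Z
  proof (rule bracket_relabel)
    have "homogeneous (R * (\<Prod>u\<in>M. con_arc u)) (K + mset_set B)"
      by (intro homogeneous_times R homogeneous_matching M fin)
    moreover have "mset_set (B \<union> Z) = mset_set B + mset_set Z"
      using R(2) by (simp add: inner_twice_def mset_set_Union)
    ultimately show "homogeneous (R * (\<Prod>u\<in>M. con_arc u)) (mset_set (B \<union> Z) + mset_set (B \<union> Z))"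
      using R(2) by (simp add: inner_twice_def ac_simps)
  qed (use R in \<open>auto simp: inner_twice_def\<close>)
  show "bracket (relabel f P * (\<Prod>u\<in>M'. con_arc u)) - bracket (relabel f P' * (\<Prod>u\<in>M'. con_arc u)) \<in> I_infinity"
    using eq M by (simp add: rel br[OF P] br[OF P'] tangle_equiv_def)
qed

text \<open>In each monomial of P exactly one arc ends at x. Joining it with the new arc moves this
  end to y, so multiplying by the arc amounts to renaming x to y.\<close>

lemma bracket_times_con:
  assumes P: "homogeneous P N" and N: "N + {#x, y#} = mset_set Y + mset_set Y" and y: "x ~= y"
  shows "bracket (P * con x y) = bracket (relabel (id(x := y)) P)"
proof -
  have "count (N + {#x, y#}) x = count (mset_set Y + mset_set Y) x" using N by simp
  then have x: "count N x = 1" using y by (simp add: count_mset_set' split: if_splits)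
  have "loop_count (m + {#Upair x y#}) = loop_count (image_mset (map_uprod (id(x := y))) m)"
    if "m \<in> Poly_Mapping.keys P" for m
  proof -
    have m: "ends m = N" using P that by (simp add: homogeneous_def)
    then have "x \<in># ends m" using x by (metis count_eq_zero_iff zero_neq_one)
    then obtain u where u: "u \<in># m" "x \<in> set_uprod u" by (auto simp: in_ends_iff)
    then obtain w where w: "u = Upair w x" by (cases u) auto
    obtain m1 where m1: "m = add_mset u m1" using u(1) by (metis insert_DiffM)
    then have "w ~= x" "x ~:# ends m1" using x m w by (auto simp: not_in_iff split: if_splits)
    have "map_uprod (id(x := y)) v = v" if "v \<in># m1" for v
    proof -
      have "x ~: set_uprod v" using that \<open>x ~:# ends m1\<close> by (auto simp: in_ends_iff)
      then show ?thesis by (cases v) auto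
    qed
    then have "image_mset (map_uprod (id(x := y))) m1 = m1"
      by (metis (mono_tags, lifting) image_mset_cong multiset.map_ident)
    then have im: "image_mset (map_uprod (id(x := y))) m = m1 + {#Upair w y#}"
      using m1 w \<open>w ~= x\<close> by simp
    have "con_step (m + {#Upair x y#}, 0) (m1 + {#Upair w y#}, 0)"
      using con_step.join[of m1 w x y 0] m1 w by (simp add: add_mset_commute)
    moreover have "twice (m + {#Upair x y#})" using N m by (intro twiceI[of _ Y]) (simp add: ac_simps)
    ultimately show ?thesis
      using loop_count_steps(2)[of "m + {#Upair x y#}" 0 "m1 + {#Upair w y#}" 0] im
      by (metis add.right_neutral r_into_rtranclp)
  qed
  then have "bracket (P * Poly_Mapping.single {#Upair x y#} 1) = bracket (relabel (id(x := y)) P)"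
    by (simp add: bracket_times_single relabel_def bracket_sum bracket_single)
  then show ?thesis by (simp add: con_arc_def)
qed

lemma relabel_matching:
  assumes "perfect_matching B M" "\<And>x. x \<in> B ==> f x = x"
  shows "relabel f (\<Prod>u\<in>M. con_arc u) = (\<Prod>u\<in>M. con_arc u)"
proof -
  have "map_uprod f u = u" if "u \<in> M" for u
  proof -
    have "set_uprod u \<subseteq> B" using assms(1) that by (auto simp: perfect_matching_def)
    then show ?thesis using assms(2) by (cases u) auto
  qed
  then show ?thesis by (simp add: relabel_prod relabel_con_arc)
qed

lemma relators_subset_I_infinity:
  "relators {..<4} (R2_pair X1 X2) \<subseteq> I_infinity" "relators {..<4} (R2_pair X2 X1) \<subseteq> I_infinity"
  "relators {..<6} (R3_pair X1 X2) \<subseteq> I_infinity" "relators {..<6} (R3_pair X2 X1) \<subseteq> I_infinity"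
  unfolding I_infinity_def by (auto intro: ideal_base)

lemma tangle_equiv_R2_pair:
  "tangle_equiv {..<4} (fst (R2_pair (if u then X2 else X1) (if u then X1 else X2)))
     (snd (R2_pair (if u then X2 else X1) (if u then X1 else X2)))"
  using relators_subset_I_infinity(1,2) by (cases u) (auto simp: tangle_equiv_def relators_def)

lemma tangle_equiv_R3_pair:
  "tangle_equiv {..<6} (fst (R3_pair (if u then X2 else X1) (if u then X1 else X2)))
     (snd (R3_pair (if u then X2 else X1) (if u then X1 else X2)))"
  using relators_subset_I_infinity(3,4) by (cases u) (auto simp: tangle_equiv_def relators_def)

lemma lessThan_4: "{..<4 :: nat} = {0, 1, 2, 3}"
  by auto

lemma lessThan_6: "{..<6 :: nat} = {0, 1, 2, 3, 4, 5}"
  by auto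

lemma homogeneous_expand_if:
  "homogeneous (expand ((if u then X1 else X2) a b c d)) {#a, b, c, d#}"
  "homogeneous (expand ((if u then X2 else X1) a b c d)) {#a, b, c, d#}"
  using homogeneous_expand[of "X1 a b c d"] homogeneous_expand[of "X2 a b c d"] by auto

lemma R2_tangle:
  assumes "distinct [p, q, p', q', x, y]"
  shows "tangle_equiv {p, q, p', q'} (expand (sym4 True u q p y x) * expand (sym4 False u x y p' q'))
    (con p p' * con q q')"
proof -
  \<comment> \<open>The edges in the places of a, ..., f of \<open>R2_pair\<close>: its first
    crossing becomes the one with the ends p', q', its second the one with the ends p, q.\<close>
  define f where "f n = [p', q', q, p, y, x] ! n" for n
  let ?S = "if u then X2 else X1" and ?T = "if u then X1 else X2"
  have f: "f 0 = p'" "f 1 = q'" "f 2 = q" "f 3 = p" "f 4 = y" "f 5 = x" "f (Suc 0) = q'"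
    by (simp_all add: f_def numeral_eq_Suc)
  have inj: "inj_on f ({..<4} \<union> {4, 5})" "inj_on f ({..<4} \<union> {})"
    using assms by (auto simp: lessThan_4 f)
  have B: "f ` {..<4} = {p, q, p', q'}" by (auto simp: lessThan_4 f)
  have L: "fst (R2_pair ?S ?T) = expand (?S 0 1 5 4) * expand (?T 3 4 5 2)"
    and R: "snd (R2_pair ?S ?T) = con 0 3 * con 1 2"
    by (simp_all add: R2_pair_def)
  have "tangle_equiv (f ` {..<4}) (relabel f (fst (R2_pair ?S ?T))) (relabel f (snd (R2_pair ?S ?T)))"
  proof (rule tangle_equiv_relabel[OF tangle_equiv_R2_pair _ _ inj(1) _ _ inj(2)])
    show "homogeneous (fst (R2_pair ?S ?T)) ({#0, 1, 5, 4#} + {#3, 4, 5, 2#})"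
      unfolding L by (intro homogeneous_times homogeneous_expand_if)
    show "homogeneous (snd (R2_pair ?S ?T)) ({#0, 3#} + {#1, 2#})"
      unfolding R by (intro homogeneous_times homogeneous_con)
  qed (simp_all add: inner_twice_def lessThan_4 add_mset_commute)
  moreover have "relabel f (fst (R2_pair ?S ?T)) = expand (sym4 True u q p y x) * expand (sym4 False u x y p' q')"
    unfolding L by (cases u) (simp_all add: relabel_times relabel_expand f sym4_def mult.commute del: expand.simps)
  moreover have "relabel f (snd (R2_pair ?S ?T)) = con p p' * con q q'"
    unfolding R by (simp add: relabel_times relabel_con_arc f con_commute)
  ultimately show ?thesis by (simp add: B)
qed

text \<open>The picture \<open>R3_picture so ro s\<close> with \<open>s = 1\<close> iff \<open>up\<close>; \<open>T\<close> tells whether the triangle is shaded. The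
  edges of the rising and the falling strand and of the sliding strand are numbered from left to right.\<close>

definition tri :: "bool => bool => bool => bool =>
    'l => 'l => 'l => 'l => 'l => 'l => 'l => 'l => 'l => 'l conpoly" where
  "tri so ro up T r0 r1 r2 f0 f1 f2 s0 s1 s2 =
    (if up then expand (sym4 ro T r1 f1 r0 f2) * expand (sym4 (\<not> so) T f0 s0 f1 s1)
              * expand (sym4 (\<not> so) (\<not> T) r2 s1 r1 s2)
     else expand (sym4 ro T r2 f0 r1 f1) * expand (sym4 (\<not> so) (\<not> T) r1 s0 r0 s1)
              * expand (sym4 (\<not> so) T f1 s1 f2 s2))"

lemma relabel_tri: "relabel g (tri so ro up T r0 r1 r2 f0 f1 f2 s0 s1 s2)
    = tri so ro up T (g r0) (g r1) (g r2) (g f0) (g f1) (g f2) (g s0) (g s1) (g s2)"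
  by (simp add: tri_def relabel_times relabel_expand map_sym4)

lemma homogeneous_tri: "homogeneous (tri so ro up T r0 r1 r2 f0 f1 f2 s0 s1 s2)
    ({#r2, f0, s0, r0, f2, s2#} + ({#r1, f1, s1#} + {#r1, f1, s1#}))"
proof (cases up)
  case True
  have "homogeneous (tri so ro up T r0 r1 r2 f0 f1 f2 s0 s1 s2)
    ({#r1, f1, r0, f2#} + {#f0, s0, f1, s1#} + {#r2, s1, r1, s2#})"
    using True unfolding tri_def by (simp only: if_True) (intro homogeneous_times homogeneous_sym4)
  then show ?thesis by (simp add: ac_simps add_mset_commute)
next
  case False
  have "homogeneous (tri so ro up T r0 r1 r2 f0 f1 f2 s0 s1 s2)
    ({#r2, f0, r1, f1#} + {#r1, s0, r0, s1#} + {#f1, s1, f2, s2#})"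
    using False unfolding tri_def by (simp only: if_False) (intro homogeneous_times homogeneous_sym4)
  then show ?thesis by (simp add: ac_simps add_mset_commute)
qed

lemma tri_rising_over:
  assumes "distinct [r0, r1, r2, f0, f1, f2, s0, s1, s2]"
  shows "tangle_equiv {r2, f0, s0, r0, f2, s2} (tri so True False T r0 r1 r2 f0 f1 f2 s0 s1 s2)
    (tri so True True (\<not> T) r0 r1 r2 f0 f1 f2 s0 s1 s2)"
proof -
  \<comment> \<open>In \<open>R3_pair\<close> the strand b, g, e is on top, c, i, f in the middle
    and a, h, d at the bottom. As rising passes over falling, the sliding strand is the top one if
    \<open>so\<close> and the bottom one otherwise, which fixes the two assignments of a, ..., i; in
    both the boundary runs counterclockwise.\<close>
  define f where "f n = (if so then [f2, s2, r2, f0, s0, r0, s1, f1, r1] else [s0, r0, f2, s2, r2, f0, r1, s1, f1]) ! n" for n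
  let ?S = "if T then X2 else X1" and ?T = "if T then X1 else X2"
  have f: "f 0 = (if so then f2 else s0)" "f 1 = (if so then s2 else r0)" "f 2 = (if so then r2 else f2)"
    "f 3 = (if so then f0 else s2)" "f 4 = (if so then s0 else r2)" "f 5 = (if so then r0 else f0)"
    "f 6 = (if so then s1 else r1)" "f 7 = (if so then f1 else s1)" "f 8 = (if so then r1 else f1)"
    "f (Suc 0) = (if so then s2 else r0)"
    by (simp_all add: f_def numeral_eq_Suc)
  have inj: "inj_on f ({..<6} \<union> {6, 7, 8})"
    using assms by (cases so) (auto simp: lessThan_6 f)
  have B: "f ` {..<6} = {r2, f0, s0, r0, f2, s2}" by (cases so) (auto simp: lessThan_6 f)
  have L: "fst (R3_pair ?S ?T) = expand (?S 0 1 7 6) * expand (?T 8 4 5 6) * expand (?T 7 2 3 8)"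
    and R: "snd (R3_pair ?S ?T) = expand (?S 0 8 7 5) * expand (?S 2 6 8 1) * expand (?T 7 6 3 4)"
    by (simp_all add: R3_pair_def)
  have "tangle_equiv (f ` {..<6}) (relabel f (fst (R3_pair ?S ?T))) (relabel f (snd (R3_pair ?S ?T)))"
  proof (rule tangle_equiv_relabel[OF tangle_equiv_R3_pair _ _ inj _ _ inj])
    show "homogeneous (fst (R3_pair ?S ?T)) ({#0, 1, 7, 6#} + {#8, 4, 5, 6#} + {#7, 2, 3, 8#})"
      unfolding L by (intro homogeneous_times homogeneous_expand_if)
    show "homogeneous (snd (R3_pair ?S ?T)) ({#0, 8, 7, 5#} + {#2, 6, 8, 1#} + {#7, 6, 3, 4#})"
      unfolding R by (intro homogeneous_times homogeneous_expand_if)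
  qed (simp_all add: inner_twice_def lessThan_6 add_mset_commute)
  moreover have "relabel f (fst (R3_pair ?S ?T)) = tri so True False T r0 r1 r2 f0 f1 f2 s0 s1 s2"
    unfolding L tri_def
    by (cases T; cases so) (simp_all add: relabel_times relabel_expand f sym4_def ac_simps expand_half_turn del: expand.simps)
  moreover have "relabel f (snd (R3_pair ?S ?T)) = tri so True True (\<not> T) r0 r1 r2 f0 f1 f2 s0 s1 s2"
    unfolding R tri_def
    by (cases T; cases so) (simp_all add: relabel_times relabel_expand f sym4_def ac_simps expand_half_turn del: expand.simps)
  ultimately show ?thesis by (simp add: B)
qed


text \<open>If the falling strand is the overpass, a second Reidemeister move creates a bigon on the other side of
  the sliding strand whose nearer crossing has the rising strand as the overpass. The sliding strand can move over or
  under this crossing, which then cancels against the original one.\<close>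

lemma tri_falling_over_aux:
  "tangle_equiv {..<6 :: nat} (tri so False False T 3 6 0 1 7 4 2 8 5) (tri so False True (\<not> T) 3 6 0 1 7 4 2 8 5)"
  unfolding tangle_equiv_def
proof (intro allI impI)
  fix M :: "nat uprod set" assume M: "perfect_matching {..<6} M"
  define E where "E = (\<Prod>u\<in>M. con_arc u)"
  have hE: "homogeneous E {#0, 1, 2, 3, 4, 5#}"
    using homogeneous_matching[OF M] by (simp add: E_def lessThan_6)
  have rE: "relabel g E = E" if "\<And>x. x < 6 ==> g x = x" for g
    unfolding E_def using M that by (intro relabel_matching) auto
  \<comment> \<open>The strands are 0 - 6 - 3 (rising, below), 1 - 7 - 4 (falling, above) and 2 - 8
    - 5 (sliding). Fresh labels: 9 and 10 cut the first two strands past the sliding one, 11 and 12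
    are the sides of the new bigon with corners A and A'. After the slide Z' has taken the place of
    A.\<close>
  define Z where "Z = expand (sym4 False T 0 1 6 (7 :: nat))"
  define Z' where "Z' = expand (sym4 True T 7 6 10 (9 :: nat))"
  define A where "A = expand (sym4 True (\<not> T) 10 9 12 (11 :: nat))"
  define A' where "A' = expand (sym4 False (\<not> T) 11 12 3 (4 :: nat))"
  define cm where "cm = (\<lambda>p p' :: nat. expand (sym4 (\<not> so) (\<not> T) p 2 p' 8))"
  define cp where "cp = (\<lambda>p p' :: nat. expand (sym4 (\<not> so) T p 8 p' 5))"
  note defs = Z_def Z'_def A_def A'_def cm_def cp_def
  have hZ: "homogeneous Z {#0, 1, 6, 7#}" "homogeneous Z' {#7, 6, 10, 9#}" "homogeneous A {#10, 9, 12, 11#}"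
    "homogeneous A' {#11, 12, 3, 4#}" "homogeneous (cm p p') {#p, 2, p', 8#}" "homogeneous (cp p p') {#p, 8, p', 5#}" for p p'
    unfolding defs by (rule homogeneous_sym4)+
  note hom = homogeneous_times homogeneous_con hE hZ
  have rel: "relabel g Z = expand (sym4 False T (g 0) (g 1) (g 6) (g 7))"
    "relabel g (cm p p') = expand (sym4 (\<not> so) (\<not> T) (g p) (g 2) (g p') (g 8))"
    "relabel g (cp p p') = expand (sym4 (\<not> so) T (g p) (g 8) (g p') (g 5))"
    "relabel g A' = expand (sym4 False (\<not> T) (g 11) (g 12) (g 3) (g 4))" for g p p'
    by (simp_all add: defs relabel_expand map_sym4)

  \<comment> \<open>Inserting the labels 9 and 10 is harmless, since the arcs 9 - 3 and 10 - 4 join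
    back to the old edges.\<close>
  have "homogeneous (Z * cm 6 9 * cp 7 10 * E * con 9 3)
    ({#0, 1, 6, 7#} + {#6, 2, 9, 8#} + {#7, 8, 10, 5#} + {#0, 1, 2, 3, 4, 5#} + {#9, 3#})"
    by (intro hom)
  from bracket_times_con[OF this, of 10 4 "{0, 1, 2, 3, 4, 5, 6, 7, 8, 9, 10}"]
  have "bracket (Z * cm 6 9 * cp 7 10 * E * con 9 3 * con 10 4) = bracket (Z * cm 6 9 * cp 7 4 * E * con 9 3)"
    by (simp add: add_mset_commute relabel_times rel rE relabel_con_arc) (simp add: defs)
  moreover
  have "homogeneous (Z * cm 6 9 * cp 7 4 * E)
    ({#0, 1, 6, 7#} + {#6, 2, 9, 8#} + {#7, 8, 4, 5#} + {#0, 1, 2, 3, 4, 5#})"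
    by (intro hom)
  from bracket_times_con[OF this, of 9 3 "{0, 1, 2, 3, 4, 5, 6, 7, 8, 9}"]
  have "bracket (Z * cm 6 9 * cp 7 4 * E * con 9 3) = bracket (Z * cm 6 3 * cp 7 4 * E)"
    by (simp add: add_mset_commute relabel_times rel rE relabel_con_arc) (simp add: defs)
  ultimately have 1: "bracket (Z * cm 6 3 * cp 7 4 * E) = bracket (con 9 3 * con 10 4 * (Z * cm 6 9 * cp 7 10 * E))"
    by (simp add: ac_simps)

  \<comment> \<open>A second move replaces the parallel arcs 9 - 3 and 10 - 4 by the bigon with
    corners A and A'.\<close>
  have 2: "bracket (con 9 3 * con 10 4 * (Z * cm 6 9 * cp 7 10 * E)) - bracket (A * A' * (Z * cm 6 9 * cp 7 10 * E)) \<in> I_infinity"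
  proof (rule tangle_equiv_bracket)
    show "tangle_equiv {9, 10, 3, 4} (con 9 3 * con 10 4) (A * A')"
      unfolding defs by (rule tangle_equiv_sym, rule R2_tangle) simp
    show "homogeneous (con 9 3 * con 10 4 :: nat conpoly) ({#9, 3#} + {#10, 4#})" by (intro hom)
    show "inner_twice {9, 10, 3, 4 :: nat} ({#9, 3#} + {#10, 4#}) {}" by (simp add: inner_twice_def add_mset_commute)
    show "homogeneous (A * A') ({#10, 9, 12, 11#} + {#11, 12, 3, 4#})" by (intro hom)
    show "inner_twice {9, 10, 3, 4 :: nat} ({#10, 9, 12, 11#} + {#11, 12, 3, 4#}) {11, 12}"
      by (simp add: inner_twice_def add_mset_commute)
    show "homogeneous (Z * cm 6 9 * cp 7 10 * E)
      ({#0, 1, 6, 7#} + {#6, 2, 9, 8#} + {#7, 8, 10, 5#} + {#0, 1, 2, 3, 4, 5#})" by (intro hom)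
    show "inner_twice {9, 10, 3, 4 :: nat} ({#0, 1, 6, 7#} + {#6, 2, 9, 8#} + {#7, 8, 10, 5#} + {#0, 1, 2, 3, 4, 5#}) {0, 1, 2, 5, 6, 7, 8}"
      by (simp add: inner_twice_def add_mset_commute)
  qed simp_all
  have tri1: "A * cm 6 9 * cp 7 10 = tri so True True (\<not> T) 12 10 7 6 9 11 2 8 5"
    unfolding defs tri_def by (simp add: expand_sym4_half_turn[of "\<not> so" _ "6 :: nat" 2 9 8] expand_sym4_half_turn[of "\<not> so" _ "7 :: nat" 8 10 5] ac_simps)
  have tri2: "Z' * cm 10 12 * cp 9 11 = tri so True False T 12 10 7 6 9 11 2 8 5"
    unfolding defs tri_def by simp
  \<comment> \<open>Having crossed at Z, the two strands reach A with rising and falling exchanged,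
    so the overpass at A is locally the rising line and the sliding strand passes A by the case
    already proved.\<close>
  have 3: "bracket (tri so True True (\<not> T) 12 10 7 6 9 11 2 8 5 * (A' * Z * E))
      - bracket (tri so True False T 12 10 7 6 9 11 2 8 5 * (A' * Z * E)) \<in> I_infinity"
  proof (rule tangle_equiv_bracket[OF _ homogeneous_tri _ homogeneous_tri])
    show "tangle_equiv {7, 6, 2, 12, 11, 5} (tri so True True (\<not> T) 12 10 7 6 9 11 2 8 5)
      (tri so True False T 12 10 7 6 9 11 2 8 (5 :: nat))"
      by (rule tangle_equiv_sym, rule tri_rising_over) simp
    show "homogeneous (A' * Z * E) ({#11, 12, 3, 4#} + {#0, 1, 6, 7#} + {#0, 1, 2, 3, 4, 5#})" by (intro hom)
    show "inner_twice {7, 6, 2, 12, 11, 5 :: nat} ({#11, 12, 3, 4#} + {#0, 1, 6, 7#} + {#0, 1, 2, 3, 4, 5#}) {0, 1, 3, 4}"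
      by (simp add: inner_twice_def add_mset_commute)
    show "inner_twice {7, 6, 2, 12, 11, 5 :: nat} ({#7, 6, 2, 12, 11, 5#} + ({#10, 9, 8#} + {#10, 9, 8#})) {8, 9, 10}"
      by (simp add: inner_twice_def add_mset_commute)
    then show "inner_twice {7, 6, 2, 12, 11, 5 :: nat} ({#7, 6, 2, 12, 11, 5#} + ({#10, 9, 8#} + {#10, 9, 8#})) {8, 9, 10}" .
  qed simp_all
  \<comment> \<open>Now Z and Z' are the corners of a bigon with sides 6 and 7, which a second move
    removes.\<close>
  have 4: "bracket (Z * Z' * (cm 10 12 * cp 9 11 * A' * E)) - bracket (con 9 0 * con 10 1 * (cm 10 12 * cp 9 11 * A' * E)) \<in> I_infinity"
  proof (rule tangle_equiv_bracket)
    have "Z * Z' = expand (sym4 True T 10 9 7 6) * expand (sym4 False T 6 7 0 1)"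
      unfolding defs expand_sym4_half_turn[of True T "10 :: nat" 9 7 6] expand_sym4_half_turn[of False T "6 :: nat" 7 0 1]
      by (rule mult.commute)
    then show "tangle_equiv {9, 10, 0, 1} (Z * Z') (con 9 0 * con 10 1)"
      using R2_tangle[of "9 :: nat" 10 0 1 6 7 T] by simp
    show "homogeneous (Z * Z') ({#0, 1, 6, 7#} + {#7, 6, 10, 9#})" by (intro hom)
    show "inner_twice {9, 10, 0, 1 :: nat} ({#0, 1, 6, 7#} + {#7, 6, 10, 9#}) {6, 7}"
      by (simp add: inner_twice_def add_mset_commute)
    show "homogeneous (con 9 0 * con 10 1 :: nat conpoly) ({#9, 0#} + {#10, 1#})" by (intro hom)
    show "inner_twice {9, 10, 0, 1 :: nat} ({#9, 0#} + {#10, 1#}) {}" by (simp add: inner_twice_def add_mset_commute)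
    show "homogeneous (cm 10 12 * cp 9 11 * A' * E)
      ({#10, 2, 12, 8#} + {#9, 8, 11, 5#} + {#11, 12, 3, 4#} + {#0, 1, 2, 3, 4, 5#})" by (intro hom)
    show "inner_twice {9, 10, 0, 1 :: nat} ({#10, 2, 12, 8#} + {#9, 8, 11, 5#} + {#11, 12, 3, 4#} + {#0, 1, 2, 3, 4, 5#}) {2, 3, 4, 5, 8, 11, 12}"
      by (simp add: inner_twice_def add_mset_commute)
  qed simp_all
  have "homogeneous (cm 10 12 * cp 9 11 * A' * E * con 9 0)
    ({#10, 2, 12, 8#} + {#9, 8, 11, 5#} + {#11, 12, 3, 4#} + {#0, 1, 2, 3, 4, 5#} + {#9, 0#})"
    by (intro hom)
  from bracket_times_con[OF this, of 10 1 "{0, 1, 2, 3, 4, 5, 8, 9, 10, 11, 12}"]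
  have 5: "bracket (cm 10 12 * cp 9 11 * A' * E * con 9 0 * con 10 1) = bracket (cm 1 12 * cp 9 11 * A' * E * con 9 0)"
    by (simp add: add_mset_commute relabel_times rel rE relabel_con_arc) (simp add: defs)
  have "homogeneous (cm 1 12 * cp 9 11 * A' * E)
    ({#1, 2, 12, 8#} + {#9, 8, 11, 5#} + {#11, 12, 3, 4#} + {#0, 1, 2, 3, 4, 5#})"
    by (intro hom)
  from bracket_times_con[OF this, of 9 0 "{0, 1, 2, 3, 4, 5, 8, 9, 11, 12}"]
  have 6: "bracket (cm 1 12 * cp 9 11 * A' * E * con 9 0) = bracket (cm 1 12 * cp 0 11 * A' * E)"
    by (simp add: add_mset_commute relabel_times rel rE relabel_con_arc) (simp add: defs)
  \<comment> \<open>The surviving inner labels 11 and 12 take over the names 6 and 7, which have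
    become free.\<close>
  have 7: "bracket (relabel (id(11 := 6, 12 := 7)) (cm 1 12 * cp 0 11 * A' * E)) = bracket (cm 1 12 * cp 0 11 * A' * E)"
  proof (rule bracket_relabel[of _ "{0, 1, 2, 3, 4, 5, 8, 11, 12}"])
    have "homogeneous (cm 1 12 * cp 0 11 * A' * E) ({#1, 2, 12, 8#} + {#0, 8, 11, 5#} + {#11, 12, 3, 4#} + {#0, 1, 2, 3, 4, 5#})"
      by (intro hom)
    then show "homogeneous (cm 1 12 * cp 0 11 * A' * E)
      (mset_set {0, 1, 2, 3, 4, 5, 8, 11, 12} + mset_set {0, 1, 2, 3, 4, 5, 8, 11, 12})"
      by (simp add: add_mset_commute)
  qed auto
  have 8: "relabel (id(11 := 6, 12 := 7)) (cm 1 12 * cp 0 11 * A' * E) = tri so False True (\<not> T) 3 6 0 1 7 4 2 8 5 * E"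
    by (simp add: relabel_times rel rE tri_def ac_simps)
  have 0: "tri so False False T 3 6 0 1 7 4 2 8 5 * E = Z * cm 6 3 * cp 7 4 * E"
    by (simp add: tri_def defs)
  have e: "A * A' * (Z * cm 6 9 * cp 7 10 * E) = A * cm 6 9 * cp 7 10 * (A' * Z * E)"
    "Z' * cm 10 12 * cp 9 11 * (A' * Z * E) = Z * Z' * (cm 10 12 * cp 9 11 * A' * E)"
    "con 9 0 * con 10 1 * (cm 10 12 * cp 9 11 * A' * E) = cm 10 12 * cp 9 11 * A' * E * con 9 0 * con 10 1"
    by (simp_all only: ac_simps)
  have "bracket (tri so False False T 3 6 0 1 7 4 2 8 5 * E)
      - bracket (con 9 0 * con 10 1 * (cm 10 12 * cp 9 11 * A' * E)) \<in> I_infinity"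
    using I_infinity_trans[OF 2[folded 1, unfolded e tri1] I_infinity_trans[OF 3 4[folded e(2), unfolded tri2]]]
    by (simp only: 0)
  moreover have "bracket (con 9 0 * con 10 1 * (cm 10 12 * cp 9 11 * A' * E))
      = bracket (tri so False True (\<not> T) 3 6 0 1 7 4 2 8 5 * E)"
    by (simp only: e(3) 5 6 7[symmetric] 8)
  ultimately show "bracket (tri so False False T 3 6 0 1 7 4 2 8 5 * (\<Prod>u\<in>M. con_arc u))
      - bracket (tri so False True (\<not> T) 3 6 0 1 7 4 2 8 5 * (\<Prod>u\<in>M. con_arc u)) \<in> I_infinity"
    by (simp only: E_def)
qed

text \<open>The case of the falling overpass needs fresh labels, which the type of labels may not
  offer. It is therefore proved for numerals and transported by renaming.\<close>

lemma tri_equiv: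
  assumes "distinct [r0, r1, r2, f0, f1, f2, s0, s1, s2]"
  shows "tangle_equiv {r2, f0, s0, r0, f2, s2} (tri so ro False T r0 r1 r2 f0 f1 f2 s0 s1 s2)
    (tri so ro True (\<not> T) r0 r1 r2 f0 f1 f2 s0 s1 s2)"
proof (cases ro)
  case True
  then show ?thesis using tri_rising_over[OF assms] by simp
next
  case False
  define f where "f n = [r2, f0, s0, r0, f2, s2, r1, f1, s1] ! n" for n
  have f: "f 0 = r2" "f 1 = f0" "f 2 = s0" "f 3 = r0" "f 4 = f2" "f 5 = s2" "f 6 = r1" "f 7 = f1" "f 8 = s1" "f (Suc 0) = f0"
    by (simp_all add: f_def numeral_eq_Suc)
  have inj: "inj_on f ({..<6} \<union> {6, 7, 8})"
    using assms by (auto simp: lessThan_6 f)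
  have B: "f ` {..<6} = {r2, f0, s0, r0, f2, s2}" by (auto simp: lessThan_6 f)
  have i: "inner_twice {..<6 :: nat} ({#0, 1, 2, 3, 4, 5#} + ({#6, 7, 8#} + {#6, 7, 8#})) {6, 7, 8}"
    by (simp add: inner_twice_def lessThan_6 add_mset_commute)
  from tangle_equiv_relabel[OF tri_falling_over_aux homogeneous_tri i inj homogeneous_tri i inj]
  show ?thesis using False by (simp add: relabel_tri f B)
qed

section \<open>Planar maps\<close>

lemma homeomorphism_UNIV_I:
  fixes f g :: "complex => complex"
  assumes "continuous_on UNIV f" "continuous_on UNIV g" "\<And>x. g (f x) = x" "\<And>y. f (g y) = y"
  shows "homeomorphism UNIV UNIV f g"
proof -
  have "range f = UNIV" "range g = UNIV" using surjI[of f g] surjI[of g f] assms(3,4) by auto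
  then show ?thesis using assms by (simp add: homeomorphism_def)
qed

lemma planar_mapI:
  fixes H :: "real \<times> complex => complex"
  assumes "continuous_on ({0..1} \<times> UNIV) H" "\<And>z. H (0, z) = z" "\<And>z. H (1, z) = f z"
    and "\<And>t. t \<in> {0..1} ==> \<exists>g. homeomorphism UNIV UNIV (\<lambda>z. H (t, z)) g"
  shows "planar_map f"
  unfolding planar_map_def homotopic_with_def
proof (intro exI[of _ H] conjI allI ballI)
  have "prod_topology (top_of_set {0..1}) (top_of_set (UNIV :: complex set)) = top_of_set ({0..1 :: real} \<times> UNIV)"
    by (rule prod_topology_subtopology_eu)
  then show "continuous_map (prod_topology (top_of_set {0..1}) (top_of_set UNIV)) (top_of_set UNIV) H"
    using assms(1) by (simp del: subtopology_UNIV)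
qed (use assms in auto)

lemma planar_map_homotopy:
  assumes "planar_map f"
  shows "\<exists>H :: real \<times> complex => complex. continuous_on ({0..1} \<times> UNIV) H \<and> (\<forall>z. H (0, z) = z)
    \<and> (\<forall>z. H (1, z) = f z) \<and> (\<forall>t\<in>{0..1}. inj (\<lambda>z. H (t, z)))"
proof -
  obtain H :: "real \<times> complex => complex" where *: "continuous_map (prod_topology (top_of_set {0..1}) (top_of_set UNIV)) (top_of_set UNIV) H
    \<and> (\<forall>z. H (0, z) = id z) \<and> (\<forall>z. H (1, z) = f z)
    \<and> (\<forall>t\<in>{0..1}. \<exists>g. homeomorphism UNIV UNIV (\<lambda>z. H (t, z)) g)"
    using assms unfolding planar_map_def homotopic_with_def by (elim exE) (rule that, assumption)
  then have H: "continuous_map (prod_topology (top_of_set {0..1}) (top_of_set UNIV)) (top_of_set UNIV) H"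
    and H': "\<And>z. H (0, z) = z" "\<And>z. H (1, z) = f z"
    "\<And>t. t \<in> {0..1} ==> \<exists>g. homeomorphism UNIV UNIV (\<lambda>z. H (t, z)) g"
    by simp_all
  have "prod_topology (top_of_set {0..1}) (top_of_set (UNIV :: complex set)) = top_of_set ({0..1 :: real} \<times> UNIV)"
    by (rule prod_topology_subtopology_eu)
  then have "continuous_on ({0..1} \<times> UNIV) H" using H by (simp del: subtopology_UNIV)
  moreover have "inj (\<lambda>z. H (t, z))" if "t \<in> {0..1}" for t
  proof (rule exE[OF H'(3)[OF that]])
    fix g assume g: "homeomorphism UNIV UNIV (\<lambda>z. H (t, z)) g"
    have "g (H (t, z)) = z" for z using homeomorphism_apply1[OF g, of z] by simp
    then show ?thesis by (rule inj_on_inverseI)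
  qed
  ultimately show ?thesis by (intro exI[of _ H]) (auto simp: H'(1,2))
qed

lemma planar_map_homeomorphism:
  assumes "planar_map h" shows "homeomorphism UNIV UNIV h (inv h)"
proof -
  obtain g where g: "homeomorphism UNIV UNIV h g"
    using homotopic_with_imp_property assms unfolding planar_map_def by blast
  then have "inv h = g" by (metis UNIV_I homeomorphism_apply1 homeomorphism_apply2 inv_equality)
  then show ?thesis using g by simp
qed

lemma planar_map_simps:
  assumes "planar_map h"
  shows "inv h (h z) = z" "h (inv h z) = z" "continuous_on S h" "continuous_on S (inv h)" "bij h" "inj h" "inj (inv h)"
proof -
  note * = planar_map_homeomorphism[OF assms]
  show a: "inv h (h z) = z" "h (inv h z) = z" for z
    using * by (auto intro: homeomorphism_apply1 homeomorphism_apply2)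
  show "continuous_on S h" "continuous_on S (inv h)"
    using * by (auto simp: homeomorphism_def intro: continuous_on_subset)
  show "bij h" by (rule o_bij[of "inv h"]) (auto simp: a)
  show "inj h" "inj (inv h)" by (metis a injI)+
qed

lemma planar_map_compose:
  assumes "planar_map h" "planar_map k" shows "planar_map (h \<circ> k)"
proof -
  let ?P = "\<lambda>f. \<exists>g. homeomorphism (UNIV :: complex set) UNIV f g"
  have "homotopic_with ?P (top_of_set UNIV) (top_of_set UNIV) (h \<circ> id) (h \<circ> k)"
  proof (rule homotopic_with_compose_continuous_map_left)
    show "homotopic_with ?P (top_of_set UNIV) (top_of_set UNIV) id k"
      using assms(2) by (simp add: planar_map_def)
    show "continuous_map (top_of_set UNIV) (top_of_set UNIV) h"
      using planar_map_simps(3)[OF assms(1)] by simp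
    show "?P (h \<circ> j)" if "?P j" for j
      using that planar_map_homeomorphism[OF assms(1)] homeomorphism_compose by blast
  qed
  then show ?thesis using assms(1) unfolding planar_map_def by (metis comp_id homotopic_with_trans)
qed

lemma planar_map_inv:
  assumes "planar_map h" shows "planar_map (inv h)"
proof -
  let ?P = "\<lambda>f. \<exists>g. homeomorphism (UNIV :: complex set) UNIV f g"
  have "homotopic_with ?P (top_of_set UNIV) (top_of_set UNIV) (inv h \<circ> id) (inv h \<circ> h)"
  proof (rule homotopic_with_compose_continuous_map_left)
    show "homotopic_with ?P (top_of_set UNIV) (top_of_set UNIV) id h"
      using assms by (simp add: planar_map_def)
    show "continuous_map (top_of_set UNIV) (top_of_set UNIV) (inv h)"
      using planar_map_simps(4)[OF assms] by simp
    show "?P (inv h \<circ> j)" if "?P j" for j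
      using that planar_map_homeomorphism[OF assms] homeomorphism_compose homeomorphism_symD by blast
  qed
  moreover have "inv h \<circ> h = id" using planar_map_simps(1)[OF assms] by auto
  ultimately show ?thesis unfolding planar_map_def by (metis comp_id homotopic_with_symD)
qed

lemma planar_map_translation: "planar_map (\<lambda>z. z + c)"
proof (rule planar_mapI[where H = "\<lambda>p. snd p + of_real (fst p) * c"])
  show "\<exists>g. homeomorphism UNIV UNIV (\<lambda>z. snd (t, z) + of_real (fst (t, z)) * c) g" for t
    by (intro exI[of _ "\<lambda>z. z - of_real t * c"] homeomorphism_UNIV_I) (auto intro!: continuous_intros)
qed (auto intro!: continuous_intros)

lemma planar_map_scale:
  assumes "c ~= 0" shows "planar_map (\<lambda>z. c * z)"
\<comment> \<open>The factor \<open>exp (t * Ln c)\<close> runs from 1 to c without meeting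
  0.\<close>
proof (rule planar_mapI[where H = "\<lambda>p. exp (of_real (fst p) * Ln c) * snd p"])
  show "\<exists>g. homeomorphism UNIV UNIV (\<lambda>z. exp (of_real (fst (t, z)) * Ln c) * snd (t, z)) g" for t
    by (intro exI[of _ "\<lambda>z. exp (- of_real t * Ln c) * z"] homeomorphism_UNIV_I)
      (auto intro!: continuous_intros simp: exp_minus)
qed (use assms in \<open>auto intro!: continuous_intros\<close>)

lemma homeomorphism_shear:
  assumes "Im w > 0"
  shows "\<exists>g. homeomorphism UNIV UNIV (\<lambda>z. of_real (Re z) + of_real (Im z) * w) g"
proof -
  have "homeomorphism UNIV UNIV (\<lambda>z. of_real (Re z) + of_real (Im z) * w)
    (\<lambda>z. of_real (Re z - Im z / Im w * Re w) + \<i> * of_real (Im z / Im w))"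
    by (rule homeomorphism_UNIV_I) (use assms in \<open>auto intro!: continuous_intros simp: complex_eq_iff\<close>)
  then show ?thesis by blast
qed

lemma planar_map_shear:
  assumes "Im w > 0" shows "planar_map (\<lambda>z. of_real (Re z) + of_real (Im z) * w)"
\<comment> \<open>The image of the imaginary unit moves along the segment from it to w, which stays
  in the upper half plane.\<close>
proof (rule planar_mapI[where H = "\<lambda>p. of_real (Re (snd p)) + of_real (Im (snd p)) * (of_real (1 - fst p) * \<i> + of_real (fst p) * w)"])
  fix t :: real assume t: "t \<in> {0..1}"
  have "Im (of_real (1 - t) * \<i> + of_real t * w) > 0" using t assms by (cases "t = 0") (auto intro: add_nonneg_pos)
  from homeomorphism_shear[OF this]
  show "\<exists>g. homeomorphism UNIV UNIV (\<lambda>z. of_real (Re (snd (t, z))) + of_real (Im (snd (t, z))) * (of_real (1 - fst (t, z)) * \<i> + of_real (fst (t, z)) * w)) g"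
    by simp
qed (auto intro!: continuous_intros simp: complex_eq_iff)

text \<open>\<open>Im (cnj u * w)\<close> is the determinant of the map. Positivity allows factoring
  the map as a shear that fixes 1, followed by multiplication by u.\<close>

lemma planar_map_linear:
  assumes "Im (cnj u * w) > 0"
  shows "planar_map (\<lambda>z. of_real (Re z) * u + of_real (Im z) * w)"
proof -
  have u: "u ~= 0" using assms by auto
  have "(Re u)\<^sup>2 + (Im u)\<^sup>2 > 0" using u by (simp add: complex_neq_0)
  then have "Im (w / u) > 0" using assms by (simp add: Im_divide algebra_simps)
  from planar_map_compose[OF planar_map_scale[OF u] planar_map_shear[OF this]]
  have "planar_map (\<lambda>z. u * (of_real (Re z) + of_real (Im z) * (w / u)))" by (simp add: o_def)
  moreover have "(\<lambda>z. u * (of_real (Re z) + of_real (Im z) * (w / u))) = (\<lambda>z. of_real (Re z) * u + of_real (Im z) * w)"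
    using u by (auto simp: field_simps)
  ultimately show ?thesis by simp
qed

subsection \<open>Orientation\<close>

text \<open>Subtracting the moving image of the centre keeps the loop off 0, since every stage of
  the isotopy is injective. This is how an isotopy to the identity controls orientation.\<close>

lemma planar_map_circle:
  assumes "planar_map f" "f 0 = 0" "r > 0"
  shows "homotopic_loops (- {0}) (circlepath 0 r) (f \<circ> circlepath 0 r)"
proof -
  obtain H :: "real \<times> complex => complex" where H: "continuous_on ({0..1} \<times> UNIV) H" "\<forall>z. H (0, z) = z" "\<forall>z. H (1, z) = f z"
    "\<forall>t\<in>{0..1}. inj (\<lambda>z. H (t, z))"
    using planar_map_homotopy[OF assms(1)] by (elim exE conjE) (rule that)
  let ?c = "circlepath 0 r"
  have c: "continuous_on {0..1} ?c" using path_circlepath[of 0 r] by (simp add: path_def)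
  have "?c s ~= 0" for s using assms(3) by (simp add: circlepath)
  then have "H (t, ?c s) ~= H (t, 0)" if "t \<in> {0..1}" for s t
    using H(4) that by (metis injD)
  moreover have "continuous_on ({0..1} \<times> {0..1}) (\<lambda>p. H (fst p, ?c (snd p)) - H (fst p, 0))"
    by (intro continuous_intros continuous_on_compose2[OF H(1)] continuous_on_compose2[OF c]) auto
  ultimately show ?thesis
    unfolding homotopic_loops
    by (intro exI[of _ "\<lambda>p. H (fst p, ?c (snd p)) - H (fst p, 0)"])
      (auto simp: H(2,3) assms(2) pathstart_def pathfinish_def circlepath)
qed

lemma connected_sgn_constant:
  fixes g :: "complex => real"
  assumes "connected S" "continuous_on S g" "\<And>z. z \<in> S ==> g z ~= 0" "z \<in> S" "w \<in> S"
  shows "sgn (g z) = sgn (g w)"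
proof (rule ccontr)
  assume "sgn (g z) ~= sgn (g w)"
  then have "g z < 0 \<and> 0 < g w \<or> g w < 0 \<and> 0 < g z"
    using assms(3)[OF assms(4)] assms(3)[OF assms(5)] by (auto simp: sgn_real_def split: if_splits)
  moreover have "is_interval (g ` S)"
    using connected_continuous_image[OF assms(2,1)] by (simp add: is_interval_connected_1)
  ultimately have "0 \<in> g ` S"
    using assms(4,5) unfolding is_interval_1 by (metis imageI less_imp_le)
  then show False using assms(3) by auto
qed

text \<open>Multiplied by b, one of the coordinates is non-negative along the segment and vanishes
  at most at x, which is not 0 then.\<close>

lemma zero_not_in_segment:
  fixes x y :: complex
  assumes "b * Re x > 0 \<and> b * Re y > 0 \<or> b * Im x > 0 \<and> b * Im y > 0
    \<or> x ~= 0 \<and> b * Re x \<ge> 0 \<and> b * Re y > 0 \<or> x ~= 0 \<and> b * Im x \<ge> 0 \<and> b * Im y > 0"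
  shows "0 ~: closed_segment x y"
proof
  assume "0 \<in> closed_segment x y"
  then obtain u where u: "0 \<le> u" "u \<le> 1" and 0: "0 = (1 - u) *\<^sub>R x + u *\<^sub>R y"
    by (auto simp: in_segment)
  have pos: "(1 - u) * k + u * l > 0" if "k \<ge> 0" "l > 0" "u > 0" for k l :: real
    using that u by (simp add: add_nonneg_pos)
  have "u > 0"
  proof (rule ccontr)
    assume "\<not> u > 0"
    then have "u = 0" using u by simp
    then show False using 0 assms by auto
  qed
  have "(1 - u) * (b * Re x) + u * (b * Re y) = b * Re ((1 - u) *\<^sub>R x + u *\<^sub>R y)"
    "(1 - u) * (b * Im x) + u * (b * Im y) = b * Im ((1 - u) *\<^sub>R x + u *\<^sub>R y)"
    by (simp_all add: algebra_simps)
  then have "(1 - u) * (b * Re x) + u * (b * Re y) = 0" "(1 - u) * (b * Im x) + u * (b * Im y) = 0"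
    using 0 by simp_all
  then show False
    using assms pos[of "b * Re x" "b * Re y"] pos[of "b * Im x" "b * Im y"] \<open>u > 0\<close> by auto
qed

lemma sgn_mult_pos: "sgn x = b ==> b ~= 0 ==> b * x > 0" for x b :: real
  by (auto simp: sgn_real_def split: if_splits)

text \<open>A planar map preserving the axes near \<open>0\<close> acts on the signs of the coordinates as the identity or the
  half turn: otherwise the image of a small circle could be deformed away from \<open>0\<close> to a constant loop or
  to the reversed circle.\<close>

lemma planar_map_axes:
  assumes f: "planar_map f" "f 0 = 0" and e: "e > 0"
    and im: "\<And>z. z \<in> ball 0 e ==> Im z = 0 ==> Im (f z) = 0"
    and re: "\<And>z. z \<in> ball 0 e ==> Re z = 0 ==> Re (f z) = 0"
    and off: "\<And>z. z \<in> ball 0 e ==> Re z ~= 0 ==> Im z ~= 0 ==> Re (f z) ~= 0 \<and> Im (f z) ~= 0"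
  obtains s :: real where "s = 1 \<or> s = -1"
    "\<And>z. z \<in> ball 0 e ==> sgn (Re (f z)) = s * sgn (Re z) \<and> sgn (Im (f z)) = s * sgn (Im z)"
proof -
  have f0: "f z ~= 0" if "z ~= 0" for z using planar_map_simps(6)[OF f(1)] f(2) that by (metis injD)
  have re0: "Re (f z) ~= 0" if "z \<in> ball 0 e" "Re z ~= 0" for z
    using that im[of z] off[of z] f0[of z] by (cases "Im z = 0") (auto simp: complex_eq_iff)
  have im0: "Im (f z) ~= 0" if "z \<in> ball 0 e" "Im z ~= 0" for z
    using that re[of z] off[of z] f0[of z] by (cases "Re z = 0") (auto simp: complex_eq_iff)
  have cont: "continuous_on S (\<lambda>z. Re (f z))" "continuous_on S (\<lambda>z. Im (f z))" for S
    using planar_map_simps(3)[OF f(1)] by (auto intro!: continuous_intros)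
  define d where "d = complex_of_real (e / 2)"
  \<comment> \<open>p 1 and p (-1) are the signs of the real part of f on the right and the left
    half disc, q 1 and q (-1) those of the imaginary part on the upper and the lower one.\<close>
  define p where "p x = sgn (Re (f (of_real x * d)))" for x
  define q where "q x = sgn (Im (f (of_real x * d * \<i>)))" for x
  have conv: "connected (ball 0 e \<inter> {z. a * Re z > 0})" "connected (ball 0 e \<inter> {z. a * Im z > 0})" for a
  proof -
    have "{z. a * Re z > 0} = {z. inner (of_real a) z > 0}" "{z. a * Im z > 0} = {z. inner (of_real a * \<i>) z > 0}"
      by (auto simp: inner_complex_def)
    then show "connected (ball 0 e \<inter> {z. a * Re z > 0})" "connected (ball 0 e \<inter> {z. a * Im z > 0})"
      by (auto intro!: convex_connected convex_Int convex_halfspace_gt)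
  qed
  have dd: "of_real x * d \<in> ball 0 e" "of_real x * d * \<i> \<in> ball 0 e" if "\<bar>x\<bar> = 1" for x
    using e that by (auto simp: d_def norm_mult)
  have P: "sgn (Re (f z)) = p (sgn (Re z)) \<and> p (sgn (Re z)) ~= 0" if "z \<in> ball 0 e" "Re z ~= 0" for z
  proof -
    have "sgn (Re (f z)) = sgn (Re (f (of_real (sgn (Re z)) * d)))"
      by (rule connected_sgn_constant[OF conv(1)[of "sgn (Re z)"] cont(1)])
        (use that re0 dd[of "sgn (Re z)"] e in \<open>auto simp: d_def sgn_real_def split: if_splits\<close>)
    moreover have "sgn (Re (f z)) ~= 0" using re0[OF that] by (simp add: sgn_zero_iff)
    ultimately show ?thesis by (simp add: p_def)
  qed
  have Q: "sgn (Im (f z)) = q (sgn (Im z)) \<and> q (sgn (Im z)) ~= 0" if "z \<in> ball 0 e" "Im z ~= 0" for z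
  proof -
    have "sgn (Im (f z)) = sgn (Im (f (of_real (sgn (Im z)) * d * \<i>)))"
      by (rule connected_sgn_constant[OF conv(2)[of "sgn (Im z)"] cont(2)])
        (use that im0 dd[of "sgn (Im z)"] e in \<open>auto simp: d_def sgn_real_def split: if_splits\<close>)
    moreover have "sgn (Im (f z)) ~= 0" using im0[OF that] by (simp add: sgn_zero_iff)
    ultimately show ?thesis by (simp add: q_def)
  qed
  define c where "c = circlepath 0 (e / 2)"
  have cb: "c t \<in> ball 0 e" "c t ~= 0" for t using e by (auto simp: c_def circlepath norm_mult norm_exp_eq_Re)
  have pc: "path c" "pathfinish c = pathstart c" by (auto simp: c_def)
  have pfc: "path (f \<circ> c)" "pathfinish (f \<circ> c) = pathstart (f \<circ> c)"
    using pc planar_map_simps(3)[OF f(1)] by (auto simp: pathfinish_compose pathstart_compose intro: path_continuous_image)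
  have one: "winding_number (f \<circ> c) 0 = 1"
    using winding_number_homotopic_loops[OF planar_map_circle[OF f, of "e / 2"]] e
    by (simp add: c_def winding_number_circlepath_centre)
  have p1: "p x = 1 \<or> p x = -1" if "\<bar>x\<bar> = 1" for x
  proof -
    have "Re (f (of_real x * d)) ~= 0" using re0[OF dd(1)[OF that]] that e by (auto simp: d_def)
    then show ?thesis by (simp add: p_def sgn_real_def)
  qed
  have q1: "q x = 1 \<or> q x = -1" if "\<bar>x\<bar> = 1" for x
  proof -
    have "Im (f (of_real x * d * \<i>)) ~= 0" using im0[OF dd(2)[OF that]] that e by (auto simp: d_def)
    then show ?thesis by (simp add: q_def sgn_real_def)
  qed
  have pQ: "sgn (Re (f (c t))) = p (sgn (Re (c t)))" "sgn (Im (f (c t))) = q (sgn (Im (c t)))"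
    if "Re (c t) ~= 0" "Im (c t) ~= 0" for t
    using P[OF cb(1)] Q[OF cb(1)] that by auto
  \<comment> \<open>Being isotopic to c, the loop f o c winds once around 0, so no straight-line
    homotopy off 0 leads to a loop g with another winding number.\<close>
  have no_hom: "\<not> (\<forall>t\<in>{0..1}. 0 ~: closed_segment (f (c t)) (g t))"
    if "path g" "pathfinish g = pathstart g" "winding_number g 0 ~= 1" for g
  proof
    assume "\<forall>t\<in>{0..1}. 0 ~: closed_segment (f (c t)) (g t)"
    then have "homotopic_loops (- {0}) (f \<circ> c) g"
      by (intro homotopic_loops_linear) (use pfc that in auto)
    from winding_number_homotopic_loops[OF this] one that(3) show False by simp
  qed
  have const: "\<not> (\<forall>t\<in>{0..1}. 0 ~: closed_segment (f (c t)) a)" if "a ~= 0" for a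
  proof -
    have "\<not> (\<forall>t\<in>{0..1}. 0 ~: closed_segment (f (c t)) (linepath a a t))"
      by (rule no_hom[of "linepath a a"]) (use that in auto)
    then show ?thesis by (simp add: linepath_refl)
  qed
  have pp: "p 1 * p 1 = 1" "q 1 * q 1 = 1" using p1[of 1] q1[of 1] by auto
  \<comment> \<open>Otherwise the image of the circle lies in a closed half plane without 0 and
    contracts to the constant p 1.\<close>
  have "p 1 ~= p (-1)"
  proof
    assume eq: "p 1 = p (-1)"
    have "0 ~: closed_segment (f (c t)) (of_real (p 1))" for t
    proof -
      have "f (c t) ~= 0" using f0[OF cb(2)] .
      moreover have "p 1 * Re (f (c t)) \<ge> 0"
      proof (cases "Re (c t) = 0")
        case True
        then show ?thesis using re[OF cb(1)] by simp
      next
        case False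
        then have "sgn (Re (f (c t))) = p 1" using P[OF cb(1)] eq by (auto simp: sgn_real_def split: if_splits)
        from sgn_mult_pos[OF this] p1[of 1] show ?thesis by fastforce
      qed
      ultimately show ?thesis by (intro zero_not_in_segment[of "p 1"]) (simp add: pp)
    qed
    then show False using const[of "of_real (p 1)"] p1[of 1] by auto
  qed
  moreover have "q 1 ~= q (-1)"
  proof
    assume eq: "q 1 = q (-1)"
    have "0 ~: closed_segment (f (c t)) (of_real (q 1) * \<i>)" for t
    proof -
      have "f (c t) ~= 0" using f0[OF cb(2)] .
      moreover have "q 1 * Im (f (c t)) \<ge> 0"
      proof (cases "Im (c t) = 0")
        case True
        then show ?thesis using im[OF cb(1)] by simp
      next
        case False
        then have "sgn (Im (f (c t))) = q 1" using Q[OF cb(1)] eq by (auto simp: sgn_real_def split: if_splits)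
        from sgn_mult_pos[OF this] q1[of 1] show ?thesis by fastforce
      qed
      ultimately show ?thesis by (intro zero_not_in_segment[of "q 1"]) (simp add: pp)
    qed
    then show False using const[of "of_real (q 1) * \<i>"] q1[of 1] by auto
  qed
  moreover have "p 1 = q 1"
  proof (rule ccontr)
    assume neq: "p 1 ~= q 1"
    \<comment> \<open>This is the circle p 1 * cnj (c t), of winding number -1; for p 1 = -1 the
      shift by half a period supplies the sign.\<close>
    define g where "g = reversepath (if p 1 = 1 then c else shiftpath (1/2) c)"
    have g: "path g" "pathfinish g = pathstart g" "winding_number g 0 ~= 1"
    proof -
      let ?c = "if p 1 = 1 then c else shiftpath (1/2) c"
      have c1: "winding_number c 0 = 1" using e by (simp add: c_def winding_number_circlepath_centre)
      have 0: "0 ~: path_image c" using cb(2) unfolding path_image_def by (metis imageE)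
      have "path ?c" "pathfinish ?c = pathstart ?c" "0 ~: path_image ?c"
        using pc 0 path_shiftpath[of c "1/2"] path_image_shiftpath[of "1/2" c] by (auto simp: endpoints_shiftpath)
      moreover have "winding_number ?c 0 = 1"
        using c1 winding_number_shiftpath[OF pc(1) 0 pc(2), of "1/2"] by simp
      ultimately show "path g" "pathfinish g = pathstart g" "winding_number g 0 ~= 1"
        by (auto simp: g_def winding_number_reversepath)
    qed
    have gt: "g t = of_real (p 1) * cnj (c t)" if "t \<in> {0..1}" for t
    proof -
      have ccis: "c u = of_real (e / 2) * cis (2 * pi * u)" for u
        by (simp add: c_def circlepath cis_conv_exp ac_simps)
      have "2 * pi * (1 - t) = 2 * pi - 2 * pi * t" by (simp add: algebra_simps)
      then have s: "c (1 - t) = cnj (c t)"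
        unfolding ccis by (simp only:) (simp add: complex_eq_iff cos_diff sin_diff)
      have "2 * pi * (1 / 2 + u) = pi + 2 * pi * u" "2 * pi * (u - 1 / 2) = 2 * pi * u - pi" for u
        by (simp_all add: algebra_simps)
      then have "c (1 / 2 + u) = - c u" "c (u - 1 / 2) = - c u" for u
        unfolding ccis by (simp_all only:) (simp_all add: complex_eq_iff cos_diff sin_diff)
      from this(1)[of "1 - t"] this(2)[of "1 - t"]
      have "shiftpath (1/2) c (1 - t) = - cnj (c t)"
        by (simp add: shiftpath_def s algebra_simps)
      then show ?thesis using p1[of 1] s by (auto simp: g_def reversepath_def)
    qed
    have pq: "p (- 1) = - p 1" "q 1 = - p 1" "q (-1) = p 1"
      using p1[of 1] p1[of "-1"] q1[of 1] q1[of "-1"] neq \<open>p 1 ~= p (-1)\<close> \<open>q 1 ~= q (-1)\<close> by auto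
    \<comment> \<open>The two points agree in the sign of the real part or, where Re (c t) = 0, in
      that of the imaginary part.\<close>
    have "0 ~: closed_segment (f (c t)) (of_real (p 1) * cnj (c t))" for t
    proof (cases "Re (c t) = 0")
      case False
      let ?b = "p 1 * sgn (Re (c t))"
      have "p (sgn (Re (c t))) = ?b" using False pq by (cases "Re (c t) > 0") simp_all
      then have "sgn (Re (f (c t))) = ?b" using P[OF cb(1) False] by simp
      moreover have "?b ~= 0" using False pp by (auto simp: sgn_zero_iff)
      ultimately have "?b * Re (f (c t)) > 0" by (rule sgn_mult_pos)
      moreover have "?b * Re (of_real (p 1) * cnj (c t)) = (p 1 * p 1) * \<bar>Re (c t)\<bar>"
        by (simp add: abs_sgn ac_simps)
      ultimately show ?thesis using False by (intro zero_not_in_segment[of ?b]) (simp add: pp)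
    next
      case True
      then have False': "Im (c t) ~= 0" using cb(2)[of t] by (auto simp: complex_eq_iff)
      let ?b = "- p 1 * sgn (Im (c t))"
      have "q (sgn (Im (c t))) = ?b" using False' pq by (cases "Im (c t) > 0") simp_all
      then have "sgn (Im (f (c t))) = ?b" using Q[OF cb(1) False'] by simp
      moreover have "?b ~= 0" using False' pp by (auto simp: sgn_zero_iff)
      ultimately have "?b * Im (f (c t)) > 0" by (rule sgn_mult_pos)
      moreover have "?b * Im (of_real (p 1) * cnj (c t)) = (p 1 * p 1) * \<bar>Im (c t)\<bar>"
        by (simp add: abs_sgn ac_simps)
      ultimately show ?thesis using False' by (intro zero_not_in_segment[of ?b]) (simp add: pp)
    qed
    then show False using no_hom[OF g] gt by simp
  qed
  ultimately have pq: "p (-1) = - p 1" "q 1 = p 1" "q (-1) = - p 1"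
    using p1[of 1] p1[of "-1"] q1[of 1] q1[of "-1"] by auto
  show thesis
  proof (rule that[of "p 1"])
    show "p 1 = 1 \<or> p 1 = -1" using p1[of 1] by simp
    fix z :: complex assume z: "z \<in> ball 0 e"
    show "sgn (Re (f z)) = p 1 * sgn (Re z) \<and> sgn (Im (f z)) = p 1 * sgn (Im z)"
    proof
      show "sgn (Re (f z)) = p 1 * sgn (Re z)"
        using P[OF z] re[OF z] pq by (cases "Re z = 0"; cases "Re z > 0") simp_all
      show "sgn (Im (f z)) = p 1 * sgn (Im z)"
        using Q[OF z] im[OF z] pq by (cases "Im z = 0"; cases "Im z > 0") simp_all
    qed
  qed
qed

section \<open>Crossing charts\<close>

lemma planar_map_image_iff:
  assumes "planar_map h" shows "z \<in> h ` S \<longleftrightarrow> inv h z \<in> S"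
  using planar_map_simps(1,2)[OF assms] by (metis image_iff)

lemma chart_mem:
  assumes "crossing_chart D v h" "z \<in> ball 0 1"
  shows "inv h z \<in> curve D \<longleftrightarrow> Re z = 0 \<or> Im z = 0" "inv h z \<in> crossings D \<longleftrightarrow> z = 0"
    "inv h z \<in> overpass D v \<longleftrightarrow> Im z = 0"
proof -
  have h: "planar_map h" using assms(1) by (simp add: crossing_chart_def)
  have img: "inv h z \<in> S \<longleftrightarrow> z \<in> h ` S \<inter> ball 0 1" for S
    using assms(2) planar_map_simps(1,2)[OF h] by (metis IntI IntD1 image_iff)
  show "inv h z \<in> curve D \<longleftrightarrow> Re z = 0 \<or> Im z = 0" "inv h z \<in> crossings D \<longleftrightarrow> z = 0"
    "inv h z \<in> overpass D v \<longleftrightarrow> Im z = 0"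
    unfolding img using assms by (auto simp: crossing_chart_def)
qed

text \<open>Overpasses are only known as germs, so charts have to be shrunk: division by r turns the
  ball on which the picture is controlled into the unit ball of a chart.\<close>

lemma crossing_chartI:
  assumes h: "planar_map h" "h v = 0" and r: "r > 0"
    and "\<And>z. z \<in> ball 0 r ==> inv h z \<in> curve D \<longleftrightarrow> Re z = 0 \<or> Im z = 0"
    and "\<And>z. z \<in> ball 0 r ==> inv h z \<in> crossings D \<longleftrightarrow> z = 0"
    and "\<And>z. z \<in> ball 0 r ==> inv h z \<in> overpass D v \<longleftrightarrow> Im z = 0"
  shows "crossing_chart D v (\<lambda>z. h z / of_real r)" "inv (\<lambda>z. h z / of_real r) = (\<lambda>z. inv h (of_real r * z))"
proof -
  let ?k = "\<lambda>z. h z / of_real r"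
  have "planar_map ((\<lambda>z. inverse (of_real r) * z) \<circ> h)"
    by (rule planar_map_compose[OF planar_map_scale h(1)]) (use r in simp)
  moreover have "(\<lambda>z. inverse (of_real r) * z) \<circ> h = ?k" by (auto simp: field_simps)
  ultimately have k: "planar_map ?k" by simp
  show inv: "inv ?k = (\<lambda>z. inv h (of_real r * z))"
    by (rule inv_equality) (use r planar_map_simps(1,2)[OF h(1)] in auto)
  have mem: "z \<in> ?k ` S \<longleftrightarrow> inv h (of_real r * z) \<in> S" for z S
    unfolding planar_map_image_iff[OF k] by (simp only: inv)
  have b: "of_real r * z \<in> ball 0 r" if "z \<in> ball 0 1" for z :: complex
    using that r by (simp add: norm_mult)
  have img: "?k ` S \<inter> ball 0 1 = {z \<in> ball 0 1. inv h (of_real r * z) \<in> S}" for S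
    using mem by blast
  have "?k ` crossings D \<inter> ball 0 1 = {0}" unfolding img using assms(5)[OF b] assms(5)[of 0] r by auto
  moreover have "?k ` curve D \<inter> ball 0 1 = {z \<in> ball 0 1. Re z = 0 \<or> Im z = 0}"
    unfolding img using assms(4)[OF b] r by auto
  moreover have "?k ` overpass D v \<inter> ball 0 1 = {z \<in> ball 0 1. Im z = 0}"
    unfolding img using assms(6)[OF b] r by auto
  ultimately show "crossing_chart D v ?k" using k h(2) by (simp add: crossing_chart_def)
qed

lemma connected_component_set_eqI:
  "connected S ==> S \<subseteq> T ==> x \<in> S ==> y \<in> S ==> connected_component_set T x = connected_component_set T y"
proof -
  assume "connected S" "S \<subseteq> T" "x \<in> S" "y \<in> S"
  then have "y \<in> connected_component_set T x" by (auto simp: connected_component_def)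
  then show ?thesis by (rule connected_component_eq[symmetric])
qed

lemma edge_at_eqI:
  "connected S ==> S \<subseteq> curve D - crossings D ==> x \<in> S ==> y \<in> S ==> edge_at D x = edge_at D y"
  unfolding edge_at_def by (rule connected_component_set_eqI)

definition axis_units :: "complex set" where
  "axis_units = {1, \<i>, - 1, - \<i>}"

lemma axis_point:
  assumes "u \<in> axis_units" "0 < t" "t < (1 :: real)"
  shows "of_real t * u \<in> ball 0 1" "of_real t * u ~= 0" "Re (of_real t * u) = 0 \<or> Im (of_real t * u) = 0"
  using assms by (auto simp: axis_units_def norm_mult)

text \<open>In the chart an open half axis is connected and off the crossing, so it lies on a single
  edge, which can be read off at any height.\<close>

lemma chart_ray_edge:
  assumes c: "crossing_chart D v h" and u: "u \<in> axis_units" and t: "0 < t" "t < 1"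
  shows "inv h (of_real t * u) \<in> curve D - crossings D" "edge_at D (inv h (of_real t * u)) = edge_at D (inv h (u / 2))"
proof -
  have h: "planar_map h" using c by (simp add: crossing_chart_def)
  have mem: "inv h (of_real t * u) \<in> curve D - crossings D" if "0 < t" "t < 1" for t :: real
    using chart_mem[OF c axis_point(1)[OF u that]] axis_point[OF u that] by simp
  then show "inv h (of_real t * u) \<in> curve D - crossings D" using t by simp
  let ?S = "(\<lambda>t :: real. inv h (of_real t * u)) ` {0<..<1}"
  have "connected ?S"
    by (intro connected_continuous_image continuous_on_compose2[OF planar_map_simps(4)[OF h, of UNIV]])
      (auto intro!: continuous_intros)
  moreover have "?S \<subseteq> curve D - crossings D" using mem by auto
  moreover have "inv h (u / 2) \<in> ?S" by (rule image_eqI[of _ _ "1 / 2"]) auto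
  ultimately show "edge_at D (inv h (of_real t * u)) = edge_at D (inv h (u / 2))"
    using t by (intro edge_at_eqI[of ?S]) auto
qed

lemma shaded_connected:
  assumes D: "checkerboard D" and "connected S" "S \<inter> curve D = {}" "x \<in> S" "y \<in> S"
  shows "x \<in> shaded D \<longleftrightarrow> y \<in> shaded D"
proof -
  let ?F = "connected_component_set (- curve D) x"
  have "S \<subseteq> ?F" using assms(2-4) by (intro connected_component_maximal) auto
  moreover have "?F \<in> faces D" using assms(3,4) by (auto simp: faces_def components_def)
  moreover have "?F \<subseteq> shaded D \<or> ?F \<inter> shaded D = {}"
    using D calculation(2) by (simp add: checkerboard_def)
  ultimately show ?thesis using assms(4,5) by blast
qed

text \<open>The edge lies in the frontier of a shaded and of a white face, so every neighbourhood of
  its points meets both faces.\<close>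

lemma both_shades:
  assumes D: "checkerboard D" and e: "e \<in> edges D" "p \<in> e" and W: "open W" "p \<in> W"
  shows "\<exists>x\<in>W - curve D. x \<in> shaded D" "\<exists>x\<in>W - curve D. x ~: shaded D"
proof -
  obtain F G where FG: "F \<in> faces D" "G \<in> faces D" "F \<subseteq> shaded D" "G \<inter> shaded D = {}" "e \<subseteq> frontier F" "e \<subseteq> frontier G"
  proof -
    have "\<forall>e\<in>edges D. \<exists>F\<in>faces D. \<exists>G\<in>faces D. F \<subseteq> shaded D \<and> G \<inter> shaded D = {} \<and> e \<subseteq> frontier F \<and> e \<subseteq> frontier G"
      using D by (simp add: checkerboard_def)
    from bspec[OF this e(1)] show thesis using that by auto
  qed
  have *: "\<exists>x\<in>W - curve D. x \<in> K" if "K \<in> faces D" "e \<subseteq> frontier K" for K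
  proof -
    have "p \<in> closure K" using that e(2) by (auto simp: frontier_def)
    then have "W \<inter> K ~= {}" using W by (meson disjoint_iff open_Int_closure_eq_empty)
    moreover have "K \<subseteq> - curve D" using that(1) unfolding faces_def by (rule in_components_subset)
    ultimately show ?thesis by blast
  qed
  show "\<exists>x\<in>W - curve D. x \<in> shaded D" using *[OF FG(1,5)] FG(3) by blast
  show "\<exists>x\<in>W - curve D. x ~: shaded D" using *[OF FG(2,6)] FG(4) by blast
qed

definition quadrant :: "real => real => complex set" where
  "quadrant a b = {z \<in> ball 0 1. a * Re z > 0 \<and> b * Im z > 0}"

lemma connected_quadrant: "connected (quadrant a b)"
proof -
  have "quadrant a b = ball 0 1 \<inter> ({z. inner (of_real a) z > 0} \<inter> {z. inner (of_real b * \<i>) z > 0})"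
    by (auto simp: quadrant_def inner_complex_def)
  then show ?thesis by (auto intro!: convex_connected convex_Int convex_halfspace_gt)
qed

definition quadrant_shaded :: "shaded_diagram => (complex => complex) => real => real => bool" where
  "quadrant_shaded D h a b \<longleftrightarrow> inv h (Complex (a / 2) (b / 2)) \<in> shaded D"

lemma Complex_half_in_quadrant:
  assumes "\<bar>a\<bar> = 1" "\<bar>b\<bar> = 1" shows "Complex (a / 2) (b / 2) \<in> quadrant a b"
proof -
  have "a * a = 1" "b * b = 1" using assms by (auto simp: abs_if split: if_splits)
  moreover have "sqrt (1 / 2) < 1" by (simp add: real_sqrt_less_iff[of _ 1, simplified])
  ultimately show ?thesis by (simp add: quadrant_def cmod_def power2_eq_square)
qed

lemma shaded_quadrant:
  assumes D: "checkerboard D" and c: "crossing_chart D v h" and ab: "\<bar>a\<bar> = 1" "\<bar>b\<bar> = 1" and z: "z \<in> quadrant a b"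
  shows "inv h z \<in> shaded D \<longleftrightarrow> quadrant_shaded D h a b"
  unfolding quadrant_shaded_def
proof (rule shaded_connected[OF D])
  have h: "planar_map h" using c by (simp add: crossing_chart_def)
  show "connected (inv h ` quadrant a b)"
    by (rule connected_continuous_image[OF planar_map_simps(4)[OF h] connected_quadrant])
  show "inv h ` quadrant a b \<inter> curve D = {}"
  proof -
    have "inv h z ~: curve D" if "z \<in> quadrant a b" for z
    proof -
      have "z \<in> ball 0 1" "Re z ~= 0" "Im z ~= 0" using that by (auto simp: quadrant_def)
      then show ?thesis using chart_mem(1)[OF c] by blast
    qed
    then show ?thesis by auto
  qed
qed (use z Complex_half_in_quadrant[OF ab] in auto)

text \<open>Around a point of the half axis between them only the two quadrants are met off the
  curve. Both colours occur there, and each quadrant has a single colour.\<close>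

lemma quadrant_shaded_adjacent:
  assumes D: "checkerboard D" and c: "crossing_chart D v h" and a: "\<bar>a\<bar> = 1"
  shows "quadrant_shaded D h a 1 ~= quadrant_shaded D h a (- 1)"
    "quadrant_shaded D h 1 a ~= quadrant_shaded D h (- 1) a"
proof -
  have h: "planar_map h" using c by (simp add: crossing_chart_def)
  have a': "a = 1 \<or> a = -1" using a by auto
  have *: "\<exists>z\<in>ball (of_real (1/2) * u) (1 / 2). Re z ~= 0 \<and> Im z ~= 0 \<and> inv h z \<in> shaded D"
    "\<exists>z\<in>ball (of_real (1/2) * u) (1 / 2). Re z ~= 0 \<and> Im z ~= 0 \<and> inv h z ~: shaded D" if u: "u \<in> axis_units" for u
  proof -
    let ?p = "inv h (of_real (1/2) * u)"
    have p: "?p \<in> curve D - crossings D" by (rule chart_ray_edge(1)[OF c u]) auto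
    then have e: "edge_at D ?p \<in> edges D" "?p \<in> edge_at D ?p" by (auto simp: edges_def components_def edge_at_def)
    \<comment> \<open>The ball of radius 1/2 around u/2 lies in the unit disc and strictly on the
      side of u, so off the curve it meets only the two quadrants next to u.\<close>
    let ?W = "h -` ball (of_real (1/2) * u) (1 / 2)"
    have W: "open ?W" "?p \<in> ?W"
      using continuous_on_open_vimage[of UNIV h] planar_map_simps[OF h] by (auto simp: open_vimage)
    have nu: "norm u = 1" using u by (auto simp: axis_units_def)
    have off: "h x \<in> ball (of_real (1/2) * u) (1 / 2)" "Re (h x) ~= 0 \<and> Im (h x) ~= 0" "inv h (h x) = x" if "x \<in> ?W - curve D" for x
    proof -
      show i: "inv h (h x) = x" by (rule planar_map_simps(1)[OF h])
      show b: "h x \<in> ball (of_real (1/2) * u) (1 / 2)" using that by simp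
      have "h x \<in> ball 0 1"
        using b nu norm_triangle_ineq4[of "of_real (1/2) * u" "of_real (1/2) * u - h x"] by (simp add: dist_norm norm_mult)
      then show "Re (h x) ~= 0 \<and> Im (h x) ~= 0" using chart_mem(1)[OF c, of "h x"] that i by auto
    qed
    show "\<exists>z\<in>ball (of_real (1/2) * u) (1 / 2). Re z ~= 0 \<and> Im z ~= 0 \<and> inv h z \<in> shaded D"
      using both_shades(1)[OF D e W] off by metis
    show "\<exists>z\<in>ball (of_real (1/2) * u) (1 / 2). Re z ~= 0 \<and> Im z ~= 0 \<and> inv h z ~: shaded D"
      using both_shades(2)[OF D e W] off by metis
  qed
  have bd: "z \<in> ball 0 1" "b * Re u > 0 ==> b * Re z > 0" "b * Im u > 0 ==> b * Im z > 0"
    if u: "u \<in> axis_units" and z: "z \<in> ball (of_real (1/2) * u) (1 / 2)" and b: "\<bar>b\<bar> = 1" for u z and b :: real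
  proof -
    have nu: "norm u = 1" using u by (auto simp: axis_units_def)
    show "z \<in> ball 0 1"
      using z nu norm_triangle_ineq4[of "of_real (1/2) * u" "of_real (1/2) * u - z"] by (simp add: dist_norm norm_mult)
    have "\<bar>Re (of_real (1/2) * u - z)\<bar> < 1 / 2" "\<bar>Im (of_real (1/2) * u - z)\<bar> < 1 / 2"
      using z abs_Re_le_cmod[of "of_real (1/2) * u - z"] abs_Im_le_cmod[of "of_real (1/2) * u - z"]
      by (auto simp: dist_norm)
    then show "b * Re u > 0 ==> b * Re z > 0" "b * Im u > 0 ==> b * Im z > 0"
      using u b by (auto simp: axis_units_def abs_if split: if_splits)
  qed
  show "quadrant_shaded D h a 1 ~= quadrant_shaded D h a (- 1)"
  proof -
    have u: "of_real a \<in> axis_units" using a' by (auto simp: axis_units_def)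
    have q: "inv h z \<in> shaded D \<longleftrightarrow> quadrant_shaded D h a (sgn (Im z))"
      if z: "z \<in> ball (of_real (1/2) * of_real a) (1 / 2)" "Im z ~= 0" for z
    proof (rule shaded_quadrant[OF D c a])
      have "a * Re z > 0" using bd(2)[OF u z(1) a] a' by auto
      then show "z \<in> quadrant a (sgn (Im z))"
        using bd(1)[OF u z(1) a] z(2) by (simp add: quadrant_def sgn_real_def)
    qed (use z in \<open>simp add: sgn_real_def\<close>)
    from *[OF u] q show ?thesis by (metis sgn_real_def)
  qed
  show "quadrant_shaded D h 1 a ~= quadrant_shaded D h (- 1) a"
  proof -
    have u: "of_real a * \<i> \<in> axis_units" using a' by (auto simp: axis_units_def)
    have q: "inv h z \<in> shaded D \<longleftrightarrow> quadrant_shaded D h (sgn (Re z)) a"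
      if z: "z \<in> ball (of_real (1/2) * (of_real a * \<i>)) (1 / 2)" "Re z ~= 0" for z
    proof (rule shaded_quadrant[OF D c _ a])
      have "a * Im z > 0" using bd(3)[OF u z(1) a] a' by auto
      then show "z \<in> quadrant (sgn (Re z)) a"
        using bd(1)[OF u z(1) a] z(2) by (simp add: quadrant_def sgn_real_def)
    qed (use z in \<open>simp add: sgn_real_def\<close>)
    from *[OF u] q show ?thesis by (metis sgn_real_def)
  qed
qed

lemma quadrant_shaded_opposite:
  assumes "checkerboard D" "crossing_chart D v h"
  shows "quadrant_shaded D h (- 1) (- 1) = quadrant_shaded D h 1 1"
  using quadrant_shaded_adjacent[OF assms, of 1] quadrant_shaded_adjacent[OF assms, of "- 1"] by auto

abbreviation end_edge :: "shaded_diagram => (complex => complex) => complex => complex set" where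
  "end_edge D h u \<equiv> edge_at D (inv h (u / 2))"

text \<open>The swept region consists of two opposite quadrants. These have the same colour, so the
  subset test in \<open>chart_symbol\<close> is decided by one point.\<close>

lemma chart_symbol_eq_sym4:
  assumes D: "checkerboard D" and c: "crossing_chart D v h"
  shows "chart_symbol D h = sym4 True (quadrant_shaded D h 1 1)
    (end_edge D h 1) (end_edge D h \<i>) (end_edge D h (- 1)) (end_edge D h (- \<i>))"
proof -
  have "inv h ` {z \<in> ball 0 1. Re z * Im z > 0} \<subseteq> shaded D \<longleftrightarrow> quadrant_shaded D h 1 1"
  proof
    assume "inv h ` {z \<in> ball 0 1. Re z * Im z > 0} \<subseteq> shaded D"
    moreover have "Complex (1 / 2) (1 / 2) \<in> {z \<in> ball 0 1. Re z * Im z > 0}"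
      using Complex_half_in_quadrant[of 1 1] by (simp add: quadrant_def)
    ultimately show "quadrant_shaded D h 1 1" unfolding quadrant_shaded_def by blast
  next
    assume q: "quadrant_shaded D h 1 1"
    show "inv h ` {z \<in> ball 0 1. Re z * Im z > 0} \<subseteq> shaded D"
    proof clarify
      fix z :: complex assume z: "z \<in> ball 0 1" "Re z * Im z > 0"
      then have "z \<in> quadrant 1 1 \<or> z \<in> quadrant (-1) (-1)" by (auto simp: quadrant_def zero_less_mult_iff)
      then show "inv h z \<in> shaded D"
        using shaded_quadrant[OF D c, of 1 1 z] shaded_quadrant[OF D c, of "-1" "-1" z] q
          quadrant_shaded_opposite[OF D c] by auto
    qed
  qed
  then show ?thesis by (simp add: chart_symbol_def Let_def sym4_def)
qed

text \<open>Near 0 the transition map of the charts preserves the overpass axis and the union of the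
  axes, so \<open>planar_map_axes\<close> lets it act on rays and quadrants as the identity or the
  half turn, and a half turn does not change the expansion.\<close>

lemma chart_symbol_unique:
  assumes D: "checkerboard D" and c: "crossing_chart D v h" "crossing_chart D v h'"
  shows "expand (chart_symbol D h) = expand (chart_symbol D h')"
proof -
  have h: "planar_map h" "h v = 0" and h': "planar_map h'" "h' v = 0" using c by (auto simp: crossing_chart_def)
  define f where "f = h' \<circ> inv h"
  have f: "planar_map f" unfolding f_def by (intro planar_map_compose planar_map_inv h h')
  have "inv h 0 = v" using planar_map_simps(1)[OF h(1), of v] h(2) by simp
  then have f0: "f 0 = 0" by (simp add: f_def h'(2))
  have hf: "inv h' (f z) = inv h z" for z by (simp add: f_def planar_map_simps(1)[OF h'(1)])
  have "isCont f 0" using planar_map_simps(3)[OF f, of UNIV] by (simp add: continuous_on_eq_continuous_at)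
  then obtain d where d: "d > 0" "\<And>z. dist z 0 < d ==> dist (f z) (f 0) < 1"
    unfolding continuous_at_eps_delta by (meson zero_less_one)
  define e where "e = min d 1"
  have e: "e > 0" "e \<le> 1" "\<And>z. z \<in> ball 0 e ==> f z \<in> ball 0 1 \<and> z \<in> ball 0 1"
    using d f0 by (auto simp: e_def dist_commute)
  have iff: "(Re z = 0 \<or> Im z = 0) \<longleftrightarrow> (Re (f z) = 0 \<or> Im (f z) = 0)" "Im z = 0 \<longleftrightarrow> Im (f z) = 0" if "z \<in> ball 0 e" for z
    using chart_mem[OF c(1), of z] chart_mem[OF c(2), of "f z"] e(3)[OF that] hf[of z] by auto
  obtain s :: real where s: "s = 1 \<or> s = -1"
    "\<And>z. z \<in> ball 0 e ==> sgn (Re (f z)) = s * sgn (Re z) \<and> sgn (Im (f z)) = s * sgn (Im z)"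
  proof (rule planar_map_axes[OF f f0 e(1)])
    fix z :: complex assume z: "z \<in> ball 0 e"
    show "Im z = 0 ==> Im (f z) = 0" using iff[OF z] by simp
    show "Re (f z) = 0" if "Re z = 0"
    proof (cases "Im z = 0")
      case True
      then have "z = 0" using that by (simp add: complex_eq_iff)
      then show ?thesis using f0 by simp
    qed (use iff[OF z] that in auto)
    show "Re z ~= 0 ==> Im z ~= 0 ==> Re (f z) ~= 0 \<and> Im (f z) ~= 0" using iff[OF z] by auto
  qed auto
  have edge: "end_edge D h u = end_edge D h' (of_real s * u)" if u: "u \<in> axis_units" for u
  proof -
    define z where "z = of_real (e / 2) * u"
    have z: "z \<in> ball 0 e" using u e by (auto simp: z_def axis_units_def norm_mult)
    have su: "of_real s * u \<in> axis_units" using s(1) u by (auto simp: axis_units_def)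
    have "z ~= 0" using u e by (auto simp: z_def axis_units_def)
    then have fz: "f z ~= 0" using f0 planar_map_simps(6)[OF f] by (metis injD)
    have sz: "sgn (Re z) = Re u" "sgn (Im z) = Im u" using u e by (auto simp: z_def axis_units_def)
    have "Re (f z) = \<bar>Re (f z)\<bar> * (s * Re u)" "Im (f z) = \<bar>Im (f z)\<bar> * (s * Im u)"
      using s(2)[OF z] sz by (metis mult.commute mult_sgn_abs)+
    moreover have "Re u = 0 ==> Re (f z) = 0" "Im u = 0 ==> Im (f z) = 0"
      using s(2)[OF z] sz by (auto simp: sgn_zero_iff)
    ultimately have "f z = of_real (norm (f z)) * (of_real s * u)"
      using u by (cases "Re u = 0") (auto simp: axis_units_def complex_eq_iff cmod_eq_Re cmod_eq_Im)
    moreover have "0 < norm (f z)" "norm (f z) < 1" using fz e(3)[OF z] by auto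
    ultimately have "edge_at D (inv h' (f z)) = end_edge D h' (of_real s * u)"
      using chart_ray_edge(2)[OF c(2) su, of "norm (f z)"] by simp
    moreover have "edge_at D (inv h z) = end_edge D h u"
      unfolding z_def by (rule chart_ray_edge(2)[OF c(1) u]) (use e in auto)
    ultimately show ?thesis by (simp add: hf)
  qed
  have "quadrant_shaded D h 1 1 = quadrant_shaded D h' s s"
  proof -
    define z where "z = Complex (e / 2) (e / 2)"
    have "norm z \<le> sqrt (1 / 2) * e" using e by (simp add: z_def cmod_def real_sqrt_mult power_divide real_sqrt_divide)
    moreover have "sqrt (1 / 2) < 1" by (simp add: real_sqrt_less_iff[of _ 1, simplified])
    ultimately have z: "z \<in> ball 0 e" using e by (simp add: order_le_less_trans)
    have "z \<in> quadrant 1 1" using e(3)[OF z] e by (simp add: quadrant_def z_def)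
    then have "inv h z \<in> shaded D \<longleftrightarrow> quadrant_shaded D h 1 1" by (intro shaded_quadrant[OF D c(1)]) auto
    moreover have "f z \<in> quadrant s s"
      using e(3)[OF z] s(1) s(2)[OF z] e(1) by (auto simp: quadrant_def z_def sgn_real_def split: if_splits)
    then have "inv h' (f z) \<in> shaded D \<longleftrightarrow> quadrant_shaded D h' s s" using s(1) by (intro shaded_quadrant[OF D c(2)]) auto
    ultimately show ?thesis by (simp add: hf)
  qed
  then show ?thesis
    using s(1) edge[of 1] edge[of \<i>] edge[of "-1"] edge[of "-\<i>"] quadrant_shaded_opposite[OF D c(2)]
      expand_sym4_half_turn
    by (auto simp: chart_symbol_eq_sym4[OF D c(1)] chart_symbol_eq_sym4[OF D c(2)] axis_units_def)
qed

lemma symbol_at_chart: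
  assumes "shaded_link_diagram D" "crossing_chart D v h"
  shows "expand (symbol_at D v) = expand (chart_symbol D h)"
  unfolding symbol_at_def
proof (rule chart_symbol_unique)
  show "crossing_chart D v (SOME h. crossing_chart D v h)" using assms(2) by (rule someI[where P = "crossing_chart D v"])
qed (use assms in \<open>auto simp: shaded_link_diagram_def\<close>)

text \<open>A criterion that needs no chart: in the affine coordinates with directions u and w the
  crossing is a pair of axes, and an orientation preserving linear map is planar.\<close>

lemma straight_crossing:
  fixes u w :: complex
  assumes D: "checkerboard D" and uw: "Im (cnj u * w) > 0" and r: "r > 0"
    and curve: "\<And>x y. \<bar>x\<bar> < r ==> \<bar>y\<bar> < r ==> p + of_real x * u + of_real y * w \<in> curve D \<longleftrightarrow> x = 0 \<or> y = 0"
    and cross: "\<And>x y. \<bar>x\<bar> < r ==> \<bar>y\<bar> < r ==> p + of_real x * u + of_real y * w \<in> crossings D \<longleftrightarrow> x = 0 \<and> y = 0"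
    and over: "\<And>x y. \<bar>x\<bar> < r ==> \<bar>y\<bar> < r ==> p + of_real x * u + of_real y * w \<in> overpass D p \<longleftrightarrow> (if ov then y = 0 else x = 0)"
    and ends: "\<And>t. 0 < t ==> t < r ==> edge_at D (p + of_real t * u) = e1"
      "\<And>t. 0 < t ==> t < r ==> edge_at D (p + of_real t * w) = e2"
      "\<And>t. 0 < t ==> t < r ==> edge_at D (p - of_real t * u) = e3"
      "\<And>t. 0 < t ==> t < r ==> edge_at D (p - of_real t * w) = e4"
    and shade: "\<And>t. 0 < t ==> t < r ==> p + of_real t * u + of_real t * w \<in> shaded D \<longleftrightarrow> sh"
  shows "\<exists>h. crossing_chart D p h \<and> expand (chart_symbol D h) = expand (sym4 ov sh e1 e2 e3 e4)"
proof -
  \<comment> \<open>The real axis of the chart must be the overpass. If that is the line in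
    direction w, the imaginary axis becomes - u, to keep the orientation.\<close>
  define U where "U = (if ov then u else w)"
  define W where "W = (if ov then w else - u)"
  have UW: "Im (cnj U * W) > 0" using uw by (auto simp: U_def W_def mult.commute)
  define g where "g = (\<lambda>z. z + p) \<circ> (\<lambda>z. of_real (Re z) * U + of_real (Im z) * W)"
  have g: "planar_map g" unfolding g_def by (intro planar_map_compose planar_map_translation planar_map_linear UW)
  define h where "h = inv g"
  have h: "planar_map h" unfolding h_def by (rule planar_map_inv[OF g])
  have ih: "inv h = g" unfolding h_def using planar_map_simps(5)[OF g] by (rule inv_inv_eq)
  have g': "g z = p + of_real (Re z) * U + of_real (Im z) * W" for z by (simp add: g_def)
  define X where "X z = (if ov then Re z else - Im z)" for z
  define Y where "Y z = (if ov then Im z else Re z)" for z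
  have gz: "g z = p + of_real (X z) * u + of_real (Y z) * w" for z
    by (simp add: g' U_def W_def X_def Y_def)
  have "g 0 = p" by (simp add: g')
  then have hp: "h p = 0" using planar_map_simps(1)[OF g, of 0] by (simp add: h_def)
  have small: "\<bar>X z\<bar> < r" "\<bar>Y z\<bar> < r" if "z \<in> ball 0 r" for z
    using that abs_Re_le_cmod[of z] abs_Im_le_cmod[of z] by (auto simp: X_def Y_def)
  have m: "inv h z \<in> curve D \<longleftrightarrow> Re z = 0 \<or> Im z = 0" "inv h z \<in> crossings D \<longleftrightarrow> z = 0"
    "inv h z \<in> overpass D p \<longleftrightarrow> Im z = 0" if "z \<in> ball 0 r" for z
    unfolding ih gz using curve[OF small[OF that]] cross[OF small[OF that]] over[OF small[OF that]]
    by (auto simp: X_def Y_def complex_eq_iff split: if_splits)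
  let ?k = "\<lambda>z. h z / of_real r"
  have k: "crossing_chart D p ?k" "inv ?k = (\<lambda>z. inv h (of_real r * z))"
    by (rule crossing_chartI[OF h hp r m]; assumption)+
  have ends': "end_edge D ?k 1 = (if ov then e1 else e2)" "end_edge D ?k \<i> = (if ov then e2 else e3)"
    "end_edge D ?k (- 1) = (if ov then e3 else e4)" "end_edge D ?k (- \<i>) = (if ov then e4 else e1)"
    unfolding k(2) ih gz using ends[of "r / 2"] r by (simp_all add: X_def Y_def)
  have "Complex (r / 2) (r / 2) = of_real r * Complex (1 / 2) (1 / 2)"
    "Complex (r / 2) (- r / 2) = of_real r * Complex (1 / 2) (- 1 / 2)" by (simp_all add: complex_eq_iff)
  then have q1: "quadrant_shaded D ?k 1 1 \<longleftrightarrow> g (Complex (r / 2) (r / 2)) \<in> shaded D"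
    "quadrant_shaded D ?k 1 (- 1) \<longleftrightarrow> g (Complex (r / 2) (- r / 2)) \<in> shaded D"
    unfolding quadrant_shaded_def k(2) ih by simp_all
  \<comment> \<open>Without \<open>ov\<close>, the quadrant between u and w is the chart quadrant
    with signs 1, -1, whose colour is opposite to that of 1, 1.\<close>
  have "quadrant_shaded D ?k 1 1 \<longleftrightarrow> (if ov then sh else \<not> sh)"
    using quadrant_shaded_adjacent(1)[OF D k(1), of 1] shade[of "r / 2"] r
    unfolding q1 by (auto simp: gz X_def Y_def)
  then have "chart_symbol D ?k = sym4 ov sh e1 e2 e3 e4"
    unfolding chart_symbol_eq_sym4[OF D k(1)] ends' by (simp add: sym4_def)
  then show ?thesis using k(1) by auto
qed

section \<open>Curves as graphs\<close>

text \<open>As the family is finite, the union of all members but one is relatively closed too, so a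
  connected set that contains a member cannot reach beyond it.\<close>

lemma components_eqI:
  assumes X: "X = \<Union>\<P>" and fin: "finite \<P>" and ne: "\<And>P. P \<in> \<P> ==> P ~= {} \<and> connected P"
    and cl: "\<And>P. P \<in> \<P> ==> closedin (top_of_set X) P"
    and disj: "\<And>P Q. P \<in> \<P> ==> Q \<in> \<P> ==> P ~= Q ==> P \<inter> Q = {}"
  shows "components X = \<P>"
proof -
  have P: "P \<in> components X" if PP: "P \<in> \<P>" for P
    unfolding in_components_maximal
  proof (intro conjI allI impI)
    show "P ~= {}" "connected P" "P \<subseteq> X" using ne[OF PP] X PP by auto
    fix C assume C: "C ~= {} \<and> P \<subseteq> C \<and> C \<subseteq> X \<and> connected C"
    define Q where "Q = \<Union>(\<P> - {P})"
    have "closedin (top_of_set X) Q" unfolding Q_def using fin cl by (intro closedin_Union) auto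
    then obtain L where L: "closed L" "Q = X \<inter> L" by (auto simp: closedin_closed)
    obtain K where K: "closed K" "P = X \<inter> K" using cl[OF PP] by (auto simp: closedin_closed)
    have PQ: "P \<inter> Q = {}" "P \<union> Q = X" using disj[OF PP] X PP by (auto simp: Q_def)
    have "K \<inter> C = {} \<or> L \<inter> C = {}"
    proof (rule connected_closedD)
      have "K \<inter> L \<inter> C \<subseteq> P \<inter> Q" using C K(2) L(2) by auto
      then show "K \<inter> L \<inter> C = {}" using PQ(1) by simp
      have "C \<subseteq> P \<union> Q" using PQ(2) C by simp
      then show "C \<subseteq> K \<union> L" using K(2) L(2) by auto
    qed (use C K(1) L(1) in auto)
    moreover have "P ~= {}" "P \<subseteq> K" using ne[OF PP] K(2) by auto
    then have "K \<inter> C ~= {}" using C by blast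
    ultimately have "C \<inter> Q = {}" using L(2) by auto
    then have "C \<subseteq> P" using PQ(2) C by blast
    then show "C = P" using C by blast
  qed
  show ?thesis
  proof (intro equalityI subsetI)
    fix C assume C: "C \<in> components X"
    then obtain x where "x \<in> C" using in_components_nonempty by blast
    moreover have "x \<in> X" using in_components_subset[OF C] \<open>x \<in> C\<close> by auto
    ultimately obtain Q where "Q \<in> \<P>" "x \<in> Q" using X by auto
    then have "C = Q" using C P[of Q] \<open>x \<in> C\<close> components_nonoverlap[of C X Q] by auto
    then show "C \<in> \<P>" using \<open>Q \<in> \<P>\<close> by simp
  qed (rule P)
qed

lemma closedin_closure_subset: "P \<subseteq> X ==> closed K ==> K \<inter> X \<subseteq> P ==> P \<subseteq> K ==> closedin (top_of_set X) P"
  unfolding closedin_closed by (intro exI[of _ K]) auto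

lemma connected_in_closed_family:
  assumes "connected S" "S ~= {}" "finite J" "\<And>j. j \<in> J ==> closed (C j)" "S \<subseteq> (\<Union>j\<in>J. C j)"
    and "\<And>i j. i \<in> J ==> j \<in> J ==> i ~= j ==> S \<inter> C i \<inter> C j = {}"
  obtains j where "j \<in> J" "S \<subseteq> C j"
proof -
  obtain x j where j: "x \<in> S" "j \<in> J" "x \<in> C j" using assms(2,5) by blast
  let ?K = "\<Union>i\<in>J - {j}. C i"
  have "closed ?K" using assms(3,4) by auto
  moreover have "C j \<inter> ?K \<inter> S = {}" using assms(6) j(2) by blast
  moreover have "S \<subseteq> C j \<union> ?K" using assms(5) by blast
  ultimately have "C j \<inter> S = {} \<or> ?K \<inter> S = {}"
    using connected_closedD[OF assms(1)] assms(4)[OF j(2)] by blast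
  then have "S \<subseteq> C j" using j \<open>S \<subseteq> C j \<union> ?K\<close> by blast
  then show thesis using that j by blast
qed

lemma closed_avoiding_ball:
  fixes p :: complex
  assumes "closed C" "p ~: C"
  obtains eps where "eps > 0" "ball p eps \<inter> C = {}"
proof -
  have "open (- C)" "p \<in> - C" using assms by auto
  then obtain eps where "eps > 0" "ball p eps \<subseteq> - C" by (rule openE)
  then show thesis using that by auto
qed

section \<open>Curves with a finite set of vertices\<close>

text \<open>The condition of \<open>open_edge\<close> with the vertex set as a parameter, so that
  cut points can join the crossings.\<close>

definition arc_edge :: "complex set => complex set => bool" where
  "arc_edge W e \<longleftrightarrow> (\<exists>g. simple_path g \<and> pathstart g \<in> W \<and> pathfinish g \<in> W \<and>
     e = path_image g - {pathstart g, pathfinish g})"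

definition arc_graph :: "complex set => complex set => bool" where
  "arc_graph X W \<longleftrightarrow> finite W \<and> W \<subseteq> X \<and> finite (components (X - W)) \<and>
     (\<forall>e\<in>components (X - W). arc_edge W e \<or> closed_edge e)"

lemma link_diagram_arc_graph: "link_diagram D ==> arc_graph (curve D) (crossings D)"
  unfolding link_diagram_def arc_graph_def edges_def open_edge_def arc_edge_def by simp

text \<open>The form in which an edge-end at a crossing or at a cut point is handled.\<close>

definition ray :: "(real => complex) => complex set" where
  "ray ga = path_image ga - {pathstart ga}"

lemma ray_eq: "arc ga ==> ray ga = ga ` {0<..1}"
proof -
  assume a: "arc ga"
  have "ga t ~= ga 0" if "0 < t" "t \<le> 1" for t
    using a that inj_onD[of ga "{0..1}" t 0] by (auto simp: arc_def)
  moreover have "{0..1 :: real} = insert 0 {0<..1}" by auto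
  ultimately show ?thesis by (auto simp: ray_def path_image_def pathstart_def)
qed

lemma connected_ray: "arc ga ==> connected (ray ga)"
proof -
  assume a: "arc ga"
  have "continuous_on {0<..1} ga"
    by (rule continuous_on_subset[of "{0..1}" ga]) (use a in \<open>auto simp: arc_def path_def\<close>)
  then have "connected (ga ` {0<..1})" by (rule connected_continuous_image) simp
  then show ?thesis using ray_eq[OF a] by simp
qed

lemma pathfinish_in_ray: "arc ga ==> pathfinish ga \<in> ray ga"
  by (simp add: ray_eq pathfinish_def)

lemma path_initial_segment:
  assumes "path g" "0 < d" "d \<le> 1"
  shows "connected (g ` {0<..<d})" "pathstart g \<in> closure (g ` {0<..<d})"
proof -
  have c: "continuous_on {0..1} g" using assms(1) by (simp add: path_def)
  show "connected (g ` {0<..<d})"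
    by (intro connected_continuous_image continuous_on_subset[OF c]) (use assms in auto)
  have "g ` closure {0<..<d} \<subseteq> closure (g ` {0<..<d})"
    by (intro image_closure_subset continuous_on_subset[OF c] closure_subset) (use assms in auto)
  then show "pathstart g \<in> closure (g ` {0<..<d})" using assms by (auto simp: pathstart_def)
qed

lemma ray_closure: "arc ga ==> pathstart ga \<in> closure (ray ga)"
proof -
  assume a: "arc ga"
  then have "pathstart ga \<in> closure (ga ` {0<..<1})" by (intro path_initial_segment) (auto simp: arc_def)
  moreover have "ga ` {0<..<1} \<subseteq> ray ga" using a by (auto simp: ray_eq)
  ultimately show ?thesis using closure_mono by blast
qed

text \<open>In the parameter of the arc both sets are intervals that accumulate at 0, so they
  overlap.\<close>

lemma arc_germs_meet:
  assumes a: "arc ga" and S: "connected S" "S \<subseteq> ray ga" "pathstart ga \<in> closure S"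
    and T: "connected T" "T \<subseteq> ray ga" "pathstart ga \<in> closure T"
  shows "S \<inter> T ~= {}"
proof -
  obtain k where k: "homeomorphism {0..1} (path_image ga) ga k" using homeomorphism_arc[OF a] by blast
  have sub: "ray ga \<subseteq> path_image ga" by (auto simp: ray_def)
  have k0: "k (pathstart ga) = 0" using homeomorphism_apply1[OF k, of 0] by (simp add: pathstart_def)
  have kpos: "0 < k x" "k x \<le> 1" "ga (k x) = x" if "x \<in> ray ga" for x
  proof -
    have x: "x \<in> path_image ga" using that sub by auto
    show "ga (k x) = x" by (rule homeomorphism_apply2[OF k x])
    have "k x \<in> {0..1}" using homeomorphism_image2[OF k] x by blast
    moreover have "k x ~= 0" using \<open>ga (k x) = x\<close> that by (auto simp: ray_def pathstart_def)
    ultimately show "0 < k x" "k x \<le> 1" by auto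
  qed
  have small: "\<exists>x\<in>R. k x < d" if R: "R \<subseteq> ray ga" "pathstart ga \<in> closure R" and d: "d > 0" for R d
  proof -
    have "continuous_on (path_image ga) k" using k by (simp add: homeomorphism_def)
    then obtain e where e: "e > 0" "\<And>x. x \<in> path_image ga ==> dist x (pathstart ga) < e ==> dist (k x) (k (pathstart ga)) < d"
      using d unfolding continuous_on_iff by (metis pathstart_in_path_image)
    obtain x where "x \<in> R" "dist x (pathstart ga) < e" using R(2) e(1) by (auto simp: closure_approachable)
    moreover from this have "x \<in> path_image ga" using R(1) sub by blast
    ultimately show ?thesis using e(2)[of x] k0 by (intro bexI[of _ x]) (auto simp: dist_real_def)
  qed
  have int: "is_interval (k ` R)" if "connected R" "R \<subseteq> ray ga" for R
  proof -
    have "continuous_on R k" using k that(2) sub by (auto simp: homeomorphism_def intro: continuous_on_subset)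
    then show ?thesis using connected_continuous_image[OF _ that(1)] by (simp add: is_interval_connected_1)
  qed
  obtain s where s: "s \<in> S" using S(3) by (metis closure_empty empty_iff equals0I)
  obtain t where t: "t \<in> T" "k t < k s" using small[OF T(2,3), of "k s"] kpos(1)[of s] s S(2) by auto
  obtain r where r: "r \<in> S" "k r < k t" using small[OF S(2,3), of "k t"] kpos(1)[of t] t T(2) by auto
  have "k r \<le> k t" "k t \<le> k s" "k r \<in> k ` S" "k s \<in> k ` S" using r s t(2) by auto
  then have "k t \<in> k ` S" using int[OF S(1,2)] unfolding is_interval_1 by blast
  then obtain q where q: "q \<in> S" "k q = k t" by auto
  then have "q \<in> ray ga" "t \<in> ray ga" using S(2) T(2) t(1) by auto
  then have "ga (k q) = q" "ga (k t) = t" using kpos(3) by blast+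
  then have "q = t" using q(2) by metis
  then show ?thesis using t(1) q(1) by auto
qed

lemma arc_edge_closed: "arc_edge W e ==> \<exists>K. closed K \<and> e \<subseteq> K \<and> K \<subseteq> e \<union> W"
proof -
  assume "arc_edge W e"
  then obtain g where g: "simple_path g" "pathstart g \<in> W" "pathfinish g \<in> W" "e = path_image g - {pathstart g, pathfinish g}"
    unfolding arc_edge_def by (elim exE conjE) (rule that)
  show ?thesis
  proof (intro exI[of _ "path_image g"] conjI)
    show "closed (path_image g)" using g(1) by (intro closed_path_image simple_path_imp_path)
    show "e \<subseteq> path_image g" "path_image g \<subseteq> e \<union> W" using g(2-4) by auto
  qed
qed

lemma closed_edge_closed: "closed_edge e ==> closed e"
  unfolding closed_edge_def by (elim exE conjE) (simp add: closed_path_image simple_path_imp_path)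

text \<open>The vertices and the other edges form a closed set, because each of the finitely many
  edges is closed up to vertices; a small ball avoids it.\<close>

lemma arc_graph_edge_neighbourhood:
  assumes G: "arc_graph X W" and e: "e \<in> components (X - W)" "p \<in> e"
  shows "\<exists>eps>0. X \<inter> ball p eps \<subseteq> e"
proof -
  have "\<exists>K. closed K \<and> d \<subseteq> K \<and> K \<subseteq> d \<union> W" if "d \<in> components (X - W)" for d
  proof -
    have "arc_edge W d \<or> closed_edge d" using G that by (simp add: arc_graph_def)
    then show ?thesis using arc_edge_closed closed_edge_closed by blast
  qed
  then obtain K where K: "\<And>d. d \<in> components (X - W) ==> closed (K d) \<and> d \<subseteq> K d \<and> K d \<subseteq> d \<union> W" by metis
  let ?C = "W \<union> (\<Union>d\<in>components (X - W) - {e}. K d)"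
  have "closed ?C" using G K by (intro closed_Un closed_UN finite_imp_closed) (auto simp: arc_graph_def)
  moreover have "p ~: ?C"
  proof -
    have "p ~: W" using in_components_subset[OF e(1)] e(2) by auto
    moreover have "p ~: d" if "d \<in> components (X - W)" "d ~= e" for d
      using components_nonoverlap[OF that(1) e(1)] that e(2) by auto
    ultimately show ?thesis using K by blast
  qed
  ultimately obtain eps where eps: "eps > 0" "ball p eps \<inter> ?C = {}" by (rule closed_avoiding_ball)
  have "X \<subseteq> ?C \<union> e"
  proof
    fix x assume "x \<in> X"
    show "x \<in> ?C \<union> e"
    proof (cases "x \<in> W")
      case False
      then have "x \<in> \<Union>(components (X - W))" using \<open>x \<in> X\<close> by simp
      then obtain d where "d \<in> components (X - W)" "x \<in> d" by blast
      then show ?thesis using K[of d] by (cases "d = e") auto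
    qed simp
  qed
  then show ?thesis using eps by blast
qed

lemma component_eqI:
  "e \<in> components Y ==> connected S ==> S \<subseteq> Y ==> S \<inter> e ~= {} ==> S \<subseteq> e"
  by (rule components_maximal) (simp_all add: Int_commute)

lemma simple_path_interior_inj:
  assumes "simple_path g" "0 < s" "s < 1" "0 < t" "t < 1" "g s = g t" shows "s = t"
proof -
  have "\<forall>x\<in>{0..1}. \<forall>y\<in>{0..1}. g x = g y \<longrightarrow> x = y \<or> x = 0 \<and> y = 1 \<or> x = 1 \<and> y = 0"
    using assms(1) by (simp add: simple_path_def loop_free_def)
  from bspec[OF bspec[OF this, of s], of t] have "s = t \<or> s = 0 \<and> t = 1 \<or> s = 1 \<and> t = 0"
    using assms(2-6) by fastforce
  then show ?thesis using assms by auto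
qed

lemma image_disjointI: "(\<And>x y. x \<in> A ==> y \<in> B ==> g x ~= g y) ==> g ` A \<inter> g ` B = {}"
  by auto

lemma not_in_imageI: "(\<And>x. x \<in> A ==> g x ~= y) ==> y ~: g ` A"
  by auto

text \<open>The source of the fact that every label occurs twice. Each end of a parametrization of e
  enters a ray, these two rays differ, and a ray inside e has to share its germ with one of them.
  The edge may well return to its starting vertex.\<close>

lemma card_rays_arc_edge:
  assumes e: "e \<in> components (X - W)" "arc_edge W e" and J: "finite J"
    and rays: "\<And>j. j \<in> J ==> arc (ga j) \<and> pathstart (ga j) \<in> W \<and> ray (ga j) \<subseteq> X - W"
    and disj: "\<And>i j. i \<in> J ==> j \<in> J ==> i ~= j ==> pathstart (ga i) = pathstart (ga j) ==> ray (ga i) \<inter> ray (ga j) = {}"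
    and cover: "\<And>w. w \<in> W ==> \<exists>eps>0. X \<inter> ball w eps \<subseteq> insert w (\<Union>j\<in>{j\<in>J. pathstart (ga j) = w}. ray (ga j))"
  shows "card {j\<in>J. ray (ga j) \<subseteq> e} = 2"
proof -
  obtain g where g: "simple_path g" "pathstart g \<in> W" "pathfinish g \<in> W" "e = path_image g - {pathstart g, pathfinish g}"
    using e(2) unfolding arc_edge_def by (elim exE conjE) (rule that)
  have eX: "e \<subseteq> X - W" by (rule in_components_subset[OF e(1)])
  \<comment> \<open>Near its start g is covered by the rays at this vertex. They are closed and
    disjoint off the vertex, so a connected initial segment of g lies on one of them.\<close>
  have end_ray: "\<exists>d j. 0 < d \<and> d < 1/2 \<and> j \<in> J \<and> pathstart (ga j) = pathstart g \<and> g ` {0<..<d} \<subseteq> ray (ga j)"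
    if g: "simple_path g" "pathstart g \<in> W" "e = path_image g - {pathstart g, pathfinish g}" for g
  proof -
    let ?w = "pathstart g" and ?J = "{j\<in>J. pathstart (ga j) = pathstart g}"
    obtain eps where eps: "eps > 0" "X \<inter> ball ?w eps \<subseteq> insert ?w (\<Union>j\<in>?J. ray (ga j))"
      using cover[OF g(2)] by blast
    have p: "path g" using g(1) by (rule simple_path_imp_path)
    then obtain d where d: "d > 0" "\<And>t. t \<in> {0..1} ==> dist t 0 < d ==> dist (g t) (g 0) < eps"
      using eps(1) unfolding path_def continuous_on_iff by (metis atLeastAtMost_iff order_refl zero_le_one)
    \<comment> \<open>A bound below 1/2 keeps the initial segments of g and of its reverse apart,
      which distinguishes the two rays below.\<close>
    define d' where "d' = min d (1/3)"
    have d': "0 < d'" "d' < 1/2" "d' \<le> 1" using d by (auto simp: d'_def)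
    define S where "S = g ` {0<..<d'}"
    have Se: "S \<subseteq> e"
    proof -
      have "g t ~= g 0" "g t ~= g 1" if "0 < t" "t < d'" for t
        using that d' g(1) unfolding simple_path_def loop_free_def by (force, force)
      then show ?thesis unfolding g(3) S_def by (auto simp: path_image_def pathstart_def pathfinish_def d'_def)
    qed
    have "S \<subseteq> X \<inter> ball ?w eps"
      using Se eX d(2) by (fastforce simp: S_def d'_def pathstart_def dist_commute dist_real_def)
    moreover have "?w ~: S" using Se eX g(2) by auto
    ultimately have S: "S \<subseteq> (\<Union>j\<in>?J. ray (ga j))" using order_trans[OF _ eps(2)] by (metis subset_insert)
    have "S ~= {}" using d' by (auto simp: S_def)
    obtain j where "j \<in> ?J" "S \<subseteq> path_image (ga j)"
    proof (rule connected_in_closed_family[OF path_initial_segment(1)[OF p d'(1,3), folded S_def] \<open>S ~= {}\<close>, of ?J "\<lambda>j. path_image (ga j)"])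
      show "closed (path_image (ga j))" if "j \<in> ?J" for j
        using rays that by (intro closed_path_image) (auto simp: arc_def)
      show "S \<subseteq> (\<Union>j\<in>?J. path_image (ga j))" using S by (auto simp: ray_def)
      show "S \<inter> path_image (ga i) \<inter> path_image (ga j) = {}" if "i \<in> ?J" "j \<in> ?J" "i ~= j" for i j
      proof -
        have "ray (ga i) \<inter> ray (ga j) = {}" using disj[of i j] that by simp
        then have "path_image (ga i) \<inter> path_image (ga j) \<subseteq> {?w}" using that by (auto simp: ray_def)
        then show ?thesis using \<open>?w ~: S\<close> by blast
      qed
    qed (use J in simp_all)
    then have "S \<subseteq> ray (ga j)" "j \<in> J" "pathstart (ga j) = ?w" using \<open>?w ~: S\<close> by (auto simp: ray_def)
    then show ?thesis using d'(1,2) unfolding S_def by (intro exI conjI)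
  qed
  obtain d j where j: "0 < d" "d < 1/2" "j \<in> J" "pathstart (ga j) = pathstart g" "g ` {0<..<d} \<subseteq> ray (ga j)"
    using end_ray[OF g(1,2,4)] by (elim exE conjE) (rule that)
  let ?g = "reversepath g"
  have gr: "simple_path ?g" "pathstart ?g \<in> W" "e = path_image ?g - {pathstart ?g, pathfinish ?g}"
    using g by (simp_all add: simple_path_reversepath insert_commute)
  obtain d' j' where j': "0 < d'" "d' < 1/2" "j' \<in> J" "pathstart (ga j') = pathstart ?g" "?g ` {0<..<d'} \<subseteq> ray (ga j')"
    using end_ray[OF gr] by (elim exE conjE) (rule that)
  have pg: "path g" using g(1) by (rule simple_path_imp_path)
  have in_e: "g t \<in> e" if "0 < t" "t < 1" for t
  proof -
    have "g t ~= g 0" "g t ~= g 1" using that g(1) unfolding simple_path_def loop_free_def by (force, force)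
    then show ?thesis using that unfolding g(4) by (auto simp: path_image_def pathstart_def pathfinish_def)
  qed
  \<comment> \<open>Two germs at the start of one arc meet, which would give g s = g (1 - t) with s
    < 1/2 < 1 - t.\<close>
  have neq: "j ~= j'"
  proof
    assume "j = j'"
    let ?S = "g ` {0<..<d}" and ?T = "?g ` {0<..<d'}"
    have "?S \<inter> ?T ~= {}"
    proof (rule arc_germs_meet[of "ga j"])
      show "connected ?S" "connected ?T" using path_initial_segment(1)[of g d] path_initial_segment(1)[of ?g d'] pg j j' by auto
      show "pathstart (ga j) \<in> closure ?S" "pathstart (ga j) \<in> closure ?T"
        using path_initial_segment(2)[of g d] path_initial_segment(2)[of ?g d'] pg j j' \<open>j = j'\<close> by auto
    qed (use j j' \<open>j = j'\<close> rays in auto)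
    then obtain s t where st: "0 < s" "s < d" "0 < t" "t < d'" "g s = g (1 - t)" by (auto simp: reversepath_def)
    then have "s = 1 - t" using j(2) j'(2) by (intro simple_path_interior_inj[OF g(1)]) auto
    then show False using st j(2) j'(2) by auto
  qed
  have sub: "ray (ga i) \<subseteq> e" if "i \<in> J" "ray (ga i) \<inter> e ~= {}" for i
    using rays[OF that(1)] connected_ray that(2) by (intro component_eqI[OF e(1)]) auto
  have "ray (ga j) \<subseteq> e" "ray (ga j') \<subseteq> e"
  proof -
    have "g (d / 2) \<in> ray (ga j)" by (rule subsetD[OF j(5)]) (use j(1) in simp)
    moreover have "?g (d' / 2) \<in> ray (ga j')" by (rule subsetD[OF j'(5)]) (use j'(1) in simp)
    moreover have "g (d / 2) \<in> e" "?g (d' / 2) \<in> e"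
      using in_e[of "d / 2"] in_e[of "1 - d' / 2"] j(1,2) j'(1,2) by (simp_all add: reversepath_def)
    ultimately show "ray (ga j) \<subseteq> e" "ray (ga j') \<subseteq> e"
      using sub[OF j(3)] sub[OF j'(3)] by (metis disjoint_iff)+
  qed
  moreover have "i = j \<or> i = j'" if i: "i \<in> J" "ray (ga i) \<subseteq> e" for i
  proof -
    let ?w = "pathstart (ga i)"
    \<comment> \<open>Near the start of ray i the set ?C is absent. What is left of e there belongs
      to the two end segments of g, hence to the ray j or j' with the same start.\<close>
    let ?C = "g ` {d..1 - d'} \<union> (\<Union>k\<in>{k\<in>{j, j'}. ?w ~= pathstart (ga k)}. path_image (ga k))"
    have wW: "?w \<in> W" using rays[OF i(1)] by auto
    have "closed ?C"
    proof (intro closed_Un closed_UN)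
      show "closed (g ` {d..1 - d'})"
        using pg j(1) j'(1) by (intro compact_imp_closed compact_continuous_image) (auto simp: path_def intro: continuous_on_subset)
      show "\<forall>k\<in>{k\<in>{j, j'}. ?w ~= pathstart (ga k)}. closed (path_image (ga k))"
        using rays j(3) j'(3) by (auto simp: arc_def intro!: closed_path_image)
    qed auto
    moreover have "?w ~: ?C"
    proof -
      have "?w ~: g ` {d..1 - d'}"
      proof
        assume "?w \<in> g ` {d..1 - d'}"
        then obtain t where t: "t \<in> {d..1 - d'}" "?w = g t" by blast
        then have "g t \<in> e" using j(1) j'(1) by (intro in_e) auto
        then show False using eX wW t(2) by auto
      qed
      moreover have "?w ~: path_image (ga k)" if "k \<in> J" "?w ~= pathstart (ga k)" for k
        using rays[OF that(1)] that(2) wW by (auto simp: ray_def)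
      ultimately show ?thesis using j(3) j'(3) by auto
    qed
    ultimately obtain eps where eps: "eps > 0" "ball ?w eps \<inter> ?C = {}" by (rule closed_avoiding_ball)
    obtain x where x: "x \<in> ray (ga i)" "dist x ?w < eps"
      using ray_closure[of "ga i"] rays[OF i(1)] eps(1) by (auto simp: closure_approachable)
    then have xb: "x \<in> ball ?w eps" by (simp add: dist_commute)
    have xC: "x ~: ?C" using eps(2) xb by blast
    have xe: "x \<in> e" using x(1) i(2) by blast
    have "x \<in> path_image g" "x ~= g 0" "x ~= g 1" using xe unfolding g(4) by (auto simp: pathstart_def pathfinish_def)
    then obtain t where t: "t \<in> {0..1}" "x = g t" "t ~= 0" "t ~= 1"
      unfolding path_image_def by (metis imageE)
    then have "t < d \<or> t > 1 - d'" using xC by force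
    then have "x \<in> ray (ga j) \<or> x \<in> ray (ga j')"
    proof
      assume "t < d" then show ?thesis using j(5) t by auto
    next
      assume "t > 1 - d'"
      then have "x = ?g (1 - t)" "1 - t \<in> {0<..<d'}" using t by (auto simp: reversepath_def)
      then show ?thesis using j'(5) by blast
    qed
    then obtain k where k: "k \<in> {j, j'}" "x \<in> ray (ga k)" by auto
    then have "?w = pathstart (ga k)" using xC by (auto simp: ray_def)
    then have "i = k" using disj[of i k] x(1) k j(3) j'(3) i(1) by auto
    then show ?thesis using k(1) by auto
  qed
  ultimately have "{j\<in>J. ray (ga j) \<subseteq> e} = {j, j'}" using j(3) j'(3) by auto
  then show ?thesis using neq by simp
qed

text \<open>A closed edge would contain the limit of the ray at its start, which is a
  vertex.\<close>

lemma no_rays_closed_edge: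
  assumes "closed_edge e" "e \<subseteq> X - W" "arc ga" "pathstart ga \<in> W"
  shows "\<not> ray ga \<subseteq> e"
proof
  assume "ray ga \<subseteq> e"
  then have "closure (ray ga) \<subseteq> e" using closed_edge_closed[OF assms(1)] by (simp add: closure_minimal)
  then show False using ray_closure[OF assms(3)] assms(2,4) by auto
qed


section \<open>Adding vertices to a curve\<close>

text \<open>The rays are the two directions of g away from g t. They stop at u and v, strictly
  inside the parameter interval, so they are arcs even if g is a closed path.\<close>

lemma rays_at_interior:
  assumes g: "simple_path g" and t: "0 < t" "t < 1" and sub: "g ` {0<..<1} \<subseteq> Y"
    and near: "eps0 > 0" "X \<inter> ball (g t) eps0 \<subseteq> path_image g"
  shows "\<exists>ga1 ga2 eps. arc ga1 \<and> arc ga2 \<and> pathstart ga1 = g t \<and> pathstart ga2 = g t \<and> ray ga1 \<subseteq> Y - {g t} \<and> ray ga2 \<subseteq> Y - {g t}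
    \<and> ray ga1 \<inter> ray ga2 = {} \<and> eps > 0 \<and> X \<inter> ball (g t) eps \<subseteq> insert (g t) (ray ga1 \<union> ray ga2)"
proof -
  note inj = simple_path_interior_inj[OF g]
  define u where "u = t / 2"
  define v where "v = (t + 1) / 2"
  have uv: "0 < u" "u < t" "t < v" "v < 1" using t by (auto simp: u_def v_def)
  let ?ga1 = "subpath t u g" and ?ga2 = "subpath t v g"
  have a: "arc ?ga1" "arc ?ga2"
    using inj[of t u] inj[of t v] uv by (auto intro!: arc_simple_path_subpath g)
  have r: "ray ?ga1 = g ` {u..<t}" "ray ?ga2 = g ` {t<..v}"
  proof -
    have "{u..t} = insert t {u..<t}" "{t..v} = insert t {t<..v}" using uv by auto
    moreover have "g x ~= g t" if "x \<in> {u..<t} \<union> {t<..v}" for x using inj[of x t] that uv by auto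
    then have "g t ~: g ` {u..<t}" "g t ~: g ` {t<..v}" by (intro not_in_imageI; simp)+
    ultimately show "ray ?ga1 = g ` {u..<t}" "ray ?ga2 = g ` {t<..v}"
      using uv by (simp_all add: ray_def path_image_subpath)
  qed
  have disj: "ray ?ga1 \<inter> ray ?ga2 = {}"
  proof -
    have "g x ~= g y" if "x \<in> {u..<t}" "y \<in> {t<..v}" for x y using inj[of x y] that uv by auto
    then show ?thesis unfolding r by (rule image_disjointI)
  qed
  let ?C = "g ` {0..u} \<union> g ` {v..1}"
  have "closed ?C"
  proof -
    have c: "continuous_on {0..1} g" using simple_path_imp_path[OF g] by (simp add: path_def)
    have "continuous_on {0..u} g" "continuous_on {v..1} g" using uv by (auto intro!: continuous_on_subset[OF c])
    then show ?thesis by (intro closed_Un compact_imp_closed compact_continuous_image) auto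
  qed
  moreover have "g t ~: ?C"
  proof -
    have lf: "x = y \<or> x = 0 \<and> y = 1 \<or> x = 1 \<and> y = 0" if "g x = g y" "x \<in> {0..1}" "y \<in> {0..1}" for x y
      using g that by (simp add: simple_path_def loop_free_def)
    have "g x ~= g t" if "x \<in> {0..u} \<union> {v..1}" for x using lf[of x t] that uv by auto
    then show ?thesis unfolding image_Un[symmetric] by (rule not_in_imageI)
  qed
  ultimately obtain eps where eps: "eps > 0" "ball (g t) eps \<inter> ?C = {}" by (rule closed_avoiding_ball)
  have "X \<inter> ball (g t) (min eps eps0) \<subseteq> insert (g t) (ray ?ga1 \<union> ray ?ga2)"
  proof
    fix x assume x: "x \<in> X \<inter> ball (g t) (min eps eps0)"
    then have "x \<in> X \<inter> ball (g t) eps0" "x \<in> ball (g t) eps" by simp_all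
    then have "x \<in> path_image g" "x ~: ?C" using subsetD[OF near(2)] eps(2) by blast+
    obtain y where y: "x = g y" "y \<in> {0..1}" using \<open>x \<in> path_image g\<close> unfolding path_image_def by (rule imageE)
    moreover have "y ~: {0..u}" "y ~: {v..1}" using \<open>x ~: ?C\<close> y(1) by auto
    ultimately have "y = t \<or> y \<in> {u..<t} \<or> y \<in> {t<..v}" by auto
    then show "x \<in> insert (g t) (ray ?ga1 \<union> ray ?ga2)" unfolding r y(1) by blast
  qed
  moreover have "ray ?ga1 \<subseteq> Y" "ray ?ga2 \<subseteq> Y"
    unfolding r by (rule order_trans[OF image_mono sub]; use uv in auto)+
  moreover have "g t ~: ray ?ga1" "g t ~: ray ?ga2" by (simp_all add: ray_def)
  ultimately show ?thesis using a disj eps(1) near(1)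
    by (intro exI[of _ ?ga1] exI[of _ ?ga2] exI[of _ "min eps eps0"]) auto
qed

lemma arc_edge_mono: "arc_edge W e ==> W \<subseteq> W' ==> arc_edge W' e"
  unfolding arc_edge_def by blast

text \<open>Only the edge through b is affected. Each new piece is closed up to vertices, so the new
  family is a finite partition into connected relatively closed sets.\<close>

lemma components_replace:
  assumes fin: "finite (components (X - W))" and e: "e \<in> components (X - W)" "b \<in> e"
    and E: "finite E" "\<Union>E = e - {b}" "\<And>P. P \<in> E ==> P ~= {} \<and> connected P"
    and cl: "\<And>P. P \<in> E ==> \<exists>K. closed K \<and> P \<subseteq> K \<and> K \<subseteq> P \<union> insert b W"
    and disj: "\<And>P Q. P \<in> E ==> Q \<in> E ==> P ~= Q ==> P \<inter> Q = {}"
  shows "components (X - insert b W) = components (X - W) - {e} \<union> E"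
proof (rule components_eqI)
  let ?C = "components (X - W)"
  have dj: "c \<inter> d = {}" if "c \<in> ?C" "d \<in> ?C" "c ~= d" for c d
    using components_nonoverlap[OF that(1,2)] that(3) by simp
  have eX: "e \<subseteq> X - W" by (rule in_components_subset[OF e(1)])
  have sub: "d \<subseteq> X - insert b W" if "d \<in> ?C - {e}" for d
    using in_components_subset[of d "X - W"] dj[of d e] that e by blast
  have subE: "P \<subseteq> X - insert b W" if "P \<in> E" for P using that E(2) eX by blast
  show "X - insert b W = \<Union>(?C - {e} \<union> E)"
  proof
    show "X - insert b W \<subseteq> \<Union>(?C - {e} \<union> E)"
    proof
      fix x assume x: "x \<in> X - insert b W"
      then have "x \<in> \<Union>?C" by simp
      then obtain d where d: "d \<in> ?C" "x \<in> d" by blast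
      show "x \<in> \<Union>(?C - {e} \<union> E)"
      proof (cases "d = e")
        case True
        then have "x \<in> \<Union>E" unfolding E(2) using d x by simp
        then show ?thesis by blast
      qed (use d in blast)
    qed
    show "\<Union>(?C - {e} \<union> E) \<subseteq> X - insert b W" using sub subE by blast
  qed
  show "finite (?C - {e} \<union> E)" using fin E(1) by simp
  fix P assume P: "P \<in> ?C - {e} \<union> E"
  show "P ~= {} \<and> connected P"
    using P E(3) in_components_nonempty[of P "X - W"] in_components_connected[of P "X - W"] by blast
  show "closedin (top_of_set (X - insert b W)) P"
  proof (cases "P \<in> E")
    case True
    then obtain K where K: "closed K" "P \<subseteq> K" "K \<subseteq> P \<union> insert b W" using cl by blast
    show ?thesis by (rule closedin_closure_subset[OF subE[OF True] K(1) _ K(2)]) (use K(3) in auto)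
  next
    case False
    then have P': "P \<in> ?C - {e}" using P by simp
    then have "closedin (top_of_set (X - W)) P" by (simp add: closedin_component)
    then show ?thesis by (rule closedin_subset_trans) (use sub[OF P'] in auto)
  qed
  fix Q assume Q: "Q \<in> ?C - {e} \<union> E" "P ~= Q"
  have de: "d \<inter> R = {}" if "d \<in> ?C - {e}" "R \<in> E" for d R using dj[of d e] that e(1) E(2) by blast
  show "P \<inter> Q = {}"
    using P Q dj[of P Q] de[of P Q] de[of Q P] disj[of P Q] by (auto simp: Int_commute)
qed

lemma arc_graph_insert:
  assumes G: "arc_graph X W" and b: "b \<in> X - W"
  shows "arc_graph X (insert b W)"
    and "\<exists>ga1 ga2 eps. arc ga1 \<and> arc ga2 \<and> pathstart ga1 = b \<and> pathstart ga2 = b \<and> ray ga1 \<subseteq> X - insert b W \<and> ray ga2 \<subseteq> X - insert b W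
      \<and> ray ga1 \<inter> ray ga2 = {} \<and> eps > 0 \<and> X \<inter> ball b eps \<subseteq> insert b (ray ga1 \<union> ray ga2)"
proof -
  let ?C = "components (X - W)"
  have "b \<in> \<Union>?C" using b by simp
  then obtain e where e: "e \<in> ?C" "b \<in> e" by blast
  have eX: "e \<subseteq> X - W" by (rule in_components_subset[OF e(1)])
  have fin: "finite ?C" "finite W" "W \<subseteq> X" using G by (auto simp: arc_graph_def)
  obtain eps0 where eps0: "eps0 > 0" "X \<inter> ball b eps0 \<subseteq> e" using arc_graph_edge_neighbourhood[OF G e] by blast
  have old: "arc_edge (insert b W) d \<or> closed_edge d" if "d \<in> ?C" for d
    using G that arc_edge_mono[of W d "insert b W"] by (auto simp: arc_graph_def)
  have Y: "X - W - {b} = X - insert b W" by auto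
  have graphI: "arc_graph X (insert b W)" if "components (X - insert b W) = ?C - {e} \<union> E" "finite E" "\<forall>P\<in>E. arc_edge (insert b W) P" for E
    using fin b old that unfolding arc_graph_def by auto
  have "arc_graph X (insert b W) \<and> (\<exists>ga1 ga2 eps. arc ga1 \<and> arc ga2 \<and> pathstart ga1 = b \<and> pathstart ga2 = b \<and> ray ga1 \<subseteq> X - insert b W \<and> ray ga2 \<subseteq> X - insert b W
      \<and> ray ga1 \<inter> ray ga2 = {} \<and> eps > 0 \<and> X \<inter> ball b eps \<subseteq> insert b (ray ga1 \<union> ray ga2))"
  proof (cases "arc_edge W e")
    case True
    then obtain g where g: "simple_path g" "pathstart g \<in> W" "pathfinish g \<in> W" "e = path_image g - {pathstart g, pathfinish g}"
      unfolding arc_edge_def by (elim exE conjE) (rule that)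
    have lf: "x = y \<or> x = 0 \<and> y = 1 \<or> x = 1 \<and> y = 0" if "g x = g y" "x \<in> {0..1}" "y \<in> {0..1}" for x y
      using g(1) that by (simp add: simple_path_def loop_free_def)
    have interior: "e = g ` {0<..<1}"
    proof
      show "e \<subseteq> g ` {0<..<1}"
      proof
        fix x assume "x \<in> e"
        then have "x \<in> path_image g" "x ~= g 0" "x ~= g 1" unfolding g(4) by (auto simp: pathstart_def pathfinish_def)
        then obtain y where "y \<in> {0..1}" "x = g y" "y ~= 0" "y ~= 1" unfolding path_image_def by (metis imageE)
        then show "x \<in> g ` {0<..<1}" by auto
      qed
      show "g ` {0<..<1} \<subseteq> e"
        unfolding g(4) path_image_def pathstart_def pathfinish_def using lf[of _ 0] lf[of _ 1] by fastforce
    qed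
    obtain t where t: "0 < t" "t < 1" "b = g t" using e(2) unfolding interior by auto
    define P where "P = g ` {0<..<t}"
    define Q where "Q = g ` {t<..<1}"
    have c: "continuous_on {0..1} g" using simple_path_imp_path[OF g(1)] by (simp add: path_def)
    have sp: "simple_path (subpath 0 t g)" "simple_path (subpath t 1 g)"
      using t by (auto intro!: simple_path_subpath g(1))
    have P': "P = path_image (subpath 0 t g) - {g 0, g t}" and Q': "Q = path_image (subpath t 1 g) - {g t, g 1}"
    proof -
      have "g x ~= g 0" "g x ~= g t" if "0 < x" "x < t" for x using lf[of x 0] lf[of x t] that t by auto
      moreover have "{0..t} = insert 0 (insert t {0<..<t})" using t by auto
      ultimately show "P = path_image (subpath 0 t g) - {g 0, g t}" using t by (auto simp: P_def path_image_subpath)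
      have "g x ~= g 1" "g x ~= g t" if "t < x" "x < 1" for x using lf[of x 1] lf[of x t] that t by auto
      moreover have "{t..1} = insert 1 (insert t {t<..<1})" using t by auto
      ultimately show "Q = path_image (subpath t 1 g) - {g t, g 1}" using t by (auto simp: Q_def path_image_subpath)
    qed
    have W: "g 0 \<in> insert b W" "g 1 \<in> insert b W" "g t \<in> insert b W"
      using g(2,3) t by (auto simp: pathstart_def pathfinish_def)
    have arcs: "arc_edge (insert b W) P" "arc_edge (insert b W) Q"
    proof -
      show "arc_edge (insert b W) P" unfolding arc_edge_def
        by (rule exI[of _ "subpath 0 t g"]) (use sp W P' in simp)
      show "arc_edge (insert b W) Q" unfolding arc_edge_def
        by (rule exI[of _ "subpath t 1 g"]) (use sp W Q' in simp)
    qed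
    have PQ: "P \<inter> Q = {}"
    proof -
      have "g x ~= g y" if "0 < x" "x < t" "t < y" "y < 1" for x y using lf[of x y] that by auto
      then show ?thesis unfolding P_def Q_def by (intro image_disjointI) simp
    qed
    have "components (X - insert b W) = ?C - {e} \<union> {P, Q}"
    proof (rule components_replace[OF fin(1) e])
      have I: "{0<..<1} = insert t ({0<..<t} \<union> {t<..<1})" using t by auto
      have "g x ~= g t" if "x \<in> {0<..<t} \<union> {t<..<1}" for x using lf[of x t] that t by auto
      then have "g t ~: g ` ({0<..<t} \<union> {t<..<1})" by (rule not_in_imageI)
      moreover have "e = insert (g t) (g ` ({0<..<t} \<union> {t<..<1}))" unfolding interior I by (rule image_insert)
      ultimately show "\<Union>{P, Q} = e - {b}" unfolding P_def Q_def t(3) by (simp add: image_Un)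
      have "continuous_on {0<..<t} g" "continuous_on {t<..<1} g" using t by (auto intro!: continuous_on_subset[OF c])
      then show "R ~= {} \<and> connected R" if "R \<in> {P, Q}" for R
        using that t by (auto simp: P_def Q_def intro!: connected_continuous_image)
      show "\<exists>K. closed K \<and> R \<subseteq> K \<and> K \<subseteq> R \<union> insert b W" if "R \<in> {P, Q}" for R
        using that arcs arc_edge_closed by blast
      show "R \<inter> S = {}" if "R \<in> {P, Q}" "S \<in> {P, Q}" "R ~= S" for R S using that PQ by auto
    qed simp
    then have "arc_graph X (insert b W)" by (rule graphI) (use arcs in auto)
    moreover have "X \<inter> ball (g t) eps0 \<subseteq> path_image g" using eps0(2) unfolding t(3) g(4) by blast
    ultimately show ?thesis
      using rays_at_interior[OF g(1) t(1,2) _ eps0(1), of "X - W" X] eX unfolding interior t(3)[symmetric] Y by simp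
  next
    case False
    then have "closed_edge e" using G e(1) by (auto simp: arc_graph_def)
    then obtain g0 where g0: "simple_path g0" "pathfinish g0 = pathstart g0" "e = path_image g0"
      unfolding closed_edge_def by (elim exE conjE) (rule that)
    \<comment> \<open>A closed edge is reparametrized to start at b; deleting b leaves a single arc
      edge with both ends at b.\<close>
    obtain t0 where t0: "t0 \<in> {0..1}" "b = g0 t0" using e(2) unfolding g0(3) path_image_def by blast
    define g where "g = shiftpath t0 g0"
    have g: "simple_path g" "pathfinish g = pathstart g" "e = path_image g"
      using g0 t0 by (auto simp: g_def simple_path_shiftpath path_image_shiftpath endpoints_shiftpath)
    have gb: "g 0 = b" using t0 by (simp add: g_def shiftpath_def)
    then have gb1: "g 1 = b" using g(2) by (simp add: pathstart_def pathfinish_def)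
    have lf: "x = y \<or> x = 0 \<and> y = 1 \<or> x = 1 \<and> y = 0" if "g x = g y" "x \<in> {0..1}" "y \<in> {0..1}" for x y
      using g(1) that by (simp add: simple_path_def loop_free_def)
    have interior: "e - {b} = g ` {0<..<1}"
    proof
      show "e - {b} \<subseteq> g ` {0<..<1}"
      proof
        fix x assume "x \<in> e - {b}"
        then have "x \<in> path_image g" "x ~= g 0" "x ~= g 1" unfolding g(3) using gb gb1 by auto
        then obtain y where "y \<in> {0..1}" "x = g y" "y ~= 0" "y ~= 1" unfolding path_image_def by (metis imageE)
        then show "x \<in> g ` {0<..<1}" by auto
      qed
      show "g ` {0<..<1} \<subseteq> e - {b}"
        unfolding g(3) path_image_def using lf[of _ 0] gb by fastforce
    qed
    have c: "continuous_on {0..1} g" using simple_path_imp_path[OF g(1)] by (simp add: path_def)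
    have arc: "arc_edge (insert b W) (e - {b})"
      unfolding arc_edge_def using g gb gb1 by (intro exI[of _ g]) (auto simp: pathstart_def pathfinish_def)
    have "components (X - insert b W) = ?C - {e} \<union> {e - {b}}"
    proof (rule components_replace[OF fin(1) e])
      have "continuous_on {0<..<1} g" by (auto intro!: continuous_on_subset[OF c])
      then show "R ~= {} \<and> connected R" if "R \<in> {e - {b}}" for R
        using that unfolding interior by (auto intro!: connected_continuous_image)
      show "\<exists>K. closed K \<and> R \<subseteq> K \<and> K \<subseteq> R \<union> insert b W" if "R \<in> {e - {b}}" for R
        using that arc arc_edge_closed by blast
    qed auto
    then have "arc_graph X (insert b W)" by (rule graphI) (use arc in auto)
    moreover
    \<comment> \<open>The shift by half a period moves b to the interior parameter 1/2, as
      \<open>rays_at_interior\<close> requires.\<close>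
    let ?h = "shiftpath (1/2) g"
    have h: "simple_path ?h" "path_image ?h = e" "?h (1/2) = b"
      using g gb1 by (auto simp: simple_path_shiftpath path_image_shiftpath) (simp add: shiftpath_def)
    have "?h ` {0<..<1} \<subseteq> path_image ?h" by (auto simp: path_image_def)
    then have "?h ` {0<..<1} \<subseteq> X - W" using h(2) eX by blast
    then have "\<exists>ga1 ga2 eps. arc ga1 \<and> arc ga2 \<and> pathstart ga1 = b \<and> pathstart ga2 = b \<and> ray ga1 \<subseteq> X - W - {b} \<and> ray ga2 \<subseteq> X - W - {b}
      \<and> ray ga1 \<inter> ray ga2 = {} \<and> eps > 0 \<and> X \<inter> ball b eps \<subseteq> insert b (ray ga1 \<union> ray ga2)"
      using rays_at_interior[OF h(1), of "1/2" "X - W" eps0 X] eps0 h(2,3) by simp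
    ultimately show ?thesis unfolding Y by simp
  qed
  then show "arc_graph X (insert b W)"
    and "\<exists>ga1 ga2 eps. arc ga1 \<and> arc ga2 \<and> pathstart ga1 = b \<and> pathstart ga2 = b \<and> ray ga1 \<subseteq> X - insert b W \<and> ray ga2 \<subseteq> X - insert b W
      \<and> ray ga1 \<inter> ray ga2 = {} \<and> eps > 0 \<and> X \<inter> ball b eps \<subseteq> insert b (ray ga1 \<union> ray ga2)"
    by simp_all
qed

lemma arc_graph_Un:
  assumes "arc_graph X W" "finite B" "B \<subseteq> X" shows "arc_graph X (W \<union> B)"
  using assms(2,3,1)
proof (induction B rule: finite_induct)
  case (insert b B)
  then show ?case using arc_graph_insert(1)[of X "W \<union> B" b] by (cases "b \<in> W \<union> B") (auto simp: insert_absorb)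
qed simp

section \<open>Subdivided diagrams\<close>

text \<open>Cut points are entered as crossings so that \<open>edges\<close> and
  \<open>edge_at\<close> see the cut curve and charts at the crossings have to avoid the cut points.
  No symbol is formed for them.\<close>

definition subdiv :: "shaded_diagram => complex set => shaded_diagram" where
  "subdiv D B = D\<lparr>crossings := crossings D \<union> B\<rparr>"

lemma subdiv_simps [simp]:
  "curve (subdiv D B) = curve D" "crossings (subdiv D B) = crossings D \<union> B"
  "overpass (subdiv D B) = overpass D" "shaded (subdiv D B) = shaded D" "faces (subdiv D B) = faces D"
  by (simp_all add: subdiv_def faces_def)

lemma checkerboard_subdiv:
  assumes "checkerboard D" shows "checkerboard (subdiv D B)"
  unfolding checkerboard_def
proof (intro conjI ballI)
  show "shaded (subdiv D B) \<inter> curve (subdiv D B) = {}" using assms by (simp add: checkerboard_def)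
  show "F \<subseteq> shaded (subdiv D B) \<or> F \<inter> shaded (subdiv D B) = {}" if "F \<in> faces (subdiv D B)" for F
    using assms that by (simp add: checkerboard_def)
  fix e assume "e \<in> edges (subdiv D B)"
  then have e: "e \<in> components (curve D - (crossings D \<union> B))" by (simp add: edges_def)
  have "e ~= {}" "connected e" "e \<subseteq> curve D - crossings D"
    using in_components_nonempty[OF e] in_components_connected[OF e] in_components_subset[OF e] by auto
  then obtain d where d: "d \<in> components (curve D - crossings D)" "e \<subseteq> d"
    using exists_component_superset[of e "curve D - crossings D"] by auto
  have "\<forall>e\<in>edges D. \<exists>F\<in>faces D. \<exists>G\<in>faces D. F \<subseteq> shaded D \<and> G \<inter> shaded D = {} \<and> e \<subseteq> frontier F \<and> e \<subseteq> frontier G"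
    using assms by (simp add: checkerboard_def)
  from bspec[OF this, of d] obtain F G where
    "F \<in> faces D" "G \<in> faces D" "F \<subseteq> shaded D" "G \<inter> shaded D = {}" "d \<subseteq> frontier F" "d \<subseteq> frontier G"
    using d(1) by (auto simp: edges_def)
  then show "\<exists>F\<in>faces (subdiv D B). \<exists>G\<in>faces (subdiv D B). F \<subseteq> shaded (subdiv D B) \<and> G \<inter> shaded (subdiv D B) = {} \<and> e \<subseteq> frontier F \<and> e \<subseteq> frontier G"
    using order_trans[OF d(2)] by (intro bexI[of _ F] bexI[of _ G]) simp_all
qed

lemma crossing_chart_subdivD:
  assumes "crossing_chart (subdiv D B) v h" "v \<in> crossings D"
  shows "crossing_chart D v h"
proof -
  have h: "planar_map h" "h v = 0" using assms(1) by (auto simp: crossing_chart_def)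
  have "h ` crossings D \<inter> ball 0 1 \<subseteq> {0}" using assms(1) by (auto simp: crossing_chart_def)
  moreover have "0 \<in> h ` crossings D" using h(2) assms(2) by (metis imageI)
  ultimately show ?thesis using assms(1) by (auto simp: crossing_chart_def)
qed

text \<open>Sends a piece of a subdivided edge to the whole edge. For a connected piece inside Y the
  chosen point is immaterial, by \<open>enclosing_eq\<close>.\<close>

definition enclosing :: "complex set => complex set => complex set" where
  "enclosing Y e = connected_component_set Y (SOME x. x \<in> e)"

lemma enclosing_eq:
  assumes "connected e" "e \<subseteq> Y" "x \<in> e"
  shows "enclosing Y e = connected_component_set Y x"
  unfolding enclosing_def by (rule connected_component_set_eqI[OF assms(1,2) someI[of "\<lambda>x. x \<in> e"] assms(3)]) (rule assms(3))

lemma edge_at_in: "x \<in> curve D - crossings D ==> x \<in> edge_at D x"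
  by (simp add: edge_at_def)

lemma edge_at_component: "x \<in> curve D - crossings D ==> edge_at D x \<in> components (curve D - crossings D)"
  unfolding edge_at_def components_def by blast

lemma edge_at_subdiv:
  assumes "x \<in> curve D - crossings D - B"
  shows "edge_at D x = enclosing (curve D - crossings D) (edge_at (subdiv D B) x)"
  unfolding edge_at_def subdiv_simps
  by (rule enclosing_eq[symmetric]) (use connected_component_subset[of "curve D - (crossings D \<union> B)" x] assms in auto)

lemma arc_edge_not_closed_edge:
  assumes "arc_edge W e" "e \<inter> W = {}" shows "\<not> closed_edge e"
proof
  assume c: "closed_edge e"
  obtain g where g: "simple_path g" "pathstart g \<in> W" "e = path_image g - {pathstart g, pathfinish g}"
    using assms(1) unfolding arc_edge_def by (elim exE conjE) (rule that)
  have lf: "x = y \<or> x = 0 \<and> y = 1 \<or> x = 1 \<and> y = 0" if "g x = g y" "x \<in> {0..1}" "y \<in> {0..1}" for x y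
    using g(1) that by (simp add: simple_path_def loop_free_def)
  have "g ` {0<..<1} \<subseteq> e"
  proof
    fix y assume "y \<in> g ` {0<..<1}"
    then obtain x where x: "0 < x" "x < 1" "y = g x" by auto
    then show "y \<in> e" unfolding g(3) using lf[of x 0] lf[of x 1] by (auto simp: path_image_def pathstart_def pathfinish_def)
  qed
  then have "closure (g ` {0<..<1}) \<subseteq> e" using closed_edge_closed[OF c] by (rule closure_minimal)
  moreover have "pathstart g \<in> closure (g ` {0<..<1})"
    by (rule path_initial_segment(2)) (use simple_path_imp_path[OF g(1)] in auto)
  ultimately show False using g(2) assms(2) by blast
qed

text \<open>A component without vertices cannot be an open arc, since it would contain the end
  points too. Conversely, a closed edge is both open and closed in the curve.\<close>

lemma crossingless_components_eq:
  assumes "arc_graph X V"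
  shows "{C \<in> components X. C \<inter> V = {}} = {e \<in> components (X - V). \<not> arc_edge V e}"
proof (intro equalityI subsetI)
  fix C assume "C \<in> {C \<in> components X. C \<inter> V = {}}"
  then have C: "C \<in> components X" "C \<inter> V = {}" by auto
  have sub: "C \<subseteq> X - V" using in_components_subset[OF C(1)] C(2) by blast
  have "C \<in> components (X - V)"
    unfolding in_components_maximal
  proof (intro conjI allI impI)
    fix E assume E: "E ~= {} \<and> C \<subseteq> E \<and> E \<subseteq> X - V \<and> connected E"
    have "E \<inter> C ~= {}" using E in_components_nonempty[OF C(1)] by blast
    then have "E \<subseteq> C" using E by (intro component_eqI[OF C(1)]) auto
    then show "E = C" using E by blast
  qed (use in_components_nonempty[OF C(1)] in_components_connected[OF C(1)] sub in auto)
  moreover have "\<not> arc_edge V C"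
  proof
    assume a: "arc_edge V C"
    obtain g where g: "simple_path g" "pathstart g \<in> V" "C = path_image g - {pathstart g, pathfinish g}" "pathfinish g \<in> V"
      using a unfolding arc_edge_def by (elim exE conjE) (rule that)
    have "path_image g \<subseteq> X" using g sub assms by (auto simp: arc_graph_def)
    moreover have "connected (path_image g)" using simple_path_imp_path[OF g(1)] by (rule connected_path_image)
    moreover have "path_image g \<inter> C ~= {}" using in_components_nonempty[OF C(1)] g(3) by blast
    ultimately have "path_image g \<subseteq> C" by (intro component_eqI[OF C(1)]) auto
    then show False using pathstart_in_path_image[of g] g(3) by blast
  qed
  ultimately show "C \<in> {e \<in> components (X - V). \<not> arc_edge V e}" by simp
next
  fix e assume "e \<in> {e \<in> components (X - V). \<not> arc_edge V e}"
  then have e: "e \<in> components (X - V)" "closed_edge e" using assms by (auto simp: arc_graph_def)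
  have sub: "e \<subseteq> X - V" by (rule in_components_subset[OF e(1)])
  have "e \<in> components X"
    unfolding in_components_maximal
  proof (intro conjI allI impI)
    fix E assume E: "E ~= {} \<and> e \<subseteq> E \<and> E \<subseteq> X \<and> connected E"
    have "\<forall>p\<in>e. \<exists>eps>0. X \<inter> ball p eps \<subseteq> e" using arc_graph_edge_neighbourhood[OF assms e(1)] by simp
    then obtain eps where eps: "\<And>p. p \<in> e ==> eps p > 0 \<and> X \<inter> ball p (eps p) \<subseteq> e" by metis
    \<comment> \<open>U is open and meets the curve exactly in e, which is also closed. A connected
      part of the curve that contains e cannot leave it.\<close>
    define U where "U = (\<Union>p\<in>e. ball p (eps p))"
    have "open U" by (auto simp: U_def)
    have "X \<inter> U \<subseteq> e" using eps by (auto simp: U_def)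
    moreover have "e \<subseteq> U" using eps by (force simp: U_def)
    ultimately have U: "X \<inter> U = e" using sub by auto
    have "U \<inter> E = {} \<or> (- e) \<inter> E = {}"
    proof (rule connectedD)
      show "open (- e)" using closed_edge_closed[OF e(2)] by (simp add: open_Compl)
      show "U \<inter> (- e) \<inter> E = {}" using U E by auto
      show "E \<subseteq> U \<union> - e" using U by auto
    qed (use E \<open>open U\<close> in auto)
    moreover have "U \<inter> E ~= {}" using \<open>e \<subseteq> U\<close> E in_components_nonempty[OF e(1)] by auto
    ultimately show "E = e" using E by auto
  qed (use in_components_nonempty[OF e(1)] in_components_connected[OF e(1)] sub in auto)
  then show "e \<in> {C \<in> components X. C \<inter> V = {}}" using sub by blast
qed

section \<open>Edge-ends and their count\<close>

definition chart_ray :: "(complex => complex) => complex => real => complex" where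
  "chart_ray h u = inv h \<circ> linepath 0 (u / 2)"

lemma chart_ray:
  assumes c: "crossing_chart D v h" and u: "u \<in> axis_units"
  shows "arc (chart_ray h u)" "pathstart (chart_ray h u) = v" "pathfinish (chart_ray h u) = inv h (u / 2)"
    "ray (chart_ray h u) = inv h ` ((\<lambda>t. of_real t * u) ` {0<..1/2})" "ray (chart_ray h u) \<subseteq> curve D - crossings D"
proof -
  have h: "planar_map h" "h v = 0" using c by (auto simp: crossing_chart_def)
  have u0: "u ~= 0" using u by (auto simp: axis_units_def)
  have i0: "inv h 0 = v" using planar_map_simps(1)[OF h(1), of v] h(2) by simp
  have "arc (linepath 0 (u / 2))" using u0 by (intro arc_linepath) simp
  then show a: "arc (chart_ray h u)"
    unfolding chart_ray_def arc_def using planar_map_simps(4,7)[OF h(1)]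
    by (auto intro!: path_continuous_image comp_inj_on intro: inj_on_subset)
  show "pathstart (chart_ray h u) = v" "pathfinish (chart_ray h u) = inv h (u / 2)"
    by (simp_all add: chart_ray_def pathstart_compose pathfinish_compose i0)
  have "linepath 0 (u / 2) ` {0<..1} = (\<lambda>t. of_real t * u) ` {0<..1/2}"
  proof (intro equalityI subsetI)
    fix z assume "z \<in> linepath 0 (u / 2) ` {0<..1}"
    then obtain t where "0 < t" "t \<le> 1" "z = linepath 0 (u / 2) t" by auto
    then show "z \<in> (\<lambda>t. of_real t * u) ` {0<..1/2}"
      by (intro image_eqI[of _ _ "t / 2"]) (auto simp: linepath_def scaleR_conv_of_real)
  next
    fix z assume "z \<in> (\<lambda>t. of_real t * u) ` {0<..1/2}"
    then obtain t where "0 < t" "t \<le> 1/2" "z = of_real t * u" by auto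
    then show "z \<in> linepath 0 (u / 2) ` {0<..1}"
      by (intro image_eqI[of _ _ "2 * t"]) (auto simp: linepath_def scaleR_conv_of_real)
  qed
  then show r: "ray (chart_ray h u) = inv h ` ((\<lambda>t. of_real t * u) ` {0<..1/2})"
    using ray_eq[OF a] by (simp only: chart_ray_def image_comp[symmetric])
  show "ray (chart_ray h u) \<subseteq> curve D - crossings D"
    unfolding r using chart_ray_edge(1)[OF c u] by auto
qed

lemma chart_rays_disjoint:
  assumes c: "crossing_chart D v h" and u: "u \<in> axis_units" "w \<in> axis_units" "u ~= w"
  shows "ray (chart_ray h u) \<inter> ray (chart_ray h w) = {}"
proof -
  have h: "planar_map h" using c by (simp add: crossing_chart_def)
  have "of_real s * u ~= of_real t * w" if "0 < s" "0 < t" for s t :: real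
    using that u by (auto simp: axis_units_def complex_eq_iff)
  then have "(\<lambda>t. of_real t * u) ` {0<..1/2} \<inter> (\<lambda>t. of_real t * w) ` {0<..1/2} = {}" by auto
  then show ?thesis
    unfolding chart_ray(4)[OF c u(1)] chart_ray(4)[OF c u(2)]
    using image_Int[OF planar_map_simps(7)[OF h], symmetric] by simp
qed

lemma chart_rays_cover:
  assumes c: "crossing_chart D v h"
  shows "\<exists>eps>0. curve D \<inter> ball v eps \<subseteq> insert v (\<Union>u\<in>axis_units. ray (chart_ray h u))"
proof -
  have h: "planar_map h" "h v = 0" using c by (auto simp: crossing_chart_def)
  have "isCont h v" using planar_map_simps(3)[OF h(1), of UNIV] by (simp add: continuous_on_eq_continuous_at)
  then obtain eps where eps: "eps > 0" "\<And>z. dist z v < eps ==> dist (h z) (h v) < 1/2"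
    unfolding continuous_at_eps_delta by (meson half_gt_zero zero_less_one)
  have "z \<in> insert v (\<Union>u\<in>axis_units. ray (chart_ray h u))" if z: "z \<in> curve D" "z \<in> ball v eps" for z
  proof -
    have n: "norm (h z) < 1/2" using eps(2)[of z] z(2) h(2) by (simp add: dist_commute)
    then have "Re (h z) = 0 \<or> Im (h z) = 0" using chart_mem(1)[OF c, of "h z"] z(1) planar_map_simps(1)[OF h(1)] by simp
    moreover have "\<bar>Re (h z)\<bar> < 1/2" "\<bar>Im (h z)\<bar> < 1/2"
      using n abs_Re_le_cmod[of "h z"] abs_Im_le_cmod[of "h z"] by auto
    ultimately consider "h z = 0" | t u where "u \<in> axis_units" "0 < t" "t \<le> 1/2" "h z = of_real t * u"
    proof -
      assume a1: "h z = 0 ==> thesis" and a2: "\<And>u t. u \<in> axis_units ==> 0 < t ==> t \<le> 1/2 ==> h z = of_real t * u ==> thesis"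
      assume "Re (h z) = 0 \<or> Im (h z) = 0" "\<bar>Re (h z)\<bar> < 1/2" "\<bar>Im (h z)\<bar> < 1/2"
      then show thesis
        using a1 a2[of 1 "Re (h z)"] a2[of "-1" "- Re (h z)"] a2[of "\<i>" "Im (h z)"] a2[of "- \<i>" "- Im (h z)"]
        by (cases "Re (h z)" "0 :: real" rule: linorder_cases; cases "Im (h z)" "0 :: real" rule: linorder_cases)
          (simp_all add: complex_eq_iff axis_units_def)
    qed
    then show ?thesis
    proof cases
      case 1
      then have "z = v" using h(2) injD[OF planar_map_simps(6)[OF h(1)], of z v] by simp
      then show ?thesis by simp
    next
      case (2 t u)
      have "z = inv h (of_real t * u)" using planar_map_simps(1)[OF h(1), of z] 2(4) by simp
      moreover have "of_real t * u \<in> (\<lambda>t. of_real t * u) ` {0<..1/2}" using 2(2,3) by (intro image_eqI[of _ _ t]) auto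
      ultimately have "z \<in> ray (chart_ray h u)" unfolding chart_ray(4)[OF c 2(1)] by (metis imageI)
      then show ?thesis using 2(1) by blast
    qed
  qed
  then have "curve D \<inter> ball v eps \<subseteq> insert v (\<Union>u\<in>axis_units. ray (chart_ray h u))"
    by (intro subsetI) (elim IntE)
  then show ?thesis using eps(1) by (intro exI[of _ eps] conjI)
qed

lemma finite_axis_units [simp]: "finite axis_units"
  by (simp add: axis_units_def)

text \<open>\<open>ga b True\<close> and \<open>ga b False\<close> leave the cut point b in its two
  directions and exhaust the curve near b; for cuts along a circle \<open>True\<close> will mean
  inside. The case of no cut points describes the diagram itself.\<close>

locale subdivision =
  fixes D :: shaded_diagram and B :: "complex set"
    and h :: "complex => complex => complex" and ga :: "complex => bool => real => complex"
  assumes D: "shaded_link_diagram D" and fin_B: "finite B" and B: "B \<subseteq> curve D - crossings D"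
    and chart: "\<And>v. v \<in> crossings D ==> crossing_chart (subdiv D B) v (h v)"
    and arc: "\<And>b i. b \<in> B ==> arc (ga b i) \<and> pathstart (ga b i) = b \<and> ray (ga b i) \<subseteq> curve D - (crossings D \<union> B)"
    and arc_disjoint: "\<And>b. b \<in> B ==> ray (ga b True) \<inter> ray (ga b False) = {}"
    and arc_cover: "\<And>b. b \<in> B ==> \<exists>eps>0. curve D \<inter> ball b eps \<subseteq> insert b (ray (ga b True) \<union> ray (ga b False))"
begin

abbreviation X where "X \<equiv> curve D"
abbreviation V where "V \<equiv> crossings D"

definition pieces :: "complex set set" where "pieces = components (X - (V \<union> B))"

definition arcs :: "complex set set" where "arcs = {e \<in> pieces. arc_edge (V \<union> B) e}"

definition side :: "complex => bool => complex set" where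
  "side b i = edge_at (subdiv D B) (pathfinish (ga b i))"

definition sym :: "complex => complex set crossing_symbol" where
  "sym v = chart_symbol (subdiv D B) (h v)"

lemma check: "checkerboard D" "checkerboard (subdiv D B)"
  using D checkerboard_subdiv by (auto simp: shaded_link_diagram_def)

lemma graph: "arc_graph X V" "arc_graph X (V \<union> B)" "finite V"
proof -
  show g: "arc_graph X V" using D by (auto simp: shaded_link_diagram_def intro: link_diagram_arc_graph)
  show "arc_graph X (V \<union> B)" using B by (intro arc_graph_Un g fin_B) auto
  show "finite V" using g by (simp add: arc_graph_def)
qed

lemma finite_pieces: "finite pieces"
  using graph(2) by (simp add: pieces_def arc_graph_def)

lemma piece: "e \<in> pieces ==> e ~= {} \<and> connected e \<and> e \<subseteq> X - (V \<union> B)"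
  unfolding pieces_def using in_components_nonempty in_components_connected in_components_subset by blast

text \<open>One index for all edge-ends allows double counting: \<open>card_ray_label\<close> counts
  them edge by edge, \<open>ends_total\<close> collects them vertex by vertex.\<close>

definition ray_index :: "((complex \<times> complex) + (complex \<times> bool)) set" where
  "ray_index = (V \<times> axis_units) <+> (B \<times> UNIV)"

fun ray_path :: "(complex \<times> complex) + (complex \<times> bool) => real => complex" where
  "ray_path (Inl (v, u)) = chart_ray (h v) u"
| "ray_path (Inr (b, i)) = ga b i"

definition ray_label :: "(complex \<times> complex) + (complex \<times> bool) => complex set" where
  "ray_label j = edge_at (subdiv D B) (pathfinish (ray_path j))"

lemma finite_ray_index: "finite ray_index"
  using graph(3) fin_B by (simp add: ray_index_def)

lemma ray_path:
  assumes "j \<in> ray_index"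
  shows "arc (ray_path j)" "pathstart (ray_path j) \<in> V \<union> B" "ray (ray_path j) \<subseteq> X - (V \<union> B)"
proof -
  have "arc (ray_path j) \<and> pathstart (ray_path j) \<in> V \<union> B \<and> ray (ray_path j) \<subseteq> X - (V \<union> B)"
  proof (cases j)
    case (Inl p)
    obtain v u where p: "p = (v, u)" by (cases p)
    have "v \<in> V" "u \<in> axis_units" using assms Inl p by (auto simp: ray_index_def)
    then show ?thesis using chart_ray[OF chart, of v u] Inl p by simp
  next
    case (Inr p)
    obtain b i where p: "p = (b, i)" by (cases p)
    have "b \<in> B" using assms Inr p by (auto simp: ray_index_def)
    then show ?thesis using arc[of b i] Inr p by simp
  qed
  then show "arc (ray_path j)" "pathstart (ray_path j) \<in> V \<union> B" "ray (ray_path j) \<subseteq> X - (V \<union> B)" by auto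
qed

lemma ray_label:
  assumes "j \<in> ray_index"
  shows "ray_label j \<in> pieces" "ray (ray_path j) \<subseteq> ray_label j" "e \<in> pieces ==> ray_label j = e \<longleftrightarrow> ray (ray_path j) \<subseteq> e"
proof -
  let ?x = "pathfinish (ray_path j)"
  have x: "?x \<in> ray (ray_path j)" "?x \<in> X - (V \<union> B)"
    using pathfinish_in_ray[OF ray_path(1)[OF assms]] ray_path(3)[OF assms] by auto
  show l: "ray_label j \<in> pieces"
    using edge_at_component[of ?x "subdiv D B"] x(2) by (simp add: ray_label_def pieces_def)
  have xl: "?x \<in> ray_label j" using edge_at_in[of ?x "subdiv D B"] x(2) by (simp add: ray_label_def)
  show sub: "ray (ray_path j) \<subseteq> ray_label j"
    using x xl connected_ray[OF ray_path(1)[OF assms]] ray_path(3)[OF assms]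
    by (intro component_eqI[OF l[unfolded pieces_def]]) auto
  show "ray_label j = e \<longleftrightarrow> ray (ray_path j) \<subseteq> e" if e: "e \<in> pieces"
  proof
    assume "ray (ray_path j) \<subseteq> e"
    then have "ray_label j \<inter> e ~= {}" using x(1) xl by auto
    then show "ray_label j = e" using components_nonoverlap[of "ray_label j" "X - (V \<union> B)" e] l e by (simp add: pieces_def)
  qed (use sub in simp)
qed

lemma card_ray_label:
  assumes e: "e \<in> pieces"
  shows "card {j \<in> ray_index. ray_label j = e} = (if e \<in> arcs then 2 else 0)"
proof -
  have eq: "{j \<in> ray_index. ray_label j = e} = {j \<in> ray_index. ray (ray_path j) \<subseteq> e}"
    using ray_label(3)[OF _ e] by auto
  show ?thesis
  proof (cases "e \<in> arcs")
    case True
    then have a: "arc_edge (V \<union> B) e" by (simp add: arcs_def)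
    have "card {j \<in> ray_index. ray (ray_path j) \<subseteq> e} = 2"
    proof (rule card_rays_arc_edge[OF e[unfolded pieces_def] a finite_ray_index])
      show "arc (ray_path j) \<and> pathstart (ray_path j) \<in> V \<union> B \<and> ray (ray_path j) \<subseteq> X - (V \<union> B)" if "j \<in> ray_index" for j
        using ray_path[OF that] by simp
      show "ray (ray_path i) \<inter> ray (ray_path j) = {}"
        if ij: "i \<in> ray_index" "j \<in> ray_index" "i ~= j" "pathstart (ray_path i) = pathstart (ray_path j)" for i j
      proof (cases i; cases j)
        fix p q assume i: "i = Inl p" and j: "j = Inl q"
        obtain v u where p: "p = (v, u)" by (cases p)
        obtain v' u' where q: "q = (v', u')" by (cases q)
        have m: "v \<in> V" "u \<in> axis_units" "v' \<in> V" "u' \<in> axis_units" using ij(1,2) i j p q by (auto simp: ray_index_def)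
        have "v = v'" using ij(4) chart_ray(2)[OF chart[OF m(1)] m(2)] chart_ray(2)[OF chart[OF m(3)] m(4)] i j p q by simp
        moreover from this have "u ~= u'" using ij(3) i j p q by simp
        ultimately show ?thesis using chart_rays_disjoint[OF chart[OF m(1)] m(2,4)] i j p q by simp
      next
        fix p q assume i: "i = Inr p" and j: "j = Inr q"
        obtain b k where p: "p = (b, k)" by (cases p)
        obtain b' k' where q: "q = (b', k')" by (cases q)
        have m: "b \<in> B" "b' \<in> B" using ij(1,2) i j p q by (auto simp: ray_index_def)
        have "b = b'" using ij(4) arc[OF m(1), of k] arc[OF m(2), of k'] i j p q by simp
        moreover from this have "k ~= k'" using ij(3) i j p q by simp
        ultimately show ?thesis using arc_disjoint[OF m(1)] i j p q by (cases k; cases k') (simp_all add: Int_commute)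
      next
        fix p q assume "i = Inl p" "j = Inr q"
        then show ?thesis using ij arc chart_ray(2)[OF chart] B by (cases p; cases q) (auto simp: ray_index_def)
      next
        fix p q assume "i = Inr p" "j = Inl q"
        then show ?thesis using ij arc chart_ray(2)[OF chart] B by (cases p; cases q) (auto simp: ray_index_def)
      qed
      fix w assume w: "w \<in> V \<union> B"
      show "\<exists>eps>0. X \<inter> ball w eps \<subseteq> insert w (\<Union>j\<in>{j \<in> ray_index. pathstart (ray_path j) = w}. ray (ray_path j))"
      proof (cases "w \<in> V")
        case True
        have "(\<Union>u\<in>axis_units. ray (chart_ray (h w) u)) \<subseteq> (\<Union>j\<in>{j \<in> ray_index. pathstart (ray_path j) = w}. ray (ray_path j))"
        proof (rule UN_least)
          fix u assume u: "u \<in> axis_units"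
          then have "Inl (w, u) \<in> {j \<in> ray_index. pathstart (ray_path j) = w}"
            using True u chart_ray(2)[OF chart[OF True] u] by (auto simp: ray_index_def)
          from UN_upper[OF this, of "\<lambda>j. ray (ray_path j)"]
          show "ray (chart_ray (h w) u) \<subseteq> (\<Union>j\<in>{j \<in> ray_index. pathstart (ray_path j) = w}. ray (ray_path j))" by simp
        qed
        note sub = insert_mono[OF this, of w]
        obtain eps where eps: "eps > 0" "X \<inter> ball w eps \<subseteq> insert w (\<Union>u\<in>axis_units. ray (chart_ray (h w) u))"
          using chart_rays_cover[OF chart[OF True]] by auto
        show ?thesis using eps(1) order_trans[OF eps(2) sub] by (intro exI[of _ eps] conjI)
      next
        case False
        then have wB: "w \<in> B" using w by simp
        have "ray (ga w i) \<subseteq> (\<Union>j\<in>{j \<in> ray_index. pathstart (ray_path j) = w}. ray (ray_path j))" for i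
        proof -
          have "Inr (w, i) \<in> {j \<in> ray_index. pathstart (ray_path j) = w}"
            using wB arc[OF wB, of i] by (auto simp: ray_index_def)
          from UN_upper[OF this, of "\<lambda>j. ray (ray_path j)"] show ?thesis by simp
        qed
        then have "ray (ga w True) \<union> ray (ga w False) \<subseteq> (\<Union>j\<in>{j \<in> ray_index. pathstart (ray_path j) = w}. ray (ray_path j))" by simp
        note sub = insert_mono[OF this, of w]
        obtain eps where eps: "eps > 0" "X \<inter> ball w eps \<subseteq> insert w (ray (ga w True) \<union> ray (ga w False))"
          using arc_cover[OF wB] by auto
        show ?thesis using eps(1) order_trans[OF eps(2) sub] by (intro exI[of _ eps] conjI)
      qed
    qed
    then show ?thesis using True by (simp only: eq if_True)
  next
    case False
    then have c: "closed_edge e" using graph(2) e by (auto simp: arcs_def pieces_def arc_graph_def)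
    have "\<not> ray (ray_path j) \<subseteq> e" if "j \<in> ray_index" for j
      using no_rays_closed_edge[OF c _ ray_path(1)[OF that] ray_path(2)[OF that], of X] piece[OF e] by simp
    then have "{j \<in> ray_index. ray (ray_path j) \<subseteq> e} = {}" by simp
    then show ?thesis using False by (simp only: eq if_False card.empty)
  qed
qed

lemma corners_sym: "corners (sym v) = {#ray_label (Inl (v, 1)), ray_label (Inl (v, \<i>)), ray_label (Inl (v, - 1)), ray_label (Inl (v, - \<i>))#}"
  if "v \<in> V"
proof -
  have "ray_label (Inl (v, u)) = end_edge (subdiv D B) (h v) u" if "u \<in> axis_units" for u
    using chart_ray(3)[OF chart[OF \<open>v \<in> V\<close>] that] by (simp add: ray_label_def)
  then show ?thesis
    unfolding sym_def chart_symbol_eq_sym4[OF check(2) chart[OF that]] corners_sym4 by (simp add: axis_units_def)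
qed

lemma ends_total:
  "(\<Sum>v\<in>V. corners (sym v)) + (\<Sum>b\<in>B. {#side b True, side b False#}) = mset_set arcs + mset_set arcs"
proof -
  have f: "finite axis_units" "axis_units = {1, \<i>, - 1, - \<i>}" by (simp_all add: axis_units_def)
  have ax: "(\<Sum>u\<in>axis_units. {#ray_label (Inl (v, u))#}) = {#ray_label (Inl (v, 1)), ray_label (Inl (v, \<i>)), ray_label (Inl (v, - 1)), ray_label (Inl (v, - \<i>))#}" for v
    unfolding f(2) by (simp add: complex_eq_iff add_mset_commute)
  have bx: "(\<Sum>i\<in>UNIV. {#ray_label (Inr (b, i))#}) = {#side b True, side b False#}" for b
    by (simp add: UNIV_bool side_def ray_label_def add_mset_commute)
  have "(\<Sum>j\<in>ray_index. {#ray_label j#}) = (\<Sum>j\<in>V \<times> axis_units. {#ray_label (Inl j)#}) + (\<Sum>j\<in>B \<times> UNIV. {#ray_label (Inr j)#})"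
    unfolding ray_index_def using graph(3) fin_B by (subst sum.Plus) auto
  also have "(\<Sum>j\<in>V \<times> axis_units. {#ray_label (Inl j)#}) = (\<Sum>v\<in>V. \<Sum>u\<in>axis_units. {#ray_label (Inl (v, u))#})"
    by (simp add: sum.cartesian_product case_prod_beta')
  also have "(\<Sum>j\<in>B \<times> UNIV. {#ray_label (Inr j)#}) = (\<Sum>b\<in>B. \<Sum>i\<in>UNIV. {#ray_label (Inr (b, i))#})"
    by (simp add: sum.cartesian_product case_prod_beta')
  finally have tot: "(\<Sum>j\<in>ray_index. {#ray_label j#}) = (\<Sum>v\<in>V. corners (sym v)) + (\<Sum>b\<in>B. {#side b True, side b False#})"
    unfolding ax bx using corners_sym by simp
  have "count (\<Sum>j\<in>ray_index. {#ray_label j#}) e = card {j \<in> ray_index. ray_label j = e}" for e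
  proof -
    have "count (\<Sum>j\<in>ray_index. {#ray_label j#}) e = (\<Sum>j\<in>ray_index. if ray_label j = e then 1 else 0)"
      unfolding count_sum by (rule sum.cong) auto
    also have "\<dots> = card {j \<in> ray_index. ray_label j = e}" using finite_ray_index by (simp add: sum.If_cases Int_def)
    finally show ?thesis .
  qed
  moreover have "card {j \<in> ray_index. ray_label j = e} = count (mset_set arcs + mset_set arcs) e" for e
  proof (cases "e \<in> pieces")
    case True
    have "finite arcs" using finite_pieces by (simp add: arcs_def)
    then show ?thesis using card_ray_label[OF True] by (simp add: count_mset_set')
  next
    case False
    then have "{j \<in> ray_index. ray_label j = e} = {}" using ray_label(1) by auto
    moreover have "e ~: arcs" using False by (simp add: arcs_def)
    ultimately show ?thesis by (simp only: card.empty) (simp add: count_mset_set')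
  qed
  ultimately show ?thesis unfolding tot[symmetric] by (intro multiset_eqI) simp
qed

end

section \<open>Loop counts of a subdivided diagram\<close>

lemma connected_split:
  fixes C :: "complex set"
  assumes C: "connected C" "C \<subseteq> P \<union> Q" "P \<inter> Q = {}"
    and P: "\<And>x. x \<in> C ==> x \<in> P ==> \<exists>eps>0. C \<inter> ball x eps \<subseteq> P"
    and Q: "\<And>x. x \<in> C ==> x \<in> Q ==> \<exists>eps>0. C \<inter> ball x eps \<subseteq> Q"
  shows "C \<inter> P = {} \<or> C \<inter> Q = {}"
proof -
  have op: "openin (top_of_set C) (C \<inter> R)" if R: "\<And>x. x \<in> C ==> x \<in> R ==> \<exists>eps>0. C \<inter> ball x eps \<subseteq> R" for R
    unfolding openin_contains_ball
  proof (intro conjI ballI)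
    fix x assume "x \<in> C \<inter> R"
    then obtain eps where "eps > 0" "C \<inter> ball x eps \<subseteq> R" using R[of x] by auto
    then show "\<exists>e>0. ball x e \<inter> C \<subseteq> C \<inter> R" by (intro exI[of _ eps]) auto
  qed simp
  have "\<not> (C \<inter> P ~= {} \<and> C \<inter> Q ~= {})"
  proof
    assume "C \<inter> P ~= {} \<and> C \<inter> Q ~= {}"
    then have "openin (top_of_set C) (C \<inter> P) \<and> openin (top_of_set C) (C \<inter> Q) \<and> C \<subseteq> (C \<inter> P) \<union> (C \<inter> Q)
        \<and> (C \<inter> P) \<inter> (C \<inter> Q) = {} \<and> C \<inter> P ~= {} \<and> C \<inter> Q ~= {}"
      using op[OF P] op[OF Q] C(2,3) by auto
    then show False using C(1) unfolding connected_openin by (elim notE) (intro exI)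
  qed
  then show ?thesis by simp
qed

lemma corners_map: "corners (map_crossing_symbol f x) = image_mset f (corners x)"
  by (cases x) simp_all

lemma smoothing_map: "smoothing (map_crossing_symbol f x) i = image_mset (map_uprod f) (smoothing x i)"
  by (cases x) simp_all

lemma weight_map: "weight (map_crossing_symbol f x) i = weight x i"
  by (cases x) simp_all

lemma set_mset_sum_UN: "finite S ==> set_mset (\<Sum>x\<in>S. f x) = (\<Union>x\<in>S. set_mset (f x))"
  by (induction S rule: finite_induct) auto

lemma image_mset_sum: "finite S ==> image_mset f (\<Sum>x\<in>S. g x) = (\<Sum>x\<in>S. image_mset f (g x))"
  by (induction S rule: finite_induct) auto

lemma mset_set_image_sum: "finite S ==> inj_on f S ==> mset_set (f ` S) = (\<Sum>x\<in>S. {#f x#})"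
  by (induction S rule: finite_induct) auto

context subdivision
begin

text \<open>The labels of the cut diagram. A cut point b is represented by {b}, which is never a
  piece because pieces avoid B.\<close>

definition marks :: "complex set set" where "marks = pieces \<union> (\<lambda>b. {b}) ` B"

abbreviation enc :: "complex set => complex set" where "enc \<equiv> enclosing (X - V)"

lemma finite_marks: "finite marks"
  using finite_pieces fin_B by (simp add: marks_def)

lemma mark: "e \<in> marks ==> e ~= {} \<and> connected e \<and> e \<subseteq> X - V"
proof -
  assume "e \<in> marks"
  then consider "e \<in> pieces" | b where "b \<in> B" "e = {b}" by (auto simp: marks_def)
  then show ?thesis
  proof cases
    case 1 then show ?thesis using piece[of e] by auto
  next
    case 2 then show ?thesis using B by auto
  qed
qed

lemma enc_eq: "e \<in> marks ==> x \<in> e ==> enc e = connected_component_set (X - V) x"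
  using mark[of e] by (intro enclosing_eq) auto

lemma enc_in: "e \<in> marks ==> enc e \<in> components (X - V)" "e \<in> marks ==> e \<subseteq> enc e"
proof -
  assume e: "e \<in> marks"
  then obtain x where x: "x \<in> e" using mark[OF e] by auto
  then have "x \<in> X - V" using mark[OF e] by auto
  then show "enc e \<in> components (X - V)" unfolding enc_eq[OF e x] components_def by blast
  show "e \<subseteq> enc e" unfolding enc_eq[OF e x] using mark[OF e] x by (intro connected_component_maximal) auto
qed

lemma marks_cover: assumes "x \<in> X - V" obtains e where "e \<in> marks" "x \<in> e"
proof (cases "x \<in> B")
  case True
  then show thesis using that[of "{x}"] by (simp add: marks_def)
next
  case False
  then have "x \<in> \<Union>(components (X - (V \<union> B)))" using assms by simp
  then obtain e where "e \<in> pieces" "x \<in> e" unfolding pieces_def by (rule UnionE)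
  then show thesis using that[of e] by (simp add: marks_def)
qed

lemma marks_disjoint: assumes "d \<in> marks" "e \<in> marks" "x \<in> d" "x \<in> e" shows "d = e"
proof -
  have pp: "d = e" if "d \<in> pieces" "e \<in> pieces" "x \<in> d" "x \<in> e" for d e
    using components_nonoverlap[of d "X - (V \<union> B)" e] that by (auto simp: pieces_def)
  have pb: "x ~: B" if "d \<in> pieces" "x \<in> d" for d using piece[OF that(1)] that(2) by auto
  show ?thesis using assms pp[of d e] pb[of d] pb[of e] by (auto simp: marks_def)
qed

lemma side_piece: "b \<in> B ==> side b i \<in> pieces" "b \<in> B ==> ray (ga b i) \<subseteq> side b i"
  using ray_label(1,2)[of "Inr (b, i)"] by (auto simp: ray_index_def ray_label_def side_def)

lemma side_mark: "b \<in> B ==> side b i \<in> marks" "b \<in> B ==> {b} \<in> marks"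
  using side_piece(1) by (auto simp: marks_def)

lemma enc_side: assumes b: "b \<in> B" shows "enc (side b i) = enc {b}"
proof -
  let ?x = "pathfinish (ga b i)"
  have a: "arc (ga b i)" "pathstart (ga b i) = b" "ray (ga b i) \<subseteq> X - (V \<union> B)" using arc[OF b] by auto
  have x: "?x \<in> side b i" using pathfinish_in_ray[OF a(1)] side_piece(2)[OF b] by auto
  have "path_image (ga b i) \<subseteq> insert b (ray (ga b i))" using a(2) by (auto simp: ray_def)
  then have "path_image (ga b i) \<subseteq> X - V" using a(3) B b by auto
  moreover have "connected (path_image (ga b i))" using a(1) by (intro connected_path_image) (simp add: arc_def)
  moreover have "b \<in> path_image (ga b i)" using pathstart_in_path_image[of "ga b i"] a(2) by simp
  ultimately have "connected_component_set (X - V) ?x = connected_component_set (X - V) b"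
    by (intro connected_component_set_eqI[of "path_image (ga b i)"]) auto
  then show ?thesis using enc_eq[OF side_mark(1)[OF b] x] enc_eq[OF side_mark(2)[OF b], of b] by simp
qed

text \<open>Two arcs at each cut point rather than one, so that {b} is a label of its own and the
  collar falls apart into an inner and an outer half.\<close>

definition collar :: "complex set uprod multiset" where
  "collar = (\<Sum>b\<in>B. {#Upair (side b True) {b}, Upair {b} (side b False)#})"

lemma in_collar: "u \<in># collar \<longleftrightarrow> (\<exists>b\<in>B. u = Upair (side b True) {b} \<or> u = Upair {b} (side b False))"
proof -
  have "set_mset collar = (\<Union>b\<in>B. set_mset {#Upair (side b True) {b}, Upair {b} (side b False)#})"
    unfolding collar_def by (rule set_mset_sum_UN[OF fin_B])
  then show ?thesis by simp
qed

lemma marks_open: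
  assumes T: "T \<subseteq> marks" "\<And>b i. b \<in> B ==> {b} \<in> T \<longleftrightarrow> side b i \<in> T" and x: "x \<in> \<Union>T"
  shows "\<exists>eps>0. X \<inter> ball x eps \<subseteq> \<Union>T"
proof -
  obtain e where e: "e \<in> T" "x \<in> e" using x by (rule UnionE)
  have "e \<in> marks" using e(1) T(1) by auto
  then consider "e \<in> pieces" | b where "b \<in> B" "e = {b}" by (auto simp: marks_def)
  then show ?thesis
  proof cases
    case 1
    then obtain eps where "eps > 0" "X \<inter> ball x eps \<subseteq> e"
      using arc_graph_edge_neighbourhood[OF graph(2), of e x] e(2) by (auto simp: pieces_def)
    then show ?thesis using e(1) by (intro exI[of _ eps]) auto
  next
    case (2 b)
    have "x = b" using e(2) 2(2) by simp
    obtain eps where eps: "eps > 0" "X \<inter> ball b eps \<subseteq> insert b (ray (ga b True) \<union> ray (ga b False))"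
      using arc_cover[OF 2(1)] by auto
    have "side b i \<in> T" for i using T(2)[OF 2(1)] e(1) 2(2) by simp
    then have "ray (ga b i) \<subseteq> \<Union>T" for i using side_piece(2)[OF 2(1), of i] by (meson Union_upper order_trans)
    then have "insert b (ray (ga b True) \<union> ray (ga b False)) \<subseteq> \<Union>T" using e(1) 2(2) by auto
    then show ?thesis using eps \<open>x = b\<close> by (intro exI[of _ eps]) auto
  qed
qed

text \<open>If no collar arc separates T, the unions of T and of its complement in
  \<open>marks\<close> are both open in the curve. An edge is connected, so it lies in one of them:
  topological connectedness becomes connectedness through collar arcs.\<close>

lemma marks_saturated:
  assumes T: "T \<subseteq> marks" "\<And>b i. b \<in> B ==> {b} \<in> T \<longleftrightarrow> side b i \<in> T"
    and de: "d \<in> T" "e \<in> marks" "enc d = enc e"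
  shows "e \<in> T"
proof (rule ccontr)
  assume "e ~: T"
  define T' where "T' = marks - T"
  have T': "T' \<subseteq> marks" "\<And>b i. b \<in> B ==> {b} \<in> T' \<longleftrightarrow> side b i \<in> T'"
    using T(2) side_mark by (auto simp: T'_def)
  have d: "d \<in> marks" using de(1) T(1) by auto
  let ?C = "enc d"
  have C: "connected ?C" "?C \<subseteq> X - V"
    using in_components_connected[OF enc_in(1)[OF d]] in_components_subset[OF enc_in(1)[OF d]] by auto
  have "?C \<inter> \<Union>T = {} \<or> ?C \<inter> \<Union>T' = {}"
  proof (rule connected_split[OF C(1)])
    show "?C \<subseteq> \<Union>T \<union> \<Union>T'"
    proof
      fix x assume "x \<in> ?C"
      then obtain k where "k \<in> marks" "x \<in> k" using C(2) marks_cover by blast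
      then show "x \<in> \<Union>T \<union> \<Union>T'" unfolding T'_def by blast
    qed
    show "\<Union>T \<inter> \<Union>T' = {}"
    proof (rule ccontr)
      assume "\<Union>T \<inter> \<Union>T' ~= {}"
      then obtain x k l where kl: "k \<in> T" "l \<in> T'" "x \<in> k" "x \<in> l" by blast
      then have "k = l" using T(1) T'(1) by (intro marks_disjoint[of k l x]) auto
      then show False using kl by (simp add: T'_def)
    qed
    show "\<exists>eps>0. ?C \<inter> ball x eps \<subseteq> \<Union>T" if x: "x \<in> \<Union>T" for x
    proof -
      obtain eps where "eps > 0" "X \<inter> ball x eps \<subseteq> \<Union>T" using marks_open[OF T x] by auto
      then show ?thesis using C(2) by (intro exI[of _ eps]) auto
    qed
    show "\<exists>eps>0. ?C \<inter> ball x eps \<subseteq> \<Union>T'" if x: "x \<in> \<Union>T'" for x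
    proof -
      obtain eps where "eps > 0" "X \<inter> ball x eps \<subseteq> \<Union>T'" using marks_open[OF T' x] by auto
      then show ?thesis using C(2) by (intro exI[of _ eps]) auto
    qed
  qed
  moreover obtain x y where "x \<in> d" "y \<in> e" using mark[OF d] mark[OF de(2)] by auto
  then have "x \<in> ?C \<inter> \<Union>T" "y \<in> ?C \<inter> \<Union>T'"
    using enc_in(2)[OF d] enc_in(2)[OF de(2)] de \<open>e ~: T\<close> by (auto simp: T'_def)
  ultimately show False by auto
qed

text \<open>Colourings of whole edges are pulled back along \<open>enc\<close>. The images of
  collar-compatible sets under \<open>enc\<close> provide the inverse, since by
  \<open>marks_saturated\<close> such sets contain all marks of an edge or none.\<close>

lemma card_colourings_subdivided:
  assumes m: "set_mset (ends m) \<subseteq> pieces"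
  shows "card (colourings (components (X - V)) (image_mset (map_uprod enc) m)) = card (colourings marks (m + collar))"
proof (rule bij_betw_same_card[of "\<lambda>A. {e \<in> marks. enc e \<in> A}"])
  let ?F = "\<lambda>A. {e \<in> marks. enc e \<in> A}"
  let ?L = "colourings (components (X - V)) (image_mset (map_uprod enc) m)" and ?R = "colourings marks (m + collar)"
  have um: "set_uprod u \<subseteq> marks" if "u \<in># m" for u
    using set_uprod_subset_ends[OF that] m by (auto simp: marks_def)
  have sur: "\<exists>e\<in>marks. enc e = C" if C: "C \<in> components (X - V)" for C
  proof -
    obtain x where x: "x \<in> C" using in_components_nonempty[OF C] by auto
    then have "x \<in> X - V" using in_components_subset[OF C] by auto
    then obtain e where e: "e \<in> marks" "x \<in> e" by (rule marks_cover)
    then have "x \<in> enc e" using enc_in(2) by auto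
    then have "enc e = C" using components_nonoverlap[OF enc_in(1)[OF e(1)] C] x by auto
    then show ?thesis using e(1) by auto
  qed
  show "bij_betw ?F ?L ?R"
    unfolding bij_betw_def
  proof (rule conjI)
    show "inj_on ?F ?L"
    proof (rule inj_onI)
    fix A A' assume A: "A \<in> ?L" "A' \<in> ?L" "?F A = ?F A'"
    have *: "C \<in> A \<longleftrightarrow> C \<in> A'" if C: "C \<in> components (X - V)" for C
    proof -
      obtain e where e: "e \<in> marks" "enc e = C" using sur[OF C] by auto
      have "e \<in> ?F A \<longleftrightarrow> e \<in> ?F A'" using A(3) by simp
      then show ?thesis using e by simp
    qed
    have "A \<subseteq> components (X - V)" "A' \<subseteq> components (X - V)" using A(1,2) by (simp_all add: colourings_def)
    then show "A = A'" using * by (intro equalityI subsetI) auto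
    qed
  next
    show "?F ` ?L = ?R"
    proof (intro equalityI subsetI)
    fix E assume "E \<in> ?F ` ?L"
    then obtain A where A: "A \<in> ?L" "E = ?F A" by (rule imageE)
    have "set_uprod u \<subseteq> E \<or> set_uprod u \<inter> E = {}" if "u \<in># m + collar" for u
    proof (cases "u \<in># m")
      case True
      then have "set_uprod (map_uprod enc u) \<subseteq> A \<or> set_uprod (map_uprod enc u) \<inter> A = {}"
        using A(1) unfolding colourings_def by (simp only: mem_Collect_eq set_image_mset ball_simps)
      then show ?thesis using um[OF True] unfolding A(2) by (cases u) auto
    next
      case False
      then have "u \<in># collar" using that by simp
      then obtain b i where b: "b \<in> B" "set_uprod u = {side b i, {b}}" unfolding in_collar by force
      then show ?thesis unfolding A(2) using side_mark[OF b(1)] enc_side[OF b(1), of i] by auto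
    qed
    then show "E \<in> ?R" unfolding colourings_def A(2) by blast
  next
    fix T assume T: "T \<in> ?R"
    have sub: "T \<subseteq> marks" using T by (simp add: colourings_def)
    have comp: "set_uprod u \<subseteq> T \<or> set_uprod u \<inter> T = {}" if "u \<in># m + collar" for u
      using T that by (simp add: colourings_def)
    have bT: "{b} \<in> T \<longleftrightarrow> side b i \<in> T" if b: "b \<in> B" for b i
    proof -
      have "Upair (side b True) {b} \<in># m + collar" "Upair {b} (side b False) \<in># m + collar"
        using b by (auto simp: in_collar)
      from comp[OF this(1)] comp[OF this(2)] show ?thesis by (cases i) auto
    qed
    define A where "A = enc ` T"
    have encA: "enc e \<in> A \<longleftrightarrow> e \<in> T" if "e \<in> marks" for e
    proof
      assume "enc e \<in> A"
      then obtain d where "d \<in> T" "enc d = enc e" unfolding A_def by auto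
      then show "e \<in> T" using marks_saturated[OF sub bT] that by blast
    qed (simp add: A_def)
    have "T = ?F A" using encA sub by blast
    moreover have "A \<in> ?L"
    proof -
      have "A \<subseteq> components (X - V)" using enc_in(1) sub by (auto simp: A_def)
      moreover have "set_uprod w \<subseteq> A \<or> set_uprod w \<inter> A = {}" if w: "w \<in># image_mset (map_uprod enc) m" for w
      proof -
        obtain u where u: "u \<in># m" "w = map_uprod enc u" using w by auto
        obtain x y where xy: "u = Upair x y" by (cases u)
        have "x \<in> marks" "y \<in> marks" using um[OF u(1)] xy by auto
        moreover have "set_uprod u \<subseteq> T \<or> set_uprod u \<inter> T = {}" using comp u(1) by simp
        ultimately show ?thesis using encA u(2) xy by auto
      qed
      ultimately show ?thesis unfolding colourings_def by blast
    qed
    ultimately show "T \<in> ?F ` ?L" by (rule image_eqI)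
    qed
  qed
qed

lemma chart_symbol_enc:
  assumes v: "v \<in> V" shows "chart_symbol D (h v) = map_crossing_symbol enc (sym v)"
proof -
  have c: "crossing_chart D v (h v)" by (rule crossing_chart_subdivD[OF chart[OF v] v])
  have "end_edge D (h v) u = enc (end_edge (subdiv D B) (h v) u)" if u: "u \<in> axis_units" for u
  proof (rule edge_at_subdiv)
    show "inv (h v) (u / 2) \<in> X - V - B"
      using chart_ray_edge(1)[OF chart[OF v] u, of "1/2"] by auto
  qed
  from this[of 1] this[of "\<i>"] this[of "-1"] this[of "-\<i>"] show ?thesis
    unfolding sym_def chart_symbol_eq_sym4[OF check(2) chart[OF v]] chart_symbol_eq_sym4[OF check(1) c] map_sym4
    by (simp add: quadrant_shaded_def axis_units_def)
qed

lemma ends_undivided: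
  "(\<Sum>v\<in>V. corners (map_crossing_symbol enc (sym v))) = mset_set {e \<in> components (X - V). arc_edge V e} + mset_set {e \<in> components (X - V). arc_edge V e}"
proof -
  have s: "subdiv D {} = D" by (simp add: subdiv_def)
  \<comment> \<open>Charts of the subdivided diagram are charts of the diagram itself, so
    \<open>ends_total\<close> can be used without cut points.\<close>
  interpret U: subdivision D "{}" h ga
    by unfold_locales (use D crossing_chart_subdivD[OF chart] in \<open>auto simp: s\<close>)
  have "U.sym v = map_crossing_symbol enc (sym v)" if "v \<in> V" for v
    using chart_symbol_enc[OF that] by (simp add: U.sym_def s)
  then show ?thesis using U.ends_total by (simp add: U.arcs_def U.pieces_def)
qed

lemma set_corners_sym: "v \<in> V ==> set_mset (corners (sym v)) \<subseteq> pieces"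
  using corners_sym[of v] ray_label(1)[of "Inl (v, _)"] by (auto simp: ray_index_def axis_units_def)

lemma ends_collar: "ends collar = (\<Sum>b\<in>B. {#side b True, side b False#}) + (mset_set ((\<lambda>b. {b}) ` B) + mset_set ((\<lambda>b. {b}) ` B))"
proof -
  have "mset_set ((\<lambda>b. {b}) ` B) = (\<Sum>b\<in>B. {#{b}#})"
    by (rule mset_set_image_sum[OF fin_B]) simp
  then show ?thesis unfolding collar_def ends_sum by (simp add: sum.distrib[symmetric] add_mset_commute)
qed

lemma arcs_marks: "finite arcs" "arcs \<subseteq> pieces" "arcs \<inter> (\<lambda>b. {b}) ` B = {}"
proof -
  show "finite arcs" "arcs \<subseteq> pieces" using finite_pieces by (auto simp: arcs_def)
  show "arcs \<inter> (\<lambda>b. {b}) ` B = {}" using piece by (fastforce simp: arcs_def)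
qed

text \<open>Both sides are exponents of 2 in the same count of colourings. The labels outside the
  arcs are the crossingless components on the left and the closed pieces on the right.\<close>

lemma loop_count_subdivided:
  fixes s :: "complex => nat"
  defines "m \<equiv> \<Sum>v\<in>V. smoothing (sym v) (s v)"
  shows "loop_count (image_mset (map_uprod enc) m) + card (crossingless_components D)
       = loop_count (m + collar) + card (pieces - arcs)"
proof -
  let ?S = "(\<lambda>b. {b}) ` B"
  have em: "ends m = (\<Sum>v\<in>V. corners (sym v))" by (simp add: m_def ends_sum)
  have m: "set_mset (ends m) \<subseteq> pieces"
    unfolding em set_mset_sum_UN[OF graph(3)] using set_corners_sym by (rule UN_least)
  have "mset_set (arcs \<union> ?S) = mset_set arcs + mset_set ?S" using arcs_marks fin_B by (intro mset_set_Union) auto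
  then have e1: "ends (m + collar) = mset_set (arcs \<union> ?S) + mset_set (arcs \<union> ?S)"
    using ends_total by (simp add: em ends_collar ac_simps)
  have tw: "twice (m + collar)" by (rule twiceI[OF e1])
  have set1: "set_mset (ends (m + collar)) = arcs \<union> ?S" unfolding e1 using arcs_marks fin_B by simp
  have "marks - (arcs \<union> ?S) = pieces - arcs" using piece by (fastforce simp: marks_def)
  then have c1: "card (colourings marks (m + collar)) = 2 ^ (loop_count (m + collar) + card (pieces - arcs))"
    using card_colourings_loop_count_superset[OF tw finite_marks] arcs_marks(2) unfolding set1 by (auto simp: marks_def)
  let ?A = "{e \<in> components (X - V). arc_edge V e}"
  have e2: "ends (image_mset (map_uprod enc) m) = mset_set ?A + mset_set ?A"
  proof -
    have "ends (image_mset (map_uprod enc) m) = image_mset enc (\<Sum>v\<in>V. corners (sym v))" by (simp add: ends_image_mset em)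
    also have "\<dots> = (\<Sum>v\<in>V. corners (map_crossing_symbol enc (sym v)))"
      by (simp add: corners_map image_mset_sum[OF graph(3)])
    finally show ?thesis using ends_undivided by simp
  qed
  have fin: "finite (components (X - V))" using graph(1) by (simp add: arc_graph_def)
  have set2: "set_mset (ends (image_mset (map_uprod enc) m)) = ?A" unfolding e2 using fin by simp
  have "components (X - V) - ?A = crossingless_components D"
    using crossingless_components_eq[OF graph(1)] by (auto simp: crossingless_components_def)
  then have c2: "card (colourings (components (X - V)) (image_mset (map_uprod enc) m))
      = 2 ^ (loop_count (image_mset (map_uprod enc) m) + card (crossingless_components D))"
    using card_colourings_loop_count_superset[OF twiceI[OF e2] fin] unfolding set2 by simp
  show ?thesis using card_colourings_subdivided[OF m] c1 c2 by simp
qed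

definition collar_poly :: "complex set conpoly" where
  "collar_poly = (\<Prod>b\<in>B. con (side b True) {b} * con {b} (side b False))"

lemma collar_poly_eq: "collar_poly = Poly_Mapping.single collar 1"
proof -
  have "con (side b True) {b} * con {b} (side b False) = Poly_Mapping.single {#Upair (side b True) {b}, Upair {b} (side b False)#} 1" for b
    by (simp add: con_arc_def mult_single add_mset_commute)
  then show ?thesis unfolding collar_poly_def collar_def using fin_B by (simp add: prod_single)
qed

text \<open>State by state the weights agree, and \<open>loop_count_subdivided\<close> converts the
  powers of o; the closed pieces take over the role of the crossingless components.\<close>

theorem ss_subdivided:
  "ss D = bracket ((\<Prod>v\<in>V. expand (sym v)) * collar_poly) * Var Vo ^ card (pieces - arcs)"
proof -
  let ?m = "\<lambda>s. \<Sum>v\<in>V. smoothing (sym v) (s v)" and ?w = "\<lambda>s. \<Prod>v\<in>V. weight (sym v) (s v)"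
  have sym: "expand (symbol_at D v) = expand (map_crossing_symbol enc (sym v))" if v: "v \<in> V" for v
    using symbol_at_chart[OF D crossing_chart_subdivD[OF chart[OF v] v]] chart_symbol_enc[OF v] by simp
  have im: "(\<Sum>v\<in>V. image_mset (map_uprod enc) (smoothing (sym v) (s v))) = image_mset (map_uprod enc) (?m s)" for s
    by (rule image_mset_sum[OF graph(3), symmetric])
  have "ss D = bracket (\<Prod>v\<in>V. expand (map_crossing_symbol enc (sym v))) * Var Vo ^ card (crossingless_components D)"
    by (simp add: ss_def sym)
  also have "\<dots> = (\<Sum>s\<in>V \<rightarrow>\<^sub>E {..<3}. ?w s * (Var Vo ^ loop_count (image_mset (map_uprod enc) (?m s)) * Var Vo ^ card (crossingless_components D)))"
    unfolding prod_expand[OF graph(3)]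
    by (simp add: bracket_sum bracket_single smoothing_map weight_map im sum_distrib_right mult.assoc)
  also have "\<dots> = (\<Sum>s\<in>V \<rightarrow>\<^sub>E {..<3}. ?w s * (Var Vo ^ loop_count (?m s + collar) * Var Vo ^ card (pieces - arcs)))"
    by (simp only: power_add[symmetric] loop_count_subdivided)
  also have "\<dots> = bracket ((\<Prod>v\<in>V. expand (sym v)) * collar_poly) * Var Vo ^ card (pieces - arcs)"
    unfolding prod_expand[OF graph(3)] collar_poly_eq
    by (simp add: sum_distrib_right mult_single bracket_sum bracket_single mult.assoc)
  finally show ?thesis .
qed

end

section \<open>Planar isotopy\<close>

lemma connected_component_planar_map:
  assumes "planar_map h"
  shows "connected_component_set (h ` S) (h x) = h ` connected_component_set S x"
proof -
  have sub: "k ` connected_component_set T y \<subseteq> connected_component_set (k ` T) (k y)" if k: "planar_map k" for k T y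
  proof (cases "y \<in> T")
    case True
    show ?thesis
    proof (rule connected_component_maximal)
      show "k y \<in> k ` connected_component_set T y" using True by simp
      show "connected (k ` connected_component_set T y)"
        by (rule connected_continuous_image[OF planar_map_simps(3)[OF k]]) simp
      show "k ` connected_component_set T y \<subseteq> k ` T" by (intro image_mono connected_component_subset)
    qed
  next
    case False
    then have "connected_component_set T y = {}" by (rule connected_component_eq_empty[THEN iffD2])
    then show ?thesis by (simp only: image_empty empty_subsetI)
  qed
  have id: "inv h ` h ` A = A" "h ` inv h ` A = A" for A
    using planar_map_simps(1,2)[OF assms] by (simp_all add: image_image)
  have "inv h ` connected_component_set (h ` S) (h x) \<subseteq> connected_component_set S x"
    using sub[OF planar_map_inv[OF assms], of "h ` S" "h x"] by (simp only: id planar_map_simps(1)[OF assms])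
  from image_mono[OF this, of h] show ?thesis using sub[OF assms, of S x] by (simp only: id)
qed

lemma components_planar_map:
  assumes "planar_map h" shows "components (h ` S) = (`) h ` components S"
  unfolding components_def by (simp only: image_image connected_component_planar_map[OF assms])

lemma frontier_planar_map:
  assumes h: "planar_map h" and e: "e \<subseteq> frontier F" shows "h ` e \<subseteq> frontier (h ` F)"
proof -
  have "h ` closure T \<subseteq> closure (h ` T)" for T
    by (rule image_closure_subset[OF planar_map_simps(3)[OF h]]) (auto intro: closure_subset[THEN subsetD])
  from this[of F] this[of "- F"] show ?thesis
    using e unfolding frontier_closures bij_image_Compl_eq[OF planar_map_simps(5)[OF h]] by blast
qed

lemma simple_path_planar_map:
  assumes h: "planar_map h" and g: "simple_path g"
  shows "simple_path (h \<circ> g)" "pathstart (h \<circ> g) = h (pathstart g)" "pathfinish (h \<circ> g) = h (pathfinish g)"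
    "path_image (h \<circ> g) = h ` path_image g"
  using simple_path_continuous_image[OF g planar_map_simps(3)[OF h]] inj_on_subset[OF planar_map_simps(6)[OF h]]
  by (auto simp: pathstart_compose pathfinish_compose path_image_compose)

definition push :: "(complex => complex) => shaded_diagram => shaded_diagram" where
  "push h D = \<lparr>curve = h ` curve D, crossings = h ` crossings D,
     overpass = (\<lambda>v. h ` overpass D (inv h v)), shaded = h ` shaded D\<rparr>"

lemma push_simps [simp]:
  "curve (push h D) = h ` curve D" "crossings (push h D) = h ` crossings D"
  "overpass (push h D) = (\<lambda>v. h ` overpass D (inv h v))" "shaded (push h D) = h ` shaded D"
  by (simp_all add: push_def)

lemma edges_push: "planar_map h ==> edges (push h D) = (`) h ` edges D"
  by (simp add: edges_def image_set_diff[OF planar_map_simps(6), symmetric] components_planar_map)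

lemma faces_push: "planar_map h ==> faces (push h D) = (`) h ` faces D"
  by (simp add: faces_def bij_image_Compl_eq[OF planar_map_simps(5), symmetric] components_planar_map)

lemma crossing_chart_push:
  assumes h: "planar_map h" and c: "crossing_chart D v k"
  shows "crossing_chart (push h D) (h v) (k \<circ> inv h)"
proof -
  have id: "(k \<circ> inv h) ` h ` A = k ` A" for A
    using planar_map_simps(1)[OF h] by (simp add: image_image)
  have "planar_map (k \<circ> inv h)"
    using c by (intro planar_map_compose planar_map_inv h) (simp add: crossing_chart_def)
  then show ?thesis using c unfolding crossing_chart_def push_simps id by (simp add: planar_map_simps(1)[OF h])
qed

lemma open_edge_push:
  assumes h: "planar_map h" and e: "open_edge D e" shows "open_edge (push h D) (h ` e)"
proof -
  obtain g where g: "simple_path g" "pathstart g \<in> crossings D" "pathfinish g \<in> crossings D"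
      "e = path_image g - {pathstart g, pathfinish g}"
    using e unfolding open_edge_def by (elim exE conjE) (rule that)
  have "h ` e = path_image (h \<circ> g) - {pathstart (h \<circ> g), pathfinish (h \<circ> g)}"
    unfolding g(4) by (simp add: simple_path_planar_map[OF h g(1)] image_set_diff[OF planar_map_simps(6)[OF h]])
  then show ?thesis
    unfolding open_edge_def using g(2,3) by (intro exI[of _ "h \<circ> g"]) (simp add: simple_path_planar_map[OF h g(1)])
qed

lemma closed_edge_push:
  assumes h: "planar_map h" and e: "closed_edge e" shows "closed_edge (h ` e)"
proof -
  obtain g where g: "simple_path g" "pathfinish g = pathstart g" "e = path_image g"
    using e unfolding closed_edge_def by (elim exE conjE) (rule that)
  then show ?thesis
    unfolding closed_edge_def by (intro exI[of _ "h \<circ> g"]) (simp add: simple_path_planar_map[OF h g(1)])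
qed

lemma shaded_link_diagram_push:
  assumes h: "planar_map h" and D: "shaded_link_diagram D"
  shows "shaded_link_diagram (push h D)"
proof -
  have L: "link_diagram D" and C: "checkerboard D" using D by (auto simp: shaded_link_diagram_def)
  have int: "h ` A \<inter> h ` B = h ` (A \<inter> B)" for A B by (rule image_Int[OF planar_map_simps(6)[OF h], symmetric])
  have "link_diagram (push h D)"
    unfolding link_diagram_def
  proof (intro conjI ballI)
    show "finite (crossings (push h D))" "crossings (push h D) \<subseteq> curve (push h D)" "finite (edges (push h D))"
      using L by (auto simp: link_diagram_def edges_push[OF h])
    show "\<exists>k. crossing_chart (push h D) v k" if v: "v \<in> crossings (push h D)" for v
    proof -
      obtain w where w: "w \<in> crossings D" "v = h w" using v by auto
      then obtain k where "crossing_chart D w k" using L by (auto simp: link_diagram_def)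
      then show ?thesis using crossing_chart_push[OF h] w(2) by auto
    qed
    fix e assume "e \<in> edges (push h D)"
    then obtain d where d: "d \<in> edges D" "e = h ` d" by (auto simp: edges_push[OF h])
    then have "open_edge D d \<or> closed_edge d" using L by (auto simp: link_diagram_def)
    then show "open_edge (push h D) e \<or> closed_edge e"
      using open_edge_push[OF h] closed_edge_push[OF h] d(2) by auto
  qed
  moreover have "checkerboard (push h D)"
    unfolding checkerboard_def
  proof (intro conjI ballI)
    show "shaded (push h D) \<inter> curve (push h D) = {}" using C by (simp add: int checkerboard_def)
    show "F \<subseteq> shaded (push h D) \<or> F \<inter> shaded (push h D) = {}" if F: "F \<in> faces (push h D)" for F
    proof -
      obtain G where G: "G \<in> faces D" "F = h ` G" using F by (auto simp: faces_push[OF h])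
      then have "G \<subseteq> shaded D \<or> G \<inter> shaded D = {}" using C by (simp add: checkerboard_def)
      then show ?thesis unfolding G(2) push_simps int by auto
    qed
    fix e assume "e \<in> edges (push h D)"
    then obtain d where d: "d \<in> edges D" "e = h ` d" by (auto simp: edges_push[OF h])
    have "\<forall>e\<in>edges D. \<exists>F\<in>faces D. \<exists>G\<in>faces D. F \<subseteq> shaded D \<and> G \<inter> shaded D = {} \<and> e \<subseteq> frontier F \<and> e \<subseteq> frontier G"
      using C by (simp add: checkerboard_def)
    from bspec[OF this d(1)] obtain F G where
      FG: "F \<in> faces D" "G \<in> faces D" "F \<subseteq> shaded D" "G \<inter> shaded D = {}" "d \<subseteq> frontier F" "d \<subseteq> frontier G" by auto
    have "h ` F \<in> faces (push h D)" "h ` G \<in> faces (push h D)" using FG(1,2) by (simp_all add: faces_push[OF h])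
    then show "\<exists>F\<in>faces (push h D). \<exists>G\<in>faces (push h D). F \<subseteq> shaded (push h D) \<and> G \<inter> shaded (push h D) = {} \<and> e \<subseteq> frontier F \<and> e \<subseteq> frontier G"
      using FG(3,4) frontier_planar_map[OF h FG(5)] frontier_planar_map[OF h FG(6)] image_mono[OF FG(3), of h] d(2)
      by (intro bexI[of _ "h ` F"] bexI[of _ "h ` G"]) (simp_all add: int)
  qed
  ultimately show ?thesis by (simp add: shaded_link_diagram_def)
qed

lemma planar_isotopic_push: "planar_map h ==> planar_isotopic D (push h D)"
  unfolding planar_isotopic_def same_germ_def by (intro exI[of _ h]) (simp add: planar_map_simps(1))

lemma chart_symbol_planar_map:
  assumes h: "planar_map h" and k: "planar_map k"
    and D': "curve D' = h ` curve D" "crossings D' = h ` crossings D" "shaded D' = h ` shaded D"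
  shows "chart_symbol D' (k \<circ> inv h) = map_crossing_symbol ((`) h) (chart_symbol D k)"
proof -
  have inv: "inv (k \<circ> inv h) = h \<circ> inv k"
    by (rule inv_equality) (simp_all add: planar_map_simps(1,2)[OF h] planar_map_simps(1,2)[OF k])
  have e: "edge_at D' (h z) = h ` edge_at D z" for z
    unfolding edge_at_def D' image_set_diff[OF planar_map_simps(6)[OF h], symmetric]
    by (rule connected_component_planar_map[OF h])
  have s: "(h \<circ> inv k) ` A \<subseteq> shaded D' \<longleftrightarrow> inv k ` A \<subseteq> shaded D" for A
    unfolding D' image_comp[symmetric] by (rule inj_image_subset_iff[OF planar_map_simps(6)[OF h]])
  show ?thesis
    unfolding chart_symbol_def Let_def inv s by (simp add: e)
qed

text \<open>The subdivision without cut points counts the edge-ends for one family of charts, and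
  the charts behind \<open>symbol_at\<close> give the same expansions.\<close>

lemma homogeneous_state_sum:
  assumes D: "shaded_link_diagram D"
  obtains Y where "finite Y" "homogeneous (\<Prod>v\<in>crossings D. expand (symbol_at D v)) (mset_set Y + mset_set Y)"
proof -
  have "\<forall>v\<in>crossings D. \<exists>h. crossing_chart D v h" using D by (simp add: shaded_link_diagram_def link_diagram_def)
  then obtain h where h: "\<And>v. v \<in> crossings D ==> crossing_chart D v (h v)" by metis
  have s: "subdiv D {} = D" by (simp add: subdiv_def)
  \<comment> \<open>There is no cut point to supply arcs for, so any path can stand here.\<close>
  interpret U: subdivision D "{}" h "\<lambda>_ _. linepath 0 1"
    by unfold_locales (use D h in \<open>auto simp: s\<close>)
  have e: "expand (symbol_at D v) = expand (U.sym v)" if "v \<in> crossings D" for v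
    using symbol_at_chart[OF D h[OF that]] by (simp add: U.sym_def s)
  have "homogeneous (\<Prod>v\<in>crossings D. expand (U.sym v)) (\<Sum>v\<in>crossings D. corners (U.sym v))"
    by (intro homogeneous_prod homogeneous_expand)
  then have "homogeneous (\<Prod>v\<in>crossings D. expand (symbol_at D v)) (mset_set U.arcs + mset_set U.arcs)"
    using U.ends_total by (simp add: e)
  then show thesis using U.arcs_marks(1) by (intro that)
qed

text \<open>A chart k at v is carried to \<open>k \<circ> inv h\<close> at h v. The isotopy matches
  overpasses only as germs, so both charts are first shrunk by the same r; the symbols then differ
  by renaming each edge to its image.\<close>

theorem ss_planar_isotopic:
  assumes D: "shaded_link_diagram D" "shaded_link_diagram D'" and iso: "planar_isotopic D D'"
  shows "ss D' = ss D"
proof -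
  obtain h where h: "planar_map h" and D': "curve D' = h ` curve D" "crossings D' = h ` crossings D" "shaded D' = h ` shaded D"
    and germ: "\<And>v. v \<in> crossings D ==> same_germ (h v) (h ` overpass D v) (overpass D' (h v))"
    using iso unfolding planar_isotopic_def by auto
  note inj = planar_map_simps(6)[OF h]
  have sym: "expand (symbol_at D' (h v)) = relabel ((`) h) (expand (symbol_at D v))" if v: "v \<in> crossings D" for v
  proof -
    obtain k where c: "crossing_chart D v k" using D(1) v by (auto simp: shaded_link_diagram_def link_diagram_def)
    have k: "planar_map k" "k v = 0" using c by (auto simp: crossing_chart_def)
    have inv: "inv (k \<circ> inv h) = h \<circ> inv k"
      by (rule inv_equality) (simp_all add: planar_map_simps(1,2)[OF h] planar_map_simps(1,2)[OF k(1)])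
    have v0: "inv k 0 = v" using planar_map_simps(1)[OF k(1), of v] k(2) by simp
    have "continuous_on UNIV (\<lambda>z. h (inv k z))"
      by (rule continuous_on_compose2[OF planar_map_simps(3)[OF h, of UNIV] planar_map_simps(4)[OF k(1)]]) simp
    then have "isCont (\<lambda>z. h (inv k z)) 0" by (simp add: continuous_on_eq_continuous_at)
    then have "filterlim (\<lambda>z. h (inv k z)) (nhds (h v)) (nhds 0)"
      using tendsto_at_iff_tendsto_nhds[of "\<lambda>z. h (inv k z)" 0] by (simp add: isCont_def v0)
    then have "\<forall>\<^sub>F z in nhds 0. h (inv k z) \<in> h ` overpass D v \<longleftrightarrow> h (inv k z) \<in> overpass D' (h v)"
      using germ[OF v] unfolding same_germ_def filterlim_iff by blast
    then obtain d where d: "d > 0" "\<And>z. dist z 0 < d ==> h (inv k z) \<in> h ` overpass D v \<longleftrightarrow> h (inv k z) \<in> overpass D' (h v)"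
      unfolding eventually_nhds_metric by auto
    define r where "r = min d 1"
    have r: "r > 0" using d(1) by (simp add: r_def)
    have b: "z \<in> ball 0 1" "dist z 0 < d" if "z \<in> ball 0 r" for z using that by (auto simp: r_def dist_commute)
    have c1: "crossing_chart D v (\<lambda>z. k z / of_real r)"
      by (rule crossing_chartI(1)[OF k r]) (use chart_mem[OF c b(1)] in simp_all)
    have kh: "planar_map (k \<circ> inv h)" by (intro planar_map_compose k planar_map_inv h)
    have "crossing_chart D' (h v) (\<lambda>z. (k \<circ> inv h) z / of_real r)"
    proof (rule crossing_chartI(1)[OF kh _ r])
      show "(k \<circ> inv h) (h v) = 0" using k(2) planar_map_simps(1)[OF h] by simp
      fix z :: complex assume z: "z \<in> ball 0 r"
      show "inv (k \<circ> inv h) z \<in> curve D' \<longleftrightarrow> Re z = 0 \<or> Im z = 0" "inv (k \<circ> inv h) z \<in> crossings D' \<longleftrightarrow> z = 0"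
        using chart_mem[OF c b(1)[OF z]] by (simp_all add: inv D' inj_image_mem_iff[OF inj])
      show "inv (k \<circ> inv h) z \<in> overpass D' (h v) \<longleftrightarrow> Im z = 0"
        using chart_mem[OF c b(1)[OF z]] d(2)[OF b(2)[OF z]] by (simp add: inv inj_image_mem_iff[OF inj])
    qed
    moreover have eq: "(\<lambda>z. (k \<circ> inv h) z / of_real r) = (\<lambda>z. k z / of_real r) \<circ> inv h" by auto
    ultimately have c2: "crossing_chart D' (h v) ((\<lambda>z. k z / of_real r) \<circ> inv h)" by simp
    have k1: "planar_map (\<lambda>z. k z / of_real r)" using c1 by (simp add: crossing_chart_def)
    show ?thesis
      unfolding symbol_at_chart[OF D(2) c2] symbol_at_chart[OF D(1) c1] relabel_expand chart_symbol_planar_map[OF h k1 D'] ..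
  qed
  have "(\<Prod>v\<in>crossings D'. expand (symbol_at D' v)) = relabel ((`) h) (\<Prod>v\<in>crossings D. expand (symbol_at D v))"
    unfolding D'(2) prod.reindex[OF inj_on_subset[OF inj subset_UNIV]] relabel_prod by (simp add: sym)
  moreover obtain Y where "finite Y" "homogeneous (\<Prod>v\<in>crossings D. expand (symbol_at D v)) (mset_set Y + mset_set Y)"
    by (rule homogeneous_state_sum[OF D(1)])
  moreover have ih: "inj_on ((`) h) S" for S using inj_image_eq_iff[OF inj] by (intro inj_onI) simp
  ultimately have br: "bracket (\<Prod>v\<in>crossings D'. expand (symbol_at D' v)) = bracket (\<Prod>v\<in>crossings D. expand (symbol_at D v))"
    using bracket_relabel by metis
  have iff: "h ` C \<inter> h ` A = {} \<longleftrightarrow> C \<inter> A = {}" for A C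
    using image_Int[OF inj, symmetric, of C A] by (simp only: image_is_empty)
  have "crossingless_components D' = (`) h ` crossingless_components D"
    unfolding crossingless_components_def D' components_planar_map[OF h] by (auto simp: iff dest: injD[OF inj])
  then have "card (crossingless_components D') = card (crossingless_components D)"
    by (simp only: card_image[OF ih])
  then show ?thesis using br by (simp add: ss_def)
qed

section \<open>Replacing the inside of a disc\<close>

lemma path_near_start:
  fixes g :: "real => complex"
  assumes "path g" "eps > 0"
  obtains d where "0 < d" "d \<le> 1" "g ` {0..d} \<subseteq> ball (pathstart g) eps"
proof -
  have c: "continuous_on {0..1} g" using assms(1) by (simp add: path_def)
  obtain d where d: "d > 0" "\<And>t. t \<in> {0..1} ==> dist t 0 < d ==> dist (g t) (g 0) < eps"
    using c[unfolded continuous_on_iff, rule_format, of 0 eps] assms(2) by auto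
  show thesis
  proof (rule that[of "min 1 (d / 2)"])
    show "g ` {0..min 1 (d / 2)} \<subseteq> ball (pathstart g) eps"
    proof (rule image_subsetI)
      fix t assume "t \<in> {0..min 1 (d / 2)}"
      then have "t \<in> {0..1}" "dist t 0 < d" using d(1) by auto
      from d(2)[OF this] show "g t \<in> ball (pathstart g) eps" by (simp add: pathstart_def dist_commute)
    qed
  qed (use d(1) in auto)
qed

lemma arc_away_from_start:
  fixes g :: "real => complex"
  assumes "arc g" "0 < c"
  obtains eps where "eps > 0" "ball (pathstart g) eps \<inter> g ` {c..1} = {}"
proof -
  have cont: "continuous_on {0..1} g" and inj: "inj_on g {0..1}" using assms(1) by (simp_all add: arc_def path_def)
  have "continuous_on {c..1} g" by (rule continuous_on_subset[OF cont]) (use assms(2) in auto)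
  then have "compact (g ` {c..1})" by (intro compact_continuous_image) auto
  then have "closed (g ` {c..1})" by (rule compact_imp_closed)
  moreover have "pathstart g ~: g ` {c..1}"
  proof (rule not_in_imageI)
    fix t assume "t \<in> {c..1}"
    then show "g t ~= pathstart g" using inj_onD[OF inj, of t 0] assms(2) by (auto simp: pathstart_def)
  qed
  ultimately show thesis by (rule closed_avoiding_ball) (rule that)
qed

text \<open>A germ of the arc at its start is contained in every connected subset that has the start in its closure.\<close>

lemma connected_contains_initial_segment:
  assumes a: "arc g" and S: "connected S" "S \<subseteq> ray g" "pathstart g \<in> closure S"
  obtains c where "0 < c" "g ` {0<..<c} \<subseteq> S"
proof -
  have cont: "continuous_on {0..1} g" and inj: "inj_on g {0..1}" and pg: "path g" using a by (simp_all add: arc_def path_def)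
  have r: "ray g = g ` {0<..1}" by (rule ray_eq[OF a])
  have Sr: "\<exists>u. 0 < u \<and> u \<le> 1 \<and> y = g u" if "y \<in> S" for y
  proof -
    have "y \<in> g ` {0<..1}" using subsetD[OF S(2) that] r by simp
    then show ?thesis by auto
  qed
  have "S ~= {}" using S(3) by auto
  then obtain x where "x \<in> S" by auto
  then obtain s where s: "0 < s" "s \<le> 1" "g s \<in> S" using Sr by auto
  have cl: "closed (g ` {p..q})" if "0 \<le> p" "q \<le> 1" for p q
    by (intro compact_imp_closed compact_continuous_image continuous_on_subset[OF cont]) (use that in auto)
  have "g t \<in> S" if t: "0 < t" "t < s" for t
  proof (rule ccontr)
    assume nt: "g t ~: S"
    have t1: "t \<le> 1" using t s by simp
    have T: "connected (g ` {0<..<t})" "pathstart g \<in> closure (g ` {0<..<t})" by (rule path_initial_segment[OF pg t(1) t1])+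
    have "g ` {0<..<t} \<subseteq> ray g" unfolding r using t1 by (intro image_mono) auto
    then have "S \<inter> g ` {0<..<t} ~= {}" by (rule arc_germs_meet[OF a S T(1) _ T(2)])
    then obtain t' where t': "0 < t'" "t' < t" "g t' \<in> S" by auto
    have "S \<inter> g ` {0..<t} = {} \<or> S \<inter> g ` {t<..1} = {}"
    proof (rule connected_split[OF S(1)])
      show "S \<subseteq> g ` {0..<t} \<union> g ` {t<..1}"
      proof
        fix y assume y: "y \<in> S"
        then obtain u where u: "0 < u" "u \<le> 1" "y = g u" using Sr by auto
        then have "u ~= t" using y nt by auto
        then show "y \<in> g ` {0..<t} \<union> g ` {t<..1}" using u by (cases "u < t") auto
      qed
      show "g ` {0..<t} \<inter> g ` {t<..1} = {}"
        by (rule image_disjointI) (use inj_onD[OF inj] t1 in force)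
      show "\<exists>eps>0. S \<inter> ball y eps \<subseteq> g ` {0..<t}" if y: "y \<in> S" "y \<in> g ` {0..<t}" for y
      proof -
        obtain u where u: "0 \<le> u" "u < t" "y = g u" using y(2) by auto
        have "y ~: g ` {t..1}" by (rule not_in_imageI) (use inj_onD[OF inj] u t1 in force)
        with cl[of t 1] t(1) obtain eps where eps: "eps > 0" "ball y eps \<inter> g ` {t..1} = {}" by (auto elim: closed_avoiding_ball)
        have "z \<in> g ` {0..<t}" if z: "z \<in> S" "z \<in> ball y eps" for z
        proof -
          obtain w where w: "0 < w" "w \<le> 1" "z = g w" using Sr[OF z(1)] by auto
          have "\<not> t \<le> w" using eps(2) z(2) w by auto
          then show ?thesis using w by auto
        qed
        then show ?thesis using eps(1) by (intro exI[of _ eps]) auto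
      qed
      show "\<exists>eps>0. S \<inter> ball y eps \<subseteq> g ` {t<..1}" if y: "y \<in> S" "y \<in> g ` {t<..1}" for y
      proof -
        obtain u where u: "t < u" "u \<le> 1" "y = g u" using y(2) by auto
        have "y ~: g ` {0..t}" by (rule not_in_imageI) (use inj_onD[OF inj] u t t1 in force)
        with cl[of 0 t] t1 obtain eps where eps: "eps > 0" "ball y eps \<inter> g ` {0..t} = {}" by (auto elim: closed_avoiding_ball)
        have "z \<in> g ` {t<..1}" if z: "z \<in> S" "z \<in> ball y eps" for z
        proof -
          obtain w where w: "0 < w" "w \<le> 1" "z = g w" using Sr[OF z(1)] by auto
          have "\<not> w \<le> t" using eps(2) z(2) w by auto
          then show ?thesis using w by auto
        qed
        then show ?thesis using eps(1) by (intro exI[of _ eps]) auto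
      qed
    qed
    moreover have "g t' \<in> S \<inter> g ` {0..<t}" "g s \<in> S \<inter> g ` {t<..1}" using t' s t by auto
    ultimately show False by auto
  qed
  then have "g ` {0<..<s} \<subseteq> S" by auto
  then show thesis by (rule that[OF s(1)])
qed

text \<open>In the application K is the disc and s the ray into it. Near b the curve consists of two
  rays, the germ of s fills one of them, and a short piece of the other stays outside K.\<close>

lemma complementary_ray:
  fixes X V K :: "complex set"
  assumes G: "arc_graph X V" and b: "b \<in> X - V"
    and s: "arc s" "pathstart s = b" "ray s \<subseteq> X \<inter> K" and near: "\<delta> > 0" "X \<inter> K \<inter> ball b \<delta> \<subseteq> insert b (ray s)"
  shows "\<exists>g. arc g \<and> pathstart g = b \<and> ray g \<subseteq> X - V - K \<and> (\<exists>eps>0. (X - K) \<inter> ball b eps \<subseteq> insert b (ray g))"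
proof -
  obtain g1 g2 eps where g: "arc g1" "arc g2" "pathstart g1 = b" "pathstart g2 = b" "ray g1 \<subseteq> X - insert b V" "ray g2 \<subseteq> X - insert b V"
      "ray g1 \<inter> ray g2 = {}" "eps > 0" "X \<inter> ball b eps \<subseteq> insert b (ray g1 \<union> ray g2)"
    using arc_graph_insert(2)[OF G b] by (elim exE conjE) (rule that)
  have ps: "path s" using s(1) by (simp add: arc_def)
  obtain d where d: "0 < d" "d \<le> 1" "s ` {0..d} \<subseteq> ball (pathstart s) eps" by (rule path_near_start[OF ps g(8)])
  define S where "S = s ` {0<..<d}"
  have S: "connected S" "b \<in> closure S" unfolding S_def using path_initial_segment[OF ps d(1,2)] s(2) by auto
  have rs: "ray s = s ` {0<..1}" by (rule ray_eq[OF s(1)])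
  have Ss: "S \<subseteq> ray s" unfolding S_def rs using d(2) by (intro image_mono) auto
  have "S \<subseteq> ball b eps" unfolding S_def using d(3) s(2) by (auto simp: image_subset_iff)
  moreover have "b ~: S" using Ss s(2) by (auto simp: ray_def)
  ultimately have S12: "S \<subseteq> ray g1 \<union> ray g2" using Ss s(3) g(9) by blast
  have avoid: "\<exists>eps>0. S \<inter> ball x eps \<subseteq> ray k" if x: "x \<in> ray k" "ray k \<inter> ray l = {}" "arc l" "pathstart l = b" "x \<in> S" "S \<subseteq> ray k \<union> ray l" for k l x
  proof -
    have "x ~: path_image l" using x \<open>b ~: S\<close> by (auto simp: ray_def)
    moreover have "closed (path_image l)" using x(3) by (intro closed_path_image) (simp add: arc_def)
    ultimately obtain eps where eps: "eps > 0" "ball x eps \<inter> path_image l = {}" by (auto elim: closed_avoiding_ball)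
    then have "S \<inter> ball x eps \<subseteq> ray k" using x(6) unfolding ray_def by blast
    then show ?thesis using eps(1) by blast
  qed
  \<comment> \<open>Off b each of the two rays is relatively open in S, so the connected germ S of s
    lies on one of them.\<close>
  have "S \<inter> ray g1 = {} \<or> S \<inter> ray g2 = {}"
  proof (rule connected_split[OF S(1) S12 g(7)])
    show "\<exists>eps>0. S \<inter> ball x eps \<subseteq> ray g1" if "x \<in> S" "x \<in> ray g1" for x by (rule avoid[OF that(2) g(7,2,4) that(1) S12])
    show "\<exists>eps>0. S \<inter> ball x eps \<subseteq> ray g2" if "x \<in> S" "x \<in> ray g2" for x
      by (rule avoid[OF that(2) _ g(1,3) that(1)]) (use g(7) S12 in auto)
  qed
  then have "S \<subseteq> ray g1 \<or> S \<subseteq> ray g2" using S12 by blast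
  moreover have main: ?thesis
    if k: "arc k" "pathstart k = b" and l: "arc l" "pathstart l = b" "ray l \<subseteq> X - insert b V" and kl: "ray k \<inter> ray l = {}"
      and cover: "X \<inter> ball b eps \<subseteq> insert b (ray k \<union> ray l)" and Sk: "S \<subseteq> ray k" for k l
  proof -
    obtain c where c: "0 < c" "k ` {0<..<c} \<subseteq> S" by (rule connected_contains_initial_segment[OF k(1) S(1) Sk]) (use S(2) k(2) in auto)
    obtain eps1 where e1: "eps1 > 0" "ball b eps1 \<inter> k ` {c..1} = {}" using arc_away_from_start[OF k(1) c(1)] k(2) by metis
    obtain eps2 where e2: "eps2 > 0" "ball b eps2 \<inter> s ` {d..1} = {}" using arc_away_from_start[OF s(1) d(1)] s(2) by metis
    have kS: "ray k \<inter> ball b eps1 \<subseteq> S"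
    proof
      fix x assume x: "x \<in> ray k \<inter> ball b eps1"
      then obtain t where t: "0 < t" "t \<le> 1" "x = k t" using ray_eq[OF k(1)] by auto
      have "\<not> c \<le> t" using e1(2) x t by auto
      then show "x \<in> S" using c(2) t by auto
    qed
    have sS: "ray s \<inter> ball b eps2 \<subseteq> S"
    proof
      fix x assume x: "x \<in> ray s \<inter> ball b eps2"
      then obtain t where t: "0 < t" "t \<le> 1" "x = s t" using rs by auto
      have "\<not> d \<le> t" using e2(2) x t by auto
      then show "x \<in> S" unfolding S_def using t by auto
    qed
    \<comment> \<open>Within \<rho> of b every other point of the curve in K is on s and hence on k,
      so a piece of l this close to b lies outside K.\<close>
    define \<rho> where "\<rho> = min \<delta> eps2"
    have \<rho>: "\<rho> > 0" using near(1) e2(1) by (simp add: \<rho>_def)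
    have pl: "path l" using l(1) by (simp add: arc_def)
    obtain e where e: "0 < e" "e \<le> 1" "l ` {0..e} \<subseteq> ball (pathstart l) \<rho>" by (rule path_near_start[OF pl \<rho>])
    obtain eps3 where e3: "eps3 > 0" "ball b eps3 \<inter> l ` {e..1} = {}" using arc_away_from_start[OF l(1) e(1)] l(2) by metis
    define g where "g = subpath 0 e l"
    have ag: "arc g" unfolding g_def by (rule arc_subpath_arc[OF l(1)]) (use e in auto)
    have "l 0 = b" using l(2) by (simp add: pathstart_def)
    then have bg: "pathstart g = b" by (simp add: g_def)
    have pg: "path_image g = l ` {0..e}" unfolding g_def using e by (simp add: path_image_subpath)
    have "l ` {0..e} \<subseteq> l ` {0..1}" using e(2) by (intro image_mono) auto
    then have rg: "ray g \<subseteq> ray l" unfolding ray_def pg bg l(2) unfolding path_image_def by (rule Diff_mono) simp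
    have gK: "x ~: K" if x: "x \<in> ray g" for x
    proof
      assume "x \<in> K"
      have "x \<in> ball b \<rho>" using x e(3) unfolding ray_def pg l(2) by blast
      then have x2: "x \<in> ball b \<delta>" "x \<in> ball b eps2" by (auto simp: \<rho>_def)
      have xl: "x \<in> ray l" using x rg by auto
      then have "x \<in> X \<inter> K \<inter> ball b \<delta>" "x ~= b" using l(3) \<open>x \<in> K\<close> x2(1) by auto
      then have "x \<in> ray s" using near(2) by auto
      then have "x \<in> ray k" using sS x2(2) Sk by auto
      then show False using kl xl by auto
    qed
    define eps4 where "eps4 = min eps (min eps1 eps3)"
    have "(X - K) \<inter> ball b eps4 \<subseteq> insert b (ray g)"
    proof
      fix x assume x: "x \<in> (X - K) \<inter> ball b eps4"
      then have xb: "x \<in> ball b eps" "x \<in> ball b eps1" "x \<in> ball b eps3" by (auto simp: eps4_def)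
      have "x ~: ray k" using kS xb(2) x order_trans[OF Ss s(3)] by blast
      then have "x = b \<or> x \<in> ray l" using cover x xb(1) by auto
      then show "x \<in> insert b (ray g)"
      proof
        assume "x \<in> ray l"
        then obtain t where t: "0 < t" "t \<le> 1" "x = l t" using ray_eq[OF l(1)] by auto
        have "\<not> e \<le> t" using e3(2) xb(3) t by auto
        then have "x \<in> path_image g" unfolding pg using t by auto
        then show ?thesis by (auto simp: ray_def bg)
      qed simp
    qed
    moreover have "eps4 > 0" using g(8) e1(1) e3(1) by (simp add: eps4_def)
    moreover have "ray g \<subseteq> X - V - K" using rg l(3) gK by auto
    ultimately show ?thesis using ag bg by blast
  qed
  ultimately show ?thesis
    using main[OF g(1,3) g(2,4,6) g(7) g(9)] main[OF g(2,4) g(1,3,5)] g(7,9) by (auto simp: Int_commute Un_commute)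
qed

text \<open>A connected set off the circle lies on one side of it. This makes the outer pieces
  depend on the outside of the disc alone.\<close>

lemma component_avoiding_sphere:
  fixes Y :: "complex set"
  assumes Y: "Y \<inter> sphere 0 1 = {}"
  shows "x \<in> ball 0 1 ==> connected_component_set Y x = connected_component_set (Y \<inter> ball 0 1) x"
    and "x ~: ball 0 1 ==> connected_component_set Y x = connected_component_set (Y - cball 0 1) x"
proof -
  let ?C = "connected_component_set Y x"
  have sub: "?C \<subseteq> Y" by (rule connected_component_subset)
  have d: "ball 0 1 \<inter> ?C = {} \<or> - cball 0 1 \<inter> ?C = {}"
  proof (rule connectedD)
    have "Y \<subseteq> ball 0 1 \<union> - cball 0 1" using Y by (auto simp: less_le)
    then show "?C \<subseteq> ball 0 1 \<union> - cball 0 1" using sub by (rule order_trans[rotated])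
  qed auto
  have id: "?C = connected_component_set Z x" if Z: "Z \<subseteq> Y" "x \<in> Y ==> x \<in> Z \<and> ?C \<subseteq> Z" for Z
  proof (cases "x \<in> Y")
    case True
    have "?C \<subseteq> connected_component_set Z x" using Z(2)[OF True] True by (intro connected_component_maximal) auto
    moreover have "connected_component_set Z x \<subseteq> ?C" by (rule connected_component_mono[OF Z(1)])
    ultimately show ?thesis by (rule equalityI)
  next
    case False
    then have "x ~: Z" using Z(1) by auto
    then have "?C = {}" "connected_component_set Z x = {}"
      using False by (auto simp only: connected_component_eq_empty)
    then show ?thesis by (rule trans[OF _ sym])
  qed
  show "?C = connected_component_set (Y \<inter> ball 0 1) x" if x: "x \<in> ball 0 1"
  proof (rule id)
    assume xY: "x \<in> Y"
    then have "x \<in> ball 0 1 \<inter> ?C" using x by simp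
    then have "- cball 0 1 \<inter> ?C = {}" using d by auto
    then have "?C \<subseteq> cball 0 1" by blast
    moreover have "cball 0 1 \<inter> Y \<subseteq> ball 0 1" using Y by (auto simp: less_le)
    ultimately show "x \<in> Y \<inter> ball 0 1 \<and> ?C \<subseteq> Y \<inter> ball 0 1" using sub xY x by blast
  qed simp
  show "?C = connected_component_set (Y - cball 0 1) x" if x: "x ~: ball 0 1"
  proof (rule id)
    assume xY: "x \<in> Y"
    then have "x ~: sphere 0 1" using Y by blast
    then have xc: "x ~: cball 0 1" using x by auto
    then have "x \<in> - cball 0 1 \<inter> ?C" using xY by simp
    then have "ball 0 1 \<inter> ?C = {}" using d by auto
    moreover have "cball 0 1 \<inter> Y \<subseteq> ball 0 1" using Y by (auto simp: less_le)
    ultimately have "?C \<inter> cball 0 1 = {}" using sub by blast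
    then show "x \<in> Y - cball 0 1 \<and> ?C \<subseteq> Y - cball 0 1" using sub xY xc by blast
  qed simp
qed

lemma filter_mset_constant:
  "(\<And>x. x \<in># M ==> P x) ==> filter_mset P M = M" "(\<And>x. x \<in># M ==> \<not> P x) ==> filter_mset P M = {#}"
  by (induction M) auto

section \<open>Cutting a diagram along the unit circle\<close>

text \<open>\<open>open_inner\<close> excludes closed edges inside the disc. All closed pieces then
  lie outside, so the power of o beside the bracket is common to two diagrams that agree
  there.\<close>

locale disc_subdivision = subdivision D B h ga for D B h ga +
  assumes on_circle: "curve D \<inter> sphere 0 1 = B"
    and inside: "\<And>b. b \<in> B ==> ray (ga b True) \<subseteq> ball 0 1"
    and outside: "\<And>b. b \<in> B ==> ray (ga b False) \<inter> cball 0 1 = {}"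
    and open_inner: "\<And>e. e \<in> components (curve D \<inter> ball 0 1 - crossings D) ==> \<not> closed e"
begin

definition inner_tangle :: "complex set conpoly" where
  "inner_tangle = (\<Prod>v\<in>V \<inter> ball 0 1. expand (sym v)) * (\<Prod>b\<in>B. con (side b True) {b})"

definition outer_tangle :: "complex set conpoly" where
  "outer_tangle = (\<Prod>v\<in>V - ball 0 1. expand (sym v)) * (\<Prod>b\<in>B. con {b} (side b False))"

lemma off_circle: "(X - (V \<union> B)) \<inter> sphere 0 1 = {}"
  using on_circle by blast

lemma inner_set: "(X - (V \<union> B)) \<inter> ball 0 1 = X \<inter> ball 0 1 - V"
  using on_circle by (auto simp: less_le)

lemma outer_set: "X - (V \<union> B) - cball 0 1 = X - V - cball 0 1"
  using on_circle by auto

lemma piece_at: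
  "x \<in> ball 0 1 ==> connected_component_set (X - (V \<union> B)) x = connected_component_set (X \<inter> ball 0 1 - V) x"
  "x ~: ball 0 1 ==> connected_component_set (X - (V \<union> B)) x = connected_component_set (X - V - cball 0 1) x"
  using component_avoiding_sphere[OF off_circle, of x] unfolding inner_set outer_set by auto

lemma piece_cases:
  assumes "e \<in> pieces"
  shows "e \<subseteq> ball 0 1 \<and> e \<in> components (X \<inter> ball 0 1 - V) \<or> e \<inter> cball 0 1 = {} \<and> e \<in> components (X - V - cball 0 1)"
proof -
  obtain x where x: "x \<in> X - (V \<union> B)" "e = connected_component_set (X - (V \<union> B)) x"
    using assms unfolding pieces_def components_def by (rule imageE)
  show ?thesis
  proof (cases "x \<in> ball 0 1")
    case True
    have "x \<in> X \<inter> ball 0 1 - V" using x(1) True by auto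
    then have "e \<in> components (X \<inter> ball 0 1 - V)" unfolding x(2) piece_at(1)[OF True] components_def by (rule imageI)
    moreover have "e \<subseteq> X \<inter> ball 0 1 - V" unfolding x(2) piece_at(1)[OF True] by (rule connected_component_subset)
    ultimately show ?thesis by auto
  next
    case False
    have "x ~: sphere 0 1" using off_circle x(1) by blast
    then have "x \<in> X - V - cball 0 1" using x(1) False by auto
    then have "e \<in> components (X - V - cball 0 1)" unfolding x(2) piece_at(2)[OF False] components_def by (rule imageI)
    moreover have "e \<subseteq> X - V - cball 0 1" unfolding x(2) piece_at(2)[OF False] by (rule connected_component_subset)
    ultimately show ?thesis by auto
  qed
qed

lemma outer_pieces: "components (X - V - cball 0 1) \<subseteq> pieces"
proof
  fix e assume "e \<in> components (X - V - cball 0 1)"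
  then obtain x where x: "x \<in> X - V - cball 0 1" "e = connected_component_set (X - V - cball 0 1) x"
    unfolding components_def by (rule imageE)
  have "x ~: ball 0 1" "x \<in> X - (V \<union> B)" using x(1) on_circle by auto
  then show "e \<in> pieces" unfolding x(2) piece_at(2)[OF \<open>x ~: ball 0 1\<close>, symmetric] pieces_def components_def by (intro imageI)
qed

lemma arcs_eq: "arcs = {e \<in> pieces. \<not> closed_edge e}"
  using graph(2) arc_edge_not_closed_edge piece by (fastforce simp: arcs_def arc_graph_def pieces_def)

lemma closed_pieces: "pieces - arcs = {e \<in> components (X - V - cball 0 1). closed_edge e}"
proof (intro equalityI subsetI)
  fix e assume "e \<in> pieces - arcs"
  then have e: "e \<in> pieces" "closed_edge e" by (auto simp: arcs_eq)
  then have "\<not> e \<in> components (X \<inter> ball 0 1 - V)" using open_inner closed_edge_closed by auto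
  then show "e \<in> {e \<in> components (X - V - cball 0 1). closed_edge e}" using piece_cases[OF e(1)] e(2) by auto
next
  fix e assume "e \<in> {e \<in> components (X - V - cball 0 1). closed_edge e}"
  then show "e \<in> pieces - arcs" using outer_pieces by (auto simp: arcs_eq)
qed

lemma off_circle_V: "v \<in> V ==> v ~: ball 0 1 ==> v ~: cball 0 1"
  using on_circle B graph(1) by (auto simp: arc_graph_def)

text \<open>The rays of v start at v, so they meet the side of the circle on which v lies, and a
  piece never changes sides.\<close>

lemma corners_inside:
  assumes v: "v \<in> V" and e: "e \<in># corners (sym v)" shows "e \<subseteq> ball 0 1 \<longleftrightarrow> v \<in> ball 0 1"
proof -
  obtain u where u: "u \<in> axis_units" "e = ray_label (Inl (v, u))"
    using e unfolding corners_sym[OF v] by (auto simp: axis_units_def)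
  have j: "Inl (v, u) \<in> ray_index" using v u by (auto simp: ray_index_def)
  have p: "e \<in> pieces" "ray (chart_ray (h v) u) \<subseteq> e" using ray_label(1,2)[OF j] u(2) by auto
  have cl: "v \<in> closure (ray (chart_ray (h v) u))"
    using ray_closure[OF ray_path(1)[OF j]] chart_ray(2)[OF chart[OF v] u(1)] by simp
  have meet: "W \<inter> ray (chart_ray (h v) u) ~= {}" if "open W" "v \<in> W" for W
    using that cl open_Int_closure_eq_empty[of W] by blast
  have ne: "e ~= {}" using piece[OF p(1)] by auto
  show ?thesis
  proof (cases "v \<in> ball 0 1")
    case True
    then have "ball 0 1 \<inter> e ~= {}" using meet[of "ball 0 1"] p(2) by auto
    then show ?thesis using piece_cases[OF p(1)] True ball_subset_cball[of 0 1] by blast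
  next
    case False
    then have "v \<in> - cball 0 1" using off_circle_V[OF v] by auto
    then have "- cball 0 1 \<inter> e ~= {}" using meet[of "- cball 0 1"] p(2) by auto
    then show ?thesis using False ball_subset_cball[of 0 1] by blast
  qed
qed

lemma side_inside: assumes "b \<in> B" shows "side b True \<subseteq> ball 0 1" "\<not> side b False \<subseteq> ball 0 1"
proof -
  have a: "arc (ga b i)" for i using arc[OF assms] by simp
  have "side b True \<inter> ball 0 1 ~= {}"
    using pathfinish_in_ray[OF a] side_piece(2)[OF assms] inside[OF assms] by blast
  then show "side b True \<subseteq> ball 0 1" using piece_cases[OF side_piece(1)[OF assms]] ball_subset_cball[of 0 1] by blast
  show "\<not> side b False \<subseteq> ball 0 1"
    using pathfinish_in_ray[OF a] side_piece(2)[OF assms] outside[OF assms] ball_subset_cball[of 0 1] by blast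
qed

lemma side_at: assumes "b \<in> B"
  shows "side b True = connected_component_set (X \<inter> ball 0 1 - V) (pathfinish (ga b True))"
    "side b False = connected_component_set (X - V - cball 0 1) (pathfinish (ga b False))"
proof -
  have a: "arc (ga b i)" for i using arc[OF assms] by simp
  have "pathfinish (ga b True) \<in> ball 0 1" using pathfinish_in_ray[OF a] inside[OF assms] by blast
  then show "side b True = connected_component_set (X \<inter> ball 0 1 - V) (pathfinish (ga b True))"
    unfolding side_def edge_at_def subdiv_simps by (rule piece_at(1))
  have "pathfinish (ga b False) ~: ball 0 1" using pathfinish_in_ray[OF a] outside[OF assms] ball_subset_cball[of 0 1] by blast
  then show "side b False = connected_component_set (X - V - cball 0 1) (pathfinish (ga b False))"
    unfolding side_def edge_at_def subdiv_simps by (rule piece_at(2))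
qed

lemma ss_tangles: "ss D = bracket (inner_tangle * outer_tangle) * Var Vo ^ card {e \<in> components (X - V - cball 0 1). closed_edge e}"
proof -
  have "(\<Prod>v\<in>V. expand (sym v)) = (\<Prod>v\<in>V \<inter> ball 0 1. expand (sym v)) * (\<Prod>v\<in>V - ball 0 1. expand (sym v))"
    by (rule prod.Int_Diff[OF graph(3)])
  moreover have "collar_poly = (\<Prod>b\<in>B. con (side b True) {b}) * (\<Prod>b\<in>B. con {b} (side b False))"
    unfolding collar_poly_def by (rule prod.distrib)
  ultimately have "(\<Prod>v\<in>V. expand (sym v)) * collar_poly = inner_tangle * outer_tangle"
    by (simp only: inner_tangle_def outer_tangle_def ac_simps)
  then show ?thesis using ss_subdivided by (simp only: closed_pieces)
qed

text \<open>Every piece lies on one side of the circle, so filtering the identity of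
  \<open>ends_total\<close> by the side splits it into an inner and an outer count.\<close>

lemma tangles_homogeneous:
  "\<exists>N. homogeneous inner_tangle N \<and> inner_twice ((\<lambda>b. {b}) ` B) N {e \<in> arcs. e \<subseteq> ball 0 1}"
  "\<exists>N. homogeneous outer_tangle N \<and> inner_twice ((\<lambda>b. {b}) ` B) N {e \<in> arcs. \<not> e \<subseteq> ball 0 1}"
proof -
  let ?P = "\<lambda>e :: complex set. e \<subseteq> ball 0 1"
  let ?I = "(\<Sum>v\<in>V \<inter> ball 0 1. corners (sym v)) + (\<Sum>b\<in>B. {#side b True#})"
  let ?O = "(\<Sum>v\<in>V - ball 0 1. corners (sym v)) + (\<Sum>b\<in>B. {#side b False#})"
  have fV: "finite (V \<inter> ball 0 1)" "finite (V - ball 0 1)" using graph(3) by auto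
  have "(\<Sum>v\<in>V. corners (sym v)) = (\<Sum>v\<in>V \<inter> ball 0 1. corners (sym v)) + (\<Sum>v\<in>V - ball 0 1. corners (sym v))"
    by (rule sum.Int_Diff[OF graph(3)])
  moreover have "(\<Sum>b\<in>B. {#side b True, side b False#}) = (\<Sum>b\<in>B. {#side b True#}) + (\<Sum>b\<in>B. {#side b False#})"
    by (simp add: sum.distrib[symmetric] add_mset_commute)
  ultimately have tot: "?I + ?O = mset_set arcs + mset_set arcs" using ends_total by (simp only: ac_simps)
  have inI: "?P e" if e: "e \<in># ?I" for e
  proof -
    consider v where "v \<in> V \<inter> ball 0 1" "e \<in># corners (sym v)" | b where "b \<in> B" "e = side b True"
      using e by (auto simp: set_mset_sum_UN[OF fV(1)] set_mset_sum_UN[OF fin_B])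
    then show ?thesis
    proof cases
      case (1 v)
      then show ?thesis using corners_inside[of v e] by simp
    next
      case (2 b)
      then show ?thesis using side_inside(1)[of b] by simp
    qed
  qed
  have inO: "\<not> ?P e" if e: "e \<in># ?O" for e
  proof -
    consider v where "v \<in> V - ball 0 1" "e \<in># corners (sym v)" | b where "b \<in> B" "e = side b False"
      using e by (auto simp: set_mset_sum_UN[OF fV(2)] set_mset_sum_UN[OF fin_B])
    then show ?thesis
    proof cases
      case (1 v)
      then show ?thesis using corners_inside[of v e] by simp
    next
      case (2 b)
      then show ?thesis using side_inside(2)[of b] by simp
    qed
  qed
  have fI: "filter_mset ?P ?I = ?I" "filter_mset (\<lambda>e. \<not> ?P e) ?I = {#}"
    by (rule filter_mset_constant, use inI in blast)+
  have fO: "filter_mset ?P ?O = {#}" "filter_mset (\<lambda>e. \<not> ?P e) ?O = ?O"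
    by (rule filter_mset_constant, use inO in blast)+
  have "?I = filter_mset ?P (?I + ?O)" unfolding filter_union_mset[of _ ?I ?O] fI fO by simp
  also have "\<dots> = mset_set {e \<in> arcs. ?P e} + mset_set {e \<in> arcs. ?P e}" unfolding tot using arcs_marks(1) by simp
  finally have I: "?I = mset_set {e \<in> arcs. ?P e} + mset_set {e \<in> arcs. ?P e}" .
  have "?O = filter_mset (\<lambda>e. \<not> ?P e) (?I + ?O)" unfolding filter_union_mset[of _ ?I ?O] fI fO by simp
  also have "\<dots> = mset_set {e \<in> arcs. \<not> ?P e} + mset_set {e \<in> arcs. \<not> ?P e}" unfolding tot using arcs_marks(1) by simp
  finally have O: "?O = mset_set {e \<in> arcs. \<not> ?P e} + mset_set {e \<in> arcs. \<not> ?P e}" .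
  have S: "mset_set ((\<lambda>b. {b}) ` B) = (\<Sum>b\<in>B. {#{b}#})" by (rule mset_set_image_sum[OF fin_B]) simp
  have tw: "inner_twice ((\<lambda>b. {b}) ` B) (mset_set ((\<lambda>b. {b}) ` B) + (mset_set {e \<in> arcs. Q e} + mset_set {e \<in> arcs. Q e})) {e \<in> arcs. Q e}" for Q
    unfolding inner_twice_def using arcs_marks fin_B by auto
  have "homogeneous inner_tangle ((\<Sum>v\<in>V \<inter> ball 0 1. corners (sym v)) + (\<Sum>b\<in>B. {#side b True, {b}#}))"
    unfolding inner_tangle_def by (intro homogeneous_times homogeneous_prod homogeneous_expand homogeneous_con)
  also have "(\<Sum>v\<in>V \<inter> ball 0 1. corners (sym v)) + (\<Sum>b\<in>B. {#side b True, {b}#}) = mset_set ((\<lambda>b. {b}) ` B) + ?I"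
    unfolding S by (simp add: sum.distrib[symmetric] ac_simps)
  finally have H: "homogeneous inner_tangle (mset_set ((\<lambda>b. {b}) ` B) + ?I)" .
  show "\<exists>N. homogeneous inner_tangle N \<and> inner_twice ((\<lambda>b. {b}) ` B) N {e \<in> arcs. e \<subseteq> ball 0 1}"
    by (rule exI, rule conjI[OF H[unfolded I] tw[of ?P]])
  have "homogeneous outer_tangle ((\<Sum>v\<in>V - ball 0 1. corners (sym v)) + (\<Sum>b\<in>B. {#{b}, side b False#}))"
    unfolding outer_tangle_def by (intro homogeneous_times homogeneous_prod homogeneous_expand homogeneous_con)
  also have "(\<Sum>v\<in>V - ball 0 1. corners (sym v)) + (\<Sum>b\<in>B. {#{b}, side b False#}) = mset_set ((\<lambda>b. {b}) ` B) + ?O"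
    unfolding S by (simp add: sum.distrib[symmetric] ac_simps)
  finally have H: "homogeneous outer_tangle (mset_set ((\<lambda>b. {b}) ` B) + ?O)" .
  show "\<exists>N. homogeneous outer_tangle N \<and> inner_twice ((\<lambda>b. {b}) ` B) N {e \<in> arcs. \<not> e \<subseteq> ball 0 1}"
    by (rule exI, rule conjI[OF H[unfolded O] tw[of "\<lambda>e. \<not> ?P e"]])
qed

end

text \<open>Equal charts and equal arcs outside the disc make the outer tangles literally equal, so
  that \<open>tangle_equiv_bracket\<close> compares the inner ones.\<close>

lemma disc_subdivision_replace:
  assumes "disc_subdivision D B h ga" "disc_subdivision D' B h' ga'"
    and agree: "agree_outside (cball 0 1) D D'"
    and charts: "\<And>v. v \<in> crossings D - ball 0 1 ==> h' v = h v \<and> inv (h v) ` ball 0 1 \<inter> cball 0 1 = {}"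
    and rays: "\<And>b. b \<in> B ==> ga' b False = ga b False"
    and equiv: "tangle_equiv ((\<lambda>b. {b}) ` B) (disc_subdivision.inner_tangle D B h ga) (disc_subdivision.inner_tangle D' B h' ga')"
  shows "ss D - ss D' \<in> I_infinity"
proof -
  interpret S: disc_subdivision D B h ga by fact
  interpret S': disc_subdivision D' B h' ga' by fact
  have eq: "curve D - crossings D - cball 0 1 = curve D' - crossings D' - cball 0 1"
    "crossings D - cball 0 1 = crossings D' - cball 0 1" "curve D - cball 0 1 = curve D' - cball 0 1" "shaded D - cball 0 1 = shaded D' - cball 0 1"
    using agree by (auto simp: agree_outside_def)
  have V: "crossings D - ball 0 1 = crossings D' - ball 0 1"
    using eq(2) S.off_circle_V S'.off_circle_V ball_subset_cball[of 0 1] by blast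
  have sym: "S'.sym v = S.sym v" if v: "v \<in> crossings D - ball 0 1" for v
  proof -
    have c: "crossing_chart (subdiv D B) v (h v)" using v by (intro S.chart) simp
    have img: "inv (h v) z ~: cball 0 1" if "z \<in> ball 0 1" for z using charts[OF v] that by blast
    have edge: "edge_at (subdiv D' B) (inv (h v) (u / 2)) = edge_at (subdiv D B) (inv (h v) (u / 2))" if "u \<in> axis_units" for u
    proof -
      have "inv (h v) (u / 2) ~: cball 0 1" by (rule img) (use that in \<open>auto simp: axis_units_def\<close>)
      then have "inv (h v) (u / 2) ~: ball 0 1" using ball_subset_cball[of 0 1] by blast
      from S.piece_at(2)[OF this] S'.piece_at(2)[OF this] show ?thesis unfolding edge_at_def subdiv_simps eq(1) by simp
    qed
    have sh: "inv (h v) ` A \<subseteq> shaded D' \<longleftrightarrow> inv (h v) ` A \<subseteq> shaded D" if A: "A \<subseteq> ball 0 1" for A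
    proof -
      have "x \<in> shaded D' \<longleftrightarrow> x \<in> shaded D" if "x \<in> inv (h v) ` A" for x
      proof -
        have "x ~: cball 0 1" using img A that by auto
        then show ?thesis using eq(4) by blast
      qed
      then show ?thesis by blast
    qed
    show ?thesis
      unfolding S.sym_def S'.sym_def charts[OF v, THEN conjunct1] chart_symbol_def Let_def subdiv_simps
      using edge[of \<i>] edge[of "-1"] edge[of "-\<i>"] edge[of 1] sh[of "{z \<in> ball 0 1. Re z * Im z > 0}"]
      by (simp add: axis_units_def subset_iff)
  qed
  have side: "S'.side b False = S.side b False" if "b \<in> B" for b
    unfolding S.side_at(2)[OF that] S'.side_at(2)[OF that] rays[OF that] eq(1) ..
  have outer: "S'.outer_tangle = S.outer_tangle"
    unfolding S.outer_tangle_def S'.outer_tangle_def V[symmetric]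
    by (intro arg_cong2[of _ _ _ _ "(*)"] prod.cong refl) (simp_all add: sym side)
  obtain N where N: "homogeneous S.inner_tangle N" "inner_twice ((\<lambda>b. {b}) ` B) N {e \<in> S.arcs. e \<subseteq> ball 0 1}"
    using S.tangles_homogeneous(1) by (elim exE conjE) (rule that)
  obtain N' where N': "homogeneous S'.inner_tangle N'" "inner_twice ((\<lambda>b. {b}) ` B) N' {e \<in> S'.arcs. e \<subseteq> ball 0 1}"
    using S'.tangles_homogeneous(1) by (elim exE conjE) (rule that)
  obtain K where K: "homogeneous S.outer_tangle K" "inner_twice ((\<lambda>b. {b}) ` B) K {e \<in> S.arcs. \<not> e \<subseteq> ball 0 1}"
    using S.tangles_homogeneous(2) by (elim exE conjE) (rule that)
  have "bracket (S.inner_tangle * S.outer_tangle) - bracket (S'.inner_tangle * S.outer_tangle) \<in> I_infinity"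
    by (rule tangle_equiv_bracket[OF equiv N N' K]) auto
  from I_infinity_times[OF this, of "Var Vo ^ card {e \<in> components (curve D - crossings D - cball 0 1). closed_edge e}"]
  show ?thesis unfolding S.ss_tangles S'.ss_tangles outer eq(1)[symmetric] by (simp add: algebra_simps)
qed

section \<open>Absorbing the arcs at the boundary\<close>

lemma relabel_relabel: "relabel f (relabel g P) = relabel (f \<circ> g) P"
proof -
  have "relabel f (relabel g P) = (\<Sum>m\<in>Poly_Mapping.keys P.
      Poly_Mapping.single (image_mset (map_uprod (f \<circ> g)) m) (Poly_Mapping.lookup P m))"
    by (simp add: relabel_def[of g] relabel_sum relabel_single image_mset.compositionality uprod.map_comp comp_def)
  then show ?thesis by (simp only: relabel_def[of "f \<circ> g"])
qed

lemma homogeneous_relabel: assumes "homogeneous P N" shows "homogeneous (relabel g P) (image_mset g N)"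
proof -
  have "homogeneous (\<Sum>m\<in>K. Poly_Mapping.single (image_mset (map_uprod g) m) (Poly_Mapping.lookup P m)) (image_mset g N)"
    if "finite K" "K \<subseteq> Poly_Mapping.keys P" for K
    using that
  proof (induction K rule: finite_induct)
    case empty then show ?case by (simp add: homogeneous_def)
  next
    case (insert m K)
    have "ends m = N" using insert.prems assms by (simp add: homogeneous_def)
    then have "homogeneous (Poly_Mapping.single (image_mset (map_uprod g) m) (Poly_Mapping.lookup P m)) (image_mset g N)"
      using homogeneous_single[of "image_mset (map_uprod g) m"] by (simp add: ends_image_mset)
    then show ?case using insert by (simp add: homogeneous_add)
  qed
  then show ?thesis unfolding relabel_def by simp
qed

text \<open>Repeated use of \<open>bracket_times_con\<close>. No s i is a t j, so the substitutions
  do not interfere and compose to g.\<close>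

lemma bracket_join:
  fixes s t :: "'i => 'l"
  assumes "finite B" "inj_on s B" "\<And>i j. i \<in> B ==> j \<in> B ==> s i ~= t j"
    and "homogeneous P N" "N + (\<Sum>i\<in>B. {#s i, t i#}) = mset_set Y + mset_set Y"
    and "\<And>i. i \<in> B ==> g (s i) = t i" "\<And>x. x ~: s ` B ==> g x = x"
  shows "bracket (P * (\<Prod>i\<in>B. con (s i) (t i))) = bracket (relabel g P)"
  using assms
proof (induction B arbitrary: P N Y g rule: finite_induct)
  case empty
  have "g = (\<lambda>x. x)" using empty.prems(6) by auto
  moreover have "map_uprod (\<lambda>x :: 'l. x) = (\<lambda>u. u)" by (rule ext, rule uprod.map_ident)
  then have "relabel (\<lambda>x. x) P = P"
    by (simp add: relabel_def poly_mapping_sum_single[symmetric])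
  ultimately show ?case by simp
next
  case (insert i F)
  let ?k = "id(s i := t i)" and ?PF = "\<Prod>j\<in>F. con (s j) (t j)" and ?SF = "\<Sum>j\<in>F. {#s j, t j#}"
  let ?Y = "Y - {s i}"
  \<comment> \<open>The substitution that remains after s i has been renamed to t i; composed with
    \<open>?k\<close> it is g.\<close>
  define g' where "g' = (\<lambda>x. if x \<in> s ` F then g x else x)"
  have ne: "s j ~= s i" if "j \<in> F" for j using insert.prems(1) insert.hyps(2) that by (auto simp: inj_on_def)
  have st: "s i' ~= t j" if "i' \<in> insert i F" "j \<in> insert i F" for i' j using insert.prems(2) that by simp
  have tot: "(N + ?SF) + {#s i, t i#} = mset_set Y + mset_set Y"
    using insert.prems(4) insert.hyps by (simp add: ac_simps)
  have memY: "s i \<in># mset_set Y" "t i \<in># mset_set Y"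
  proof -
    have "s i \<in># mset_set Y + mset_set Y" "t i \<in># mset_set Y + mset_set Y" unfolding tot[symmetric] by simp_all
    then show "s i \<in># mset_set Y" "t i \<in># mset_set Y" by simp_all
  qed
  have fY: "finite Y" using memY(1) by (metis empty_iff mset_set.infinite set_mset_empty)
  have kfix: "?k (s j) = s j" "?k (t j) = t j" if "j \<in> F" for j using ne[OF that] st[of i j] that by auto
  have "bracket (P * (\<Prod>j\<in>insert i F. con (s j) (t j))) = bracket ((P * ?PF) * con (s i) (t i))"
    using insert.hyps by (simp add: ac_simps)
  also have "\<dots> = bracket (relabel ?k (P * ?PF))"
  proof (rule bracket_times_con[OF _ tot])
    show "homogeneous (P * ?PF) (N + ?SF)"
      by (intro homogeneous_times homogeneous_prod homogeneous_con insert.prems(3))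
  qed (use st in simp)
  also have "relabel ?k (P * ?PF) = relabel ?k P * ?PF"
    unfolding relabel_times relabel_prod relabel_con_arc by (simp add: kfix cong: prod.cong del: fun_upd_apply)
  also have "bracket (relabel ?k P * ?PF) = bracket (relabel g' (relabel ?k P))"
  proof (rule insert.IH)
    show "inj_on s F" using insert.prems(1) by simp
    show "s i' ~= t j" if "i' \<in> F" "j \<in> F" for i' j using st that by simp
    show "homogeneous (relabel ?k P) (image_mset ?k N)" by (rule homogeneous_relabel[OF insert.prems(3)])
    show "image_mset ?k N + ?SF = mset_set ?Y + mset_set ?Y"
    proof -
      have "image_mset ?k ?SF = ?SF"
        unfolding image_mset_sum[OF insert.hyps(1)] by (rule sum.cong) (simp_all add: kfix del: fun_upd_apply)
      then have 1: "image_mset ?k ((N + ?SF) + {#s i, t i#}) = image_mset ?k N + ?SF + {#t i, t i#}"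
        using st[of i i] by simp
      have Y: "mset_set Y = add_mset (s i) (add_mset (t i) (mset_set (Y - {s i} - {t i})))"
        using memY fY st[of i i] mset_set.remove[of Y "s i"] mset_set.remove[of "Y - {s i}" "t i"] by simp
      have "image_mset ?k (mset_set (Y - {s i} - {t i})) = mset_set (Y - {s i} - {t i})"
        using fY by (intro multiset.map_ident_strong) auto
      then have "image_mset ?k (mset_set Y) = add_mset (t i) (add_mset (t i) (mset_set (Y - {s i} - {t i})))"
        unfolding Y using st[of i i] by simp
      also have "\<dots> = add_mset (t i) (mset_set ?Y)"
        using memY fY st[of i i] mset_set.remove[of "Y - {s i}" "t i"] by simp
      finally have "image_mset ?k N + ?SF + {#t i, t i#} = mset_set ?Y + mset_set ?Y + {#t i, t i#}"
        using 1 unfolding tot by simp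
      then show ?thesis by simp
    qed
    show "g' (s j) = t j" if "j \<in> F" for j using insert.prems(5) that by (simp add: g'_def)
    show "g' x = x" if "x ~: s ` F" for x using that by (simp add: g'_def)
  qed
  also have "relabel g' (relabel ?k P) = relabel g P"
  proof -
    have "g' \<circ> ?k = g"
    proof
      fix x
      have "t i ~: s ` F" using st by force
      moreover have "s i ~: s ` F" using ne by force
      ultimately show "(g' \<circ> ?k) x = g x"
        using insert.prems(5)[of i] insert.prems(6)[of x] by (auto simp: g'_def)
    qed
    then show ?thesis by (simp add: relabel_relabel)
  qed
  finally show ?case .
qed

lemma tangle_equiv_trans: "tangle_equiv B P Q ==> tangle_equiv B Q R ==> tangle_equiv B P R"
  unfolding tangle_equiv_def by (meson I_infinity_trans)

text \<open>Lets the formal arcs to the cut points disappear: the outer edges s i of the tangle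
  simply take the boundary labels t i.\<close>

lemma tangle_join:
  fixes s t :: "'i => 'l"
  assumes B: "finite B" "inj_on s B" "inj_on t B" and st: "\<And>i j. i \<in> B ==> j \<in> B ==> s i ~= t j"
    and P: "homogeneous P (mset_set (s ` B) + (mset_set I + mset_set I))" and I: "finite I" "I \<inter> s ` B = {}" "I \<inter> t ` B = {}"
    and g: "\<And>i. i \<in> B ==> g (s i) = t i" "\<And>x. x ~: s ` B ==> g x = x"
  shows "tangle_equiv (t ` B) (P * (\<Prod>i\<in>B. con (s i) (t i))) (relabel g P)"
  unfolding tangle_equiv_def
proof (intro allI impI)
  fix M assume M: "perfect_matching (t ` B) M"
  let ?M = "\<Prod>u\<in>M. con_arc u"
  have fT: "finite (t ` B)" using B(1) by simp
  have dis: "s ` B \<inter> t ` B = {}" using st by (auto simp: disjoint_iff)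
  have "bracket ((P * ?M) * (\<Prod>i\<in>B. con (s i) (t i))) = bracket (relabel g (P * ?M))"
  proof (rule bracket_join[OF B(1,2) st homogeneous_times[OF P homogeneous_matching[OF M fT]] _ g])
    have "(\<Sum>i\<in>B. {#s i, t i#}) = (\<Sum>i\<in>B. {#s i#}) + (\<Sum>i\<in>B. {#t i#})"
      by (simp add: sum.distrib[symmetric] add_mset_commute)
    then have 1: "(\<Sum>i\<in>B. {#s i, t i#}) = mset_set (s ` B) + mset_set (t ` B)"
      by (simp only: mset_set_image_sum[OF B(1,2)] mset_set_image_sum[OF B(1,3)])
    have "(I \<union> s ` B) \<inter> t ` B = {}" using I dis by blast
    then have 2: "mset_set (I \<union> s ` B \<union> t ` B) = mset_set I + mset_set (s ` B) + mset_set (t ` B)"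
      using I B(1) by (simp add: mset_set_Union)
    show "mset_set (s ` B) + (mset_set I + mset_set I) + mset_set (t ` B) + (\<Sum>i\<in>B. {#s i, t i#})
        = mset_set (I \<union> s ` B \<union> t ` B) + mset_set (I \<union> s ` B \<union> t ` B)"
      unfolding 1 2 by (simp only: ac_simps)
  qed auto
  also have "relabel g (P * ?M) = relabel g P * ?M"
  proof -
    have "g x = x" if "x \<in> t ` B" for x using g(2) dis that by blast
    then show ?thesis unfolding relabel_times using relabel_matching[OF M, of g] by simp
  qed
  finally have "bracket (P * (\<Prod>i\<in>B. con (s i) (t i)) * ?M) = bracket (relabel g P * ?M)" by (simp add: ac_simps)
  then show "bracket (P * (\<Prod>i\<in>B. con (s i) (t i)) * ?M) - bracket (relabel g P * ?M) \<in> I_infinity"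
    by (simp add: I_infinity_zero)
qed

lemma tangle_rename_inner:
  assumes P: "homogeneous P (mset_set B + (mset_set I + mset_set I))" and fin: "finite B" "finite I" "B \<inter> I = {}"
    and k: "inj_on k (B \<union> I)" "\<And>x. x \<in> B ==> k x = x"
  shows "tangle_equiv B P (relabel k P)"
  unfolding tangle_equiv_def
proof (intro allI impI)
  fix M assume M: "perfect_matching B M"
  let ?M = "\<Prod>u\<in>M. con_arc u"
  have "mset_set B + (mset_set I + mset_set I) + mset_set B = mset_set (B \<union> I) + mset_set (B \<union> I)"
    using fin by (simp add: mset_set_Union ac_simps)
  then have "homogeneous (P * ?M) (mset_set (B \<union> I) + mset_set (B \<union> I))"
    using homogeneous_times[OF P homogeneous_matching[OF M fin(1)]] by simp
  then have "bracket (relabel k (P * ?M)) = bracket (P * ?M)"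
    by (rule bracket_relabel) (use fin k in auto)
  then show "bracket (P * ?M) - bracket (relabel k P * ?M) \<in> I_infinity"
    using relabel_matching[OF M k(2)] by (simp add: relabel_times I_infinity_zero)
qed

text \<open>A straight edge through \<open>q\<close> separates the two shades.\<close>

lemma shade_flip:
  assumes D: "checkerboard D" and q: "q \<in> curve D - crossings D" and \<delta>: "\<delta> > 0"
    and line: "\<And>z. z \<in> ball q \<delta> ==> z \<in> curve D \<longleftrightarrow> Im (cnj u * (z - q)) = 0"
    and z: "z1 \<in> ball q \<delta>" "z2 \<in> ball q \<delta>" "Im (cnj u * (z1 - q)) > 0" "Im (cnj u * (z2 - q)) < 0"
  shows "z1 \<in> shaded D \<longleftrightarrow> z2 ~: shaded D"
proof -
  \<comment> \<open>Up to a positive factor \<open>Im (cnj u * (z - q))\<close> is the signed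
    distance from the line through q in direction u, so c = 1 and c = -1 give the two half
    discs.\<close>
  let ?H = "\<lambda>c. ball q \<delta> \<inter> {z. c * Im (cnj u * (z - q)) > 0}"
  have cv: "convex (?H c)" for c
  proof (rule convex_Int)
    have "{z. c * Im (cnj u * (z - q)) > 0} = {z. inner (of_real c * (\<i> * u)) z > c * Im (cnj u * q)}"
      by (auto simp: inner_complex_def algebra_simps)
    then show "convex {z. c * Im (cnj u * (z - q)) > 0}" using convex_halfspace_gt by simp
  qed simp
  have same: "x \<in> shaded D \<longleftrightarrow> y \<in> shaded D" if "x \<in> ?H c" "y \<in> ?H c" for x y c
  proof (rule shaded_connected[OF D convex_connected[OF cv[of c]] _ that])
    show "?H c \<inter> curve D = {}" using line by fastforce
  qed
  have e: "edge_at D q \<in> edges D" "q \<in> edge_at D q" using edge_at_component[OF q] edge_at_in[OF q] by (auto simp: edges_def)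
  have W: "open (ball q \<delta>)" "q \<in> ball q \<delta>" using \<delta> by auto
  have split: "x \<in> ?H 1 \<or> x \<in> ?H (-1)" if "x \<in> ball q \<delta> - curve D" for x
    using that line[of x] by auto
  have z': "z1 \<in> ?H 1" "z2 \<in> ?H (-1)" using z by auto
  obtain x y where xy: "x \<in> ball q \<delta> - curve D" "x \<in> shaded D" "y \<in> ball q \<delta> - curve D" "y ~: shaded D"
    using both_shades[OF D e W] by blast
  have "(x \<in> shaded D \<longleftrightarrow> z1 \<in> shaded D) \<or> (x \<in> shaded D \<longleftrightarrow> z2 \<in> shaded D)"
    using split[OF xy(1)] same[OF _ z'(1)] same[OF _ z'(2)] by blast
  moreover have "(y \<in> shaded D \<longleftrightarrow> z1 \<in> shaded D) \<or> (y \<in> shaded D \<longleftrightarrow> z2 \<in> shaded D)"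
    using split[OF xy(3)] same[OF _ z'(1)] same[OF _ z'(2)] by blast
  ultimately show ?thesis using xy(2,4) by blast
qed

lemma shaded_connected_image:
  assumes "checkerboard D" "connected R" "continuous_on R f" "f ` R \<inter> curve D = {}" "x \<in> R" "y \<in> R"
  shows "f x \<in> shaded D \<longleftrightarrow> f y \<in> shaded D"
  by (rule shaded_connected[OF assms(1) connected_continuous_image[OF assms(3,2)] assms(4)]) (use assms(5,6) in auto)

text \<open>A version of \<open>straight_crossing\<close> for diagrams whose overpass is prescribed
  only as the germ of a set S, as in a picture.\<close>

lemma crossing_in_disc:
  fixes u w :: complex
  assumes D: "checkerboard D" and uw: "Im (cnj u * w) > 0" and r: "r > 0" and germ: "same_germ p (overpass D p) S"
    and curve: "\<And>x y. \<bar>x\<bar> < r ==> \<bar>y\<bar> < r ==> p + of_real x * u + of_real y * w \<in> curve D \<longleftrightarrow> x = 0 \<or> y = 0"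
    and cross: "\<And>x y. \<bar>x\<bar> < r ==> \<bar>y\<bar> < r ==> p + of_real x * u + of_real y * w \<in> crossings D \<longleftrightarrow> x = 0 \<and> y = 0"
    and over: "\<And>x y. \<bar>x\<bar> < r ==> \<bar>y\<bar> < r ==> p + of_real x * u + of_real y * w \<in> S \<longleftrightarrow> (if ov then y = 0 else x = 0)"
    and ends: "\<And>t. 0 < t ==> t < r ==> edge_at D (p + of_real t * u) = e1"
      "\<And>t. 0 < t ==> t < r ==> edge_at D (p + of_real t * w) = e2"
      "\<And>t. 0 < t ==> t < r ==> edge_at D (p - of_real t * u) = e3"
      "\<And>t. 0 < t ==> t < r ==> edge_at D (p - of_real t * w) = e4"
    and shade: "\<And>t. 0 < t ==> t < r ==> p + of_real t * u + of_real t * w \<in> shaded D \<longleftrightarrow> sh"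
  shows "\<exists>h. crossing_chart D p h \<and> expand (chart_symbol D h) = expand (sym4 ov sh e1 e2 e3 e4)"
proof -
  obtain d where d: "d > 0" "\<And>z. dist z p < d ==> z \<in> overpass D p \<longleftrightarrow> z \<in> S"
    using germ unfolding same_germ_def eventually_nhds_metric by auto
  \<comment> \<open>A point with coordinates below \<rho> is at distance less than \<rho> * n, which
    is at most d, from p; the summand 1 makes the estimate strict.\<close>
  define n where "n = norm u + norm w + 1"
  have n: "n > 0" unfolding n_def by (simp add: add_nonneg_pos)
  define \<rho> where "\<rho> = min r (d / n)"
  have \<rho>: "\<rho> > 0" "\<rho> \<le> r" using r d(1) n by (simp_all add: \<rho>_def)
  have "p + of_real x * u + of_real y * w \<in> overpass D p \<longleftrightarrow> (if ov then y = 0 else x = 0)"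
    if xy: "\<bar>x\<bar> < \<rho>" "\<bar>y\<bar> < \<rho>" for x y
  proof -
    have "dist (p + of_real x * u + of_real y * w) p \<le> \<bar>x\<bar> * norm u + \<bar>y\<bar> * norm w"
      using norm_triangle_ineq[of "of_real x * u" "of_real y * w"] by (simp add: dist_norm norm_mult algebra_simps)
    also have "\<dots> \<le> \<rho> * norm u + \<rho> * norm w" using xy by (intro add_mono mult_right_mono) auto
    also have "\<dots> < \<rho> * n" using \<rho>(1) by (simp add: n_def algebra_simps)
    also have "\<dots> \<le> d" using n by (simp add: \<rho>_def min_def field_simps)
    finally have "p + of_real x * u + of_real y * w \<in> overpass D p \<longleftrightarrow> p + of_real x * u + of_real y * w \<in> S" by (rule d(2))
    then show ?thesis using over[of x y] xy \<rho>(2) by simp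
  qed
  then show ?thesis
    by (intro straight_crossing[OF D uw \<rho>(1), where ov = ov and sh = sh]) (use \<rho>(2) curve cross ends shade in auto)
qed

section \<open>Explicit pictures\<close>

definition graph_piece :: "complex => (nat => real => real) => (nat => real) => (nat => real) => nat => complex set" where
  "graph_piece sg f lo hi j = (\<lambda>x. sg * Complex x (f j x)) ` {lo j<..<hi j}"

text \<open>The edges inside the disc are rotated graphs over open intervals that end at crossings or on the circle.\<close>

locale graph_picture =
  fixes D :: shaded_diagram and sg :: complex and n :: nat and f :: "nat => real => real" and lo hi :: "nat => real"
    and C Bd :: "complex set" and \<beta> :: "complex => nat"
  assumes D: "shaded_link_diagram D" and unit: "norm sg = 1"
    and cont: "\<And>j. j < n ==> continuous_on UNIV (f j)" and lo_hi: "\<And>j. j < n ==> lo j < hi j"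
    and disjoint: "\<And>i j x. i < n ==> j < n ==> i ~= j ==> lo i < x ==> x < hi i ==> lo j < x ==> x < hi j ==> f i x ~= f j x"
    and cross: "crossings D \<inter> cball 0 1 = C" and C: "C \<subseteq> ball 0 1"
    and curve: "curve D \<inter> cball 0 1 = C \<union> Bd \<union> (\<Union>j<n. graph_piece sg f lo hi j)"
    and graph_ball: "\<And>j x. j < n ==> lo j < x ==> x < hi j ==> norm (Complex x (f j x)) < 1"
    and graph_C: "\<And>j x. j < n ==> lo j < x ==> x < hi j ==> sg * Complex x (f j x) ~: C"
    and Bd: "finite Bd" "Bd \<subseteq> sphere 0 1"
    and ends: "\<And>j. j < n ==> sg * Complex (lo j) (f j (lo j)) \<in> C \<union> Bd" "\<And>j. j < n ==> sg * Complex (hi j) (f j (hi j)) \<in> C \<union> Bd"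
    and \<beta>: "\<And>w. w \<in> Bd ==> \<beta> w < n"
      "\<And>w. w \<in> Bd ==> w = sg * Complex (lo (\<beta> w)) (f (\<beta> w) (lo (\<beta> w))) \<or> w = sg * Complex (hi (\<beta> w)) (f (\<beta> w) (hi (\<beta> w)))"
      "\<And>w i. w \<in> Bd ==> i < n ==> i ~= \<beta> w ==> w ~= sg * Complex (lo i) (f i (lo i)) \<and> w ~= sg * Complex (hi i) (f i (hi i))"
begin

definition pt :: "nat => real => complex" where "pt j x = sg * Complex x (f j x)"

abbreviation G where "G \<equiv> graph_piece sg f lo hi"

abbreviation Y where "Y \<equiv> curve D \<inter> ball 0 1 - crossings D"

lemma G_eq: "G j = pt j ` {lo j<..<hi j}"
  by (simp add: graph_piece_def pt_def)

lemma pt_eq: "pt i x = pt j y \<longleftrightarrow> x = y \<and> f i x = f j y"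
proof -
  have "sg ~= 0" using unit by auto
  then show ?thesis by (auto simp: pt_def)
qed

lemma continuous_pt: "j < n ==> continuous_on S (pt j)"
proof -
  assume "j < n"
  then have "continuous_on S (f j)" using cont continuous_on_subset by blast
  then show ?thesis unfolding pt_def Complex_eq by (intro continuous_intros)
qed

lemma G_inside: "j < n ==> G j \<subseteq> Y"
proof -
  assume j: "j < n"
  have "G j \<subseteq> ball 0 1" using graph_ball[OF j] unit by (auto simp: graph_piece_def norm_mult)
  moreover have "G j \<subseteq> curve D \<inter> cball 0 1" unfolding curve using j by auto
  moreover have "G j \<inter> C = {}" using graph_C[OF j] by (auto simp: graph_piece_def)
  ultimately show "G j \<subseteq> Y" using cross ball_subset_cball[of 0 1] by blast
qed

lemma norm_Bd: "w \<in> Bd ==> norm w = 1"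
  using subsetD[OF Bd(2)] by simp

lemma norm_Y: "z \<in> Y ==> norm z < 1"
  by simp

lemma Bd_Y: "w \<in> Bd ==> w ~: Y"
  using norm_Bd norm_Y by fastforce

lemma Bd_not_crossing: assumes "w \<in> Bd" shows "w ~: crossings D"
proof
  assume "w \<in> crossings D"
  then have "w \<in> C" using norm_Bd[OF assms] unfolding cross[symmetric] by simp
  then show False using subsetD[OF C, of w] norm_Bd[OF assms] by simp
qed

lemma Y_eq: "Y = (\<Union>j<n. G j)"
proof (intro equalityI subsetI)
  fix x assume x: "x \<in> Y"
  then have "x \<in> curve D \<inter> cball 0 1" "x ~: C" "x ~: Bd" using Bd_Y by (auto simp: cross[symmetric])
  then show "x \<in> (\<Union>j<n. G j)" unfolding curve by simp
qed (use G_inside in blast)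

lemma ends_outside: "j < n ==> pt j (lo j) ~: Y" "j < n ==> pt j (hi j) ~: Y"
proof -
  have "x ~: Y" if "x \<in> C \<union> Bd" for x using that Bd_Y by (auto simp: cross[symmetric])
  then show "j < n ==> pt j (lo j) ~: Y" "j < n ==> pt j (hi j) ~: Y" using ends unfolding pt_def by blast+
qed

lemma closed_arc: "j < n ==> closed (pt j ` {p..q})"
  by (intro compact_imp_closed compact_continuous_image continuous_pt) auto

text \<open>The closure of a graph adds only its two end points. These are crossings or lie on the
  circle, so each graph is closed in Y.\<close>

lemma components_Y: "components Y = G ` {..<n}"
proof (rule components_eqI)
  show "Y = \<Union>(G ` {..<n})" using Y_eq by simp
  show "P ~= {} \<and> connected P" if P: "P \<in> G ` {..<n}" for P
  proof -
    obtain j where j: "j < n" "P = pt j ` {lo j<..<hi j}" using P G_eq by auto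
    then show ?thesis using lo_hi[OF j(1)] by (auto intro!: connected_continuous_image continuous_pt)
  qed
  show "closedin (top_of_set Y) P" if P: "P \<in> G ` {..<n}" for P
  proof -
    obtain j where j: "j < n" "P = G j" using P by auto
    have "pt j ` {lo j..hi j} \<inter> Y \<subseteq> G j"
    proof
      fix z assume z: "z \<in> pt j ` {lo j..hi j} \<inter> Y"
      then obtain x where x: "lo j \<le> x" "x \<le> hi j" "z = pt j x" by auto
      have "x ~= lo j" "x ~= hi j" using z x(3) ends_outside[OF j(1)] by auto
      then show "z \<in> G j" unfolding G_eq x(3) using x by (intro imageI) auto
    qed
    moreover have "G j \<subseteq> pt j ` {lo j..hi j}" unfolding G_eq by (intro image_mono) auto
    ultimately show ?thesis unfolding j(2) by (rule closedin_closure_subset[OF G_inside[OF j(1)] closed_arc[OF j(1)]])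
  qed
  show "P \<inter> Q = {}" if PQ: "P \<in> G ` {..<n}" "Q \<in> G ` {..<n}" "P ~= Q" for P Q
  proof -
    obtain i where i: "i < n" "P = G i" using PQ by auto
    obtain j where j: "j < n" "Q = G j" using PQ by auto
    have ij: "i ~= j" using PQ(3) i j by auto
    show ?thesis unfolding i(2) j(2) G_eq
      using disjoint[OF i(1) j(1) ij] by (auto simp: pt_eq)
  qed
qed simp

lemma pt_in_G: "lo j < x ==> x < hi j ==> pt j x \<in> G j"
  unfolding G_eq by (rule imageI) simp

lemma component_pt:
  assumes "j < n" "z \<in> G j" shows "connected_component_set Y z = G j"
proof -
  have z: "z \<in> Y" by (rule subsetD[OF G_inside[OF assms(1)] assms(2)])
  then have "connected_component_set Y z \<in> components Y" unfolding components_def by (rule imageI)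
  moreover have "G j \<in> components Y" unfolding components_Y using assms(1) by simp
  moreover have "z \<in> connected_component_set Y z \<inter> G j" using z assms(2) by simp
  ultimately show ?thesis using components_nonoverlap by blast
qed

lemma G_inj: "i < n ==> j < n ==> G i = G j ==> i = j"
proof (rule ccontr)
  assume i: "i < n" "j < n" "G i = G j" "i ~= j"
  have "pt i ((lo i + hi i) / 2) \<in> G i" using lo_hi[OF i(1)] by (intro pt_in_G) auto
  then have "pt i ((lo i + hi i) / 2) \<in> G j" using i(3) by simp
  then show False using disjoint[OF i(1,2,4)] lo_hi[OF i(1)] by (auto simp: G_eq pt_eq)
qed

lemma not_closed: assumes "e \<in> components Y" shows "\<not> closed e"
proof
  assume c: "closed e"
  obtain j where j: "j < n" "e = G j" using assms components_Y by auto
  have "pt j ` closure {lo j<..<hi j} \<subseteq> e"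
    by (rule image_closure_subset[OF continuous_pt[OF j(1)] c]) (simp add: j(2) G_eq)
  then have "pt j (lo j) \<in> e" using lo_hi[OF j(1)] by auto
  then show False using ends_outside(1)[OF j(1)] G_inside[OF j(1)] j(2) by auto
qed

lemma on_sphere: "curve D \<inter> sphere 0 1 = Bd"
proof -
  have "curve D \<inter> sphere 0 1 = (curve D \<inter> cball 0 1) \<inter> sphere 0 1" by auto
  also have "\<dots> = Bd"
  proof -
    have "x ~: sphere 0 1" if "x \<in> C \<union> (\<Union>j<n. G j)" for x
      using that subsetD[OF C, of x] norm_Y[of x] unfolding Y_eq[symmetric] by auto
    then show ?thesis unfolding curve using Bd(2) by blast
  qed
  finally show ?thesis .
qed

lemma Bd_curve: "Bd \<subseteq> curve D - crossings D"
proof -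
  have "Bd \<subseteq> curve D" using on_sphere by blast
  then show ?thesis using Bd_not_crossing by blast
qed

lemma edge_at_pt: "j < n ==> z \<in> G j ==> edge_at (subdiv D Bd) z = G j"
proof -
  assume j: "j < n" "z \<in> G j"
  have *: "(curve D - (crossings D \<union> Bd)) \<inter> sphere 0 1 = {}" using on_sphere by auto
  have "z \<in> ball 0 1" using subsetD[OF G_inside[OF j(1)] j(2)] by simp
  moreover have "(curve D - (crossings D \<union> Bd)) \<inter> ball 0 1 = Y" using Bd_Y by blast
  ultimately show ?thesis
    unfolding edge_at_def subdiv_simps using component_avoiding_sphere(1)[OF *, of z] component_pt[OF j] by simp
qed

definition inner_ray :: "complex => (real => complex) => bool" where
  "inner_ray w s \<longleftrightarrow> arc s \<and> pathstart s = w \<and> ray s \<subseteq> G (\<beta> w)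
    \<and> (\<exists>eps>0. curve D \<inter> cball 0 1 \<inter> ball w eps \<subseteq> insert w (ray s))"

lemma inner_ray_exists: assumes w: "w \<in> Bd" shows "\<exists>s. inner_ray w s"
proof -
  obtain k where k: "k = \<beta> w" by simp
  have j: "k < n" unfolding k by (rule \<beta>(1)[OF w])
  define m where "m = (lo k + hi k) / 2"
  have m: "lo k < m" "m < hi k" using lo_hi[OF j] by (simp_all add: m_def)
  obtain x0 x1 where x: "x0 = lo k \<and> x1 = hi k \<or> x0 = hi k \<and> x1 = lo k" "w = pt k x0"
    using \<beta>(2)[OF w] unfolding pt_def k by blast
  define s where "s = (\<lambda>t. pt k (x0 + t * (m - x0)))"
  have mx: "m ~= x0" using x m by auto
  have "continuous_on {0..1} s"
    unfolding s_def by (rule continuous_on_compose2[OF continuous_pt[OF j, of UNIV]]) (auto intro!: continuous_intros)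
  moreover have "inj_on s {0..1}" using mx by (auto simp: inj_on_def s_def pt_eq)
  ultimately have as: "arc s" by (simp add: arc_def path_def)
  have ps: "pathstart s = w" by (simp add: pathstart_def s_def x(2)[symmetric])
  have rs: "ray s = s ` {0<..1}" by (rule ray_eq[OF as])
  have "ray s \<subseteq> G k"
    unfolding rs unfolding s_def
  proof (rule image_subsetI)
    fix t :: real assume t: "t \<in> {0<..1}"
    have e: "x0 + t * (m - x0) = (1 - t) * x0 + t * m" by (simp add: algebra_simps)
    have "lo k \<le> x0" "x0 \<le> hi k" using x m by auto
    then have "(1 - t) * lo k \<le> (1 - t) * x0" "(1 - t) * x0 \<le> (1 - t) * hi k" using t by (auto intro: mult_left_mono)
    moreover have "t * lo k < t * m" "t * m < t * hi k" using t m by auto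
    ultimately have "(1 - t) * lo k + t * lo k < (1 - t) * x0 + t * m" "(1 - t) * x0 + t * m < (1 - t) * hi k + t * hi k"
      by linarith+
    then show "pt k (x0 + t * (m - x0)) \<in> G k" unfolding e by (intro pt_in_G) (simp_all add: algebra_simps)
  qed
  \<comment> \<open>Everything in the picture except w and the half of its graph next to w: the
    other graphs with their ends, the far half of the graph itself, the other vertices.\<close>
  define Z where "Z = (\<Union>i\<in>{..<n} - {k}. pt i ` {lo i..hi i}) \<union> pt k ` {min m x1..max m x1} \<union> (C \<union> Bd - {w})"
  have "finite (crossings D)" using D by (simp add: shaded_link_diagram_def link_diagram_def)
  then have "finite C" unfolding cross[symmetric] by (rule finite_Int[OF disjI1])
  then have "closed (C \<union> Bd - {w})" using Bd(1) by (intro finite_imp_closed) simp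
  moreover have "closed (pt k ` {min m x1..max m x1})" by (rule closed_arc[OF j])
  moreover have "closed (\<Union>i\<in>{..<n} - {k}. pt i ` {lo i..hi i})" by (intro closed_UN) (auto intro: closed_arc)
  ultimately have "closed Z" unfolding Z_def by (intro closed_Un)
  moreover have "w ~: Z"
  proof -
    have 1: "w ~: pt i ` {lo i..hi i}" if i: "i < n" "i ~= k" for i
    proof (rule not_in_imageI)
      fix x assume xx: "x \<in> {lo i..hi i}"
      show "pt i x ~= w"
      proof (cases "x = lo i \<or> x = hi i")
        case True
        then show ?thesis using \<beta>(3)[OF w i[unfolded k]] by (auto simp: pt_def)
      next
        case False
        then have "pt i x \<in> G i" using xx by (intro pt_in_G) auto
        then have "pt i x \<in> Y" by (rule subsetD[OF G_inside[OF i(1)]])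
        then show ?thesis using Bd_Y[OF w] by metis
      qed
    qed
    have "w ~: pt k ` {min m x1..max m x1}"
      by (rule not_in_imageI) (use x m in \<open>auto simp: pt_eq\<close>)
    then show ?thesis using 1 by (auto simp: Z_def)
  qed
  ultimately obtain eps where eps: "eps > 0" "ball w eps \<inter> Z = {}" by (rule closed_avoiding_ball)
  have "curve D \<inter> cball 0 1 \<inter> ball w eps \<subseteq> insert w (ray s)"
  proof
    fix z assume z: "z \<in> curve D \<inter> cball 0 1 \<inter> ball w eps"
    then have nz: "z ~: Z" using eps(2) by blast
    have "z \<in> C \<union> Bd \<union> (\<Union>j<n. G j)" using z unfolding curve by simp
    then consider "z = w" | i where "i < n" "z \<in> G i" using nz by (auto simp: Z_def)
    then show "z \<in> insert w (ray s)"
    proof cases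
      case (2 i)
      have "G i \<subseteq> pt i ` {lo i..hi i}" unfolding G_eq by (intro image_mono) auto
      then have "i = k" using 2 nz by (auto simp: Z_def)
      then obtain y where y: "lo k < y" "y < hi k" "z = pt k y" using 2(2) by (auto simp: G_eq)
      have "y ~: {min m x1..max m x1}" using nz y(3) by (auto simp: Z_def)
      then have "0 < (y - x0) / (m - x0)" "(y - x0) / (m - x0) \<le> 1"
        using x(1) y m by (auto simp: divide_simps)
      moreover have "z = s ((y - x0) / (m - x0))" using mx by (simp add: s_def y(3))
      ultimately show ?thesis unfolding rs by auto
    qed simp
  qed
  then have "inner_ray w s" unfolding inner_ray_def k[symmetric] using as ps \<open>ray s \<subseteq> G k\<close> eps(1) by blast
  then show ?thesis by (rule exI[of _ s])
qed

lemma disc_subdivisionI: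
  assumes h: "\<And>v. v \<in> crossings D ==> crossing_chart (subdiv D Bd) v (h v)"
    and s: "\<And>w. w \<in> Bd ==> inner_ray w (s w)"
    and g: "\<And>w. w \<in> Bd ==> arc (g w) \<and> pathstart (g w) = w \<and> ray (g w) \<subseteq> curve D - crossings D - cball 0 1
      \<and> (\<exists>eps>0. (curve D - cball 0 1) \<inter> ball w eps \<subseteq> insert w (ray (g w)))"
  shows "disc_subdivision D Bd h (\<lambda>w i. if i then s w else g w)"
proof
  have si: "ray (s w) \<subseteq> Y" if "w \<in> Bd" for w
    using s[OF that] G_inside[OF \<beta>(1)[OF that]] unfolding inner_ray_def by blast
  show "shaded_link_diagram D" "finite Bd" "Bd \<subseteq> curve D - crossings D" "curve D \<inter> sphere 0 1 = Bd"
    by (rule D Bd(1) Bd_curve on_sphere)+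
  show "crossing_chart (subdiv D Bd) v (h v)" if "v \<in> crossings D" for v by (rule h[OF that])
  show "arc (if i then s w else g w) \<and> pathstart (if i then s w else g w) = w
      \<and> ray (if i then s w else g w) \<subseteq> curve D - (crossings D \<union> Bd)" if w: "w \<in> Bd" for w i
  proof (cases i)
    case True
    have "ray (s w) \<subseteq> curve D - (crossings D \<union> Bd)" using si[OF w] Bd_Y by blast
    then show ?thesis using s[OF w] True by (simp add: inner_ray_def)
  next
    case False
    have "ray (g w) \<subseteq> curve D - (crossings D \<union> Bd)" using g[OF w] Bd(2) sphere_cball[of 0 1] by blast
    then show ?thesis using g[OF w] False by simp
  qed
  fix w assume w: "w \<in> Bd"
  have 1: "ray (s w) \<subseteq> ball 0 1" using si[OF w] by auto
  have 2: "ray (g w) \<inter> cball 0 1 = {}" using g[OF w] by auto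
  show "ray (if True then s w else g w) \<subseteq> ball 0 1" using 1 by simp
  show "ray (if False then s w else g w) \<inter> cball 0 1 = {}" using 2 by simp
  show "ray (if True then s w else g w) \<inter> ray (if False then s w else g w) = {}"
    unfolding if_True if_False using 1 2 ball_subset_cball[of 0 1] by blast
  obtain eps1 where e1: "eps1 > 0" "curve D \<inter> cball 0 1 \<inter> ball w eps1 \<subseteq> insert w (ray (s w))"
    using s[OF w] by (auto simp: inner_ray_def)
  obtain eps2 where e2: "eps2 > 0" "(curve D - cball 0 1) \<inter> ball w eps2 \<subseteq> insert w (ray (g w))" using g[OF w] by auto
  have "curve D \<inter> ball w (min eps1 eps2) \<subseteq> insert w (ray (s w) \<union> ray (g w))"
  proof
    fix z assume z: "z \<in> curve D \<inter> ball w (min eps1 eps2)"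
    show "z \<in> insert w (ray (s w) \<union> ray (g w))"
    proof (cases "z \<in> cball 0 1")
      case True
      then have "z \<in> curve D \<inter> cball 0 1 \<inter> ball w eps1" using z by auto
      from subsetD[OF e1(2) this] show ?thesis by auto
    next
      case False
      then have "z \<in> (curve D - cball 0 1) \<inter> ball w eps2" using z by auto
      from subsetD[OF e2(2) this] show ?thesis by auto
    qed
  qed
  then show "\<exists>eps>0. curve D \<inter> ball w eps \<subseteq> insert w (ray (if True then s w else g w) \<union> ray (if False then s w else g w))"
    using e1(1) e2(1) by (intro exI[of _ "min eps1 eps2"]) simp
next
  fix e assume "e \<in> components (curve D \<inter> ball 0 1 - crossings D)"
  then show "\<not> closed e" by (rule not_closed)
qed

lemma inner_tangle_eq:
  assumes S: "disc_subdivision D Bd h (\<lambda>w i. if i then s w else g w)"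
    and s: "\<And>w. w \<in> Bd ==> inner_ray w (s w)"
    and y: "\<And>v. v \<in> C ==> expand (chart_symbol (subdiv D Bd) (h v)) = y v"
  shows "disc_subdivision.inner_tangle D Bd h (\<lambda>w i. if i then s w else g w)
    = (\<Prod>v\<in>C. y v) * (\<Prod>w\<in>Bd. con (G (\<beta> w)) {w})"
proof -
  interpret S: disc_subdivision D Bd h "\<lambda>w i. if i then s w else g w" by fact
  have "crossings D \<inter> ball 0 1 = C" using cross C by auto
  moreover have "S.side w True = G (\<beta> w)" if w: "w \<in> Bd" for w
  proof -
    have "arc (s w)" "ray (s w) \<subseteq> G (\<beta> w)" using s[OF w] by (simp_all add: inner_ray_def)
    then have "pathfinish (s w) \<in> G (\<beta> w)" using pathfinish_in_ray by blast
    then show ?thesis using S.side_at(1)[OF w] component_pt[OF \<beta>(1)[OF w]] by simp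
  qed
  ultimately show ?thesis unfolding S.inner_tangle_def S.sym_def by (simp add: y)
qed

end

section \<open>Replacing one explicit picture by another\<close>

text \<open>Outside the disc the diagrams agree and their overpasses have equal germs. A chart of D,
  shrunk far enough, is thus a chart of D' as well and keeps away from the disc.\<close>

lemma outer_chart:
  assumes D: "shaded_link_diagram D" and agree: "agree_outside (cball 0 1) D D'"
    and v: "v \<in> crossings D" "v ~: cball 0 1" and B: "B \<subseteq> cball 0 1"
  shows "\<exists>k. crossing_chart (subdiv D B) v k \<and> crossing_chart (subdiv D' B) v k \<and> inv k ` ball 0 1 \<inter> cball 0 1 = {}"
proof -
  obtain k where c: "crossing_chart D v k" using D v by (auto simp: shaded_link_diagram_def link_diagram_def)
  have k: "planar_map k" "k v = 0" using c by (auto simp: crossing_chart_def)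
  have v0: "inv k 0 = v" using planar_map_simps(1)[OF k(1), of v] k(2) by simp
  have "continuous_on UNIV (inv k)" by (rule planar_map_simps(4)[OF k(1)])
  then have "isCont (inv k) 0" by (simp add: continuous_on_eq_continuous_at)
  then have lim: "filterlim (inv k) (nhds v) (nhds 0)"
    using tendsto_at_iff_tendsto_nhds[of "inv k" 0] by (simp add: isCont_def v0)
  have "v \<in> crossings D - cball 0 1" using v by blast
  then have "same_germ v (overpass D v) (overpass D' v)" using agree unfolding agree_outside_def by blast
  then have "\<forall>\<^sub>F z in nhds v. z \<in> overpass D v \<longleftrightarrow> z \<in> overpass D' v" by (simp add: same_germ_def)
  moreover have "\<forall>\<^sub>F z in nhds v. z \<in> - cball 0 1" by (rule eventually_nhds_in_open) (use v(2) in auto)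
  ultimately have "\<forall>\<^sub>F z in nhds v. z ~: cball 0 1 \<and> (z \<in> overpass D v \<longleftrightarrow> z \<in> overpass D' v)"
    by eventually_elim simp
  then have "\<forall>\<^sub>F z in nhds 0. inv k z ~: cball 0 1 \<and> (inv k z \<in> overpass D v \<longleftrightarrow> inv k z \<in> overpass D' v)"
    using lim unfolding filterlim_iff by blast
  then obtain d where d: "d > 0" "\<And>z. dist z 0 < d ==> inv k z ~: cball 0 1 \<and> (inv k z \<in> overpass D v \<longleftrightarrow> inv k z \<in> overpass D' v)"
    unfolding eventually_nhds_metric by blast
  define r where "r = min d 1"
  have r: "r > 0" using d(1) by (simp add: r_def)
  have b: "z \<in> ball 0 1" "dist z 0 < d" if "z \<in> ball 0 r" for z using that by (auto simp: r_def dist_commute)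
  have eq: "curve D - cball 0 1 = curve D' - cball 0 1" "crossings D - cball 0 1 = crossings D' - cball 0 1"
    using agree by (auto simp: agree_outside_def)
  have "crossing_chart (subdiv D B) v (\<lambda>z. k z / of_real r)"
  proof (rule crossing_chartI(1)[OF k r])
    fix z :: complex assume z: "z \<in> ball 0 r"
    have "inv k z ~: cball 0 1" using d(2)[OF b(2)[OF z]] by blast
    then have "inv k z ~: B" using B by blast
    then show "inv k z \<in> curve (subdiv D B) \<longleftrightarrow> Re z = 0 \<or> Im z = 0" "inv k z \<in> crossings (subdiv D B) \<longleftrightarrow> z = 0"
      "inv k z \<in> overpass (subdiv D B) v \<longleftrightarrow> Im z = 0"
      using chart_mem[OF c b(1)[OF z]] by simp_all
  qed
  moreover have "crossing_chart (subdiv D' B) v (\<lambda>z. k z / of_real r)"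
  proof (rule crossing_chartI(1)[OF k r])
    fix z :: complex assume z: "z \<in> ball 0 r"
    have o: "inv k z ~: cball 0 1" "inv k z \<in> overpass D v \<longleftrightarrow> inv k z \<in> overpass D' v" using d(2)[OF b(2)[OF z]] by blast+
    then have "inv k z ~: B" "inv k z \<in> curve D' \<longleftrightarrow> inv k z \<in> curve D" "inv k z \<in> crossings D' \<longleftrightarrow> inv k z \<in> crossings D"
      using B eq by blast+
    then show "inv k z \<in> curve (subdiv D' B) \<longleftrightarrow> Re z = 0 \<or> Im z = 0" "inv k z \<in> crossings (subdiv D' B) \<longleftrightarrow> z = 0"
      "inv k z \<in> overpass (subdiv D' B) v \<longleftrightarrow> Im z = 0"
      using chart_mem[OF c b(1)[OF z]] o(2) by simp_all
  qed
  moreover have "inv (\<lambda>z. k z / of_real r) ` ball 0 1 \<inter> cball 0 1 = {}"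
  proof -
    have i: "inv (\<lambda>z. k z / of_real r) = (\<lambda>z. inv k (of_real r * z))"
      by (rule inv_equality) (use r planar_map_simps(1,2)[OF k(1)] in auto)
    have "inv k (of_real r * z) ~: cball 0 1" if "z \<in> ball 0 1" for z
    proof -
      have "of_real r * z \<in> ball 0 r" using that r by (simp add: norm_mult)
      then show ?thesis using d(2)[OF b(2)] by blast
    qed
    then show ?thesis unfolding i by blast
  qed
  ultimately show ?thesis by blast
qed

text \<open>The outer arcs are constructed in D, as complements of the inner rays, and reused in D',
  because the curves coincide off the disc. Charts are chosen by the pictures inside and jointly for
  both diagrams outside.\<close>

theorem graph_replacement:
  assumes P: "graph_picture D sg n f lo hi C Bd \<beta>" and P': "graph_picture D' sg' n' f' lo' hi' C' Bd \<beta>'"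
    and agree: "agree_outside (cball 0 1) D D'"
    and y: "\<And>v. v \<in> C ==> \<exists>h. crossing_chart (subdiv D Bd) v h \<and> expand (chart_symbol (subdiv D Bd) h) = y v"
    and y': "\<And>v. v \<in> C' ==> \<exists>h. crossing_chart (subdiv D' Bd) v h \<and> expand (chart_symbol (subdiv D' Bd) h) = y' v"
    and equiv: "tangle_equiv ((\<lambda>w. {w}) ` Bd)
      ((\<Prod>v\<in>C. y v) * (\<Prod>w\<in>Bd. con (graph_piece sg f lo hi (\<beta> w)) {w}))
      ((\<Prod>v\<in>C'. y' v) * (\<Prod>w\<in>Bd. con (graph_piece sg' f' lo' hi' (\<beta>' w)) {w}))"
  shows "ss D - ss D' \<in> I_infinity"
proof -
  interpret P: graph_picture D sg n f lo hi C Bd \<beta> by fact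
  interpret P': graph_picture D' sg' n' f' lo' hi' C' Bd \<beta>' by fact
  have eq: "curve D - cball 0 1 = curve D' - cball 0 1" "crossings D - cball 0 1 = crossings D' - cball 0 1"
    using agree by (auto simp: agree_outside_def)
  have Bc: "Bd \<subseteq> cball 0 1" using P.Bd(2) by auto
  obtain s where s: "\<And>w. w \<in> Bd ==> P.inner_ray w (s w)" using P.inner_ray_exists by metis
  obtain s' where s': "\<And>w. w \<in> Bd ==> P'.inner_ray w (s' w)" using P'.inner_ray_exists by metis
  have "\<exists>g. arc g \<and> pathstart g = w \<and> ray g \<subseteq> curve D - crossings D - cball 0 1
      \<and> (\<exists>eps>0. (curve D - cball 0 1) \<inter> ball w eps \<subseteq> insert w (ray g))" if w: "w \<in> Bd" for w
  proof -
    have i: "arc (s w)" "pathstart (s w) = w" "ray (s w) \<subseteq> P.G (\<beta> w)" using s[OF w] by (simp_all add: P.inner_ray_def)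
    obtain eps where e: "eps > 0" "curve D \<inter> cball 0 1 \<inter> ball w eps \<subseteq> insert w (ray (s w))"
      using s[OF w] by (auto simp: P.inner_ray_def)
    have "ray (s w) \<subseteq> curve D \<inter> cball 0 1" using i(3) P.G_inside[OF P.\<beta>(1)[OF w]] ball_subset_cball[of 0 1] by blast
    moreover have "arc_graph (curve D) (crossings D)" using P.D by (auto simp: shaded_link_diagram_def intro: link_diagram_arc_graph)
    moreover have "w \<in> curve D - crossings D" using w P.Bd_curve by auto
    ultimately show ?thesis by (intro complementary_ray[OF _ _ i(1,2) _ e])
  qed
  then obtain g where g: "\<And>w. w \<in> Bd ==> arc (g w) \<and> pathstart (g w) = w \<and> ray (g w) \<subseteq> curve D - crossings D - cball 0 1
      \<and> (\<exists>eps>0. (curve D - cball 0 1) \<inter> ball w eps \<subseteq> insert w (ray (g w)))" by metis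
  have "curve D - crossings D - cball 0 1 = curve D' - crossings D' - cball 0 1" using eq by blast
  then have g': "\<And>w. w \<in> Bd ==> arc (g w) \<and> pathstart (g w) = w \<and> ray (g w) \<subseteq> curve D' - crossings D' - cball 0 1
      \<and> (\<exists>eps>0. (curve D' - cball 0 1) \<inter> ball w eps \<subseteq> insert w (ray (g w)))" using g eq(1) by simp
  obtain k where k: "\<And>v. v \<in> crossings D ==> v ~: cball 0 1 ==> crossing_chart (subdiv D Bd) v (k v)
      \<and> crossing_chart (subdiv D' Bd) v (k v) \<and> inv (k v) ` ball 0 1 \<inter> cball 0 1 = {}"
    using outer_chart[OF P.D agree _ _ Bc] by metis
  obtain c where c: "\<And>v. v \<in> C ==> crossing_chart (subdiv D Bd) v (c v) \<and> expand (chart_symbol (subdiv D Bd) (c v)) = y v"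
    using y by metis
  obtain c' where c': "\<And>v. v \<in> C' ==> crossing_chart (subdiv D' Bd) v (c' v) \<and> expand (chart_symbol (subdiv D' Bd) (c' v)) = y' v"
    using y' by metis
  define h where "h = (\<lambda>v. if v \<in> cball 0 1 then c v else k v)"
  define h' where "h' = (\<lambda>v. if v \<in> cball 0 1 then c' v else k v)"
  have Cc: "C \<subseteq> cball 0 1" "C' \<subseteq> cball 0 1" using P.cross P'.cross by auto
  have h: "crossing_chart (subdiv D Bd) v (h v)" if v: "v \<in> crossings D" for v
    using v c[of v] k[OF v] P.cross unfolding h_def by auto
  have h': "crossing_chart (subdiv D' Bd) v (h' v)" if v: "v \<in> crossings D'" for v
  proof (cases "v \<in> cball 0 1")
    case True
    then show ?thesis using v c'[of v] P'.cross unfolding h'_def by auto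
  next
    case False
    then have "v \<in> crossings D" using v eq(2) by blast
    then show ?thesis using k[of v] False by (simp add: h'_def)
  qed
  note S = P.disc_subdivisionI[OF h s g] and S' = P'.disc_subdivisionI[OF h' s' g']
  show ?thesis
  proof (rule disc_subdivision_replace[OF S S' agree])
    show "h' v = h v \<and> inv (h v) ` ball 0 1 \<inter> cball 0 1 = {}" if v: "v \<in> crossings D - ball 0 1" for v
    proof -
      have "v ~: cball 0 1" using v P.cross P.C by blast
      then show ?thesis using k[of v] v by (simp add: h_def h'_def)
    qed
    have "expand (chart_symbol (subdiv D Bd) (h v)) = y v" if "v \<in> C" for v
      using c[OF that] that Cc by (auto simp: h_def)
    note T = P.inner_tangle_eq[OF S s this]
    have "expand (chart_symbol (subdiv D' Bd) (h' v)) = y' v" if "v \<in> C'" for v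
      using c'[OF that] that Cc by (auto simp: h'_def)
    note T' = P'.inner_tangle_eq[OF S' s' this]
    show "tangle_equiv ((\<lambda>w. {w}) ` Bd) (disc_subdivision.inner_tangle D Bd h (\<lambda>w i. if i then s w else g w))
        (disc_subdivision.inner_tangle D' Bd h' (\<lambda>w i. if i then s' w else g w))"
      using equiv by (simp only: T T')
  qed simp_all
qed

lemma convex_half_plane: "convex {z :: complex. a * Re z + b * Im z < c}"
proof -
  have "{z :: complex. a * Re z + b * Im z < c} = {z. inner (Complex a b) z < c}" by (simp add: inner_complex_def)
  then show ?thesis using convex_halfspace_lt by simp
qed

lemma mem_graph_piece: "sg ~= 0 ==> sg * Complex x y \<in> graph_piece sg f lo hi j \<longleftrightarrow> lo j < x \<and> x < hi j \<and> y = f j x"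
  by (auto simp: graph_piece_def)

context graph_picture
begin

lemma check: "checkerboard D" "checkerboard (subdiv D Bd)"
  using D checkerboard_subdiv by (auto simp: shaded_link_diagram_def)

lemma Re_unit: "cnj sg * sg = 1" "sg * cnj sg = 1"
  using complex_norm_square[of sg] unit by (simp_all add: mult.commute)

text \<open>(u1, u2) and (w1, w2) are the directions of two consecutive edges, in coordinates before
  the rotation by \<open>sg\<close>; a rotation preserves their determinant.\<close>

lemma crossing_symbol_at:
  fixes a b u1 u2 w1 w2 r :: real
  assumes uw: "u1 * w2 - u2 * w1 > 0" and r: "r > 0"
    and germ: "same_germ (sg * Complex a b) (overpass D (sg * Complex a b)) S"
    and inside: "\<And>x y. \<bar>x\<bar> < r ==> \<bar>y\<bar> < r ==> norm (Complex (a + x * u1 + y * w1) (b + x * u2 + y * w2)) < 1"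
    and curve: "\<And>x y. \<bar>x\<bar> < r ==> \<bar>y\<bar> < r ==> sg * Complex (a + x * u1 + y * w1) (b + x * u2 + y * w2) \<in> curve D \<longleftrightarrow> x = 0 \<or> y = 0"
    and cross: "\<And>x y. \<bar>x\<bar> < r ==> \<bar>y\<bar> < r ==> sg * Complex (a + x * u1 + y * w1) (b + x * u2 + y * w2) \<in> crossings D \<longleftrightarrow> x = 0 \<and> y = 0"
    and over: "\<And>x y. \<bar>x\<bar> < r ==> \<bar>y\<bar> < r ==> sg * Complex (a + x * u1 + y * w1) (b + x * u2 + y * w2) \<in> S \<longleftrightarrow> (if ov then y = 0 else x = 0)"
    and j: "j1 < n" "j2 < n" "j3 < n" "j4 < n"
    and e: "\<And>t. 0 < t ==> t < r ==> sg * Complex (a + t * u1) (b + t * u2) \<in> G j1"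
      "\<And>t. 0 < t ==> t < r ==> sg * Complex (a + t * w1) (b + t * w2) \<in> G j2"
      "\<And>t. 0 < t ==> t < r ==> sg * Complex (a - t * u1) (b - t * u2) \<in> G j3"
      "\<And>t. 0 < t ==> t < r ==> sg * Complex (a - t * w1) (b - t * w2) \<in> G j4"
    and shade: "\<And>t. 0 < t ==> t < r ==> sg * Complex (a + t * u1 + t * w1) (b + t * u2 + t * w2) \<in> shaded D \<longleftrightarrow> shd"
  shows "\<exists>h. crossing_chart (subdiv D Bd) (sg * Complex a b) h
    \<and> expand (chart_symbol (subdiv D Bd) h) = expand (sym4 ov shd (G j1) (G j2) (G j3) (G j4))"
proof -
  let ?u = "sg * Complex u1 u2" and ?w = "sg * Complex w1 w2" and ?p = "sg * Complex a b"
  have lin: "?p + of_real x * ?u + of_real y * ?w = sg * Complex (a + x * u1 + y * w1) (b + x * u2 + y * w2)" for x y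
    by (simp add: complex_eq_iff algebra_simps)
  have lin1: "?p + of_real x * ?u = sg * Complex (a + x * u1) (b + x * u2)" "?p - of_real x * ?u = sg * Complex (a - x * u1) (b - x * u2)"
    "?p + of_real x * ?w = sg * Complex (a + x * w1) (b + x * w2)" "?p - of_real x * ?w = sg * Complex (a - x * w1) (b - x * w2)" for x
    by (simp_all add: complex_eq_iff algebra_simps)
  have "cnj ?u * ?w = (cnj sg * sg) * (cnj (Complex u1 u2) * Complex w1 w2)" by (simp only: complex_cnj_mult ac_simps)
  then have "cnj ?u * ?w = cnj (Complex u1 u2) * Complex w1 w2" by (simp only: Re_unit mult_1)
  then have pos: "Im (cnj ?u * ?w) > 0" using uw by (simp only:) simp
  have nB: "sg * Complex x y ~: Bd" if "norm (Complex x y) < 1" for x y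
    using norm_Bd[of "sg * Complex x y"] that unit by (auto simp: norm_mult)
  show ?thesis
  proof (rule crossing_in_disc[OF check(2) pos r, where S = S])
    show "same_germ ?p (overpass (subdiv D Bd) ?p) S" using germ by simp
    fix x y :: real assume xy: "\<bar>x\<bar> < r" "\<bar>y\<bar> < r"
    show "?p + of_real x * ?u + of_real y * ?w \<in> curve (subdiv D Bd) \<longleftrightarrow> x = 0 \<or> y = 0"
      unfolding lin using curve[OF xy] by simp
    show "?p + of_real x * ?u + of_real y * ?w \<in> crossings (subdiv D Bd) \<longleftrightarrow> x = 0 \<and> y = 0"
      unfolding lin using cross[OF xy] nB[OF inside[OF xy]] by simp
    show "?p + of_real x * ?u + of_real y * ?w \<in> S \<longleftrightarrow> (if ov then y = 0 else x = 0)"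
      unfolding lin by (rule over[OF xy])
  next
    fix t :: real assume t: "0 < t" "t < r"
    show "edge_at (subdiv D Bd) (?p + of_real t * ?u) = G j1" "edge_at (subdiv D Bd) (?p + of_real t * ?w) = G j2"
      "edge_at (subdiv D Bd) (?p - of_real t * ?u) = G j3" "edge_at (subdiv D Bd) (?p - of_real t * ?w) = G j4"
      unfolding lin1 using edge_at_pt[OF j(1) e(1)[OF t]] edge_at_pt[OF j(2) e(2)[OF t]] edge_at_pt[OF j(3) e(3)[OF t]]
        edge_at_pt[OF j(4) e(4)[OF t]] by auto
    show "?p + of_real t * ?u + of_real t * ?w \<in> shaded (subdiv D Bd) \<longleftrightarrow> shd"
      unfolding lin using shade[OF t] by simp
  qed
qed

lemma region_shade:
  assumes "convex R" "\<And>x y. Complex x y \<in> R ==> sg * Complex x y ~: curve D" "z \<in> R" "z' \<in> R"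
  shows "sg * z \<in> shaded D \<longleftrightarrow> sg * z' \<in> shaded D"
proof (rule shaded_connected_image[OF check(1) convex_connected[OF assms(1)] _ _ assms(3,4)])
  have "sg * z ~: curve D" if "z \<in> R" for z using assms(2)[of "Re z" "Im z"] that by simp
  then show "(\<lambda>z. sg * z) ` R \<inter> curve D = {}" by blast
qed (intro continuous_intros)

text \<open>Locally the curve is the line through (a, b) in direction (u1, u2), and
  \<open>sides\<close> puts the two points to its left and to its right.\<close>

lemma edge_flip:
  fixes a b u1 u2 \<delta> :: real
  assumes q: "sg * Complex a b \<in> curve D - crossings D" and \<delta>: "\<delta> > 0"
    and line: "\<And>x y. \<bar>x - a\<bar> < \<delta> ==> \<bar>y - b\<bar> < \<delta> ==> sg * Complex x y \<in> curve D \<longleftrightarrow> u1 * (y - b) = u2 * (x - a)"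
    and near: "norm (Complex (x1 - a) (y1 - b)) < \<delta>" "norm (Complex (x2 - a) (y2 - b)) < \<delta>"
    and sides: "u1 * (y1 - b) > u2 * (x1 - a)" "u1 * (y2 - b) < u2 * (x2 - a)"
  shows "sg * Complex x1 y1 \<in> shaded D \<longleftrightarrow> sg * Complex x2 y2 ~: shaded D"
proof (rule shade_flip[OF check(1) q \<delta>, where u = "sg * Complex u1 u2"])
  have d: "sg * Complex x y - sg * Complex a b = sg * Complex (x - a) (y - b)" for x y
    by (simp add: complex_eq_iff algebra_simps)
  have im: "Im (cnj (sg * Complex u1 u2) * (sg * Complex x y - sg * Complex a b)) = u1 * (y - b) - u2 * (x - a)" for x y
  proof -
    have "cnj (sg * Complex u1 u2) * (sg * Complex x y - sg * Complex a b) = (cnj sg * sg) * (cnj (Complex u1 u2) * Complex (x - a) (y - b))"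
      unfolding d by (simp only: complex_cnj_mult ac_simps)
    then have "cnj (sg * Complex u1 u2) * (sg * Complex x y - sg * Complex a b) = cnj (Complex u1 u2) * Complex (x - a) (y - b)"
      by (simp only: Re_unit mult_1)
    then show ?thesis by (simp only:) simp
  qed
  have ball: "sg * Complex x y \<in> ball (sg * Complex a b) \<delta> \<longleftrightarrow> norm (Complex (x - a) (y - b)) < \<delta>" for x y
    by (simp only: mem_ball dist_norm norm_minus_commute[of "sg * Complex a b"] d norm_mult unit mult_1)
  show "sg * Complex x1 y1 \<in> ball (sg * Complex a b) \<delta>" "sg * Complex x2 y2 \<in> ball (sg * Complex a b) \<delta>"
    unfolding ball by (rule near)+
  show "Im (cnj (sg * Complex u1 u2) * (sg * Complex x1 y1 - sg * Complex a b)) > 0"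
    "Im (cnj (sg * Complex u1 u2) * (sg * Complex x2 y2 - sg * Complex a b)) < 0" unfolding im using sides by simp_all
  fix z assume z: "z \<in> ball (sg * Complex a b) \<delta>"
  define x y where "x = Re (cnj sg * z)" and "y = Im (cnj sg * z)"
  have "Complex x y = cnj sg * z" by (simp only: x_def y_def complex_surj)
  then have zeq: "z = sg * Complex x y" by (simp only: mult.assoc[symmetric] Re_unit mult_1)
  have "norm (Complex (x - a) (y - b)) < \<delta>" using z unfolding zeq ball .
  then have "\<bar>x - a\<bar> < \<delta>" "\<bar>y - b\<bar> < \<delta>"
    using abs_Re_le_cmod[of "Complex (x - a) (y - b)"] abs_Im_le_cmod[of "Complex (x - a) (y - b)"] by auto
  then show "z \<in> curve D \<longleftrightarrow> Im (cnj (sg * Complex u1 u2) * (z - sg * Complex a b)) = 0"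
    unfolding zeq im using line by simp
qed

end

section \<open>The pictures of the third Reidemeister move\<close>

text \<open>The coordinates, up to sign, of the points where the two diagonals meet the unit
  circle.\<close>

definition diag :: real where "diag = sqrt (1/2)"

lemma diag: "1/2 < diag" "diag < 1" "diag * diag = 1/2"
proof -
  show d: "diag * diag = 1/2" by (simp add: diag_def)
  show "1/2 < diag" unfolding diag_def by (rule real_less_rsqrt) (simp add: power2_eq_square)
  show "diag < 1" unfolding diag_def by simp
qed

lemma norm_diag: "norm (Complex x x) \<le> 1 \<longleftrightarrow> \<bar>x\<bar> \<le> diag" "norm (Complex x x) < 1 \<longleftrightarrow> \<bar>x\<bar> < diag"
  "norm (Complex x (- x)) \<le> 1 \<longleftrightarrow> \<bar>x\<bar> \<le> diag" "norm (Complex x (- x)) < 1 \<longleftrightarrow> \<bar>x\<bar> < diag"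
proof -
  have d: "diag > 0" "diag\<^sup>2 = 1/2" using diag by (auto simp: power2_eq_square)
  have 1: "x\<^sup>2 + x\<^sup>2 \<le> 1 \<longleftrightarrow> \<bar>x\<bar> \<le> diag" using abs_le_square_iff[of x diag] d by auto
  have 2: "x\<^sup>2 + x\<^sup>2 < 1 \<longleftrightarrow> \<bar>x\<bar> < diag" using abs_le_square_iff[of diag x] d by auto
  show "norm (Complex x x) \<le> 1 \<longleftrightarrow> \<bar>x\<bar> \<le> diag" "norm (Complex x x) < 1 \<longleftrightarrow> \<bar>x\<bar> < diag"
    "norm (Complex x (- x)) \<le> 1 \<longleftrightarrow> \<bar>x\<bar> \<le> diag" "norm (Complex x (- x)) < 1 \<longleftrightarrow> \<bar>x\<bar> < diag"
    using 1 2 by (simp_all add: complex_norm)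
qed

lemma norm_le_sum: "norm (Complex x y) \<le> \<bar>x\<bar> + \<bar>y\<bar>"
  using cmod_le[of "Complex x y"] by simp

text \<open>Numbers 0 to 2 belong to the rising, 3 to 5 to the falling and 6 to 8 to the sliding
  strand for s = -1, each from left to right, as in \<open>tri\<close>. The strands are cut where
  they meet: at x = 0, and on the sliding strand at -1/3 and 1/3.\<close>

definition f3 :: "nat => real => real" where
  "f3 j = (if j < 3 then (\<lambda>x. x) else if j < 6 then (\<lambda>x. - x) else (\<lambda>x. (\<bar>x\<bar> - 1) / 2))"

definition lo3 :: "nat => real" where
  "lo3 j = [- diag, -1/3, 0, - diag, 0, 1/3, -1, -1/3, 1/3] ! j"

definition hi3 :: "nat => real" where
  "hi3 j = [-1/3, 0, diag, 0, 1/3, diag, -1/3, 1/3, 1] ! j"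

lemma f3_simps [simp]: "f3 0 x = x" "f3 1 x = x" "f3 (Suc 0) x = x" "f3 2 x = x" "f3 3 x = - x" "f3 4 x = - x" "f3 5 x = - x"
  "f3 6 x = (\<bar>x\<bar> - 1) / 2" "f3 7 x = (\<bar>x\<bar> - 1) / 2" "f3 8 x = (\<bar>x\<bar> - 1) / 2"
  by (simp_all add: f3_def)

lemma lo3_simps [simp]: "lo3 0 = - diag" "lo3 1 = -1/3" "lo3 (Suc 0) = -1/3" "lo3 2 = 0" "lo3 3 = - diag" "lo3 4 = 0" "lo3 5 = 1/3"
  "lo3 6 = -1" "lo3 7 = -1/3" "lo3 8 = 1/3"
  by (simp_all add: lo3_def)

lemma hi3_simps [simp]: "hi3 0 = -1/3" "hi3 1 = 0" "hi3 (Suc 0) = 0" "hi3 2 = diag" "hi3 3 = 0" "hi3 4 = 1/3" "hi3 5 = diag"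
  "hi3 6 = -1/3" "hi3 7 = 1/3" "hi3 8 = 1"
  by (simp_all add: hi3_def)

lemma lessThan_9: "{..<9 :: nat} = {0, 1, 2, 3, 4, 5, 6, 7, 8}"
  by auto

lemma lt9: "(j :: nat) < 9 \<longleftrightarrow> j \<in> {0, 1, 2, 3, 4, 5, 6, 7, 8}"
  using lessThan_9 by (metis lessThan_iff)

lemma disjoint3:
  assumes "i < 9" "j < 9" "i ~= j" "lo3 i < x" "x < hi3 i" "lo3 j < x" "x < hi3 j" shows "f3 i x ~= f3 j x"
proof
  assume eq: "f3 i x = f3 j x"
  \<comment> \<open>On one strand x determines the number of the piece, and two strands meet only
    over the crossings, which the open intervals exclude.\<close>
  have i: "(i < 3 \<and> f3 i x = x \<and> x ~= 0 \<and> x ~= -1/3 \<and> i = (if x < -1/3 then 0 else if x < 0 then 1 else 2))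
    \<or> (3 \<le> i \<and> i < 6 \<and> f3 i x = - x \<and> x ~= 0 \<and> x ~= 1/3 \<and> i = (if x < 0 then 3 else if x < 1/3 then 4 else 5))
    \<or> (6 \<le> i \<and> f3 i x = (\<bar>x\<bar> - 1) / 2 \<and> x ~= -1/3 \<and> x ~= 1/3 \<and> i = (if x < -1/3 then 6 else if x < 1/3 then 7 else 8))"
    if "i < 9" "lo3 i < x" "x < hi3 i" for i
    using that diag unfolding lt9 by (elim insertE emptyE) simp_all
  have kinds: "x = - x ==> x = 0" "x = (\<bar>x\<bar> - 1) / 2 ==> x = -1/3" "- x = (\<bar>x\<bar> - 1) / 2 ==> x = 1/3"
    by (simp_all add: abs_if split: if_splits)
  show False
    using i[OF assms(1,4,5)] i[OF assms(2,6,7)] kinds eq assms(3) by (elim disjE conjE) (simp_all only: minus_equation_iff, metis+)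
qed


text \<open>The graphs with an end on the circle; 1, 4 and 7 are the sides of the triangle.\<close>

definition J3 :: "nat set" where "J3 = {0, 2, 3, 5, 6, 8}"

lemma cover3:
  assumes "\<bar>x\<bar> \<le> diag \<and> y = x \<or> \<bar>x\<bar> \<le> diag \<and> y = - x \<or> \<bar>x\<bar> \<le> 1 \<and> y = (\<bar>x\<bar> - 1) / 2"
    and C: "x = 0 ==> y = 0 ==> R" "x = -1/3 ==> y = -1/3 ==> R" "x = 1/3 ==> y = -1/3 ==> R"
    and Q: "\<And>j. j \<in> J3 ==> Complex x y = Complex (lo3 j) (f3 j (lo3 j)) \<or> Complex x y = Complex (hi3 j) (f3 j (hi3 j)) ==> \<bar>x\<bar> > 1/3 ==> R"
    and P: "\<And>j. j < 9 ==> lo3 j < x ==> x < hi3 j ==> y = f3 j x ==> R"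
  shows R
proof -
  have q: "0 \<in> J3" "2 \<in> J3" "3 \<in> J3" "5 \<in> J3" "6 \<in> J3" "8 \<in> J3" by (simp_all add: J3_def)
  consider "y = x" "x = - diag \<or> - diag < x \<and> x < -1/3 \<or> x = -1/3 \<or> -1/3 < x \<and> x < 0 \<or> x = 0 \<or> 0 < x \<and> x < diag \<or> x = diag"
    | "y = - x" "x = - diag \<or> - diag < x \<and> x < 0 \<or> x = 0 \<or> 0 < x \<and> x < 1/3 \<or> x = 1/3 \<or> 1/3 < x \<and> x < diag \<or> x = diag"
    | "y = (\<bar>x\<bar> - 1) / 2" "x = - 1 \<or> - 1 < x \<and> x < -1/3 \<or> x = -1/3 \<or> -1/3 < x \<and> x < 1/3 \<or> x = 1/3 \<or> 1/3 < x \<and> x < 1 \<or> x = 1"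
    using assms(1) diag by (smt (verit))
  then show R
  proof cases
    case 1
    show R using 1(2)
    proof (elim disjE conjE)
      assume "x = - diag" then show R using Q[OF q(1)] 1(1) diag by simp
    next
      assume "- diag < x" "x < -1/3" then show R using P[of 0] 1(1) by simp
    next
      assume "x = -1/3" then show R using C(2) 1(1) by simp
    next
      assume "-1/3 < x" "x < 0" then show R using P[of 1] 1(1) by simp
    next
      assume "x = 0" then show R using C(1) 1(1) by simp
    next
      assume "0 < x" "x < diag" then show R using P[of 2] 1(1) by simp
    next
      assume "x = diag" then show R using Q[OF q(2)] 1(1) diag by simp
    qed
  next
    case 2
    show R using 2(2)
    proof (elim disjE conjE)
      assume "x = - diag" then show R using Q[OF q(3)] 2(1) diag by simp
    next
      assume "- diag < x" "x < 0" then show R using P[of 3] 2(1) by simp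
    next
      assume "x = 0" then show R using C(1) 2(1) by simp
    next
      assume "0 < x" "x < 1/3" then show R using P[of 4] 2(1) by simp
    next
      assume "x = 1/3" then show R using C(3) 2(1) by simp
    next
      assume "1/3 < x" "x < diag" then show R using P[of 5] 2(1) by simp
    next
      assume "x = diag" then show R using Q[OF q(4)] 2(1) diag by simp
    qed
  next
    case 3
    show R using 3(2)
    proof (elim disjE conjE)
      assume "x = - 1" then show R using Q[OF q(5)] 3(1) by simp
    next
      assume "- 1 < x" "x < -1/3" then show R using P[of 6] 3(1) by simp
    next
      assume "x = -1/3" then show R using C(2) 3(1) by simp
    next
      assume "-1/3 < x" "x < 1/3" then show R using P[of 7] 3(1) by simp
    next
      assume "x = 1/3" then show R using C(3) 3(1) by simp
    next
      assume "1/3 < x" "x < 1" then show R using P[of 8] 3(1) by simp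
    next
      assume "x = 1" then show R using Q[OF q(6)] 3(1) by simp
    qed
  qed
qed

text \<open>The factor - s is 1 for s = -1 and the half turn for s = 1, and the half turn carries
  the first picture to the second. One family of graphs thus describes both.\<close>

lemma R3_strands:
  assumes "s = 1 \<or> s = -1" and "norm (Complex x y) \<le> 1"
  shows "of_real (- s) * Complex x y \<in> strands (R3_picture so ro s) \<longleftrightarrow> y = x \<or> y = - x \<or> y = (\<bar>x\<bar> - 1) / 2"
proof -
  have "\<bar>x\<bar> \<le> 1" using abs_Re_le_cmod[of "Complex x y"] assms(2) by simp
  then show ?thesis using assms by (auto simp: R3_picture_def Let_def complex_norm)
qed

lemma R3_crossing_points:
  assumes "s = 1 \<or> s = -1"
  shows "of_real (- s) * Complex x y \<in> crossing_points (R3_picture so ro s)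
    \<longleftrightarrow> x = 0 \<and> y = 0 \<or> x = -1/3 \<and> y = -1/3 \<or> x = 1/3 \<and> y = -1/3"
  using assms by (auto simp: R3_picture_def Let_def complex_eq_iff)

lemma R3_over_strand:
  assumes "s = 1 \<or> s = -1" and "norm (Complex x y) \<le> 1"
  shows "of_real (- s) * Complex x y \<in> over_strand (R3_picture so ro s) 0 \<longleftrightarrow> (if ro then y = x else y = - x)"
    "a ~= 0 ==> of_real (- s) * Complex x y \<in> over_strand (R3_picture so ro s) (of_real (- s) * Complex a b)
      \<longleftrightarrow> (if so then y = (\<bar>x\<bar> - 1) / 2 else y = x \<or> y = - x)"
proof -
  have "\<bar>x\<bar> \<le> 1" using abs_Re_le_cmod[of "Complex x y"] assms(2) by simp
  moreover have "a ~= 0 ==> of_real (- s) * Complex a b ~= 0" using assms(1) by (auto simp: complex_eq_iff)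
  ultimately show "of_real (- s) * Complex x y \<in> over_strand (R3_picture so ro s) 0 \<longleftrightarrow> (if ro then y = x else y = - x)"
    "a ~= 0 ==> of_real (- s) * Complex x y \<in> over_strand (R3_picture so ro s) (of_real (- s) * Complex a b)
      \<longleftrightarrow> (if so then y = (\<bar>x\<bar> - 1) / 2 else y = x \<or> y = - x)"
    using assms by (auto simp: R3_picture_def Let_def complex_norm complex_eq_iff)
qed

text \<open>The entries at 1, 4 and 7 are fillers; only the numbers in \<open>J3\<close> have an end
  on the circle.\<close>

definition corner3 :: "nat => complex" where
  "corner3 j = (let x = [- diag, 0, diag, - diag, 0, diag, -1, 0, 1] ! j in Complex x (f3 j x))"

lemma corner3_simps [simp]: "corner3 0 = Complex (- diag) (- diag)" "corner3 2 = Complex diag diag"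
  "corner3 3 = Complex (- diag) diag" "corner3 5 = Complex diag (- diag)" "corner3 6 = -1" "corner3 8 = 1"
  by (simp_all add: corner3_def Let_def complex_eq_iff)

lemma norm_corner3: "j \<in> J3 ==> norm (corner3 j) = 1"
  using diag by (auto simp: J3_def complex_norm power2_eq_square)

lemma inj_corner3: "inj_on corner3 J3"
  using diag by (auto simp: inj_on_def J3_def complex_eq_iff)

lemma corner3_end:
  "j \<in> J3 ==> corner3 j = Complex (lo3 j) (f3 j (lo3 j)) \<or> corner3 j = Complex (hi3 j) (f3 j (hi3 j))"
  by (auto simp: J3_def complex_eq_iff)

lemma end3: assumes "j < 9" "x = lo3 j \<or> x = hi3 j"
  shows "Complex x (f3 j x) \<in> {0, Complex (-1/3) (-1/3), Complex (1/3) (-1/3)} \<or> j \<in> J3 \<and> Complex x (f3 j x) = corner3 j"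
  using assms unfolding lt9 J3_def by (elim insertE emptyE; elim disjE) (simp_all add: complex_eq_iff)

lemma norm_le_oneI: "\<bar>x\<bar> + \<bar>y\<bar> \<le> 1 ==> norm (Complex x y) \<le> 1"
  using norm_le_sum[of x y] by linarith

lemma norm_less_oneI: "\<bar>x\<bar> + \<bar>y\<bar> < 1 ==> norm (Complex x y) < 1"
  using norm_le_sum[of x y] by linarith

lemma f3_cases: "f3 j x = x \<or> f3 j x = - x \<or> f3 j x = (\<bar>x\<bar> - 1) / 2"
  by (simp add: f3_def)

lemma graph_ball3:
  assumes "j < 9" "lo3 j < x" "x < hi3 j" shows "norm (Complex x (f3 j x)) < 1"
proof -
  have sl: "norm (Complex x ((\<bar>x\<bar> - 1) / 2)) < 1" if "\<bar>x\<bar> < 1"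
  proof -
    have "\<bar>(\<bar>x\<bar> - 1) / 2\<bar> = (1 - \<bar>x\<bar>) / 2" using that by simp
    then have "norm (Complex x ((\<bar>x\<bar> - 1) / 2)) \<le> \<bar>x\<bar> + (1 - \<bar>x\<bar>) / 2" using norm_le_sum[of x "(\<bar>x\<bar> - 1) / 2"] by simp
    also have "\<dots> < 1" using that by (simp add: field_simps)
    finally show ?thesis .
  qed
  show ?thesis
  proof (cases "j < 6")
    case True
    then have "j \<in> {0, 1, 2, 3, 4, 5}" by auto
    then show ?thesis using assms(2,3) diag by (elim insertE emptyE) (simp_all add: norm_diag)
  next
    case False
    then have "j \<in> {6, 7, 8}" using assms(1) by auto
    then have "\<bar>x\<bar> < 1" using assms(2,3) by (elim insertE emptyE) (simp_all add: abs_less_iff)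
    then show ?thesis using sl False by (simp add: f3_def)
  qed
qed

locale R3_disc =
  fixes D :: shaded_diagram and so ro :: bool and s :: real
  assumes D: "shaded_link_diagram D" and s: "s = 1 \<or> s = -1" and pic: "shows_picture id D (R3_picture so ro s)"
begin

abbreviation sg :: complex where "sg \<equiv> of_real (- s)"

definition C :: "complex set" where "C = {sg * Complex 0 0, sg * Complex (-1/3) (-1/3), sg * Complex (1/3) (-1/3)}"

definition corner :: "nat => complex" where "corner j = sg * corner3 j"

definition Bd :: "complex set" where "Bd = corner ` J3"

definition \<beta> :: "complex => nat" where "\<beta> = inv_into J3 corner"

lemma sigma_unit: "norm sg = 1" "sg * sg = 1" "sg ~= 0"
  using s by auto

lemma point: obtains x y where "z = sg * Complex x y" "norm z = norm (Complex x y)"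
proof -
  have "z = sg * Complex (Re (sg * z)) (Im (sg * z))" by (simp only: complex_surj mult.assoc[symmetric] sigma_unit mult_1)
  moreover from this have "norm z = norm (Complex (Re (sg * z)) (Im (sg * z)))"
    by (metis norm_mult sigma_unit(1) mult_1)
  ultimately show thesis by (rule that)
qed

lemma in_disc: "sg * Complex x y \<in> cball 0 1 \<longleftrightarrow> norm (Complex x y) \<le> 1"
  using sigma_unit(1) by (simp add: norm_mult)

lemma on_curve: "norm (Complex x y) \<le> 1 ==> sg * Complex x y \<in> curve D \<longleftrightarrow> y = x \<or> y = - x \<or> y = (\<bar>x\<bar> - 1) / 2"
proof -
  assume n: "norm (Complex x y) \<le> 1"
  have "curve D \<inter> cball 0 1 = strands (R3_picture so ro s)" using pic by (simp add: shows_picture_def)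
  then have "sg * Complex x y \<in> curve D \<longleftrightarrow> sg * Complex x y \<in> strands (R3_picture so ro s)" using n in_disc by blast
  then show ?thesis using R3_strands[OF s n] by simp
qed

lemma is_crossing: "norm (Complex x y) \<le> 1 ==> sg * Complex x y \<in> crossings D
    \<longleftrightarrow> x = 0 \<and> y = 0 \<or> x = -1/3 \<and> y = -1/3 \<or> x = 1/3 \<and> y = -1/3"
proof -
  assume n: "norm (Complex x y) \<le> 1"
  have "crossings D \<inter> cball 0 1 = crossing_points (R3_picture so ro s)" using pic by (simp add: shows_picture_def)
  then have "sg * Complex x y \<in> crossings D \<longleftrightarrow> sg * Complex x y \<in> crossing_points (R3_picture so ro s)" using n in_disc by blast
  then show ?thesis using R3_crossing_points[OF s] by simp
qed

lemma germ: "norm (Complex x y) \<le> 1 ==> sg * Complex x y \<in> crossings D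
    ==> same_germ (sg * Complex x y) (overpass D (sg * Complex x y)) (over_strand (R3_picture so ro s) (sg * Complex x y))"
  using pic in_disc unfolding shows_picture_def by simp

lemma sigma_eq: "sg * a = sg * b \<longleftrightarrow> a = b"
  using sigma_unit(3) by simp

lemma in_C: "sg * Complex x y \<in> C \<longleftrightarrow> x = 0 \<and> y = 0 \<or> x = -1/3 \<and> y = -1/3 \<or> x = 1/3 \<and> y = -1/3"
  unfolding C_def insert_iff empty_iff sigma_eq complex.inject by simp

lemma inj_corner: "inj_on corner J3"
  using inj_corner3 unfolding inj_on_def corner_def sigma_eq by blast

lemma beta: "j \<in> J3 ==> \<beta> (corner j) = j" "w \<in> Bd ==> corner (\<beta> w) = w" "w \<in> Bd ==> \<beta> w \<in> J3"
  using inj_corner unfolding \<beta>_def Bd_def by (auto intro: inv_into_f_f f_inv_into_f inv_into_into)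

lemma J3_less: "j \<in> J3 ==> j < 9"
  by (auto simp: J3_def)

lemma picture: "graph_picture D sg 9 f3 lo3 hi3 C Bd \<beta>"
proof
  show "shaded_link_diagram D" "norm sg = 1" by (rule D, rule sigma_unit)
  show "continuous_on UNIV (f3 j)" for j by (auto simp: f3_def intro!: continuous_intros)
  show "lo3 j < hi3 j" if "j < 9" for j using that diag unfolding lt9 by (elim insertE emptyE) simp_all
  show "f3 i x ~= f3 j x" if "i < 9" "j < 9" "i ~= j" "lo3 i < x" "x < hi3 i" "lo3 j < x" "x < hi3 j" for i j x
    using disjoint3 that by blast
  show cross: "crossings D \<inter> cball 0 1 = C"
  proof (rule set_eqI)
    fix z
    obtain x y where z: "z = sg * Complex x y" "norm z = norm (Complex x y)" by (rule point)
    have "norm (Complex x y) \<le> 1" if "z \<in> C"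
      using that unfolding z(1) in_C by (elim disjE conjE) (simp_all add: norm_le_oneI)
    then show "z \<in> crossings D \<inter> cball 0 1 \<longleftrightarrow> z \<in> C"
      using is_crossing[of x y] in_disc[of x y] unfolding z(1) in_C by blast
  qed
  have nC: "norm (Complex x y) < 1" if "sg * Complex x y \<in> C" for x y
    using that norm_le_sum[of x y] unfolding in_C by auto
  show "C \<subseteq> ball 0 1"
  proof
    fix z assume "z \<in> C"
    obtain x y where z: "z = sg * Complex x y" "norm z = norm (Complex x y)" by (rule point)
    show "z \<in> ball 0 1" using nC[of x y] \<open>z \<in> C\<close> z by simp
  qed
  have nBd: "norm w = 1" if "w \<in> Bd" for w
    using that norm_corner3 sigma_unit(1) by (auto simp: Bd_def corner_def norm_mult)
  show "finite Bd" by (simp add: Bd_def J3_def)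
  show "Bd \<subseteq> sphere 0 1" using nBd by auto
  show gb: "norm (Complex x (f3 j x)) < 1" if "j < 9" "lo3 j < x" "x < hi3 j" for j x by (rule graph_ball3[OF that])
  show "sg * Complex x (f3 j x) ~: C" if "j < 9" "lo3 j < x" "x < hi3 j" for j x
    using that diag unfolding in_C lt9 by (elim insertE emptyE) auto
  have fin: "sg * Complex x (f3 j x) \<in> C \<union> Bd" if "j < 9" "x = lo3 j \<or> x = hi3 j" for j x
    using end3[OF that] unfolding C_def Bd_def corner_def by (auto simp: complex_eq_iff)
  show "sg * Complex (lo3 j) (f3 j (lo3 j)) \<in> C \<union> Bd" "sg * Complex (hi3 j) (f3 j (hi3 j)) \<in> C \<union> Bd" if "j < 9" for j
    using fin[OF that] by auto
  show "\<beta> w < 9" if "w \<in> Bd" for w using J3_less[OF beta(3)[OF that]] .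
  show "w = sg * Complex (lo3 (\<beta> w)) (f3 (\<beta> w) (lo3 (\<beta> w))) \<or> w = sg * Complex (hi3 (\<beta> w)) (f3 (\<beta> w) (hi3 (\<beta> w)))"
    if w: "w \<in> Bd" for w
    using corner3_end[OF beta(3)[OF w]] beta(2)[OF w] unfolding corner_def by metis
  show "w ~= sg * Complex (lo3 i) (f3 i (lo3 i)) \<and> w ~= sg * Complex (hi3 i) (f3 i (hi3 i))"
    if w: "w \<in> Bd" and i: "i < 9" "i ~= \<beta> w" for w i
  proof -
    have "w ~= sg * Complex x (f3 i x)" if x: "x = lo3 i \<or> x = hi3 i" for x
    proof
      assume e: "w = sg * Complex x (f3 i x)"
      then have "sg * Complex x (f3 i x) ~: C" using nC[of x "f3 i x"] nBd[OF w] sigma_unit(1) by (auto simp: norm_mult)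
      then have "i \<in> J3" "Complex x (f3 i x) = corner3 i" using end3[OF i(1) x] by (auto simp: C_def complex_eq_iff)
      then have "w = corner i" "i \<in> J3" using e by (simp_all add: corner_def)
      then have "\<beta> w = i" using beta(1)[of i] by simp
      then show False using i(2) by simp
    qed
    then show ?thesis by blast
  qed
  show "curve D \<inter> cball 0 1 = C \<union> Bd \<union> (\<Union>j<9. graph_piece sg f3 lo3 hi3 j)"
  proof (rule set_eqI)
    fix z
    obtain x y where z: "z = sg * Complex x y" "norm z = norm (Complex x y)" by (rule point)
    show "z \<in> curve D \<inter> cball 0 1 \<longleftrightarrow> z \<in> C \<union> Bd \<union> (\<Union>j<9. graph_piece sg f3 lo3 hi3 j)"
    proof
      assume "z \<in> curve D \<inter> cball 0 1"
      then have n: "norm (Complex x y) \<le> 1" and "sg * Complex x y \<in> curve D" using z by auto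
      then have yx: "y = x \<or> y = - x \<or> y = (\<bar>x\<bar> - 1) / 2" using on_curve by blast
      have "\<bar>x\<bar> \<le> 1" using abs_Re_le_cmod[of "Complex x y"] n by simp
      then have "\<bar>x\<bar> \<le> diag \<and> y = x \<or> \<bar>x\<bar> \<le> diag \<and> y = - x \<or> \<bar>x\<bar> \<le> 1 \<and> y = (\<bar>x\<bar> - 1) / 2"
        using yx n norm_diag[of x] by auto
      then show "z \<in> C \<union> Bd \<union> (\<Union>j<9. graph_piece sg f3 lo3 hi3 j)"
      proof (rule cover3)
        fix j assume j: "j \<in> J3" "Complex x y = Complex (lo3 j) (f3 j (lo3 j)) \<or> Complex x y = Complex (hi3 j) (f3 j (hi3 j))" "\<bar>x\<bar> > 1/3"
        have "x = lo3 j \<or> x = hi3 j" "Complex x y = Complex x (f3 j x)" using j(2) by auto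
        then have "sg * Complex x y \<in> C \<union> Bd" using fin[OF J3_less[OF j(1)]] by simp
        then show "z \<in> C \<union> Bd \<union> (\<Union>j<9. graph_piece sg f3 lo3 hi3 j)" unfolding z(1) by blast
      next
        fix j assume j: "j < 9" "lo3 j < x" "x < hi3 j" "y = f3 j x"
        then have "z \<in> graph_piece sg f3 lo3 hi3 j" unfolding z(1) using mem_graph_piece[OF sigma_unit(3)] by blast
        then show "z \<in> C \<union> Bd \<union> (\<Union>j<9. graph_piece sg f3 lo3 hi3 j)" using j(1) by blast
      qed (use z(1) in_C[of x y] in blast)+
    next
      assume "z \<in> C \<union> Bd \<union> (\<Union>j<9. graph_piece sg f3 lo3 hi3 j)"
      then consider "z \<in> C" | "z \<in> Bd" | j where "j < 9" "z \<in> graph_piece sg f3 lo3 hi3 j" by blast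
      then show "z \<in> curve D \<inter> cball 0 1"
      proof cases
        case 1
        then have "norm (Complex x y) \<le> 1" using nC[of x y] z(1) by simp
        then show ?thesis using 1 on_curve[of x y] z in_C[of x y] by auto
      next
        case 2
        then obtain j where j: "j \<in> J3" "z = corner j" by (auto simp: Bd_def)
        have "corner3 j = Complex x y" using j(2) z(1) by (simp only: corner_def sigma_eq)
        moreover have "\<exists>x'. corner3 j = Complex x' (f3 j x')" using corner3_end[OF j(1)] by blast
        ultimately obtain x' where x': "Complex x y = Complex x' (f3 j x')" by auto
        have n: "norm (Complex x y) \<le> 1" using nBd[OF 2] z by simp
        then have "sg * Complex x y \<in> curve D" using on_curve[OF n] f3_cases[of j x'] x' by simp
        then show ?thesis using n z by simp
      next
        case (3 j)
        then have m: "lo3 j < x" "x < hi3 j" "y = f3 j x" using mem_graph_piece[OF sigma_unit(3)] z(1) by blast+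
        have n: "norm (Complex x y) \<le> 1" using gb[OF 3(1) m(1,2)] m(3) by simp
        then have "sg * Complex x y \<in> curve D" using on_curve[OF n] f3_cases[of j x] m(3) by simp
        then show ?thesis using n z by simp
      qed
    qed
  qed
qed

sublocale graph_picture D sg 9 f3 lo3 hi3 C Bd \<beta>
  by (rule picture)

text \<open>The chosen point is inside the triangle whose corners are the three crossings.\<close>

definition T :: bool where "T \<longleftrightarrow> sg * Complex 0 (-1/4) \<in> shaded D"

lemma shade_T: "norm (Complex x y) \<le> 1 ==> y < x ==> y < - x ==> x - 1 < 2 * y ==> - x - 1 < 2 * y ==> sg * Complex x y \<in> shaded D \<longleftrightarrow> T"
  unfolding T_def
proof (rule region_shade[of "cball 0 1 \<inter> {z. (-1) * Re z + 1 * Im z < 0} \<inter> {z. 1 * Re z + 1 * Im z < 0}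
        \<inter> {z. 1 * Re z + (-2) * Im z < 1} \<inter> {z. (-1) * Re z + (-2) * Im z < 1}"])
  show "convex (cball 0 1 \<inter> {z. (-1) * Re z + 1 * Im z < 0} \<inter> {z. 1 * Re z + 1 * Im z < 0}
        \<inter> {z. 1 * Re z + (-2) * Im z < 1} \<inter> {z. (-1) * Re z + (-2) * Im z < 1})"
    by (intro convex_Int convex_cball convex_half_plane)
qed (auto simp: on_curve abs_if norm_le_oneI simp del: of_real_minus mult_minus_left)

definition W :: bool where "W \<longleftrightarrow> sg * Complex (-1/3) 0 \<in> shaded D"

lemma shade_W: "norm (Complex x y) \<le> 1 ==> x < y ==> y < - x ==> - x - 1 < 2 * y ==> sg * Complex x y \<in> shaded D \<longleftrightarrow> W"
  unfolding W_def
proof (rule region_shade[of "cball 0 1 \<inter> {z. 1 * Re z + (-1) * Im z < 0} \<inter> {z. 1 * Re z + 1 * Im z < 0}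
        \<inter> {z. (-1) * Re z + (-2) * Im z < 1}"])
  show "convex (cball 0 1 \<inter> {z. 1 * Re z + (-1) * Im z < 0} \<inter> {z. 1 * Re z + 1 * Im z < 0}
        \<inter> {z. (-1) * Re z + (-2) * Im z < 1})"
    by (intro convex_Int convex_cball convex_half_plane)
qed (auto simp: on_curve abs_if norm_le_oneI simp del: of_real_minus mult_minus_left)

definition N :: bool where "N \<longleftrightarrow> sg * Complex 0 1 \<in> shaded D"

lemma shade_N: "norm (Complex x y) \<le> 1 ==> x < y ==> - x < y ==> sg * Complex x y \<in> shaded D \<longleftrightarrow> N"
  unfolding N_def
proof (rule region_shade[of "cball 0 1 \<inter> {z. 1 * Re z + (-1) * Im z < 0} \<inter> {z. (-1) * Re z + (-1) * Im z < 0}"])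
  show "convex (cball 0 1 \<inter> {z. 1 * Re z + (-1) * Im z < 0} \<inter> {z. (-1) * Re z + (-1) * Im z < 0})"
    by (intro convex_Int convex_cball convex_half_plane)
qed (auto simp: on_curve abs_if norm_le_oneI simp del: of_real_minus mult_minus_left)

definition S :: bool where "S \<longleftrightarrow> sg * Complex 0 (-1) \<in> shaded D"

lemma shade_S: "norm (Complex x y) \<le> 1 ==> y < x ==> y < - x ==> 2 * y < - x - 1 ==> sg * Complex x y \<in> shaded D \<longleftrightarrow> S"
  unfolding S_def
proof (rule region_shade[of "cball 0 1 \<inter> {z. (-1) * Re z + 1 * Im z < 0} \<inter> {z. 1 * Re z + 1 * Im z < 0}
        \<inter> {z. 1 * Re z + 2 * Im z < - 1}"])
  show "convex (cball 0 1 \<inter> {z. (-1) * Re z + 1 * Im z < 0} \<inter> {z. 1 * Re z + 1 * Im z < 0}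
        \<inter> {z. 1 * Re z + 2 * Im z < - 1})"
    by (intro convex_Int convex_cball convex_half_plane)
qed (auto simp: on_curve abs_if norm_le_oneI simp del: of_real_minus mult_minus_left)

text \<open>Each crossing of an edge changes the colour: from the triangle over the side 1 at (-1/6,
  -1/6) to the left region W, from there over the falling strand at (-1/6, 1/6) to the upper region
  N, and from the triangle over the side 7 at (-1/6, -5/12) to the lower region S.\<close>

lemma shades: "W \<longleftrightarrow> \<not> T" "N \<longleftrightarrow> T" "S \<longleftrightarrow> \<not> T"
proof -
  have near: "norm (Complex x y) \<le> 1" if "\<bar>x - a\<bar> < 1/20" "\<bar>y - b\<bar> < 1/20" "\<bar>a\<bar> + \<bar>b\<bar> \<le> 9/10" for x y a b :: real
    by (rule norm_le_oneI) (use that in linarith)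
  have small: "norm (Complex x y) < 1/20" if "\<bar>x\<bar> + \<bar>y\<bar> < 1/20" for x y using that norm_le_sum[of x y] by linarith
  have "sg * Complex (-1/6 - 1/100) (-1/6 + 1/100) \<in> shaded D \<longleftrightarrow> sg * Complex (-1/6 + 1/100) (-1/6 - 1/100) ~: shaded D"
  proof (rule edge_flip[of "-1/6" "-1/6" "1/20" 1 1])
    show "sg * Complex x y \<in> curve D \<longleftrightarrow> 1 * (y - -1/6) = 1 * (x - -1/6)" if "\<bar>x - -1/6\<bar> < 1/20" "\<bar>y - -1/6\<bar> < 1/20" for x y
    proof -
      have "norm (Complex x y) \<le> 1" by (rule near[OF that]) simp
      note c = on_curve[OF this]
      have b: "-1/4 < x" "x < -1/10" "-1/4 < y" "y < -1/10" using that unfolding abs_less_iff by linarith+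
      then have "\<bar>x\<bar> = - x" by simp
      then show ?thesis unfolding c using b by auto
    qed
  qed ((rule small | simp add: on_curve is_crossing norm_le_oneI del: of_real_minus mult_minus_left)+)
  then show W: "W \<longleftrightarrow> \<not> T"
    by (simp add: shade_W shade_T norm_le_oneI del: of_real_minus mult_minus_left)
  have "sg * Complex (-1/6 + 1/100) (1/6 + 1/100) \<in> shaded D \<longleftrightarrow> sg * Complex (-1/6 - 1/100) (1/6 - 1/100) ~: shaded D"
  proof (rule edge_flip[of "-1/6" "1/6" "1/20" 1 "-1"])
    show "sg * Complex x y \<in> curve D \<longleftrightarrow> 1 * (y - 1/6) = -1 * (x - -1/6)" if "\<bar>x - -1/6\<bar> < 1/20" "\<bar>y - 1/6\<bar> < 1/20" for x y
    proof -
      have "norm (Complex x y) \<le> 1" by (rule near[OF that]) simp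
      note c = on_curve[OF this]
      have b: "-1/4 < x" "x < -1/10" "1/10 < y" "y < 1/4" using that unfolding abs_less_iff by linarith+
      then have "\<bar>x\<bar> = - x" by simp
      then show ?thesis unfolding c using b by auto
    qed
  qed ((rule small | simp add: on_curve is_crossing norm_le_oneI del: of_real_minus mult_minus_left)+)
  then show "N \<longleftrightarrow> T" using W
    by (simp add: shade_W shade_N norm_le_oneI del: of_real_minus mult_minus_left)
  have "sg * Complex (-1/6 + 1/100) (-5/12 + 1/100) \<in> shaded D \<longleftrightarrow> sg * Complex (-1/6 - 1/100) (-5/12 - 1/100) ~: shaded D"
  proof (rule edge_flip[of "-1/6" "-5/12" "1/20" 2 "-1"])
    show "sg * Complex x y \<in> curve D \<longleftrightarrow> 2 * (y - -5/12) = -1 * (x - -1/6)" if "\<bar>x - -1/6\<bar> < 1/20" "\<bar>y - -5/12\<bar> < 1/20" for x y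
    proof -
      have "norm (Complex x y) \<le> 1" by (rule near[OF that]) simp
      note c = on_curve[OF this]
      have b: "-1/4 < x" "x < -1/10" "-1/2 < y" "y < -1/3" using that unfolding abs_less_iff by linarith+
      then have "\<bar>x\<bar> = - x" by simp
      then show ?thesis unfolding c using b by auto
    qed
  qed ((rule small | simp add: on_curve is_crossing norm_le_oneI del: of_real_minus mult_minus_left)+)
  then show "S \<longleftrightarrow> \<not> T"
    by (simp add: shade_T shade_S norm_le_oneI del: of_real_minus mult_minus_left)
qed


text \<open>Counterclockwise from the upper right the edges are 2, 3, 1, 4. The quadrant between 2
  and 3 is the upper region, which is coloured like the triangle.\<close>

lemma symbol_centre:
  "\<exists>h. crossing_chart (subdiv D Bd) (sg * Complex 0 0) h
    \<and> expand (chart_symbol (subdiv D Bd) h) = expand (sym4 ro T (G 2) (G 3) (G 1) (G 4))"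
proof (rule crossing_symbol_at[where r = "1/20" and ?u1.0 = 1 and ?u2.0 = 1 and ?w1.0 = "-1" and ?w2.0 = 1
      and S = "over_strand (R3_picture so ro s) (sg * Complex 0 0)"])
  show "same_germ (sg * Complex 0 0) (overpass D (sg * Complex 0 0)) (over_strand (R3_picture so ro s) (sg * Complex 0 0))"
    by (rule germ) (simp_all only: is_crossing norm_le_oneI, simp_all)
  fix x y :: real assume xy: "\<bar>x\<bar> < 1/20" "\<bar>y\<bar> < 1/20"
  have P: "Complex (0 + x * 1 + y * - 1) (0 + x * 1 + y * 1) = Complex (x - y) (x + y)" by simp
  have b: "-1/20 < x" "x < 1/20" "-1/20 < y" "y < 1/20" using xy unfolding abs_less_iff by linarith+
  have "\<bar>x - y\<bar> < 1/10" "\<bar>x + y\<bar> < 1/10" using b unfolding abs_less_iff by linarith+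
  note c = this[unfolded abs_less_iff]
  have n: "norm (Complex (x - y) (x + y)) < 1" by (rule norm_less_oneI) (use \<open>\<bar>x - y\<bar> < 1/10\<close> \<open>\<bar>x + y\<bar> < 1/10\<close> in linarith)
  then show "norm (Complex (0 + x * 1 + y * - 1) (0 + x * 1 + y * 1)) < 1" unfolding P .
  have ne: "x + y ~= (\<bar>x - y\<bar> - 1) / 2" using b \<open>\<bar>x - y\<bar> < 1/10\<close> by (auto simp: abs_less_iff)
  show "sg * Complex (0 + x * 1 + y * - 1) (0 + x * 1 + y * 1) \<in> curve D \<longleftrightarrow> x = 0 \<or> y = 0"
    unfolding P on_curve[OF less_imp_le[OF n]] using ne by auto
  show "sg * Complex (0 + x * 1 + y * - 1) (0 + x * 1 + y * 1) \<in> crossings D \<longleftrightarrow> x = 0 \<and> y = 0"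
    unfolding P is_crossing[OF less_imp_le[OF n]] using b by auto
  have z: "sg * Complex 0 0 = 0" by (simp add: complex_eq_iff)
  show "sg * Complex (0 + x * 1 + y * - 1) (0 + x * 1 + y * 1) \<in> over_strand (R3_picture so ro s) (sg * Complex 0 0)
      \<longleftrightarrow> (if ro then y = 0 else x = 0)"
    unfolding P z R3_over_strand(1)[OF s less_imp_le[OF n]] by auto
next
  fix t :: real assume t: "0 < t" "t < 1/20"
  show "sg * Complex (0 + t * 1) (0 + t * 1) \<in> G 2" "sg * Complex (0 + t * - 1) (0 + t * 1) \<in> G 3"
    "sg * Complex (0 - t * 1) (0 - t * 1) \<in> G 1" "sg * Complex (0 - t * - 1) (0 - t * 1) \<in> G 4"
    unfolding mem_graph_piece[OF sigma_unit(3)] using t diag by auto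
  have P: "Complex (0 + t * 1 + t * - 1) (0 + t * 1 + t * 1) = Complex 0 (2 * t)" by simp
  show "sg * Complex (0 + t * 1 + t * - 1) (0 + t * 1 + t * 1) \<in> shaded D \<longleftrightarrow> T"
    unfolding P shades(2)[symmetric] by (rule shade_N) (use t in \<open>auto intro!: norm_le_oneI\<close>)
qed simp_all

text \<open>The edges 1 and 0 are on the rising strand, 6 and 7 on the sliding one. The quadrant
  between 1 and 6 is the left region, of the colour opposite to the triangle.\<close>

lemma symbol_left:
  "\<exists>h. crossing_chart (subdiv D Bd) (sg * Complex (-1/3) (-1/3)) h
    \<and> expand (chart_symbol (subdiv D Bd) h) = expand (sym4 (\<not> so) (\<not> T) (G 1) (G 6) (G 0) (G 7))"
proof (rule crossing_symbol_at[where r = "1/20" and ?u1.0 = 1 and ?u2.0 = 1 and ?w1.0 = "-1" and ?w2.0 = "1/2"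
      and S = "over_strand (R3_picture so ro s) (sg * Complex (-1/3) (-1/3))"])
  show "same_germ (sg * Complex (-1/3) (-1/3)) (overpass D (sg * Complex (-1/3) (-1/3))) (over_strand (R3_picture so ro s) (sg * Complex (-1/3) (-1/3)))"
    by (rule germ) (simp_all only: is_crossing norm_le_oneI, simp_all add: norm_le_oneI)
  fix x y :: real assume xy: "\<bar>x\<bar> < 1/20" "\<bar>y\<bar> < 1/20"
  have P: "Complex (-1/3 + x * 1 + y * - 1) (-1/3 + x * 1 + y * (1/2)) = Complex (x - y - 1/3) (x + y / 2 - 1/3)" by simp
  have b: "-1/20 < x" "x < 1/20" "-1/20 < y" "y < 1/20" using xy unfolding abs_less_iff by linarith+
  have a: "\<bar>x - y - 1/3\<bar> = 1/3 + y - x" "\<bar>x + y / 2 - 1/3\<bar> = 1/3 - x - y / 2" using b by (simp_all add: abs_if)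
  have n: "norm (Complex (x - y - 1/3) (x + y / 2 - 1/3)) < 1" by (rule norm_less_oneI) (use a b in linarith)
  then show "norm (Complex (-1/3 + x * 1 + y * - 1) (-1/3 + x * 1 + y * (1/2))) < 1" unfolding P .
  show "sg * Complex (-1/3 + x * 1 + y * - 1) (-1/3 + x * 1 + y * (1/2)) \<in> curve D \<longleftrightarrow> x = 0 \<or> y = 0"
    unfolding P on_curve[OF less_imp_le[OF n]] a using b by auto
  show "sg * Complex (-1/3 + x * 1 + y * - 1) (-1/3 + x * 1 + y * (1/2)) \<in> crossings D \<longleftrightarrow> x = 0 \<and> y = 0"
    unfolding P is_crossing[OF less_imp_le[OF n]] using b by auto
  have "- 1 / 3 ~= (0 :: real)" by simp
  from R3_over_strand(2)[OF s less_imp_le[OF n] this]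
  show "sg * Complex (-1/3 + x * 1 + y * - 1) (-1/3 + x * 1 + y * (1/2)) \<in> over_strand (R3_picture so ro s) (sg * Complex (-1/3) (-1/3))
      \<longleftrightarrow> (if \<not> so then y = 0 else x = 0)"
    unfolding P a using b by auto
next
  fix t :: real assume t: "0 < t" "t < 1/20"
  show "sg * Complex (-1/3 + t * 1) (-1/3 + t * 1) \<in> G 1" "sg * Complex (-1/3 + t * - 1) (-1/3 + t * (1/2)) \<in> G 6"
    "sg * Complex (-1/3 - t * 1) (-1/3 - t * 1) \<in> G 0" "sg * Complex (-1/3 - t * - 1) (-1/3 - t * (1/2)) \<in> G 7"
    unfolding mem_graph_piece[OF sigma_unit(3)] using t diag by auto
  have P: "Complex (-1/3 + t * 1 + t * - 1) (-1/3 + t * 1 + t * (1/2)) = Complex (-1/3) (3/2 * t - 1/3)" by simp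
  show "sg * Complex (-1/3 + t * 1 + t * - 1) (-1/3 + t * 1 + t * (1/2)) \<in> shaded D \<longleftrightarrow> \<not> T"
    unfolding P shades(1)[symmetric] by (rule shade_W) (use t in \<open>auto intro!: norm_le_oneI\<close>)
qed simp_all

text \<open>The edges 4 and 5 are on the falling strand, 7 and 8 on the sliding one. The quadrant
  between 4 and 7 is the triangle itself.\<close>

lemma symbol_right:
  "\<exists>h. crossing_chart (subdiv D Bd) (sg * Complex (1/3) (-1/3)) h
    \<and> expand (chart_symbol (subdiv D Bd) h) = expand (sym4 (\<not> so) T (G 4) (G 7) (G 5) (G 8))"
proof (rule crossing_symbol_at[where r = "1/20" and ?u1.0 = "-1" and ?u2.0 = 1 and ?w1.0 = "-1" and ?w2.0 = "-1/2"
      and S = "over_strand (R3_picture so ro s) (sg * Complex (1/3) (-1/3))"])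
  show "same_germ (sg * Complex (1/3) (-1/3)) (overpass D (sg * Complex (1/3) (-1/3))) (over_strand (R3_picture so ro s) (sg * Complex (1/3) (-1/3)))"
    by (rule germ) (simp_all only: is_crossing norm_le_oneI, simp_all add: norm_le_oneI)
  fix x y :: real assume xy: "\<bar>x\<bar> < 1/20" "\<bar>y\<bar> < 1/20"
  have P: "Complex (1/3 + x * - 1 + y * - 1) (-1/3 + x * 1 + y * (-1/2)) = Complex (1/3 - x - y) (x - y / 2 - 1/3)" by simp
  have b: "-1/20 < x" "x < 1/20" "-1/20 < y" "y < 1/20" using xy unfolding abs_less_iff by linarith+
  have a: "\<bar>1/3 - x - y\<bar> = 1/3 - x - y" "\<bar>x - y / 2 - 1/3\<bar> = 1/3 - x + y / 2" using b by (simp_all add: abs_if)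
  have n: "norm (Complex (1/3 - x - y) (x - y / 2 - 1/3)) < 1" by (rule norm_less_oneI) (use a b in linarith)
  then show "norm (Complex (1/3 + x * - 1 + y * - 1) (-1/3 + x * 1 + y * (-1/2))) < 1" unfolding P .
  show "sg * Complex (1/3 + x * - 1 + y * - 1) (-1/3 + x * 1 + y * (-1/2)) \<in> curve D \<longleftrightarrow> x = 0 \<or> y = 0"
    unfolding P on_curve[OF less_imp_le[OF n]] a using b by auto
  show "sg * Complex (1/3 + x * - 1 + y * - 1) (-1/3 + x * 1 + y * (-1/2)) \<in> crossings D \<longleftrightarrow> x = 0 \<and> y = 0"
    unfolding P is_crossing[OF less_imp_le[OF n]] using b by auto
  have "1 / 3 ~= (0 :: real)" by simp
  from R3_over_strand(2)[OF s less_imp_le[OF n] this]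
  show "sg * Complex (1/3 + x * - 1 + y * - 1) (-1/3 + x * 1 + y * (-1/2)) \<in> over_strand (R3_picture so ro s) (sg * Complex (1/3) (-1/3))
      \<longleftrightarrow> (if \<not> so then y = 0 else x = 0)"
    unfolding P a using b by auto
next
  fix t :: real assume t: "0 < t" "t < 1/20"
  show "sg * Complex (1/3 + t * - 1) (-1/3 + t * 1) \<in> G 4" "sg * Complex (1/3 + t * - 1) (-1/3 + t * (-1/2)) \<in> G 7"
    "sg * Complex (1/3 - t * - 1) (-1/3 - t * 1) \<in> G 5" "sg * Complex (1/3 - t * - 1) (-1/3 - t * (-1/2)) \<in> G 8"
    unfolding mem_graph_piece[OF sigma_unit(3)] using t diag by auto
  have P: "Complex (1/3 + t * - 1 + t * - 1) (-1/3 + t * 1 + t * (-1/2)) = Complex (1/3 - 2 * t) (t / 2 - 1/3)" by simp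
  show "sg * Complex (1/3 + t * - 1 + t * - 1) (-1/3 + t * 1 + t * (-1/2)) \<in> shaded D \<longleftrightarrow> T"
    unfolding P by (rule shade_T) (use t in \<open>auto intro!: norm_le_oneI\<close>)
qed simp_all

definition crossing_value :: "complex => complex set conpoly" where
  "crossing_value v = (if v = sg * Complex 0 0 then expand (sym4 ro T (G 2) (G 3) (G 1) (G 4))
     else if v = sg * Complex (-1/3) (-1/3) then expand (sym4 (\<not> so) (\<not> T) (G 1) (G 6) (G 0) (G 7))
     else expand (sym4 (\<not> so) T (G 4) (G 7) (G 5) (G 8)))"

lemma crossing_value:
  assumes "v \<in> C"
  shows "\<exists>h. crossing_chart (subdiv D Bd) v h \<and> expand (chart_symbol (subdiv D Bd) h) = crossing_value v"
proof -
  consider "v = sg * Complex 0 0" | "v = sg * Complex (-1/3) (-1/3)" | "v = sg * Complex (1/3) (-1/3)"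
    using assms unfolding C_def by blast
  then show ?thesis
  proof cases
    case 1
    show ?thesis unfolding crossing_value_def if_P[OF 1] unfolding 1 by (rule symbol_centre)
  next
    case 2
    have "v ~= sg * Complex 0 0" unfolding 2 sigma_eq by simp
    then show ?thesis unfolding crossing_value_def if_not_P[OF \<open>v ~= sg * Complex 0 0\<close>] if_P[OF 2] unfolding 2 by (intro symbol_left)
  next
    case 3
    have n: "v ~= sg * Complex 0 0" "v ~= sg * Complex (-1/3) (-1/3)" unfolding 3 sigma_eq by simp_all
    show ?thesis unfolding crossing_value_def if_not_P[OF n(1)] if_not_P[OF n(2)] unfolding 3 by (rule symbol_right)
  qed
qed

lemma prod_crossing_value: "(\<Prod>v\<in>C. crossing_value v) = tri so ro False T (G 0) (G 1) (G 2) (G 3) (G 4) (G 5) (G 6) (G 7) (G 8)"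
proof -
  have n: "sg * Complex 0 0 ~= sg * Complex (-1/3) (-1/3)" "sg * Complex 0 0 ~= sg * Complex (1/3) (-1/3)"
    "sg * Complex (-1/3) (-1/3) ~= sg * Complex (1/3) (-1/3)" unfolding sigma_eq by simp_all
  have v: "crossing_value (sg * Complex 0 0) = expand (sym4 ro T (G 2) (G 3) (G 1) (G 4))"
    "crossing_value (sg * Complex (-1/3) (-1/3)) = expand (sym4 (\<not> so) (\<not> T) (G 1) (G 6) (G 0) (G 7))"
    "crossing_value (sg * Complex (1/3) (-1/3)) = expand (sym4 (\<not> so) T (G 4) (G 7) (G 5) (G 8))"
    unfolding crossing_value_def using n by (simp_all only: if_True if_False refl not_sym simp_thms split: if_split)
  have "(\<Prod>v\<in>{a, b, c}. f v) = f a * f b * f c" if "a ~= b" "a ~= c" "b ~= c" for f :: "complex => complex set conpoly" and a b c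
    using that by (simp add: ac_simps)
  from this[OF n, of crossing_value] show ?thesis unfolding C_def v tri_def by simp
qed

end

context R3_disc
begin

definition lab :: "nat => complex set" where "lab j = graph_piece sg f3 lo3 hi3 j"

text \<open>The inner tangle after the arcs at the circle have been absorbed: outer edges are named
  by their end points on the circle, which are common to both diagrams of a move.\<close>

definition R3_value :: "complex set conpoly" where
  "R3_value = tri so ro False T {corner 0} (lab 1) {corner 2} {corner 3} (lab 4) {corner 5} {corner 6} (lab 7) {corner 8}"

lemma lab_eq_iff: "i < 9 ==> j < 9 ==> lab i = lab j \<longleftrightarrow> i = j"
  unfolding lab_def using G_inj by blast

lemma inj_lab: "inj_on lab {..<9}"
  using lab_eq_iff by (auto simp: inj_on_def)

lemma lab_not_point: "i < 9 ==> w \<in> Bd ==> lab i ~= {w}"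
  unfolding lab_def using G_inside[of i] Bd_Y[of w] by blast

lemma corner_Bd: "j \<in> J3 ==> corner j \<in> Bd"
  by (simp add: Bd_def)

lemma beta_Bd: "\<beta> ` Bd = J3"
proof
  show "\<beta> ` Bd \<subseteq> J3" using beta(3) by (rule image_subsetI)
  show "J3 \<subseteq> \<beta> ` Bd"
  proof
    fix j assume "j \<in> J3"
    then show "j \<in> \<beta> ` Bd" using beta(1)[of j] corner_Bd[of j] by (intro image_eqI[of _ _ "corner j"]) simp_all
  qed
qed

lemma R3_join:
  "tangle_equiv ((\<lambda>w. {w}) ` Bd) ((\<Prod>v\<in>C. crossing_value v) * (\<Prod>w\<in>Bd. con (G (\<beta> w)) {w})) R3_value"
proof -
  let ?P = "tri so ro False T (lab 0) (lab 1) (lab 2) (lab 3) (lab 4) (lab 5) (lab 6) (lab 7) (lab 8)"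
  define g where "g = (\<lambda>e. if e \<in> lab ` J3 then {corner (inv_into J3 lab e)} else e)"
  have iJ: "inj_on lab J3" using J3_less by (intro inj_on_subset[OF inj_lab]) auto
  have sB: "(\<lambda>w. lab (\<beta> w)) ` Bd = lab ` J3" unfolding beta_Bd[symmetric] by (simp only: image_image)
  have gJ: "g (lab j) = {corner j}" if "j \<in> J3" for j using inv_into_f_f[OF iJ that] that by (simp add: g_def)
  have gI: "g (lab j) = lab j" if "j < 9" "j ~: J3" for j
  proof -
    have "lab j ~: lab ` J3" using that J3_less lab_eq_iff by blast
    then show ?thesis by (simp add: g_def)
  qed
  have "tangle_equiv ((\<lambda>w. {w}) ` Bd) (?P * (\<Prod>w\<in>Bd. con (lab (\<beta> w)) {w})) (relabel g ?P)"
  proof (rule tangle_join[where s = "\<lambda>w. lab (\<beta> w)" and I = "{lab 1, lab 4, lab 7}"])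
    show "finite Bd" "inj_on (\<lambda>w. {w}) Bd" by (rule Bd(1)) simp
    show "inj_on (\<lambda>w. lab (\<beta> w)) Bd"
    proof (rule inj_onI)
      fix w w' assume w: "w \<in> Bd" "w' \<in> Bd" "lab (\<beta> w) = lab (\<beta> w')"
      then have "\<beta> w = \<beta> w'" using lab_eq_iff[OF \<beta>(1) \<beta>(1)] by blast
      then have "corner (\<beta> w) = corner (\<beta> w')" by (rule arg_cong)
      then show "w = w'" unfolding beta(2)[OF w(1)] beta(2)[OF w(2)] .
    qed
    show "lab (\<beta> w) ~= {w'}" if "w \<in> Bd" "w' \<in> Bd" for w w' by (rule lab_not_point[OF \<beta>(1)[OF that(1)] that(2)])
    have "mset_set (lab ` J3) = image_mset lab (mset_set J3)" by (rule image_mset_mset_set[OF iJ, symmetric])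
    also have "\<dots> = {#lab 2, lab 3, lab 6, lab 0, lab 5, lab 8#}" by (simp add: J3_def add_mset_commute)
    finally have m1: "mset_set (lab ` J3) = {#lab 2, lab 3, lab 6, lab 0, lab 5, lab 8#}" .
    have "mset_set (lab ` {1, 4, 7}) = image_mset lab (mset_set {1, 4, 7})"
      by (rule image_mset_mset_set[OF inj_on_subset[OF inj_lab], symmetric]) auto
    then have m2: "mset_set {lab 1, lab 4, lab 7} = {#lab 1, lab 4, lab 7#}" by (simp add: add_mset_commute)
    show "homogeneous ?P (mset_set ((\<lambda>w. lab (\<beta> w)) ` Bd) + (mset_set {lab 1, lab 4, lab 7} + mset_set {lab 1, lab 4, lab 7}))"
      unfolding sB m1 m2 by (rule homogeneous_tri)
    have "x ~: lab ` J3" if "x \<in> lab ` {1, 4, 7}" for x using that J3_less by (auto simp: J3_def lab_eq_iff)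
    then show "{lab 1, lab 4, lab 7} \<inter> (\<lambda>w. lab (\<beta> w)) ` Bd = {}" unfolding sB by auto
    have "x ~: (\<lambda>w. {w}) ` Bd" if x: "x \<in> lab ` {1, 4, 7}" for x
    proof -
      obtain j where j: "j \<in> {1, 4, 7}" "x = lab j" using x by (rule imageE)
      then have "j < 9" by auto
      show ?thesis unfolding j(2) by (rule not_in_imageI) (use lab_not_point[OF \<open>j < 9\<close>] in metis)
    qed
    then show "{lab 1, lab 4, lab 7} \<inter> (\<lambda>w. {w}) ` Bd = {}" by auto
    show "g (lab (\<beta> w)) = {w}" if "w \<in> Bd" for w using gJ[OF beta(3)[OF that]] beta(2)[OF that] by simp
    show "g x = x" if "x ~: (\<lambda>w. lab (\<beta> w)) ` Bd" for x using that unfolding sB by (simp add: g_def)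
  qed simp
  moreover have "relabel g ?P = R3_value"
    unfolding relabel_tri R3_value_def by (simp add: gJ gI J3_def)
  ultimately show ?thesis unfolding prod_crossing_value lab_def[symmetric] by simp
qed

lemma bottom_shade: "sg * Complex 0 (-1) \<in> shaded D \<longleftrightarrow> \<not> T" "sg * Complex 0 1 \<in> shaded D \<longleftrightarrow> T"
  by (rule shades(3)[unfolded S_def], rule shades(2)[unfolded N_def])

lemma distinct_labels:
  "distinct [{corner 0}, lab 1, {corner 2}, {corner 3}, lab 4, {corner 5}, {corner 6}, lab 7, {corner 8}]"
proof -
  have c: "corner i = corner j \<longleftrightarrow> i = j" if "i \<in> J3" "j \<in> J3" for i j using inj_on_eq_iff[OF inj_corner that] .
  have n: "lab i ~= {corner j}" "{corner j} ~= lab i" if "i < 9" "j \<in> J3" for i j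
    using lab_not_point[OF that(1) corner_Bd[OF that(2)]] by auto
  show ?thesis by (simp add: c n lab_eq_iff J3_def)
qed

lemma Bd_corners: "(\<lambda>w. {w}) ` Bd = {{corner 2}, {corner 3}, {corner 6}, {corner 0}, {corner 5}, {corner 8}}"
  by (auto simp: Bd_def J3_def)

end

text \<open>The half turn that brings the sliding strand from above to below reverses the numbering
  along every strand.\<close>

lemma tri_rotate: "tri so ro True T r0 r1 r2 f0 f1 f2 s0 s1 s2 = tri so ro False T r2 r1 r0 f2 f1 f0 s2 s1 s0"
  unfolding tri_def using expand_sym4_half_turn[of ro T r1 f1 r0 f2] expand_sym4_half_turn[of "\<not> so" T f0 s0 f1 s1]
    expand_sym4_half_turn[of "\<not> so" "\<not> T" r2 s1 r1 s2] by (simp add: ac_simps)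

text \<open>\<open>tri_equiv\<close> keeps the inner labels, but the sides of the triangles in two
  diagrams are different sets; renaming them on the right closes the gap.\<close>

lemma tri_slide:
  assumes d: "distinct [r0, r1, r2, f0, f1, f2, s0, s1, s2]" and d': "distinct [r2, r1', r0, f2, f1', f0, s2, s1', s0]"
  shows "tangle_equiv {r2, f0, s0, r0, f2, s2} (tri so ro False T r0 r1 r2 f0 f1 f2 s0 s1 s2)
    (tri so ro True (\<not> T) r0 r1' r2 f0 f1' f2 s0 s1' s2)"
proof -
  define k where "k = (\<lambda>x. if x = r1 then r1' else if x = f1 then f1' else if x = s1 then s1' else x)"
  let ?B = "{r2, f0, s0, r0, f2, s2}" and ?I = "{r1, f1, s1}"
  have dr: "distinct (rev [r0, r1, r2, f0, f1, f2, s0, s1, s2])" using d by (simp only: distinct_rev)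
  have dr': "distinct (rev [r2, r1', r0, f2, f1', f0, s2, s1', s0])" using d' by (simp only: distinct_rev)
  have k: "k r1 = r1'" "k f1 = f1'" "k s1 = s1'" "k r2 = r2" "k f0 = f0" "k s0 = s0" "k r0 = r0" "k f2 = f2" "k s2 = s2"
    using d dr by (simp_all add: k_def)
  let ?Q = "tri so ro True (\<not> T) r0 r1 r2 f0 f1 f2 s0 s1 s2"
  have "tangle_equiv ?B ?Q (relabel k ?Q)"
  proof (rule tangle_rename_inner[where I = ?I])
    have m: "mset_set ?B = {#r2, f0, s0, r0, f2, s2#}" "mset_set ?I = {#r1, f1, s1#}" using d dr by simp_all
    show "homogeneous ?Q (mset_set ?B + (mset_set ?I + mset_set ?I))" unfolding m by (rule homogeneous_tri)
    show "?B \<inter> ?I = {}" using d dr by simp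
    have "distinct (map k [r2, f0, s0, r0, f2, s2, r1, f1, s1])"
      unfolding list.map k using d' dr' by simp
    then have "inj_on k (set [r2, f0, s0, r0, f2, s2, r1, f1, s1])" by (rule distinct_map[THEN iffD1, THEN conjunct2])
    moreover have "set [r2, f0, s0, r0, f2, s2, r1, f1, s1] = ?B \<union> ?I" by auto
    ultimately show "inj_on k (?B \<union> ?I)" by (simp only:)
    show "k x = x" if "x \<in> ?B" for x using that k by auto
  qed simp_all
  moreover have "relabel k ?Q = tri so ro True (\<not> T) r0 r1' r2 f0 f1' f2 s0 s1' s2" unfolding relabel_tri k ..
  ultimately have "tangle_equiv ?B ?Q (tri so ro True (\<not> T) r0 r1' r2 f0 f1' f2 s0 s1' s2)" by (simp only:)
  then show ?thesis by (rule tangle_equiv_trans[OF tri_equiv[OF d]])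
qed

text \<open>Shades agree on the circle, since they agree just outside and the complement of the curve is open.\<close>

lemma shade_on_circle:
  assumes D: "shaded_link_diagram D" "shaded_link_diagram D'" and agree: "agree_outside (cball 0 1) D D'"
    and p: "norm p = 1" "p ~: curve D" "p ~: curve D'"
  shows "p \<in> shaded D \<longleftrightarrow> p \<in> shaded D'"
proof -
  have ex: "\<exists>eps>0. ball p eps \<inter> curve E = {}" if E: "shaded_link_diagram E" "p ~: curve E" for E
  proof -
    have G: "arc_graph (curve E) (crossings E)" using E(1) by (auto simp: shaded_link_diagram_def intro: link_diagram_arc_graph)
    have "closed (curve E)"
    proof -
      have K: "\<exists>K. closed K \<and> e \<subseteq> K \<and> K \<subseteq> curve E" if e: "e \<in> components (curve E - crossings E)" for e
      proof -
        have sub: "e \<subseteq> curve E" "crossings E \<subseteq> curve E" using in_components_subset[OF e] G by (auto simp: arc_graph_def)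
        have "arc_edge (crossings E) e \<or> closed_edge e" using G e by (simp add: arc_graph_def)
        then show ?thesis
        proof
          assume "arc_edge (crossings E) e"
          from arc_edge_closed[OF this] show ?thesis using sub by blast
        next
          assume "closed_edge e"
          from closed_edge_closed[OF this] show ?thesis using sub by blast
        qed
      qed
      then obtain K where K: "\<And>e. e \<in> components (curve E - crossings E) ==> closed (K e) \<and> e \<subseteq> K e \<and> K e \<subseteq> curve E" by metis
      have "curve E = crossings E \<union> (\<Union>e\<in>components (curve E - crossings E). K e)"
      proof (intro equalityI subsetI)
        fix x assume x: "x \<in> curve E"
        show "x \<in> crossings E \<union> (\<Union>e\<in>components (curve E - crossings E). K e)"
        proof (cases "x \<in> crossings E")
          case False
          then have "x \<in> \<Union>(components (curve E - crossings E))" using x by simp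
          then show ?thesis using K by blast
        qed simp
      next
        fix x assume "x \<in> crossings E \<union> (\<Union>e\<in>components (curve E - crossings E). K e)"
        then show "x \<in> curve E" using K G by (auto simp: arc_graph_def)
      qed
      moreover have "closed (crossings E \<union> (\<Union>e\<in>components (curve E - crossings E). K e))"
        using G K by (intro closed_Un finite_imp_closed closed_UN) (auto simp: arc_graph_def)
      ultimately show ?thesis by simp
    qed
    from closed_avoiding_ball[OF this E(2)] show ?thesis by blast
  qed
  obtain eps1 where e1: "eps1 > 0" "ball p eps1 \<inter> curve D = {}" using ex[OF D(1) p(2)] by auto
  obtain eps2 where e2: "eps2 > 0" "ball p eps2 \<inter> curve D' = {}" using ex[OF D(2) p(3)] by auto
  define eps where "eps = min eps1 eps2"
  \<comment> \<open>A point on the ray through p, outside the closed disc and in both balls; there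
    the colours agree by assumption.\<close>
  define q where "q = p + of_real (eps / 2) * p"
  have eps: "eps > 0" using e1 e2 by (simp add: eps_def)
  have "dist p q = eps / 2" using eps p(1) by (simp add: q_def dist_norm norm_mult)
  then have q: "q \<in> ball p eps1" "q \<in> ball p eps2" using eps by (auto simp: eps_def)
  have "q = of_real (1 + eps / 2) * p" by (simp add: q_def algebra_simps)
  then have "norm q = 1 + eps / 2" using eps p(1) by (simp only: norm_mult norm_of_real) simp
  then have "q ~: cball 0 1" using eps by simp
  then have "q \<in> shaded D \<longleftrightarrow> q \<in> shaded D'" using agree unfolding agree_outside_def by blast
  moreover have "p \<in> shaded D \<longleftrightarrow> q \<in> shaded D"
    by (rule shaded_connected[of D "ball p eps1"]) (use D(1) e1 q in \<open>auto simp: shaded_link_diagram_def\<close>)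
  moreover have "p \<in> shaded D' \<longleftrightarrow> q \<in> shaded D'"
    by (rule shaded_connected[of D' "ball p eps2"]) (use D(2) e2 q in \<open>auto simp: shaded_link_diagram_def\<close>)
  ultimately show ?thesis by simp
qed

theorem reidemeister3_disc:
  assumes "shaded_link_diagram D" "shaded_link_diagram D'" and agree: "agree_outside (cball 0 1) D D'"
    and "shows_picture id D (R3_picture so ro (-1))" "shows_picture id D' (R3_picture so ro 1)"
  shows "ss D - ss D' \<in> I_infinity"
proof -
  interpret R: R3_disc D so ro "-1" by unfold_locales (use assms in auto)
  interpret R': R3_disc D' so ro 1 by unfold_locales (use assms in auto)
  \<comment> \<open>The coordinates of the second diagram contain a half turn, which exchanges
    opposite corners; as a set the boundary points are the same.\<close>
  have corner: "R'.corner 0 = R.corner 2" "R'.corner 2 = R.corner 0" "R'.corner 3 = R.corner 5" "R'.corner 5 = R.corner 3"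
    "R'.corner 6 = R.corner 8" "R'.corner 8 = R.corner 6"
    by (simp_all add: R.corner_def R'.corner_def complex_eq_iff)
  have Bd: "R'.Bd = R.Bd" by (auto simp: R.Bd_def R'.Bd_def J3_def corner)
  \<comment> \<open>Compared at the lowest point of the circle. In D it lies beyond the sliding
    strand and has the colour opposite to the triangle; in the turned coordinates of D' it is the
    highest point, coloured like the triangle.\<close>
  have "R'.T \<longleftrightarrow> \<not> R.T"
  proof -
    have p: "norm (- \<i>) = 1" "- \<i> = of_real (- (- 1)) * Complex 0 (- 1)" "- \<i> = of_real (- 1) * Complex 0 1"
      by (simp_all add: complex_eq_iff)
    have n: "norm (Complex 0 (- 1)) \<le> 1" "norm (Complex 0 1) \<le> 1" by (simp_all add: complex_norm)
    have "- \<i> ~: curve D" unfolding p(2) R.on_curve[OF n(1)] by simp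
    moreover have "- \<i> ~: curve D'" unfolding p(3) R'.on_curve[OF n(2)] by simp
    ultimately have "- \<i> \<in> shaded D \<longleftrightarrow> - \<i> \<in> shaded D'"
      by (rule shade_on_circle[OF assms(1,2) agree p(1)])
    moreover have "- \<i> \<in> shaded D \<longleftrightarrow> \<not> R.T" using R.bottom_shade(1) by (simp only: p(2))
    moreover have "- \<i> \<in> shaded D' \<longleftrightarrow> R'.T" using R'.bottom_shade(2) by (simp only: p(3))
    ultimately show ?thesis by simp
  qed
  then have V': "R'.R3_value = tri so ro True (\<not> R.T) {R.corner 0} (R'.lab 1) {R.corner 2} {R.corner 3} (R'.lab 4) {R.corner 5}
      {R.corner 6} (R'.lab 7) {R.corner 8}"
    unfolding R'.R3_value_def tri_rotate corner by simp
  have "tangle_equiv ((\<lambda>w. {w}) ` R.Bd) R.R3_value R'.R3_value"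
    unfolding R.Bd_corners V' R.R3_value_def by (rule tri_slide[OF R.distinct_labels R'.distinct_labels[unfolded corner]])
  note e1 = this
  show ?thesis
  proof (rule graph_replacement[OF R.picture R'.picture[unfolded Bd] agree R.crossing_value R'.crossing_value[unfolded Bd]])
    show "tangle_equiv ((\<lambda>w. {w}) ` R.Bd) ((\<Prod>v\<in>R.C. R.crossing_value v) * (\<Prod>w\<in>R.Bd. con (R.G (R.\<beta> w)) {w}))
        ((\<Prod>v\<in>R'.C. R'.crossing_value v) * (\<Prod>w\<in>R.Bd. con (R'.G (R'.\<beta> w)) {w}))"
      using tangle_equiv_trans[OF tangle_equiv_trans[OF R.R3_join e1] tangle_equiv_sym[OF R'.R3_join[unfolded Bd]]] .
  qed
qed

section \<open>The pictures of the second Reidemeister move\<close>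

text \<open>Two joins eliminate x and y; no loop splits off, hence no power of o appears.\<close>

lemma R2_trivial_tangle:
  assumes d: "distinct [a, b, c, d, x, y]"
  shows "tangle_equiv {a, b, c, d} (con x a * con x b * (con y c * con y d)) (con a b * con c d)"
  unfolding tangle_equiv_def
proof (intro allI impI)
  fix M assume M: "perfect_matching {a, b, c, d} M"
  let ?m = "{#Upair c y, Upair y d#} + {#Upair a x, Upair x b#}" and ?m1 = "{#Upair c y, Upair y d#} + {#Upair a b#}" and ?m' = "{#Upair a b#} + {#Upair c d#}"
  have fM: "finite M" by (rule finite_perfect_matching[OF M]) simp
  have prodM: "(\<Prod>u\<in>M. con_arc u) = Poly_Mapping.single (mset_set M) 1" by (rule con_arc_prod[OF fM])
  have "con x a * con x b * (con y c * con y d) = con a x * con x b * (con c y * con y d)"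
    by (simp only: con_commute[of x a] con_commute[of y c])
  then have L: "con x a * con x b * (con y c * con y d) = Poly_Mapping.single ?m 1"
    by (simp only: con_arc_def mult_single) (simp add: ac_simps add_mset_commute)
  have R: "con a b * con c d = Poly_Mapping.single ?m' 1"
    by (simp only: con_arc_def mult_single) (simp add: add_mset_commute)
  have "con_step (?m, 0) (?m1, 0)" by (rule con_step.join)
  moreover have "con_step (?m1, 0) (?m', 0)"
    using con_step.join[of "{#Upair a b#}" c y d 0] by (simp add: add_mset_commute)
  ultimately have steps: "con_step\<^sup>*\<^sup>* (?m, 0) (?m', 0)" by simp
  have "bracket ((\<Prod>u\<in>M. con_arc u) * Poly_Mapping.single ?m 1) = Var Vo ^ 0 * bracket ((\<Prod>u\<in>M. con_arc u) * Poly_Mapping.single ?m' 1)"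
  proof (rule bracket_times_steps[OF _ steps])
    fix l assume "l \<in> Poly_Mapping.keys (\<Prod>u\<in>M. con_arc u)"
    then have l: "l = mset_set M" unfolding prodM by simp
    have "ends (l + ?m) = mset_set {a, b, c, d, x, y} + mset_set {a, b, c, d, x, y}"
      unfolding l ends_simps ends_perfect_matching[OF M finite.intros(2)[OF finite.intros(2)[OF finite.intros(2)[OF finite.intros(2)[OF finite.emptyI]]]]]
      using d by simp
    then show "twice (l + ?m)" by (rule twiceI)
  qed
  then show "bracket (con x a * con x b * (con y c * con y d) * (\<Prod>u\<in>M. con_arc u)) - bracket (con a b * con c d * (\<Prod>u\<in>M. con_arc u)) \<in> I_infinity"
    unfolding L R by (simp add: mult.commute I_infinity_zero)
qed

definition Bd2 :: "complex set" where
  "Bd2 = {Complex (-4/5) (-3/5), Complex (-4/5) (3/5), Complex (4/5) (-3/5), Complex (4/5) (3/5)}"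

lemma norm_Bd2: "w \<in> Bd2 ==> norm w = 1"
  by (auto simp: Bd2_def complex_norm power2_eq_square)

lemma in_Bd2: "Complex x y \<in> Bd2 \<longleftrightarrow> (x = -4/5 \<or> x = 4/5) \<and> (y = -3/5 \<or> y = 3/5)"
  by (auto simp: Bd2_def)

lemma one_Complex: "1 * Complex x y = Complex x y"
  by simp

lemma picture_R2_right:
  assumes D: "shaded_link_diagram D" and pic: "shows_picture id D R2_right"
  shows "graph_picture D 1 2 (\<lambda>j x. if j = 0 then 3/5 else -3/5) (\<lambda>_. -4/5) (\<lambda>_. 4/5) {} Bd2 (\<lambda>w. if Im w > 0 then 0 else 1)"
proof
  have cr: "crossings D \<inter> cball 0 1 = {}" and cu: "curve D \<inter> cball 0 1 = {z. \<bar>Re z\<bar> \<le> 4/5 \<and> \<bar>Im z\<bar> = 3/5}"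
    using pic by (simp_all add: shows_picture_def R2_right_def)
  show "shaded_link_diagram D" "crossings D \<inter> cball 0 1 = {}" by (rule D cr)+
  show "finite Bd2" "Bd2 \<subseteq> sphere 0 1" using norm_Bd2 by (auto simp: Bd2_def)
  show "norm (Complex x (if j = 0 then 3/5 else -3/5)) < 1" if "-4/5 < x" "x < 4/5" for j :: nat and x :: real
  proof -
    have "\<bar>x\<bar> < \<bar>4/5\<bar>" using that by auto
    then have "x\<^sup>2 < (4/5)\<^sup>2" by (simp only: power2_strict_mono)
    then show ?thesis by (simp add: complex_norm power2_eq_square)
  qed
  have "z \<in> {z. \<bar>Re z\<bar> \<le> 4/5 \<and> \<bar>Im z\<bar> = 3/5} \<longleftrightarrow> z \<in> Bd2 \<union> (\<Union>j<2. graph_piece 1 (\<lambda>j x. if j = 0 then 3/5 else -3/5) (\<lambda>_. -4/5) (\<lambda>_. 4/5) j)" for z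
  proof -
    obtain x y where z: "z = Complex x y" by (cases z)
    have two: "(\<exists>j\<in>{..<2 :: nat}. Q j) \<longleftrightarrow> Q 0 \<or> Q 1" for Q by (auto simp: less_2_cases_iff)
    have p: "Complex x y \<in> graph_piece 1 f lo hi j \<longleftrightarrow> lo j < x \<and> x < hi j \<and> y = f j x" for f lo hi j
      using mem_graph_piece[of 1 x y f lo hi j] by simp
    show ?thesis unfolding z Un_iff UN_iff two p in_Bd2 by (auto simp: abs_if split: if_splits)
  qed
  then show "curve D \<inter> cball 0 1 = {} \<union> Bd2 \<union> (\<Union>j<2. graph_piece 1 (\<lambda>j x. if j = 0 then 3/5 else -3/5) (\<lambda>_. -4/5) (\<lambda>_. 4/5) j)"
    unfolding cu by (simp add: set_eq_iff)
qed (auto simp: in_Bd2 one_Complex Bd2_def less_2_cases_iff)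

text \<open>Numbers 0 to 2 belong to the overpass, 3 to 5 to the other strand, cut at the crossings
  over -2/5 and 2/5.\<close>

definition f2 :: "nat => real => real" where
  "f2 j = (if j < 3 then (\<lambda>x. 3/2 * \<bar>x\<bar> - 3/5) else (\<lambda>x. 3/5 - 3/2 * \<bar>x\<bar>))"

definition lo2 :: "nat => real" where "lo2 j = [-4/5, -2/5, 2/5, -4/5, -2/5, 2/5] ! j"

definition hi2 :: "nat => real" where "hi2 j = [-2/5, 2/5, 4/5, -2/5, 2/5, 4/5] ! j"

lemma f2_simps [simp]: "f2 0 x = 3/2 * \<bar>x\<bar> - 3/5" "f2 1 x = 3/2 * \<bar>x\<bar> - 3/5" "f2 (Suc 0) x = 3/2 * \<bar>x\<bar> - 3/5" "f2 2 x = 3/2 * \<bar>x\<bar> - 3/5"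
  "f2 3 x = 3/5 - 3/2 * \<bar>x\<bar>" "f2 4 x = 3/5 - 3/2 * \<bar>x\<bar>" "f2 5 x = 3/5 - 3/2 * \<bar>x\<bar>"
  by (simp_all add: f2_def)

lemma lo2_simps [simp]: "lo2 0 = -4/5" "lo2 1 = -2/5" "lo2 (Suc 0) = -2/5" "lo2 2 = 2/5" "lo2 3 = -4/5" "lo2 4 = -2/5" "lo2 5 = 2/5"
  by (simp_all add: lo2_def)

lemma hi2_simps [simp]: "hi2 0 = -2/5" "hi2 1 = 2/5" "hi2 (Suc 0) = 2/5" "hi2 2 = 4/5" "hi2 3 = -2/5" "hi2 4 = 2/5" "hi2 5 = 4/5"
  by (simp_all add: hi2_def)

lemma lt6: "(j :: nat) < 6 \<longleftrightarrow> j \<in> {0, 1, 2, 3, 4, 5}"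
  by auto

lemma norm2:
  assumes "\<bar>x\<bar> < 4/5" "y = 3/2 * \<bar>x\<bar> - 3/5 \<or> y = 3/5 - 3/2 * \<bar>x\<bar>" shows "norm (Complex x y) < 1"
proof -
  have y: "y\<^sup>2 = (3/2 * \<bar>x\<bar> - 3/5)\<^sup>2" using assms(2) by (auto simp: power2_commute)
  have "a\<^sup>2 + (3/2 * a - 3/5)\<^sup>2 < 1" if "0 \<le> a" "a < 4/5" for a :: real
  proof -
    \<comment> \<open>This product is a^2 + (3/2 a - 3/5)^2 - 1; its root 4/5 is the end of the
      strand on the circle.\<close>
    have "(a - 4/5) * (13/4 * a + 4/5) < 0" using that by (intro mult_neg_pos) auto
    then show ?thesis by (simp add: power2_eq_square field_simps)
  qed
  from this[of "\<bar>x\<bar>"] have "x\<^sup>2 + (3/2 * \<bar>x\<bar> - 3/5)\<^sup>2 < 1" using assms(1) by simp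
  then show ?thesis using y by (simp add: complex_norm)
qed

lemma cover2:
  assumes "\<bar>x\<bar> \<le> 4/5 \<and> (y = 3/2 * \<bar>x\<bar> - 3/5 \<or> y = 3/5 - 3/2 * \<bar>x\<bar>)"
    and C: "x = -2/5 \<or> x = 2/5 ==> y = 0 ==> R" and Q: "x = -4/5 \<or> x = 4/5 ==> y = -3/5 \<or> y = 3/5 ==> R"
    and P: "\<And>j. j < 6 ==> lo2 j < x ==> x < hi2 j ==> y = f2 j x ==> R"
  shows R
proof -
  have y: "y = 3/2 * \<bar>x\<bar> - 3/5 \<or> y = 3/5 - 3/2 * \<bar>x\<bar>" using assms(1) ..
  have "-4/5 \<le> x" "x \<le> 4/5" using assms(1) unfolding abs_le_iff by linarith+
  then consider "x = -4/5" | "-4/5 < x" "x < -2/5" | "x = -2/5" | "-2/5 < x" "x < 2/5" | "x = 2/5" | "2/5 < x" "x < 4/5" | "x = 4/5" by linarith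
  then show R
  proof cases
    case 1 then show R using Q y by auto
  next
    case 2 then show R using P[of 0] P[of 3] y by (elim disjE) simp_all
  next
    case 3 then show R using C y by auto
  next
    case 4 then show R using P[of 1] P[of 4] y by (elim disjE) simp_all
  next
    case 5 then show R using C y by auto
  next
    case 6 then show R using P[of 2] P[of 5] y by (elim disjE) simp_all
  next
    case 7 then show R using Q y by auto
  qed
qed

locale R2_disc =
  fixes D :: shaded_diagram
  assumes D: "shaded_link_diagram D" and pic: "shows_picture id D R2_left"
begin

definition C :: "complex set" where "C = {Complex (-2/5) 0, Complex (2/5) 0}"

definition \<beta> :: "complex => nat" where
  "\<beta> w = (if Re w < 0 then (if Im w > 0 then 0 else 3) else (if Im w > 0 then 2 else 5))"

lemma on_curve: "norm (Complex x y) \<le> 1 ==> Complex x y \<in> curve D \<longleftrightarrow> \<bar>x\<bar> \<le> 4/5 \<and> (y = 3/2 * \<bar>x\<bar> - 3/5 \<or> y = 3/5 - 3/2 * \<bar>x\<bar>)"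
proof -
  assume n: "norm (Complex x y) \<le> 1"
  have "curve D \<inter> cball 0 1 = strands R2_left" using pic by (simp add: shows_picture_def)
  then have "Complex x y \<in> curve D \<longleftrightarrow> Complex x y \<in> strands R2_left" using n by (auto simp: set_eq_iff)
  then show ?thesis by (auto simp: R2_left_def Let_def)
qed

lemma is_crossing: "norm (Complex x y) \<le> 1 ==> Complex x y \<in> crossings D \<longleftrightarrow> (x = -2/5 \<or> x = 2/5) \<and> y = 0"
proof -
  assume n: "norm (Complex x y) \<le> 1"
  have "crossings D \<inter> cball 0 1 = crossing_points R2_left" using pic by (simp add: shows_picture_def)
  then have "Complex x y \<in> crossings D \<longleftrightarrow> Complex x y \<in> crossing_points R2_left" using n by (auto simp: set_eq_iff)
  then show ?thesis by (auto simp: R2_left_def Let_def)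
qed

lemma germ: "norm v \<le> 1 ==> v \<in> crossings D ==> same_germ v (overpass D v) {z. \<bar>Re z\<bar> \<le> 4/5 \<and> Im z = 3/2 * \<bar>Re z\<bar> - 3/5}"
  using pic unfolding shows_picture_def by (simp add: R2_left_def Let_def)

lemma picture: "graph_picture D 1 6 f2 lo2 hi2 C Bd2 \<beta>"
proof
  show "shaded_link_diagram D" by (rule D)
  show "continuous_on UNIV (f2 j)" for j by (auto simp: f2_def intro!: continuous_intros)
  show "lo2 j < hi2 j" if "j < 6" for j using that unfolding lt6 by (elim insertE emptyE) simp_all
  show "f2 i x ~= f2 j x" if a: "i < 6" "j < 6" "i ~= j" "lo2 i < x" "x < hi2 i" "lo2 j < x" "x < hi2 j" for i j x
  proof
    assume eq: "f2 i x = f2 j x"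
    have i: "x ~= -2/5 \<and> x ~= 2/5 \<and> (i < 3 \<and> f2 i x = 3/2 * \<bar>x\<bar> - 3/5 \<and> i = (if x < -2/5 then 0 else if x < 2/5 then 1 else 2)
      \<or> 3 \<le> i \<and> f2 i x = 3/5 - 3/2 * \<bar>x\<bar> \<and> i = (if x < -2/5 then 3 else if x < 2/5 then 4 else 5))"
      if "i < 6" "lo2 i < x" "x < hi2 i" for i
      using that unfolding lt6 by (elim insertE emptyE) simp_all
    have "3/2 * \<bar>x\<bar> - 3/5 ~= 3/5 - 3/2 * \<bar>x\<bar>" using i[OF a(1,4,5)] by (auto simp: abs_if)
    then show False using i[OF a(1,4,5)] i[OF a(2,6,7)] eq a(3) by (metis)
  qed
  have nC: "norm w < 1" if "w \<in> C" for w using that by (auto simp: C_def complex_norm)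
  show "crossings D \<inter> cball 0 1 = C" using pic by (auto simp: shows_picture_def R2_left_def Let_def C_def)
  show "C \<subseteq> ball 0 1" using nC by auto
  show gb: "norm (Complex x (f2 j x)) < 1" if "j < 6" "lo2 j < x" "x < hi2 j" for j x
  proof (rule norm2)
    show "\<bar>x\<bar> < 4/5" using that unfolding lt6 by (elim insertE emptyE) (simp_all add: abs_less_iff)
  qed (simp add: f2_def)
  show "1 * Complex x (f2 j x) ~: C" if "j < 6" "lo2 j < x" "x < hi2 j" for j x
    using that unfolding lt6 C_def by (elim insertE emptyE) auto
  show "finite Bd2" "Bd2 \<subseteq> sphere 0 1" using norm_Bd2 by (auto simp: Bd2_def)
  show "1 * Complex (lo2 j) (f2 j (lo2 j)) \<in> C \<union> Bd2" "1 * Complex (hi2 j) (f2 j (hi2 j)) \<in> C \<union> Bd2" if "j < 6" for j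
    using that unfolding lt6 C_def one_Complex Un_iff in_Bd2 by (elim insertE emptyE; simp)+
  show "\<beta> w < 6" for w by (simp add: \<beta>_def)
  show "w = 1 * Complex (lo2 (\<beta> w)) (f2 (\<beta> w) (lo2 (\<beta> w))) \<or> w = 1 * Complex (hi2 (\<beta> w)) (f2 (\<beta> w) (hi2 (\<beta> w)))" if "w \<in> Bd2" for w
    using that unfolding Bd2_def by (elim insertE emptyE) (simp_all add: \<beta>_def)
  show "w ~= 1 * Complex (lo2 i) (f2 i (lo2 i)) \<and> w ~= 1 * Complex (hi2 i) (f2 i (hi2 i))" if "w \<in> Bd2" "i < 6" "i ~= \<beta> w" for w i
    using that unfolding Bd2_def lt6 by (elim insertE emptyE) (simp_all add: \<beta>_def)
  have "z \<in> strands R2_left \<longleftrightarrow> z \<in> C \<union> Bd2 \<union> (\<Union>j<6. graph_piece 1 f2 lo2 hi2 j)" for z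
  proof -
    obtain x y where z: "z = Complex x y" by (cases z)
    have p: "Complex x y \<in> graph_piece 1 f2 lo2 hi2 j \<longleftrightarrow> lo2 j < x \<and> x < hi2 j \<and> y = f2 j x" for j
      using mem_graph_piece[of 1 x y f2 lo2 hi2 j] by simp
    have C: "Complex x y \<in> C \<longleftrightarrow> (x = -2/5 \<or> x = 2/5) \<and> y = 0" by (auto simp: C_def)
    have S: "Complex x y \<in> strands R2_left \<longleftrightarrow> \<bar>x\<bar> \<le> 4/5 \<and> (y = 3/2 * \<bar>x\<bar> - 3/5 \<or> y = 3/5 - 3/2 * \<bar>x\<bar>)"
      by (auto simp: R2_left_def Let_def)
    show ?thesis
      unfolding z
    proof
      assume "Complex x y \<in> strands R2_left"
      then have "\<bar>x\<bar> \<le> 4/5 \<and> (y = 3/2 * \<bar>x\<bar> - 3/5 \<or> y = 3/5 - 3/2 * \<bar>x\<bar>)" unfolding S .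
      then show "Complex x y \<in> C \<union> Bd2 \<union> (\<Union>j<6. graph_piece 1 f2 lo2 hi2 j)"
      proof (rule cover2)
        fix j assume "j < 6" "lo2 j < x" "x < hi2 j" "y = f2 j x"
        then have "j \<in> {..<6}" "Complex x y \<in> graph_piece 1 f2 lo2 hi2 j" using p by auto
        then show "Complex x y \<in> C \<union> Bd2 \<union> (\<Union>j<6. graph_piece 1 f2 lo2 hi2 j)" by (intro UnI2 UN_I)
      qed (use C in_Bd2 in blast)+
    next
      assume "Complex x y \<in> C \<union> Bd2 \<union> (\<Union>j<6. graph_piece 1 f2 lo2 hi2 j)"
      then consider "Complex x y \<in> C" | "Complex x y \<in> Bd2" | j where "j < 6" "Complex x y \<in> graph_piece 1 f2 lo2 hi2 j" by blast
      then show "Complex x y \<in> strands R2_left"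
      proof cases
        case 1 then show ?thesis unfolding C S by auto
      next
        case 2 then show ?thesis unfolding in_Bd2 S by auto
      next
        case (3 j)
        have "-4/5 \<le> x" "x \<le> 4/5" using 3(1) 3(2)[unfolded p] unfolding lt6 by (elim insertE emptyE, simp_all)+
        then have "\<bar>x\<bar> \<le> 4/5" by auto
        moreover have "y = 3/2 * \<bar>x\<bar> - 3/5 \<or> y = 3/5 - 3/2 * \<bar>x\<bar>" using 3(2)[unfolded p] by (simp add: f2_def split: if_splits)
        ultimately show ?thesis unfolding S by blast
      qed
    qed
  qed
  moreover have "curve D \<inter> cball 0 1 = strands R2_left" using pic by (simp add: shows_picture_def)
  ultimately show "curve D \<inter> cball 0 1 = C \<union> Bd2 \<union> (\<Union>j<6. graph_piece 1 f2 lo2 hi2 j)" by blast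
qed simp_all

sublocale graph_picture D 1 6 f2 lo2 hi2 C Bd2 \<beta>
  by (rule picture)

definition lab :: "nat => complex set" where "lab j = graph_piece 1 f2 lo2 hi2 j"

definition T :: bool where "T \<longleftrightarrow> 1 * Complex 0 0 \<in> shaded D"

definition N :: bool where "N \<longleftrightarrow> 1 * Complex (2/5) (1/5) \<in> shaded D"

lemma shade_T: "norm (Complex x y) \<le> 1 ==> y < 3/5 - 3/2 * x ==> y < 3/5 + 3/2 * x ==> - y < 3/5 - 3/2 * x ==> - y < 3/5 + 3/2 * x
    ==> 1 * Complex x y \<in> shaded D \<longleftrightarrow> T"
  unfolding T_def
proof (rule region_shade[of "cball 0 1 \<inter> {z. 3/2 * Re z + 1 * Im z < 3/5} \<inter> {z. (-3/2) * Re z + 1 * Im z < 3/5}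
      \<inter> {z. 3/2 * Re z + (-1) * Im z < 3/5} \<inter> {z. (-3/2) * Re z + (-1) * Im z < 3/5}"])
  show "convex (cball 0 1 \<inter> {z. 3/2 * Re z + 1 * Im z < 3/5} \<inter> {z. (-3/2) * Re z + 1 * Im z < 3/5}
      \<inter> {z. 3/2 * Re z + (-1) * Im z < 3/5} \<inter> {z. (-3/2) * Re z + (-1) * Im z < 3/5})"
    by (intro convex_Int convex_cball convex_half_plane)
qed (auto simp: on_curve abs_if norm_le_oneI)

lemma shade_N: "norm (Complex x y) \<le> 1 ==> 3/5 - 3/2 * x < y ==> 3/2 * x - 3/5 < y ==> 1 * Complex x y \<in> shaded D \<longleftrightarrow> N"
  unfolding N_def
proof (rule region_shade[of "cball 0 1 \<inter> {z. (-3/2) * Re z + (-1) * Im z < -3/5} \<inter> {z. 3/2 * Re z + (-1) * Im z < 3/5}"])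
  show "convex (cball 0 1 \<inter> {z. (-3/2) * Re z + (-1) * Im z < -3/5} \<inter> {z. 3/2 * Re z + (-1) * Im z < 3/5})"
    by (intro convex_Int convex_cball convex_half_plane)
qed (auto simp: on_curve abs_if norm_le_oneI)

text \<open>Crossing the side 4 of the bigon at (1/5, 3/10) leads from the bigon, whose colour is T,
  to the region N above both strands.\<close>

lemma shades: "N \<longleftrightarrow> \<not> T"
proof -
  have small: "norm (Complex x y) < 1/20" if "\<bar>x\<bar> + \<bar>y\<bar> < 1/20" for x y using that norm_le_sum[of x y] by linarith
  have "1 * Complex (1/5 + 1/100) (3/10 + 1/100) \<in> shaded D \<longleftrightarrow> 1 * Complex (1/5 - 1/100) (3/10 - 1/100) ~: shaded D"
  proof (rule edge_flip[of "1/5" "3/10" "1/20" 2 "-3"])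
    show "1 * Complex x y \<in> curve D \<longleftrightarrow> 2 * (y - 3/10) = -3 * (x - 1/5)" if xy: "\<bar>x - 1/5\<bar> < 1/20" "\<bar>y - 3/10\<bar> < 1/20" for x y
    proof -
      have b: "3/20 < x" "x < 1/4" "1/4 < y" "y < 7/20" using xy unfolding abs_less_iff by linarith+
      then have a: "\<bar>x\<bar> = x" "\<bar>y\<bar> = y" by simp_all
      have "norm (Complex x y) \<le> 1" by (rule norm_le_oneI) (use a b in linarith)
      from on_curve[OF this] show ?thesis unfolding one_Complex a using b by auto
    qed
  qed ((rule small | simp add: on_curve is_crossing norm_le_oneI)+)
  moreover have "1 * Complex (1/5 + 1/100) (3/10 + 1/100) \<in> shaded D \<longleftrightarrow> N"
    by (rule shade_N) (simp_all add: norm_le_oneI)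
  moreover have "1 * Complex (1/5 - 1/100) (3/10 - 1/100) \<in> shaded D \<longleftrightarrow> T"
    by (rule shade_T) (simp_all add: norm_le_oneI)
  ultimately show ?thesis by simp
qed

abbreviation "over \<equiv> {z. \<bar>Re z\<bar> \<le> 4/5 \<and> Im z = 3/2 * \<bar>Re z\<bar> - 3/5}"

text \<open>Counterclockwise from the lower right the edges are 1, 4, 0, 3; the overpass contains 1
  and 0, and the quadrant between 1 and 4 is the bigon.\<close>

lemma symbol_left:
  "\<exists>h. crossing_chart (subdiv D Bd2) (1 * Complex (-2/5) 0) h
    \<and> expand (chart_symbol (subdiv D Bd2) h) = expand (sym4 True T (G 1) (G 4) (G 0) (G 3))"
proof (rule crossing_symbol_at[where r = "1/20" and ?u1.0 = 1 and ?u2.0 = "-3/2" and ?w1.0 = 1 and ?w2.0 = "3/2" and S = over])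
  show "same_germ (1 * Complex (-2/5) 0) (overpass D (1 * Complex (-2/5) 0)) over"
    unfolding one_Complex by (rule germ) (simp_all add: is_crossing norm_le_oneI)
  fix x y :: real assume xy: "\<bar>x\<bar> < 1/20" "\<bar>y\<bar> < 1/20"
  have P: "1 * Complex (-2/5 + x * 1 + y * 1) (0 + x * (-3/2) + y * (3/2)) = Complex (x + y - 2/5) (3/2 * y - 3/2 * x)" by simp
  have b: "-1/20 < x" "x < 1/20" "-1/20 < y" "y < 1/20" using xy unfolding abs_less_iff by linarith+
  have a: "\<bar>x + y - 2/5\<bar> = 2/5 - x - y" using b by (simp add: abs_if)
  have e1: "3/2 * y - 3/2 * x = 3/2 * (2/5 - x - y) - 3/5 \<longleftrightarrow> y = 0" by (auto simp: field_simps)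
  have e2: "3/2 * y - 3/2 * x = 3/5 - 3/2 * (2/5 - x - y) \<longleftrightarrow> x = 0" by (auto simp: field_simps)
  have e3: "2/5 - x - y \<le> 4/5" using b by linarith
  have e4: "x + y - 2/5 = -2/5 \<and> 3/2 * y - 3/2 * x = 0 \<longleftrightarrow> x = 0 \<and> y = 0" by (rule iffI; elim conjE; intro conjI; linarith)
  have e5: "x + y - 2/5 ~= 2/5" using b by linarith
  have "\<bar>3/2 * y - 3/2 * x\<bar> < 3/10" using b unfolding abs_less_iff by linarith
  then have n: "norm (Complex (x + y - 2/5) (3/2 * y - 3/2 * x)) < 1" by (intro norm_less_oneI) (use a b in linarith)
  then show "norm (Complex (-2/5 + x * 1 + y * 1) (0 + x * (-3/2) + y * (3/2))) < 1" using P by (simp only: one_Complex)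
  show "1 * Complex (-2/5 + x * 1 + y * 1) (0 + x * (-3/2) + y * (3/2)) \<in> curve D \<longleftrightarrow> x = 0 \<or> y = 0"
    unfolding P on_curve[OF less_imp_le[OF n]] a e1 e2 using e3 by blast
  show "1 * Complex (-2/5 + x * 1 + y * 1) (0 + x * (-3/2) + y * (3/2)) \<in> crossings D \<longleftrightarrow> x = 0 \<and> y = 0"
    unfolding P is_crossing[OF less_imp_le[OF n]] using e4 e5 by blast
  show "1 * Complex (-2/5 + x * 1 + y * 1) (0 + x * (-3/2) + y * (3/2)) \<in> over \<longleftrightarrow> (if True then y = 0 else x = 0)"
    unfolding P mem_Collect_eq complex.sel a e1 if_True using e3 by blast
next
  fix t :: real assume t: "0 < t" "t < 1/20"
  have a: "\<bar>-2/5 + t * 1\<bar> = 2/5 - t" "\<bar>-2/5 - t * 1\<bar> = 2/5 + t"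
    using t by (simp_all add: abs_if)
  show "1 * Complex (-2/5 + t * 1) (0 + t * (-3/2)) \<in> G 1"
    unfolding mem_graph_piece[OF one_neq_zero] f2_simps lo2_simps hi2_simps a using t by (auto simp: field_simps)
  show "1 * Complex (-2/5 + t * 1) (0 + t * (3/2)) \<in> G 4"
    unfolding mem_graph_piece[OF one_neq_zero] f2_simps lo2_simps hi2_simps a using t by (auto simp: field_simps)
  show "1 * Complex (-2/5 - t * 1) (0 - t * (-3/2)) \<in> G 0"
    unfolding mem_graph_piece[OF one_neq_zero] f2_simps lo2_simps hi2_simps a using t by (auto simp: field_simps)
  show "1 * Complex (-2/5 - t * 1) (0 - t * (3/2)) \<in> G 3"
    unfolding mem_graph_piece[OF one_neq_zero] f2_simps lo2_simps hi2_simps a using t by (auto simp: field_simps)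
  have P: "Complex (-2/5 + t * 1 + t * 1) (0 + t * (-3/2) + t * (3/2)) = Complex (2 * t - 2/5) 0" by simp
  have m: "norm (Complex (2 * t - 2/5) 0) \<le> 1" by (rule norm_le_oneI) (use t in auto)
  have q: "3/2 * (2 * t - 2/5) = 3 * t - 3/5" by (simp add: field_simps)
  show "1 * Complex (-2/5 + t * 1 + t * 1) (0 + t * (-3/2) + t * (3/2)) \<in> shaded D \<longleftrightarrow> T"
    unfolding P by (rule shade_T[OF m]; unfold q; use t in linarith)
qed simp_all

text \<open>Counterclockwise from the upper right the edges are 2, 4, 1, 5; the overpass contains 2
  and 1, and the quadrant between 2 and 4 is the upper region.\<close>

lemma symbol_right:
  "\<exists>h. crossing_chart (subdiv D Bd2) (1 * Complex (2/5) 0) h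
    \<and> expand (chart_symbol (subdiv D Bd2) h) = expand (sym4 True (\<not> T) (G 2) (G 4) (G 1) (G 5))"
proof (rule crossing_symbol_at[where r = "1/20" and ?u1.0 = 1 and ?u2.0 = "3/2" and ?w1.0 = "-1" and ?w2.0 = "3/2" and S = over])
  show "same_germ (1 * Complex (2/5) 0) (overpass D (1 * Complex (2/5) 0)) over"
    unfolding one_Complex by (rule germ) (simp_all add: is_crossing norm_le_oneI)
  fix x y :: real assume xy: "\<bar>x\<bar> < 1/20" "\<bar>y\<bar> < 1/20"
  have P: "1 * Complex (2/5 + x * 1 + y * - 1) (0 + x * (3/2) + y * (3/2)) = Complex (x - y + 2/5) (3/2 * y + 3/2 * x)" by simp
  have b: "-1/20 < x" "x < 1/20" "-1/20 < y" "y < 1/20" using xy unfolding abs_less_iff by linarith+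
  have a: "\<bar>x - y + 2/5\<bar> = x - y + 2/5" using b by (simp add: abs_if)
  have e1: "3/2 * y + 3/2 * x = 3/2 * (x - y + 2/5) - 3/5 \<longleftrightarrow> y = 0" by (auto simp: field_simps)
  have e2: "3/2 * y + 3/2 * x = 3/5 - 3/2 * (x - y + 2/5) \<longleftrightarrow> x = 0" by (auto simp: field_simps)
  have e3: "x - y + 2/5 \<le> 4/5" using b by linarith
  have e4: "x - y + 2/5 = 2/5 \<and> 3/2 * y + 3/2 * x = 0 \<longleftrightarrow> x = 0 \<and> y = 0" by (rule iffI; elim conjE; intro conjI; linarith)
  have e5: "x - y + 2/5 ~= -2/5" using b by linarith
  have "\<bar>3/2 * y + 3/2 * x\<bar> < 3/10" using b unfolding abs_less_iff by linarith
  then have n: "norm (Complex (x - y + 2/5) (3/2 * y + 3/2 * x)) < 1" by (intro norm_less_oneI) (use a b in linarith)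
  then show "norm (Complex (2/5 + x * 1 + y * - 1) (0 + x * (3/2) + y * (3/2))) < 1" using P by (simp only: one_Complex)
  show "1 * Complex (2/5 + x * 1 + y * - 1) (0 + x * (3/2) + y * (3/2)) \<in> curve D \<longleftrightarrow> x = 0 \<or> y = 0"
    unfolding P on_curve[OF less_imp_le[OF n]] a e1 e2 using e3 by blast
  show "1 * Complex (2/5 + x * 1 + y * - 1) (0 + x * (3/2) + y * (3/2)) \<in> crossings D \<longleftrightarrow> x = 0 \<and> y = 0"
    unfolding P is_crossing[OF less_imp_le[OF n]] using e4 e5 by blast
  show "1 * Complex (2/5 + x * 1 + y * - 1) (0 + x * (3/2) + y * (3/2)) \<in> over \<longleftrightarrow> (if True then y = 0 else x = 0)"
    unfolding P mem_Collect_eq complex.sel a e1 if_True using e3 by blast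
next
  fix t :: real assume t: "0 < t" "t < 1/20"
  have a: "\<bar>2/5 + t * 1\<bar> = 2/5 + t" "\<bar>2/5 + t * - 1\<bar> = 2/5 - t" "\<bar>2/5 - t * 1\<bar> = 2/5 - t" "\<bar>2/5 - t * - 1\<bar> = 2/5 + t"
    using t by (simp_all add: abs_if)
  show "1 * Complex (2/5 + t * 1) (0 + t * (3/2)) \<in> G 2"
    unfolding mem_graph_piece[OF one_neq_zero] f2_simps lo2_simps hi2_simps a using t by (auto simp: field_simps)
  show "1 * Complex (2/5 + t * - 1) (0 + t * (3/2)) \<in> G 4"
    unfolding mem_graph_piece[OF one_neq_zero] f2_simps lo2_simps hi2_simps a using t by (auto simp: field_simps)
  show "1 * Complex (2/5 - t * 1) (0 - t * (3/2)) \<in> G 1"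
    unfolding mem_graph_piece[OF one_neq_zero] f2_simps lo2_simps hi2_simps a using t by (auto simp: field_simps)
  show "1 * Complex (2/5 - t * - 1) (0 - t * (3/2)) \<in> G 5"
    unfolding mem_graph_piece[OF one_neq_zero] f2_simps lo2_simps hi2_simps a using t by (auto simp: field_simps)
  have P: "Complex (2/5 + t * 1 + t * - 1) (0 + t * (3/2) + t * (3/2)) = Complex (2/5) (3 * t)" by simp
  show "1 * Complex (2/5 + t * 1 + t * - 1) (0 + t * (3/2) + t * (3/2)) \<in> shaded D \<longleftrightarrow> \<not> T"
    unfolding P shades[symmetric] by (rule shade_N) (use t in \<open>auto intro!: norm_le_oneI\<close>)
qed simp_all

definition crossing_value :: "complex => complex set conpoly" where
  "crossing_value v = (if v = Complex (-2/5) 0 then expand (sym4 True T (lab 1) (lab 4) (lab 0) (lab 3))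
     else expand (sym4 True (\<not> T) (lab 2) (lab 4) (lab 1) (lab 5)))"

lemma crossing_value:
  assumes "v \<in> C"
  shows "\<exists>h. crossing_chart (subdiv D Bd2) v h \<and> expand (chart_symbol (subdiv D Bd2) h) = crossing_value v"
  using assms symbol_left symbol_right unfolding C_def one_Complex crossing_value_def lab_def by auto

text \<open>A half turn of the left symbol and a quarter turn of the right one bring the product
  into the form of \<open>R2_tangle\<close>.\<close>

lemma prod_crossing_value: "(\<Prod>v\<in>C. crossing_value v)
    = expand (sym4 True T (lab 0) (lab 3) (lab 1) (lab 4)) * expand (sym4 False T (lab 4) (lab 1) (lab 5) (lab 2))"
  using expand_sym4_half_turn[of True T "lab 1" "lab 4" "lab 0" "lab 3"]
    expand_sym4_quarter_turn[of True "\<not> T" "lab 2" "lab 4" "lab 1" "lab 5"]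
  by (simp add: C_def crossing_value_def)

lemma R2_join:
  "tangle_equiv ((\<lambda>w. {w}) ` Bd2) ((\<Prod>v\<in>C. crossing_value v) * (\<Prod>w\<in>Bd2. con (G (\<beta> w)) {w}))
    (con {Complex (-4/5) (-3/5)} {Complex (4/5) (-3/5)} * con {Complex (-4/5) (3/5)} {Complex (4/5) (3/5)})"
proof -
  let ?LL = "Complex (-4/5) (-3/5)" and ?UL = "Complex (-4/5) (3/5)" and ?LR = "Complex (4/5) (-3/5)" and ?UR = "Complex (4/5) (3/5)"
  let ?P = "expand (sym4 True T (lab 0) (lab 3) (lab 1) (lab 4)) * expand (sym4 False T (lab 4) (lab 1) (lab 5) (lab 2))"
  have li: "lab i = lab j \<longleftrightarrow> i = j" if "i < 6" "j < 6" for i j unfolding lab_def using G_inj that by blast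
  have lp: "lab i ~= {w}" if "i < 6" "w \<in> Bd2" for i w unfolding lab_def using G_inside[OF that(1)] Bd_Y[OF that(2)] by blast
  have bt: "\<beta> ?LL = 3" "\<beta> ?UL = 0" "\<beta> ?LR = 5" "\<beta> ?UR = 2" by (simp_all add: \<beta>_def)
  define g where "g = (\<lambda>e. if e = lab 3 then {?LL} else if e = lab 0 then {?UL} else if e = lab 5 then {?LR} else if e = lab 2 then {?UR} else e)"
  have gl: "g (lab 3) = {?LL}" "g (lab 0) = {?UL}" "g (lab 5) = {?LR}" "g (lab 2) = {?UR}" "g (lab 1) = lab 1" "g (lab 4) = lab 4"
    by (simp_all add: g_def li)
  have sB: "(\<lambda>w. lab (\<beta> w)) ` Bd2 = {lab 3, lab 0, lab 5, lab 2}" unfolding Bd2_def image_insert image_empty bt ..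
  have t1: "tangle_equiv ((\<lambda>w. {w}) ` Bd2) (?P * (\<Prod>w\<in>Bd2. con (lab (\<beta> w)) {w})) (relabel g ?P)"
  proof (rule tangle_join[where s = "\<lambda>w. lab (\<beta> w)" and I = "{lab 1, lab 4}"])
    show "finite Bd2" "inj_on (\<lambda>w. {w}) Bd2" by (rule Bd(1)) simp
    show "inj_on (\<lambda>w. lab (\<beta> w)) Bd2"
    proof (rule inj_onI)
      fix w w' assume w: "w \<in> Bd2" "w' \<in> Bd2" "lab (\<beta> w) = lab (\<beta> w')"
      then have "\<beta> w = \<beta> w'" using li[OF \<beta>(1) \<beta>(1)] by blast
      then show "w = w'" using w(1,2) unfolding Bd2_def by (elim insertE emptyE) (simp_all add: \<beta>_def)
    qed
    show "lab (\<beta> w) ~= {w'}" if "w \<in> Bd2" "w' \<in> Bd2" for w w' by (rule lp[OF \<beta>(1)[OF that(1)] that(2)])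
    have m: "mset_set {lab 3, lab 0, lab 5, lab 2} = {#lab 3, lab 0, lab 5, lab 2#}" "mset_set {lab 1, lab 4} = {#lab 1, lab 4#}"
      by (simp_all add: li)
    have "homogeneous ?P ({#lab 0, lab 3, lab 1, lab 4#} + {#lab 4, lab 1, lab 5, lab 2#})"
      by (intro homogeneous_times homogeneous_sym4)
    then show "homogeneous ?P (mset_set ((\<lambda>w. lab (\<beta> w)) ` Bd2) + (mset_set {lab 1, lab 4} + mset_set {lab 1, lab 4}))"
      unfolding sB m by (simp add: add_mset_commute)
    show "{lab 1, lab 4} \<inter> (\<lambda>w. lab (\<beta> w)) ` Bd2 = {}" unfolding sB by (simp add: li)
    show "{lab 1, lab 4} \<inter> (\<lambda>w. {w}) ` Bd2 = {}" using lp[of 1] lp[of 4] by auto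
    show "g (lab (\<beta> w)) = {w}" if "w \<in> Bd2" for w
      using that unfolding Bd2_def by (elim insertE emptyE) (simp_all only: bt gl)
    show "g x = x" if "x ~: (\<lambda>w. lab (\<beta> w)) ` Bd2" for x using that unfolding sB by (simp add: g_def)
  qed simp
  have r: "relabel g ?P = expand (sym4 True T {?UL} {?LL} (lab 1) (lab 4)) * expand (sym4 False T (lab 4) (lab 1) {?LR} {?UR})"
    unfolding relabel_times relabel_expand map_sym4 gl ..
  have t2: "tangle_equiv {{?LL}, {?UL}, {?LR}, {?UR}}
      (expand (sym4 True T {?UL} {?LL} (lab 1) (lab 4)) * expand (sym4 False T (lab 4) (lab 1) {?LR} {?UR}))
      (con {?LL} {?LR} * con {?UL} {?UR})"
    by (rule R2_tangle) (simp add: li lp lp[THEN not_sym] in_Bd2)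
  have b: "(\<lambda>w. {w}) ` Bd2 = {{?LL}, {?UL}, {?LR}, {?UR}}" by (simp add: Bd2_def)
  show ?thesis
    unfolding prod_crossing_value lab_def[symmetric] by (rule tangle_equiv_trans[OF t1[unfolded r] t2[folded b]])
qed

end

theorem reidemeister2_disc:
  assumes "shaded_link_diagram D" "shaded_link_diagram D'" and agree: "agree_outside (cball 0 1) D D'"
    and "shows_picture id D R2_left" "shows_picture id D' R2_right"
  shows "ss D - ss D' \<in> I_infinity"
proof -
  interpret R: R2_disc D by unfold_locales (use assms in auto)
  note P' = picture_R2_right[OF assms(2,5)]
  let ?f = "\<lambda>j x. if j = (0 :: nat) then 3/5 else -3/5 :: real"
  interpret P': graph_picture D' 1 2 ?f "\<lambda>_. -4/5" "\<lambda>_. 4/5" "{}" Bd2 "\<lambda>w. if Im w > 0 then 0 else 1" by (rule P')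
  define l where "l = graph_piece 1 ?f (\<lambda>_. -4/5) (\<lambda>_. 4/5)"
  let ?LL = "Complex (-4/5) (-3/5)" and ?UL = "Complex (-4/5) (3/5)" and ?LR = "Complex (4/5) (-3/5)" and ?UR = "Complex (4/5) (3/5)"
  have l01: "l 0 ~= l 1" unfolding l_def using P'.G_inj[of 0 1] by auto
  have lp: "l i ~= {w}" if "i < 2" "w \<in> Bd2" for i w unfolding l_def using P'.G_inside[OF that(1)] P'.Bd_Y[OF that(2)] by blast
  \<comment> \<open>Without crossings each strand is a single edge, tied by formal arcs to its two
    end points.\<close>
  have "tangle_equiv {{?LL}, {?LR}, {?UL}, {?UR}} (con (l 1) {?LL} * con (l 1) {?LR} * (con (l 0) {?UL} * con (l 0) {?UR}))
      (con {?LL} {?LR} * con {?UL} {?UR})"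
    by (rule R2_trivial_tangle) (use l01 l01[THEN not_sym] in \<open>simp add: lp lp[THEN not_sym] in_Bd2\<close>)
  moreover have "(\<Prod>w\<in>Bd2. con (l (if Im w > 0 then 0 else 1)) {w}) = con (l 1) {?LL} * con (l 1) {?LR} * (con (l 0) {?UL} * con (l 0) {?UR})"
    by (simp add: Bd2_def ac_simps)
  moreover have "{{?LL}, {?LR}, {?UL}, {?UR}} = (\<lambda>w. {w}) ` Bd2" by (auto simp: Bd2_def)
  ultimately have e: "tangle_equiv ((\<lambda>w. {w}) ` Bd2) (\<Prod>w\<in>Bd2. con (l (if Im w > 0 then 0 else 1)) {w}) (con {?LL} {?LR} * con {?UL} {?UR})"
    by (simp only:)
  show ?thesis
  proof (rule graph_replacement[OF R.picture P' agree R.crossing_value])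
    show "tangle_equiv ((\<lambda>w. {w}) ` Bd2) ((\<Prod>v\<in>R.C. R.crossing_value v) * (\<Prod>w\<in>Bd2. con (graph_piece 1 f2 lo2 hi2 (R.\<beta> w)) {w}))
        ((\<Prod>v\<in>{}. 1) * (\<Prod>w\<in>Bd2. con (graph_piece 1 ?f (\<lambda>_. -4/5) (\<lambda>_. 4/5) (if Im w > 0 then 0 else 1)) {w}))"
      using tangle_equiv_trans[OF R.R2_join tangle_equiv_sym[OF e]] unfolding l_def prod.empty mult_1 .
  qed simp_all
qed

text \<open>Pushing both diagrams forward moves the disc of the replacement to the unit disc.\<close>

lemma replaces_push:
  assumes "replaces P Q D D'"
  obtains h where "planar_map h" "agree_outside (cball 0 1) (push h D) (push h D')"
    "shows_picture id (push h D) P" "shows_picture id (push h D') Q"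
proof -
  obtain h where h: "planar_map h" and agree: "agree_outside (h -` cball 0 1) D D'" and P: "shows_picture h D P" and Q: "shows_picture h D' Q"
    using assms unfolding replaces_def by blast
  note inj = planar_map_simps(6)[OF h]
  have diff: "h ` A - cball 0 1 = h ` (A - h -` cball 0 1)" for A by blast
  have germ: "same_germ (h v) (h ` A) (h ` A')" if "same_germ v A A'" for v A A'
  proof -
    have "continuous_on UNIV (inv h)" by (rule planar_map_simps(4)[OF h])
    then have "isCont (inv h) (h v)" by (simp add: continuous_on_eq_continuous_at)
    then have "filterlim (inv h) (nhds v) (nhds (h v))"
      using tendsto_at_iff_tendsto_nhds[of "inv h" "h v"] by (simp add: isCont_def planar_map_simps(1)[OF h])
    then have "\<forall>\<^sub>F z in nhds (h v). inv h z \<in> A \<longleftrightarrow> inv h z \<in> A'"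
      using that unfolding same_germ_def filterlim_iff by blast
    then show ?thesis unfolding same_germ_def planar_map_image_iff[OF h] .
  qed
  have pic: "shows_picture id (push h E) R" if "shows_picture h E R" for E R
    using that unfolding shows_picture_def by (auto simp: planar_map_simps(1)[OF h])
  have "agree_outside (cball 0 1) (push h D) (push h D')"
    unfolding agree_outside_def push_simps diff
  proof (intro conjI ballI)
    show "h ` (curve D - h -` cball 0 1) = h ` (curve D' - h -` cball 0 1)"
      "h ` (crossings D - h -` cball 0 1) = h ` (crossings D' - h -` cball 0 1)"
      "h ` (shaded D - h -` cball 0 1) = h ` (shaded D' - h -` cball 0 1)"
      using agree by (simp_all only: agree_outside_def)
    fix v assume "v \<in> h ` (crossings D - h -` cball 0 1)"
    then obtain w where w: "w \<in> crossings D - h -` cball 0 1" "v = h w" by (rule imageE)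
    then have "same_germ w (overpass D w) (overpass D' w)" using agree unfolding agree_outside_def by blast
    from germ[OF this] show "same_germ v (h ` overpass D (inv h v)) (h ` overpass D' (inv h v))"
      by (simp add: w(2) planar_map_simps(1)[OF h])
  qed
  then show thesis using h pic[OF P] pic[OF Q] by (intro that)
qed

section \<open>Invariance under all moves\<close>

lemma ss_push: "planar_map h ==> shaded_link_diagram D ==> ss (push h D) = ss D"
  by (rule ss_planar_isotopic[OF _ shaded_link_diagram_push planar_isotopic_push])

lemma ss_regular_step:
  assumes "regular_step D D'" shows "ss D - ss D' \<in> I_infinity"
proof -
  have D: "shaded_link_diagram D" "shaded_link_diagram D'" using assms by (auto simp: regular_step_def)
  consider "planar_isotopic D D'" | "reidemeister2 D D'" | "reidemeister3 D D'" using assms by (auto simp: regular_step_def)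
  then show ?thesis
  proof cases
    case 1
    then show ?thesis using ss_planar_isotopic[OF D] by (simp add: I_infinity_zero)
  next
    case 2
    then obtain h where h: "planar_map h" "agree_outside (cball 0 1) (push h D) (push h D')"
      "shows_picture id (push h D) R2_left" "shows_picture id (push h D') R2_right"
      unfolding reidemeister2_def by (rule replaces_push)
    show ?thesis
      using reidemeister2_disc[OF shaded_link_diagram_push[OF h(1) D(1)] shaded_link_diagram_push[OF h(1) D(2)] h(2-4)]
      by (simp only: ss_push[OF h(1) D(1)] ss_push[OF h(1) D(2)])
  next
    case 3
    then obtain so ro where "replaces (R3_picture so ro (- 1)) (R3_picture so ro 1) D D'" by (auto simp: reidemeister3_def)
    then obtain h where h: "planar_map h" "agree_outside (cball 0 1) (push h D) (push h D')"
      "shows_picture id (push h D) (R3_picture so ro (- 1))" "shows_picture id (push h D') (R3_picture so ro 1)"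
      by (rule replaces_push)
    show ?thesis
      using reidemeister3_disc[OF shaded_link_diagram_push[OF h(1) D(1)] shaded_link_diagram_push[OF h(1) D(2)] h(2-4)]
      by (simp only: ss_push[OF h(1) D(1)] ss_push[OF h(1) D(2)])
  qed
qed

text \<open>Congruence modulo \<open>I_infinity\<close> is symmetric and transitive, so it passes
  from single steps to the equivalence they generate.\<close>

lemma ss_regularly_isotopic:
  assumes "regularly_isotopic D D'" shows "ss D - ss D' \<in> I_infinity"
  using assms unfolding regularly_isotopic_def
proof (induction rule: equivclp_induct)
  case base
  then show ?case by (simp add: I_infinity_zero)
next
  case (step E E')
  have "ss E - ss E' \<in> I_infinity" using step.hyps(2) ss_regular_step I_infinity_commute by blast
  then show ?case by (rule I_infinity_trans[OF step.IH])
qed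

theorem mainTheorem3:
  fixes k :: nat and D D' :: shaded_diagram
  assumes "k \<ge> 1"
    and "shaded_link_diagram D" and "shaded_link_diagram D'"
    and "regularly_isotopic D D'"
  shows "eta k (ss D) = eta k (ss D')"
  by (rule eta_eqI[OF ss_regularly_isotopic[OF assms(4)]])

end
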